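(* Let $E$ be a set, let $I\subseteq E\times E$ be an irreflexive symmetric relation, and let $M(E,I)$ be the corresponding free partially commutative monoid. Let $R$ be a projective free ring with $1$ and with $\operatorname{gl\,dim}R=n<\infty$. Suppose that there is a maximal number $m<\infty$ of mutually commuting distinct elements of $E$. Then for each bounded below $\mathbb{Z}$-graded $R[M(E,I)]$-module $A$ there exists an exact sequence of $\mathbb{Z}$-graded $R[M(E,I)]$-modules and $\mathbb{Z}$-graded homomorphisms of degree $0$ $$0\to F_{n+m}\to F_{n+m-1}\to\cdots\to F_0\to A\to 0$$ in which $F_0,F_1,\ldots,F_{n+m}$ are free bounded below $\mathbb{Z}$-graded $R[M(E,I)]$-modules.
   Context: **Free partially commutative monoid.** $M(E,I)$ is the monoid given by the generating set $E$ and the relations $ab=ba$ for all $(a,b)\in I$. Distinct elements of $E$ are mutually commuting if every two of them form a pair in $I$. Thus $m$ is the clique number of the simple graph with vertex set $E$ and edges $\{a,b\}$, $(a,b)\in I$. **Grading of the monoid ring.** For $\mu\in M(E,I)$, $|\mu|$ denotes the length of $\mu$, i.e. the number of generators in any word representing $\mu$. The monoid ring $R[M(E,I)]$ is graded by $R[M(E,I)]=\bigoplus_{k\in\mathbb{Z}}R[M(E,I)]_k$, where $R[M(E,I)]_k$ is the $R$-submodule generated by the elements $\mu\in M(E,I)$ with $|\mu|=k$. In particular $R[M(E,I)]_0=R$ and $R[M(E,I)]_k=0$ for $k<0$. **Modules.** Modules are left modules. A $\mathbb{Z}$-graded module $A=\bigoplus_k A_k$ is bounded below if there is $k_0$ with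 $A_k=0$ for all $k<k_0$. **Projective free ring.** A ring $R$ with $1$ is projective free if every projective $R$-module is free. **Global dimension.** $\operatorname{gl\,dim}R$ is the global dimension of the category of left $R$-modules, i.e. the supremum of those $k\ge 0$ for which $Ext^k(A,B)\ne0$ for some left $R$-modules $A,B$. *)

theory Defs
  imports "HOL-Algebra.Module" "HOL-Algebra.AbelCoset" "HOL-Library.Extended_Nat"
begin

section \<open>Free partially commutative monoids\<close>

inductive_set fpc_cong :: "'e set \<Rightarrow> ('e \<times> 'e) set \<Rightarrow> ('e list \<times> 'e list) set"
  for E :: "'e set" and I :: "('e \<times> 'e) set"
  where
    fpc_comm: "(a, b) \<in> I \<Longrightarrow> a \<in> E \<Longrightarrow> b \<in> E \<Longrightarrow> ([a, b], [b, a]) \<in> fpc_cong E I"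
  | fpc_refl: "w \<in> lists E \<Longrightarrow> (w, w) \<in> fpc_cong E I"
  | fpc_sym: "(v, w) \<in> fpc_cong E I \<Longrightarrow> (w, v) \<in> fpc_cong E I"
  | fpc_trans: "(u, v) \<in> fpc_cong E I \<Longrightarrow> (v, w) \<in> fpc_cong E I \<Longrightarrow> (u, w) \<in> fpc_cong E I"
  | fpc_append: "(u, u') \<in> fpc_cong E I \<Longrightarrow> (v, v') \<in> fpc_cong E I
      \<Longrightarrow> (u @ v, u' @ v') \<in> fpc_cong E I"

definition fpc_monoid :: "'e set \<Rightarrow> ('e \<times> 'e) set \<Rightarrow> 'e list set monoid" where
  "fpc_monoid E I =
    \<lparr>carrier = lists E // fpc_cong E I,
     monoid.mult = (\<lambda>\<mu> \<nu>. fpc_cong E I `` {u @ v | u v. u \<in> \<mu> \<and> v \<in> \<nu>}),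
     monoid.one = fpc_cong E I `` {[]}\<rparr>"

text \<open>All words representing an element of the monoid have the same length
  (\<open>fpc_cong_length\<close> below), so the choice of the representative is immaterial.\<close>

definition fpc_length :: "'e list set \<Rightarrow> nat" where
  "fpc_length \<mu> = length (SOME w. w \<in> \<mu>)"

definition mutually_commuting :: "('e \<times> 'e) set \<Rightarrow> 'e set \<Rightarrow> bool" where
  "mutually_commuting I C \<longleftrightarrow> (\<forall>a\<in>C. \<forall>b\<in>C. a \<noteq> b \<longrightarrow> (a, b) \<in> I)"

text \<open>Infinite mutually commuting sets are excluded as well, because they have finite
  subsets of every cardinality.\<close>

definition max_commuting :: "'e set \<Rightarrow> ('e \<times> 'e) set \<Rightarrow> nat \<Rightarrow> bool" where
  "max_commuting E I m \<longleftrightarrow>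
    (\<exists>C\<subseteq>E. finite C \<and> mutually_commuting I C \<and> card C = m) \<and>
    (\<forall>C\<subseteq>E. finite C \<and> mutually_commuting I C \<longrightarrow> card C \<le> m)"

lemma fpc_cong_lists:
  assumes "(v, w) \<in> fpc_cong E I"
  shows "v \<in> lists E \<and> w \<in> lists E"
  using assms by (induction rule: fpc_cong.induct) auto

lemma equiv_fpc_cong: "equiv (lists E) (fpc_cong E I)"
  by (rule equivI)
    (auto intro!: refl_onI symI transI dest: fpc_cong_lists intro: fpc_cong.intros)

lemma fpc_cong_length: "(v, w) \<in> fpc_cong E I \<Longrightarrow> length v = length w"
  by (induction rule: fpc_cong.induct) auto

lemma fpc_length_class:
  assumes "w \<in> lists E"
  shows "fpc_length (fpc_cong E I `` {w}) = length w"
proof -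
  have "w \<in> fpc_cong E I `` {w}" using assms by (auto intro: fpc_refl)
  then have "(SOME v. v \<in> fpc_cong E I `` {w}) \<in> fpc_cong E I `` {w}" by (rule someI)
  then show ?thesis unfolding fpc_length_def by (auto dest: fpc_cong_length)
qed

lemma fpc_mult_class:
  assumes "v \<in> lists E" and "w \<in> lists E"
  shows "(fpc_cong E I `` {v}) \<otimes>\<^bsub>fpc_monoid E I\<^esub> (fpc_cong E I `` {w}) = fpc_cong E I `` {v @ w}"
proof -
  have "(v @ w, x) \<in> fpc_cong E I \<longleftrightarrow>
     (\<exists>a b. (v, a) \<in> fpc_cong E I \<and> (w, b) \<in> fpc_cong E I \<and> (a @ b, x) \<in> fpc_cong E I)" for x
    using assms by (metis fpc_append fpc_refl fpc_trans)
  then show ?thesis by (auto simp: fpc_monoid_def Image_def)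
qed

lemma monoid_fpc_monoid: "monoid (fpc_monoid E I)"
proof -
  have carr: "thesis"
    if "x \<in> carrier (fpc_monoid E I)"
      "\<And>w. w \<in> lists E \<Longrightarrow> x = fpc_cong E I `` {w} \<Longrightarrow> thesis" for x thesis
    using that unfolding fpc_monoid_def by simp (metis quotientE)
  have cl: "fpc_cong E I `` {w} \<in> carrier (fpc_monoid E I)" if "w \<in> lists E" for w
    using that by (simp add: fpc_monoid_def quotientI)
  have one: "\<one>\<^bsub>fpc_monoid E I\<^esub> = fpc_cong E I `` {[]}" by (simp add: fpc_monoid_def)
  have app: "v @ w \<in> lists E" if "v \<in> lists E" "w \<in> lists E" for v w
    using that by simp
  have nil: "[] \<in> lists E" by simp
  show ?thesis
    by (rule monoidI; (elim carr)?; hypsubst?;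
        simp only: one fpc_mult_class cl app nil append_assoc append_Nil append_Nil2)
qed


section \<open>Monoid rings\<close>

text \<open>The element \<open>\<Sum> r\<^sub>\<mu> \<mu>\<close> of the monoid ring is the finitely supported function
  \<open>\<mu> \<mapsto> r\<^sub>\<mu>\<close>, which vanishes outside the carrier of the monoid. The ring is not assumed
  to be commutative; its elements commute with those of the monoid.\<close>

definition supp :: "('r, 'x) ring_scheme \<Rightarrow> ('m \<Rightarrow> 'r) \<Rightarrow> 'm set" where
  "supp R f = {\<mu>. f \<mu> \<noteq> \<zero>\<^bsub>R\<^esub>}"

definition monoid_ring :: "'r ring \<Rightarrow> 'm monoid \<Rightarrow> ('m \<Rightarrow> 'r) ring" where
  "monoid_ring R M =
    \<lparr>carrier = {f. range f \<subseteq> carrier R \<and> supp R f \<subseteq> carrier M \<and> finite (supp R f)},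
     monoid.mult = (\<lambda>f g \<mu>.
       \<Oplus>\<^bsub>R\<^esub>p\<in>{p \<in> supp R f \<times> supp R g. fst p \<otimes>\<^bsub>M\<^esub> snd p = \<mu>}. f (fst p) \<otimes>\<^bsub>R\<^esub> g (snd p)),
     monoid.one = (\<lambda>\<mu>. if \<mu> = \<one>\<^bsub>M\<^esub> then \<one>\<^bsub>R\<^esub> else \<zero>\<^bsub>R\<^esub>),
     ring.zero = (\<lambda>\<mu>. \<zero>\<^bsub>R\<^esub>),
     ring.add = (\<lambda>f g \<mu>. f \<mu> \<oplus>\<^bsub>R\<^esub> g \<mu>)\<rparr>"

abbreviation fpc_ring :: "'r ring \<Rightarrow> 'e set \<Rightarrow> ('e \<times> 'e) set \<Rightarrow> ('e list set \<Rightarrow> 'r) ring" where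
  "fpc_ring R E I \<equiv> monoid_ring R (fpc_monoid E I)"

text \<open>The \<open>R\<close>-span of the monoid elements of length \<open>k\<close> consists of the elements
  supported on monoid elements of length \<open>k\<close>.\<close>

definition fpc_ring_grading ::
  "'r ring \<Rightarrow> 'e set \<Rightarrow> ('e \<times> 'e) set \<Rightarrow> int \<Rightarrow> ('e list set \<Rightarrow> 'r) set" where
  "fpc_ring_grading R E I k =
    {f \<in> carrier (fpc_ring R E I). \<forall>\<mu>\<in>supp R f. int (fpc_length \<mu>) = k}"


section \<open>Left modules\<close>

text \<open>The locale \<^locale>\<open>module\<close> of the library requires a commutative ring.\<close>

locale left_module = R?: ring R + M?: abelian_group M
  for R :: "('r, 'x) ring_scheme" (structure) and M :: "('r, 'a, 'y) module_scheme" (structure) +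
  assumes smult_closed:
      "\<lbrakk>a \<in> carrier R; x \<in> carrier M\<rbrakk> \<Longrightarrow> a \<odot>\<^bsub>M\<^esub> x \<in> carrier M"
    and smult_l_distr:
      "\<lbrakk>a \<in> carrier R; b \<in> carrier R; x \<in> carrier M\<rbrakk>
        \<Longrightarrow> (a \<oplus>\<^bsub>R\<^esub> b) \<odot>\<^bsub>M\<^esub> x = a \<odot>\<^bsub>M\<^esub> x \<oplus>\<^bsub>M\<^esub> b \<odot>\<^bsub>M\<^esub> x"
    and smult_r_distr:
      "\<lbrakk>a \<in> carrier R; x \<in> carrier M; y \<in> carrier M\<rbrakk>
        \<Longrightarrow> a \<odot>\<^bsub>M\<^esub> (x \<oplus>\<^bsub>M\<^esub> y) = a \<odot>\<^bsub>M\<^esub> x \<oplus>\<^bsub>M\<^esub> a \<odot>\<^bsub>M\<^esub> y"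
    and smult_assoc1:
      "\<lbrakk>a \<in> carrier R; b \<in> carrier R; x \<in> carrier M\<rbrakk>
        \<Longrightarrow> (a \<otimes>\<^bsub>R\<^esub> b) \<odot>\<^bsub>M\<^esub> x = a \<odot>\<^bsub>M\<^esub> (b \<odot>\<^bsub>M\<^esub> x)"
    and smult_one:
      "x \<in> carrier M \<Longrightarrow> \<one>\<^bsub>R\<^esub> \<odot>\<^bsub>M\<^esub> x = x"

text \<open>Homomorphisms are extensional, i.e. \<^const>\<open>undefined\<close> outside the carrier, so that
  equality of functions is equality of homomorphisms.\<close>

definition module_homs :: "'r ring \<Rightarrow> ('r, 'a) module \<Rightarrow> ('r, 'b) module \<Rightarrow> ('a \<Rightarrow> 'b) set" where
  "module_homs R M N =
    {h \<in> carrier M \<rightarrow>\<^sub>E carrier N.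
      (\<forall>x\<in>carrier M. \<forall>y\<in>carrier M. h (x \<oplus>\<^bsub>M\<^esub> y) = h x \<oplus>\<^bsub>N\<^esub> h y) \<and>
      (\<forall>r\<in>carrier R. \<forall>x\<in>carrier M. h (r \<odot>\<^bsub>M\<^esub> x) = r \<odot>\<^bsub>N\<^esub> h x)}"

definition is_basis :: "'r ring \<Rightarrow> ('r, 'a) module \<Rightarrow> 'a set \<Rightarrow> bool" where
  "is_basis R M B \<longleftrightarrow> B \<subseteq> carrier M \<and>
    (\<forall>x\<in>carrier M. \<exists>!c. range c \<subseteq> carrier R \<and> supp R c \<subseteq> B \<and> finite (supp R c) \<and>
      x = (\<Oplus>\<^bsub>M\<^esub>b\<in>supp R c. c b \<odot>\<^bsub>M\<^esub> b))"

definition free_module :: "'r ring \<Rightarrow> ('r, 'a) module \<Rightarrow> bool" where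
  "free_module R M \<longleftrightarrow> left_module R M \<and> (\<exists>B. is_basis R M B)"

text \<open>A quantifier over all modules is rendered as a quantifier over all modules whose
  carrier is a set of elements of a type \<open>'u\<close>, which plays the role of a universe.\<close>

definition projective_module :: "'r ring \<Rightarrow> ('r, 'u) module \<Rightarrow> bool" where
  "projective_module R P \<longleftrightarrow> left_module R P \<and>
    (\<forall>(L :: ('r, 'u) module) (N :: ('r, 'u) module). \<forall>g\<in>module_homs R L N. \<forall>f\<in>module_homs R P N.
      left_module R L \<and> left_module R N \<and> g ` carrier L = carrier N \<longrightarrow>
      (\<exists>h\<in>module_homs R P L. \<forall>x\<in>carrier P. g (h x) = f x))"

definition projective_free :: "'u itself \<Rightarrow> 'r ring \<Rightarrow> bool" where
  "projective_free U R \<longleftrightarrow>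
    (\<forall>P :: ('r, 'u) module. projective_module R P \<longrightarrow> free_module R P)"


section \<open>Resolutions, Ext and global dimension\<close>

text \<open>Exactness of \<open>\<dots> \<rightarrow> F 2 \<rightarrow> F 1 \<rightarrow> F 0 \<rightarrow> A \<rightarrow> 0\<close>, where \<open>d i : F (i + 1) \<rightarrow> F i\<close> and
  \<open>\<epsilon> : F 0 \<rightarrow> A\<close>. An exact sequence \<open>0 \<rightarrow> F N \<rightarrow> \<dots> \<rightarrow> F 0 \<rightarrow> A \<rightarrow> 0\<close> is the case in which
  \<open>F i\<close> is the zero module for all \<open>i > N\<close>.\<close>

definition exact_resolution ::
  "'r ring \<Rightarrow> (nat \<Rightarrow> ('r, 'b) module) \<Rightarrow> (nat \<Rightarrow> 'b \<Rightarrow> 'b) \<Rightarrow> ('b \<Rightarrow> 'a) \<Rightarrow> ('r, 'a) module \<Rightarrow> bool"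
  where
  "exact_resolution R F d \<epsilon> A \<longleftrightarrow>
    \<epsilon> \<in> module_homs R (F 0) A \<and>
    (\<forall>i. d i \<in> module_homs R (F (Suc i)) (F i)) \<and>
    \<epsilon> ` carrier (F 0) = carrier A \<and>
    a_kernel (F 0) A \<epsilon> = d 0 ` carrier (F 1) \<and>
    (\<forall>i. a_kernel (F (Suc i)) (F i) (d i) = d (Suc i) ` carrier (F (Suc (Suc i))))"

definition projective_resolution ::
  "'r ring \<Rightarrow> (nat \<Rightarrow> ('r, 'u) module) \<Rightarrow> (nat \<Rightarrow> 'u \<Rightarrow> 'u) \<Rightarrow> ('u \<Rightarrow> 'u) \<Rightarrow> ('r, 'u) module \<Rightarrow> bool"
  where
  "projective_resolution R P d \<epsilon> A \<longleftrightarrow>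
    (\<forall>i. projective_module R (P i)) \<and> exact_resolution R P d \<epsilon> A"

text \<open>The cohomology in degree \<open>k\<close> of the complex of abelian groups
  \<open>0 \<rightarrow> Hom (P 0) B \<rightarrow> Hom (P 1) B \<rightarrow> \<dots>\<close>.\<close>

definition cocycles ::
  "'r ring \<Rightarrow> (nat \<Rightarrow> ('r, 'u) module) \<Rightarrow> (nat \<Rightarrow> 'u \<Rightarrow> 'u) \<Rightarrow> ('r, 'u) module \<Rightarrow> nat \<Rightarrow> ('u \<Rightarrow> 'u) set"
  where
  "cocycles R P d B k =
    {f \<in> module_homs R (P k) B. \<forall>x\<in>carrier (P (Suc k)). f (d k x) = \<zero>\<^bsub>B\<^esub>}"

definition coboundaries ::
  "'r ring \<Rightarrow> (nat \<Rightarrow> ('r, 'u) module) \<Rightarrow> (nat \<Rightarrow> 'u \<Rightarrow> 'u) \<Rightarrow> ('r, 'u) module \<Rightarrow> nat \<Rightarrow> ('u \<Rightarrow> 'u) set"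
  where
  "coboundaries R P d B k =
    (case k of
       0 \<Rightarrow> {\<lambda>x\<in>carrier (P 0). \<zero>\<^bsub>B\<^esub>}
     | Suc j \<Rightarrow> (\<lambda>f. compose (carrier (P k)) f (d j)) ` module_homs R (P j) B)"

definition hom_cohomology ::
  "'r ring \<Rightarrow> (nat \<Rightarrow> ('r, 'u) module) \<Rightarrow> (nat \<Rightarrow> 'u \<Rightarrow> 'u) \<Rightarrow> ('r, 'u) module \<Rightarrow> nat
    \<Rightarrow> ('u \<Rightarrow> 'u) set monoid"
  where
  "hom_cohomology R P d B k =
    \<lparr>carrier = cocycles R P d B k,
     monoid.mult = (\<lambda>f g. \<lambda>x\<in>carrier (P k). f x \<oplus>\<^bsub>B\<^esub> g x),
     monoid.one = (\<lambda>x\<in>carrier (P k). \<zero>\<^bsub>B\<^esub>)\<rparr> Mod coboundaries R P d B k"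

text \<open>Ext is computed from an arbitrarily chosen projective resolution. It is meaningful
  if the type \<open>'u\<close> is large enough for such a resolution to exist, for which it suffices
  that \<open>'u\<close> is infinite and at least as large as the ring.\<close>

definition Ext ::
  "'r ring \<Rightarrow> nat \<Rightarrow> ('r, 'u) module \<Rightarrow> ('r, 'u) module \<Rightarrow> ('u \<Rightarrow> 'u) set monoid" where
  "Ext R k A B =
    (let (P, d) = (SOME (P, d). \<exists>\<epsilon>. projective_resolution R P d \<epsilon> A)
     in hom_cohomology R P d B k)"

definition gl_dim :: "'u itself \<Rightarrow> 'r ring \<Rightarrow> enat" where
  "gl_dim U R =
    Sup {enat k | k. \<exists>(A :: ('r, 'u) module) (B :: ('r, 'u) module).
      left_module R A \<and> left_module R B \<and> carrier (Ext R k A B) \<noteq> {\<one>\<^bsub>Ext R k A B\<^esub>}}"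

text \<open>The universe used for a ring with elements in \<open>'r\<close>, generators in \<open>'e\<close> and a module with
  elements in \<open>'a\<close>. It is infinite and contains copies of these three types, hence an isomorphic
  copy of every module over the ring or over the monoid ring that is generated by at most as
  many elements as this type has. In particular \<^const>\<open>projective_free\<close> and \<^const>\<open>gl_dim\<close>
  with respect to it do not depend on \<open>'e\<close> and \<open>'a\<close> and agree with the unrestricted notions:
  projective modules are direct sums of countably generated ones (Kaplansky), and the global
  dimension is determined by the groups \<open>Ext\<^sup>k (A, B)\<close> with \<open>A\<close> cyclic and \<open>B\<close> a syzygy
  of \<open>A\<close> in a free resolution.\<close>

type_synonym ('r, 'e, 'a) universe = "'r + 'e + 'a + nat"


section \<open>Graded modules\<close>

definition graded_module ::
  "'s ring \<Rightarrow> (int \<Rightarrow> 's set) \<Rightarrow> ('s, 'a) module \<Rightarrow> (int \<Rightarrow> 'a set) \<Rightarrow> bool" where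
  "graded_module S Sgr A Agr \<longleftrightarrow> left_module S A \<and>
    (\<forall>k. additive_subgroup (Agr k) A) \<and>
    (\<forall>x\<in>carrier A. \<exists>!c. (\<forall>k. c k \<in> Agr k) \<and> finite {k. c k \<noteq> \<zero>\<^bsub>A\<^esub>} \<and>
      x = (\<Oplus>\<^bsub>A\<^esub>k\<in>{k. c k \<noteq> \<zero>\<^bsub>A\<^esub>}. c k)) \<and>
    (\<forall>k l. \<forall>s\<in>Sgr k. \<forall>x\<in>Agr l. s \<odot>\<^bsub>A\<^esub> x \<in> Agr (k + l))"

definition bounded_below :: "('s, 'a) module \<Rightarrow> (int \<Rightarrow> 'a set) \<Rightarrow> bool" where
  "bounded_below A Agr \<longleftrightarrow> (\<exists>k\<^sub>0. \<forall>k<k\<^sub>0. Agr k = {\<zero>\<^bsub>A\<^esub>})"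

text \<open>A free graded module is one with a basis of homogeneous elements, i.e. a direct sum
  of shifted copies of the graded ring.\<close>

definition free_graded_module ::
  "'s ring \<Rightarrow> (int \<Rightarrow> 's set) \<Rightarrow> ('s, 'a) module \<Rightarrow> (int \<Rightarrow> 'a set) \<Rightarrow> bool" where
  "free_graded_module S Sgr A Agr \<longleftrightarrow>
    graded_module S Sgr A Agr \<and> (\<exists>B. B \<subseteq> (\<Union>k. Agr k) \<and> is_basis S A B)"

definition degree_zero :: "(int \<Rightarrow> 'a set) \<Rightarrow> (int \<Rightarrow> 'b set) \<Rightarrow> ('a \<Rightarrow> 'b) \<Rightarrow> bool" where
  "degree_zero Agr Bgr h \<longleftrightarrow> (\<forall>k. h ` Agr k \<subseteq> Bgr k)"

end

(* Let S = R[M(E,I)]. For an S-module A bounded below, the Koszul complex has in degree p the sum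
   of the modules S \<otimes> A_i over all p-element cliques c of E and all i, with differential
     \<mu> \<otimes> c \<otimes> a  \<mapsto>  \<Sum>e\<in>c. \<plusminus> (\<mu> e \<otimes> (c - {e}) \<otimes> a - \<mu> \<otimes> (c - {e}) \<otimes> e a).
   It vanishes above degree m. It is a resolution of A: modulo terms in which |\<mu>| + |c| is smaller, a
   contracting homotopy is obtained by moving a right divisor e of \<mu> \<Prod>c, chosen in dependence of this
   product only, from \<mu> to c. Each A_i, as an R-module, has a free resolution of length n: since
   Ext^(n+1) vanishes, its n-th syzygy is projective, hence free. Inducing these to S and splicing them
   along the cycles of the Koszul complex by the horseshoe lemma and mapping cones gives a graded free
   resolution of length n + m. *)

theory Submission
  imports Defs "HOL-Algebra.Free_Abelian_Groups"
begin

text \<open>Freeness is settled over \<open>R\<close>: inducing turns bases over \<open>R\<close>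
  into homogeneous bases, so no graded projective module over the monoid ring ever has to be shown
  free. The homotopy exists because a generator outside c that divides \<mu> \<Prod>c already
  divides \<mu> and commutes with all of c (\<open>right_diamond\<close>, \<open>cprod_dvd\<close>),
  so it may be moved into the clique. The count is n + m + 1 free modules: every Koszul term takes n
  + 1 of them, the cycles in degree m vanish and are given the allowance n, and each of the m + 1
  cones on the way down to A adds one. The obstacle that shapes the proof is typing: if free modules
  were indexed by the elements they cover, the type would grow with every syzygy. Hence all of them
  are function modules \<open>Fr S J\<close> with J inside one ambient set \<open>J0\<close>,
  disjoint unions are formed inside \<open>J0\<close> by two injections, and one injection of
  \<open>Fr S J0\<close> finally carries everything into the universe. The lower bound
  \<open>k0\<close> for the degrees of A bounds the degrees of all index sets, which keeps every
  free module bounded below.\<close>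

context abelian_group
begin

lemma minus_eq_zero_iff:
  assumes "x \<in> carrier G" "y \<in> carrier G"
  shows "x \<ominus> y = \<zero> \<longleftrightarrow> x = y"
  using assms by (metis a_minus_def add.inv_closed minus_minus minus_equality r_neg)

lemma minus_add_cancel: "x \<in> carrier G \<Longrightarrow> y \<in> carrier G \<Longrightarrow> (x \<ominus> y) \<oplus> y = x"
  by (simp add: a_minus_def a_assoc l_neg)

end

lemma abelian_group_homI':
  assumes "abelian_group G" "abelian_group H" "\<And>x. x \<in> carrier G \<Longrightarrow> h x \<in> carrier H"
    and "\<And>x y. x \<in> carrier G \<Longrightarrow> y \<in> carrier G \<Longrightarrow> h (x \<oplus>\<^bsub>G\<^esub> y) = h x \<oplus>\<^bsub>H\<^esub> h y"
  shows "abelian_group_hom G H h"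
proof -
  interpret G: abelian_group G by fact
  interpret H: abelian_group H by fact
  show ?thesis
    by (rule abelian_group_homI)
      (use assms in \<open>auto intro!: group_hom.intro group_hom_axioms.intro G.a_group H.a_group simp: hom_def\<close>)
qed

lemma (in abelian_group_hom) hom_minus:
  "x \<in> carrier G \<Longrightarrow> y \<in> carrier G \<Longrightarrow> h (x \<ominus>\<^bsub>G\<^esub> y) = h x \<ominus>\<^bsub>H\<^esub> h y"
  by (simp add: a_minus_def)

lemma (in abelian_group_hom) hom_finsum:
  "f \<in> A \<rightarrow> carrier G \<Longrightarrow> h (finsum G f A) = finsum H (\<lambda>x. h (f x)) A"
  by (induction A rule: infinite_finite_induct) (auto simp: Pi_iff)

lemma abelian_group_hom_compose:
  assumes "abelian_group_hom G H g" "abelian_group_hom H K h"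
  shows "abelian_group_hom G K (\<lambda>x. h (g x))"
proof -
  interpret g: abelian_group_hom G H g by fact
  interpret h: abelian_group_hom H K h by fact
  show ?thesis by (rule abelian_group_homI') (auto intro: g.G.abelian_group_axioms h.H.abelian_group_axioms)
qed

section \<open>Left modules, their homomorphisms and submodules\<close>

context left_module
begin

lemma smult_hom: "a \<in> carrier R \<Longrightarrow> abelian_group_hom M M (\<lambda>x. a \<odot>\<^bsub>M\<^esub> x)"
  by (rule abelian_group_homI') (auto intro: smult_closed smult_r_distr M.abelian_group_axioms)

lemma smult_left_hom: "x \<in> carrier M \<Longrightarrow> abelian_group_hom R M (\<lambda>a. a \<odot>\<^bsub>M\<^esub> x)"
  by (rule abelian_group_homI')
    (auto intro: smult_closed smult_l_distr M.abelian_group_axioms R.is_abelian_group)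

lemma smult_r_null: "a \<in> carrier R \<Longrightarrow> a \<odot>\<^bsub>M\<^esub> \<zero>\<^bsub>M\<^esub> = \<zero>\<^bsub>M\<^esub>"
  by (rule abelian_group_hom.hom_zero[OF smult_hom])

lemma smult_l_null: "x \<in> carrier M \<Longrightarrow> \<zero>\<^bsub>R\<^esub> \<odot>\<^bsub>M\<^esub> x = \<zero>\<^bsub>M\<^esub>"
  by (rule abelian_group_hom.hom_zero[OF smult_left_hom])

lemma smult_l_minus: "a \<in> carrier R \<Longrightarrow> x \<in> carrier M \<Longrightarrow> (\<ominus>\<^bsub>R\<^esub> a) \<odot>\<^bsub>M\<^esub> x = \<ominus>\<^bsub>M\<^esub> (a \<odot>\<^bsub>M\<^esub> x)"
  by (rule abelian_group_hom.hom_a_inv[OF smult_left_hom])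

lemmas left_module = left_module_axioms

end

lemma left_moduleI:
  fixes M :: "('r, 'a, 'y) module_scheme" and R :: "('r, 'x) ring_scheme"
  assumes "ring R" "abelian_group M"
    and "\<And>a x. \<lbrakk>a \<in> carrier R; x \<in> carrier M\<rbrakk> \<Longrightarrow> a \<odot>\<^bsub>M\<^esub> x \<in> carrier M"
    and "\<And>a b x. \<lbrakk>a \<in> carrier R; b \<in> carrier R; x \<in> carrier M\<rbrakk>
        \<Longrightarrow> (a \<oplus>\<^bsub>R\<^esub> b) \<odot>\<^bsub>M\<^esub> x = a \<odot>\<^bsub>M\<^esub> x \<oplus>\<^bsub>M\<^esub> b \<odot>\<^bsub>M\<^esub> x"
    and "\<And>a x y. \<lbrakk>a \<in> carrier R; x \<in> carrier M; y \<in> carrier M\<rbrakk>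
        \<Longrightarrow> a \<odot>\<^bsub>M\<^esub> (x \<oplus>\<^bsub>M\<^esub> y) = a \<odot>\<^bsub>M\<^esub> x \<oplus>\<^bsub>M\<^esub> a \<odot>\<^bsub>M\<^esub> y"
    and "\<And>a b x. \<lbrakk>a \<in> carrier R; b \<in> carrier R; x \<in> carrier M\<rbrakk>
        \<Longrightarrow> (a \<otimes>\<^bsub>R\<^esub> b) \<odot>\<^bsub>M\<^esub> x = a \<odot>\<^bsub>M\<^esub> (b \<odot>\<^bsub>M\<^esub> x)"
    and "\<And>x. x \<in> carrier M \<Longrightarrow> \<one>\<^bsub>R\<^esub> \<odot>\<^bsub>M\<^esub> x = x"
  shows "left_module R M"
  using assms by (intro left_module.intro left_module_axioms.intro) auto

text \<open>Unlike \<open>module_homs\<close> this puts no condition on values outside the carrier,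
  so plain lambda terms and composites qualify; \<open>module_homs_mhom\<close> and
  \<open>restrict_module_homs\<close> translate. Both module structures are included, so one fact
  supplies everything about a map.\<close>

definition mhom :: "('r, 'x) ring_scheme \<Rightarrow> ('r, 'a, 'y) module_scheme \<Rightarrow> ('r, 'b, 'z) module_scheme \<Rightarrow> ('a \<Rightarrow> 'b) \<Rightarrow> bool"
  where "mhom R M N h \<longleftrightarrow> left_module R M \<and> left_module R N \<and> abelian_group_hom M N h \<and>
    (\<forall>r\<in>carrier R. \<forall>x\<in>carrier M. h (r \<odot>\<^bsub>M\<^esub> x) = r \<odot>\<^bsub>N\<^esub> h x)"

lemma left_module_abelian_group: "left_module R M \<Longrightarrow> abelian_group M"
  by (simp add: left_module_def)

lemma left_module_ring: "left_module R M \<Longrightarrow> ring R"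
  by (simp add: left_module_def)

lemma mhomI:
  assumes "left_module R M" "left_module R N" "\<And>x. x \<in> carrier M \<Longrightarrow> h x \<in> carrier N"
    and "\<And>x y. x \<in> carrier M \<Longrightarrow> y \<in> carrier M \<Longrightarrow> h (x \<oplus>\<^bsub>M\<^esub> y) = h x \<oplus>\<^bsub>N\<^esub> h y"
    and "\<And>r x. r \<in> carrier R \<Longrightarrow> x \<in> carrier M \<Longrightarrow> h (r \<odot>\<^bsub>M\<^esub> x) = r \<odot>\<^bsub>N\<^esub> h x"
  shows "mhom R M N h"
  using assms by (auto simp: mhom_def intro!: abelian_group_homI' left_module_abelian_group)

context
  fixes R :: "('r, 'x) ring_scheme" and M :: "('r, 'a, 'y) module_scheme"
    and N :: "('r, 'b, 'z) module_scheme" and h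
  assumes h: "mhom R M N h"
begin

lemma mhom_hom: "abelian_group_hom M N h"
  using h by (simp add: mhom_def)
lemma mhom_dom: "left_module R M"
  using h by (simp add: mhom_def)
lemma mhom_cod: "left_module R N"
  using h by (simp add: mhom_def)
lemma mhom_closed: "x \<in> carrier M \<Longrightarrow> h x \<in> carrier N"
  by (rule abelian_group_hom.hom_closed[OF mhom_hom])
lemma mhom_add: "x \<in> carrier M \<Longrightarrow> y \<in> carrier M \<Longrightarrow> h (x \<oplus>\<^bsub>M\<^esub> y) = h x \<oplus>\<^bsub>N\<^esub> h y"
  by (rule abelian_group_hom.hom_add[OF mhom_hom])
lemma mhom_minus: "x \<in> carrier M \<Longrightarrow> y \<in> carrier M \<Longrightarrow> h (x \<ominus>\<^bsub>M\<^esub> y) = h x \<ominus>\<^bsub>N\<^esub> h y"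
  by (rule abelian_group_hom.hom_minus[OF mhom_hom])
lemma mhom_uminus: "x \<in> carrier M \<Longrightarrow> h (\<ominus>\<^bsub>M\<^esub> x) = \<ominus>\<^bsub>N\<^esub> h x"
  by (rule abelian_group_hom.hom_a_inv[OF mhom_hom])
lemma mhom_zero: "h \<zero>\<^bsub>M\<^esub> = \<zero>\<^bsub>N\<^esub>"
  by (rule abelian_group_hom.hom_zero[OF mhom_hom])
lemma mhom_smult: "r \<in> carrier R \<Longrightarrow> x \<in> carrier M \<Longrightarrow> h (r \<odot>\<^bsub>M\<^esub> x) = r \<odot>\<^bsub>N\<^esub> h x"
  using h by (simp add: mhom_def)
lemma mhom_finsum: "f \<in> A \<rightarrow> carrier M \<Longrightarrow> h (finsum M f A) = finsum N (\<lambda>x. h (f x)) A"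
  by (rule abelian_group_hom.hom_finsum[OF mhom_hom])

end

lemma mhom_cong:
  assumes h: "mhom R M N h" and eq: "\<And>x. x \<in> carrier M \<Longrightarrow> h' x = h x"
  shows "mhom R M N h'"
proof -
  interpret M: left_module R M using h by (rule mhom_dom)
  show ?thesis
    by (rule mhomI)
      (auto simp: eq mhom_add[OF h] mhom_smult[OF h] M.smult_closed intro: mhom_closed[OF h] mhom_dom[OF h] mhom_cod[OF h])
qed

lemma mhom_comp:
  assumes "mhom R M N g" "mhom R N K h"
  shows "mhom R M K (\<lambda>x. h (g x))"
  using assms by (auto simp: mhom_def intro: abelian_group_hom_compose abelian_group_hom.hom_closed)

lemma mhom_id: "left_module R M \<Longrightarrow> mhom R M M (\<lambda>x. x)"
  by (rule mhomI) auto

lemma mhom_zero_map: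
  assumes "left_module R M" "left_module R N" shows "mhom R M N (\<lambda>x. \<zero>\<^bsub>N\<^esub>)"
proof -
  interpret N: left_module R N by fact
  show ?thesis using assms by (intro mhomI) (auto simp: N.smult_r_null)
qed

lemma mhom_plus:
  assumes g: "mhom R M N g" and h: "mhom R M N h"
  shows "mhom R M N (\<lambda>x. g x \<oplus>\<^bsub>N\<^esub> h x)"
proof -
  interpret N: left_module R N using g by (rule mhom_cod)
  show ?thesis
    using mhom_closed[OF g] mhom_closed[OF h] mhom_add[OF g] mhom_add[OF h] mhom_smult[OF g] mhom_smult[OF h]
    by (intro mhomI) (auto intro: mhom_dom[OF g] N.left_module simp: N.smult_r_distr N.a_ac)
qed

lemma mhom_inv_into:
  assumes h: "mhom R M N h" and bij: "bij_betw h (carrier M) (carrier N)"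
  shows "mhom R N M (inv_into (carrier M) h)"
proof -
  let ?i = "inv_into (carrier M) h"
  interpret M: left_module R M using h by (rule mhom_dom)
  have i: "?i y \<in> carrier M" "h (?i y) = y" if "y \<in> carrier N" for y
    using that bij by (auto simp: bij_betw_def inv_into_into f_inv_into_f)
  have inv: "?i (h x) = x" if "x \<in> carrier M" for x
    using that bij by (simp add: bij_betw_def)
  show ?thesis
  proof (rule mhomI)
    fix x y assume xy: "x \<in> carrier N" "y \<in> carrier N"
    then have "x \<oplus>\<^bsub>N\<^esub> y = h (?i x \<oplus>\<^bsub>M\<^esub> ?i y)" by (simp add: i mhom_add[OF h])
    then show "?i (x \<oplus>\<^bsub>N\<^esub> y) = ?i x \<oplus>\<^bsub>M\<^esub> ?i y" using xy by (simp add: inv i)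
  next
    fix r y assume xy: "r \<in> carrier R" "y \<in> carrier N"
    then have "r \<odot>\<^bsub>N\<^esub> y = h (r \<odot>\<^bsub>M\<^esub> ?i y)" by (simp add: i mhom_smult[OF h])
    then show "?i (r \<odot>\<^bsub>N\<^esub> y) = r \<odot>\<^bsub>M\<^esub> ?i y" using xy by (simp add: inv i M.smult_closed)
  qed (auto simp: i mhom_dom[OF h] mhom_cod[OF h])
qed

lemma module_homs_mhom:
  assumes "left_module R M" "left_module R N"
  shows "h \<in> module_homs R M N \<longleftrightarrow> h \<in> extensional (carrier M) \<and> mhom R M N h"
  using assms by (auto simp: module_homs_def PiE_def Pi_iff intro!: mhomI dest: mhom_closed mhom_add mhom_smult)

lemma restrict_module_homs:
  assumes "mhom R M N h"
  shows "restrict h (carrier M) \<in> module_homs R M N"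
  using assms by (auto simp: module_homs_mhom mhom_dom[OF assms] mhom_cod[OF assms] intro: mhom_cong)

lemma a_kernelI: "x \<in> carrier M \<Longrightarrow> h x = \<zero>\<^bsub>N\<^esub> \<Longrightarrow> x \<in> a_kernel M N h"
  by (simp add: a_kernel_def')

lemma a_kernel_iff: "x \<in> a_kernel M N h \<longleftrightarrow> x \<in> carrier M \<and> h x = \<zero>\<^bsub>N\<^esub>"
  by (simp add: a_kernel_def')

subsection \<open>Submodules\<close>

text \<open>Negatives are multiples by -1, so closure under sums and scalars gives a subgroup. A
  submodule is then obtained by a mere change of carrier and inherits the operations of
  \<open>M\<close>.\<close>

definition submod :: "('r, 'x) ring_scheme \<Rightarrow> ('r, 'a, 'y) module_scheme \<Rightarrow> 'a set \<Rightarrow> bool"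
  where "submod R M C \<longleftrightarrow> C \<subseteq> carrier M \<and> \<zero>\<^bsub>M\<^esub> \<in> C \<and> (\<forall>x\<in>C. \<forall>y\<in>C. x \<oplus>\<^bsub>M\<^esub> y \<in> C) \<and>
    (\<forall>r\<in>carrier R. \<forall>x\<in>C. r \<odot>\<^bsub>M\<^esub> x \<in> C)"

lemma left_module_submod:
  assumes "left_module R M" "submod R M C"
  shows "left_module R (M\<lparr>carrier := C\<rparr>)"
proof -
  interpret left_module R M by fact
  have C: "x \<in> carrier M" if "x \<in> C" for x using that assms(2) by (auto simp: submod_def)
  have neg: "\<exists>y\<in>C. x \<oplus>\<^bsub>M\<^esub> y = \<zero>\<^bsub>M\<^esub>" if "x \<in> C" for x
  proof (rule bexI)
    have *: "(\<ominus>\<^bsub>R\<^esub> \<one>\<^bsub>R\<^esub>) \<odot>\<^bsub>M\<^esub> x = \<ominus>\<^bsub>M\<^esub> x" using C that by (simp add: smult_l_minus smult_one)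
    then show "\<ominus>\<^bsub>M\<^esub> x \<in> C"
      using assms(2) that unfolding submod_def by (metis R.add.inv_closed R.one_closed)
  qed (use C that in \<open>simp add: M.r_neg\<close>)
  show ?thesis
    using assms(2)
    by (intro left_moduleI abelian_groupI)
      (auto simp: submod_def C M.a_ac smult_l_distr smult_r_distr smult_assoc1 smult_one neg intro: R.ring_axioms)
qed

lemma mhom_incl:
  assumes "left_module R M" "submod R M C"
  shows "mhom R (M\<lparr>carrier := C\<rparr>) M (\<lambda>x. x)"
  using left_module_submod[OF assms] assms by (intro mhomI) (auto simp: submod_def)

lemma submod_kernel:
  assumes h: "mhom R M N h" shows "submod R M (a_kernel M N h)"
proof -
  interpret M: left_module R M using h by (rule mhom_dom)
  interpret N: left_module R N using h by (rule mhom_cod)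
  show ?thesis
    by (auto simp: submod_def a_kernel_iff M.smult_closed mhom_add[OF h] mhom_zero[OF h] mhom_smult[OF h] N.smult_r_null)
qed

lemmas left_module_kernel = left_module_submod[OF mhom_dom submod_kernel]
lemmas mhom_kernel_incl = mhom_incl[OF mhom_dom submod_kernel]

lemma mhom_into_sub:
  assumes h: "mhom R M N h" and C: "submod R N C" and im: "\<And>x. x \<in> carrier M \<Longrightarrow> h x \<in> C"
  shows "mhom R M (N\<lparr>carrier := C\<rparr>) h"
  using left_module_submod[OF mhom_cod[OF h] C] im
  by (intro mhomI) (auto simp: mhom_add[OF h] mhom_smult[OF h] mhom_dom[OF h])

lemma mhom_from_sub:
  assumes h: "mhom R M N h" and C: "submod R M C"
  shows "mhom R (M\<lparr>carrier := C\<rparr>) N h"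
  using mhom_comp[OF mhom_incl[OF mhom_dom[OF h] C] h] .

lemma mhom_inj_iff:
  assumes h: "mhom R M N h"
  shows "inj_on h (carrier M) \<longleftrightarrow> (\<forall>x\<in>carrier M. h x = \<zero>\<^bsub>N\<^esub> \<longrightarrow> x = \<zero>\<^bsub>M\<^esub>)"
proof -
  interpret M: left_module R M using h by (rule mhom_dom)
  interpret N: left_module R N using h by (rule mhom_cod)
  show ?thesis
  proof (intro iffI ballI impI inj_onI)
    fix x assume "inj_on h (carrier M)" "x \<in> carrier M" "h x = \<zero>\<^bsub>N\<^esub>"
    then show "x = \<zero>\<^bsub>M\<^esub>" using mhom_zero[OF h] by (metis inj_onD M.zero_closed)
  next
    fix x y assume *: "\<forall>x\<in>carrier M. h x = \<zero>\<^bsub>N\<^esub> \<longrightarrow> x = \<zero>\<^bsub>M\<^esub>" "x \<in> carrier M" "y \<in> carrier M" "h x = h y"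
    then have "h (x \<ominus>\<^bsub>M\<^esub> y) = \<zero>\<^bsub>N\<^esub>"
      by (metis mhom_minus[OF h] mhom_closed[OF h] N.minus_eq_zero_iff)
    then have "x \<ominus>\<^bsub>M\<^esub> y = \<zero>\<^bsub>M\<^esub>" using * by simp
    then show "x = y" using * by (simp add: M.minus_eq_zero_iff)
  qed
qed

subsection \<open>Finitely supported functions\<close>

definition dsupp :: "('x \<Rightarrow> ('u, 'y) ring_scheme) \<Rightarrow> ('x \<Rightarrow> 'u) \<Rightarrow> 'x set" where
  "dsupp N f = {x. f x \<noteq> \<zero>\<^bsub>N x\<^esub>}"

text \<open>\<open>N\<close> is a family over the whole index type and \<open>X\<close> only bounds
  the support, so direct sums over different index sets share their zero and their addition. The
  scalar action is a parameter because the action of an induced module is itself defined by sums in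
  the underlying group.\<close>

definition dirsum :: "'x set \<Rightarrow> ('x \<Rightarrow> ('u, 'y) ring_scheme) \<Rightarrow> ('r \<Rightarrow> ('x \<Rightarrow> 'u) \<Rightarrow> 'x \<Rightarrow> 'u)
    \<Rightarrow> ('r, 'x \<Rightarrow> 'u) module" where
  "dirsum X N sm =
    \<lparr>carrier = {f. (\<forall>x. f x \<in> carrier (N x)) \<and> dsupp N f \<subseteq> X \<and> finite (dsupp N f)},
     monoid.mult = undefined, monoid.one = undefined,
     ring.zero = (\<lambda>x. \<zero>\<^bsub>N x\<^esub>), ring.add = (\<lambda>f g x. f x \<oplus>\<^bsub>N x\<^esub> g x), smult = sm\<rparr>"

definition sing :: "('x \<Rightarrow> ('u, 'y) ring_scheme) \<Rightarrow> 'x \<Rightarrow> 'u \<Rightarrow> 'x \<Rightarrow> 'u" where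
  "sing N x a = (\<lambda>y. if y = x then a else \<zero>\<^bsub>N y\<^esub>)"

text \<open>The map given by the universal property of the direct sum, with component
  \<open>g x\<close> on \<open>N x\<close>.\<close>

definition dext :: "('x \<Rightarrow> ('u, 'y) ring_scheme) \<Rightarrow> ('b, 'z) ring_scheme \<Rightarrow> ('x \<Rightarrow> 'u \<Rightarrow> 'b) \<Rightarrow> ('x \<Rightarrow> 'u) \<Rightarrow> 'b" where
  "dext N H g f = (\<Oplus>\<^bsub>H\<^esub>x\<in>dsupp N f. g x (f x))"

lemma dirsum_simps:
  "carrier (dirsum X N sm) = {f. (\<forall>x. f x \<in> carrier (N x)) \<and> dsupp N f \<subseteq> X \<and> finite (dsupp N f)}"
  "\<zero>\<^bsub>dirsum X N sm\<^esub> = (\<lambda>x. \<zero>\<^bsub>N x\<^esub>)"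
  "f \<oplus>\<^bsub>dirsum X N sm\<^esub> g = (\<lambda>x. f x \<oplus>\<^bsub>N x\<^esub> g x)"
  "r \<odot>\<^bsub>dirsum X N sm\<^esub> f = sm r f"
  by (simp_all add: dirsum_def)

locale dirsum_family =
  fixes X :: "'x set" and N :: "'x \<Rightarrow> ('u, 'y) ring_scheme" and sm :: "'r \<Rightarrow> ('x \<Rightarrow> 'u) \<Rightarrow> 'x \<Rightarrow> 'u"
  assumes N: "\<And>x. abelian_group (N x)"
begin

lemma dsupp_zero: "dsupp N (\<lambda>x. \<zero>\<^bsub>N x\<^esub>) = {}"
  by (simp add: dsupp_def)

lemma dsupp_add:
  shows "dsupp N (\<lambda>x. f x \<oplus>\<^bsub>N x\<^esub> g x) \<subseteq> dsupp N f \<union> dsupp N g"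
proof
  fix x assume "x \<in> dsupp N (\<lambda>x. f x \<oplus>\<^bsub>N x\<^esub> g x)"
  then show "x \<in> dsupp N f \<union> dsupp N g"
    using abelian_groupE(5,2)[OF N[of x]] by (auto simp: dsupp_def)
qed

lemma dirsumD:
  assumes "f \<in> carrier (dirsum X N sm)"
  shows "f x \<in> carrier (N x)" "x \<in> dsupp N f \<Longrightarrow> x \<in> X" "dsupp N f \<subseteq> X" "finite (dsupp N f)"
  using assms by (auto simp: dirsum_simps)

lemma dirsum_group: "abelian_group (dirsum X N sm)"
proof (rule abelian_groupI)
  fix f g assume fg: "f \<in> carrier (dirsum X N sm)" "g \<in> carrier (dirsum X N sm)"
  then have "finite (dsupp N (\<lambda>x. f x \<oplus>\<^bsub>N x\<^esub> g x))" "dsupp N (\<lambda>x. f x \<oplus>\<^bsub>N x\<^esub> g x) \<subseteq> X"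
    using dsupp_add[of f g] by (auto simp: dirsum_simps intro: finite_subset)
  then show "f \<oplus>\<^bsub>dirsum X N sm\<^esub> g \<in> carrier (dirsum X N sm)"
    using fg abelian_groupE(1)[OF N] by (auto simp: dirsum_simps)
next
  show "\<zero>\<^bsub>dirsum X N sm\<^esub> \<in> carrier (dirsum X N sm)"
    using abelian_groupE(2)[OF N] by (simp add: dirsum_simps dsupp_zero)
next
  fix f assume f: "f \<in> carrier (dirsum X N sm)"
  let ?g = "\<lambda>x. \<ominus>\<^bsub>N x\<^esub> f x"
  have inv: "?g x \<in> carrier (N x)" "?g x \<oplus>\<^bsub>N x\<^esub> f x = \<zero>\<^bsub>N x\<^esub>"
       "f x = \<zero>\<^bsub>N x\<^esub> \<Longrightarrow> ?g x = \<zero>\<^bsub>N x\<^esub>" for x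
  proof -
    interpret abelian_group "N x" by (rule N)
    show "?g x \<in> carrier (N x)" "?g x \<oplus>\<^bsub>N x\<^esub> f x = \<zero>\<^bsub>N x\<^esub>"
       "f x = \<zero>\<^bsub>N x\<^esub> \<Longrightarrow> ?g x = \<zero>\<^bsub>N x\<^esub>" using f by (auto simp: dirsum_simps l_neg)
  qed
  have "dsupp N ?g \<subseteq> dsupp N f" using inv by (auto simp: dsupp_def)
  then have "?g \<in> carrier (dirsum X N sm)" using f inv by (auto simp: dirsum_simps intro: finite_subset)
  then show "\<exists>g\<in>carrier (dirsum X N sm). g \<oplus>\<^bsub>dirsum X N sm\<^esub> f = \<zero>\<^bsub>dirsum X N sm\<^esub>"
    by (intro bexI[of _ ?g]) (auto simp: dirsum_simps inv)
qed (use abelian_groupE[OF N] in \<open>auto simp: dirsum_simps fun_eq_iff\<close>)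

sublocale D: abelian_group "dirsum X N sm" by (rule dirsum_group)

lemma eval_hom: "abelian_group_hom (dirsum X N sm) (N x) (\<lambda>f. f x)"
  by (rule abelian_group_homI') (auto simp: dirsum_simps N dirsum_group[unfolded dirsum_simps])

lemma eval_finsum: "F \<in> A \<rightarrow> carrier (dirsum X N sm) \<Longrightarrow> finsum (dirsum X N sm) F A x = finsum (N x) (\<lambda>a. F a x) A"
  by (rule abelian_group_hom.hom_finsum[OF eval_hom])

lemma eval_uminus: "f \<in> carrier (dirsum X N sm) \<Longrightarrow> (\<ominus>\<^bsub>dirsum X N sm\<^esub> f) x = \<ominus>\<^bsub>N x\<^esub> f x"
  by (rule abelian_group_hom.hom_a_inv[OF eval_hom])

lemma sing_supp: "dsupp N (sing N x a) \<subseteq> {x}"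
  by (auto simp: dsupp_def sing_def)

lemma sing_closed: "x \<in> X \<Longrightarrow> a \<in> carrier (N x) \<Longrightarrow> sing N x a \<in> carrier (dirsum X N sm)"
  using abelian_groupE(2)[OF N] sing_supp[of x a]
  by (auto simp: dirsum_simps sing_def intro: finite_subset[OF sing_supp[unfolded sing_def]])

lemma sing_hom: "x \<in> X \<Longrightarrow> abelian_group_hom (N x) (dirsum X N sm) (sing N x)"
  using abelian_groupE(2,5)[OF N] by (intro abelian_group_homI')
   (auto simp: N dirsum_group sing_closed, auto simp: dirsum_simps sing_def fun_eq_iff)

lemma sing_add: "x \<in> X \<Longrightarrow> a \<in> carrier (N x) \<Longrightarrow> b \<in> carrier (N x) \<Longrightarrow>
    sing N x (a \<oplus>\<^bsub>N x\<^esub> b) = sing N x a \<oplus>\<^bsub>dirsum X N sm\<^esub> sing N x b"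
  by (rule abelian_group_hom.hom_add[OF sing_hom])

lemma dirsum_expand:
  assumes f: "f \<in> carrier (dirsum X N sm)"
  shows "f = finsum (dirsum X N sm) (\<lambda>x. sing N x (f x)) (dsupp N f)"
proof
  fix y
  interpret Ny: abelian_group "N y" by (rule N)
  have "finsum (dirsum X N sm) (\<lambda>x. sing N x (f x)) (dsupp N f) y = (\<Oplus>\<^bsub>N y\<^esub>x\<in>dsupp N f. sing N x (f x) y)"
    using dirsumD[OF f] by (intro eval_finsum) (auto intro!: sing_closed)
  also have "\<dots> = f y"
  proof (cases "y \<in> dsupp N f")
    case True
    have "(\<Oplus>\<^bsub>N y\<^esub>x\<in>dsupp N f. sing N x (f x) y) = (\<Oplus>\<^bsub>N y\<^esub>x\<in>dsupp N f. if y = x then f y else \<zero>\<^bsub>N y\<^esub>)"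
      using f by (intro Ny.finsum_cong') (auto simp: sing_def dirsum_simps)
    also have "\<dots> = f y" using True f by (intro Ny.finsum_singleton) (auto simp: dirsum_simps)
    finally show ?thesis .
  next
    case False
    then have "(\<Oplus>\<^bsub>N y\<^esub>x\<in>dsupp N f. sing N x (f x) y) = (\<Oplus>\<^bsub>N y\<^esub>x\<in>dsupp N f. \<zero>\<^bsub>N y\<^esub>)"
      using f by (intro Ny.finsum_cong') (auto simp: sing_def dirsum_simps)
    then show ?thesis using False by (simp add: dsupp_def)
  qed
  finally show "f y = finsum (dirsum X N sm) (\<lambda>x. sing N x (f x)) (dsupp N f) y" ..
qed

text \<open>Every element is a finite sum of one-entry functions (\<open>dirsum_expand\<close>), so
  additive statements have to be tested on these only. Linearity proofs for free modules, induced
  modules and the Koszul maps all rest on this.\<close>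

lemma dirsum_induct [consumes 1, case_names zero sing add]:
  assumes f: "f \<in> carrier (dirsum X N sm)"
    and z: "P \<zero>\<^bsub>dirsum X N sm\<^esub>"
    and s: "\<And>x a. x \<in> X \<Longrightarrow> a \<in> carrier (N x) \<Longrightarrow> P (sing N x a)"
    and a: "\<And>f g. f \<in> carrier (dirsum X N sm) \<Longrightarrow> g \<in> carrier (dirsum X N sm) \<Longrightarrow> P f \<Longrightarrow> P g \<Longrightarrow> P (f \<oplus>\<^bsub>dirsum X N sm\<^esub> g)"
  shows "P f"
proof -
  have "A \<subseteq> X \<Longrightarrow> P (finsum (dirsum X N sm) (\<lambda>x. sing N x (f x)) A)" if "finite A" for A
    using that
  proof induction
    case (insert x A)
    then have "finsum (dirsum X N sm) (\<lambda>x. sing N x (f x)) A \<in> carrier (dirsum X N sm)"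
      using insert dirsumD[OF f] by (intro D.finsum_closed) (auto intro!: sing_closed)
    moreover have "finsum (dirsum X N sm) (\<lambda>x. sing N x (f x)) (insert x A) =
       sing N x (f x) \<oplus>\<^bsub>dirsum X N sm\<^esub> finsum (dirsum X N sm) (\<lambda>x. sing N x (f x)) A"
      using insert dirsumD[OF f] by (intro D.finsum_insert) (auto intro!: sing_closed)
    ultimately show ?case
      using insert dirsumD[OF f] by (auto intro!: a s sing_closed)
  qed (simp add: z)
  then have "P (finsum (dirsum X N sm) (\<lambda>x. sing N x (f x)) (dsupp N f))" using f by (simp add: dirsum_simps)
  then show ?thesis using dirsum_expand[OF f] by simp
qed

end

locale dirsum_ext = dirsum_family X N sm + H: abelian_group H
  for X :: "'x set" and N :: "'x \<Rightarrow> ('u, 'y) ring_scheme" and sm :: "'r \<Rightarrow> ('x \<Rightarrow> 'u) \<Rightarrow> 'x \<Rightarrow> 'u"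
    and H :: "('b, 'z) ring_scheme" +
  fixes g :: "'x \<Rightarrow> 'u \<Rightarrow> 'b"
  assumes g: "\<And>x. x \<in> X \<Longrightarrow> abelian_group_hom (N x) H (g x)"
begin

lemma g_closed: "x \<in> X \<Longrightarrow> a \<in> carrier (N x) \<Longrightarrow> g x a \<in> carrier H"
  using g by (rule abelian_group_hom.hom_closed)

text \<open>Padding the support by zero entries changes nothing; this allows two elements and their
  sum to be summed over one common set.\<close>

lemma dext_superset:
  assumes f: "f \<in> carrier (dirsum X N sm)" and A: "finite A" "dsupp N f \<subseteq> A" "A \<subseteq> X"
  shows "dext N H g f = (\<Oplus>\<^bsub>H\<^esub>x\<in>A. g x (f x))"
  unfolding dext_def
proof (rule H.add.finprod_mono_neutral_cong_left)
  show "g i (f i) = \<zero>\<^bsub>H\<^esub>" if "i \<in> A - dsupp N f" for i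
    using A that by (auto simp: dsupp_def abelian_group_hom.hom_zero[OF g])
qed (use A dirsumD[OF f] in \<open>auto intro!: g_closed\<close>)

lemma dext_closed: "f \<in> carrier (dirsum X N sm) \<Longrightarrow> dext N H g f \<in> carrier H"
  unfolding dext_def by (intro H.finsum_closed) (auto simp: dirsum_simps intro!: g_closed)

lemma dext_hom: "abelian_group_hom (dirsum X N sm) H (dext N H g)"
proof (rule abelian_group_homI')
  fix f h assume fh: "f \<in> carrier (dirsum X N sm)" "h \<in> carrier (dirsum X N sm)"
  let ?A = "dsupp N f \<union> dsupp N h"
  have A: "finite ?A" "?A \<subseteq> X" using fh by (auto simp: dirsum_simps)
  have "dext N H g (f \<oplus>\<^bsub>dirsum X N sm\<^esub> h) = (\<Oplus>\<^bsub>H\<^esub>x\<in>?A. g x ((f \<oplus>\<^bsub>dirsum X N sm\<^esub> h) x))"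
    using dsupp_add[of f h] fh A D.a_closed[OF fh] by (intro dext_superset) (auto simp: dirsum_simps(3))
  also have "\<dots> = (\<Oplus>\<^bsub>H\<^esub>x\<in>?A. g x (f x) \<oplus>\<^bsub>H\<^esub> g x (h x))"
    using fh A by (intro H.finsum_cong') (auto intro!: g_closed H.a_closed abelian_group_hom.hom_add[OF g] simp: dirsum_simps)
  also have "\<dots> = (\<Oplus>\<^bsub>H\<^esub>x\<in>?A. g x (f x)) \<oplus>\<^bsub>H\<^esub> (\<Oplus>\<^bsub>H\<^esub>x\<in>?A. g x (h x))"
    using fh A by (intro H.finsum_addf) (auto intro!: g_closed simp: dirsum_simps)
  also have "\<dots> = dext N H g f \<oplus>\<^bsub>H\<^esub> dext N H g h"
    using dext_superset[OF fh(1) A(1) _ A(2)] dext_superset[OF fh(2) A(1) _ A(2)] by simp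
  finally show "dext N H g (f \<oplus>\<^bsub>dirsum X N sm\<^esub> h) = dext N H g f \<oplus>\<^bsub>H\<^esub> dext N H g h" .
qed (auto intro: dirsum_group dext_closed H.abelian_group_axioms)

lemma dext_sing:
  assumes "x \<in> X" "a \<in> carrier (N x)"
  shows "dext N H g (sing N x a) = g x a"
proof -
  have "dext N H g (sing N x a) = (\<Oplus>\<^bsub>H\<^esub>y\<in>{x}. g y (sing N x a y))"
    using assms sing_supp by (intro dext_superset sing_closed) auto
  then show ?thesis using assms by (simp add: sing_def g_closed)
qed

end

section \<open>Graded modules\<close>

text \<open>The grading is given by its projections \<open>p k\<close> instead of a unique
  decomposition. Projections are homomorphisms, can be restricted to kernels and commute with maps
  of degree zero, which makes kernels and preimages of homogeneous elements easy to handle.\<close>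

locale graded_group = abelian_group A
  for A :: "('a, 'x) ring_scheme" (structure) and Agr :: "int \<Rightarrow> 'a set" and p :: "int \<Rightarrow> 'a \<Rightarrow> 'a" +
  assumes gr_sub: "x \<in> Agr k \<Longrightarrow> x \<in> carrier A"
    and p_hom: "abelian_group_hom A A (p k)"
    and p_gr: "x \<in> carrier A \<Longrightarrow> p k x \<in> Agr k"
    and p_id: "x \<in> Agr k \<Longrightarrow> p k x = x"
    and p_other: "x \<in> Agr l \<Longrightarrow> k \<noteq> l \<Longrightarrow> p k x = \<zero>"
    and p_fin: "x \<in> carrier A \<Longrightarrow> finite {k. p k x \<noteq> \<zero>}"
    and p_sum: "x \<in> carrier A \<Longrightarrow> x = (\<Oplus>k\<in>{k. p k x \<noteq> \<zero>}. p k x)"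
begin

lemma p_closed: "x \<in> carrier A \<Longrightarrow> p k x \<in> carrier A"
  using p_gr gr_sub by blast

lemma gr_iff: "x \<in> Agr k \<longleftrightarrow> x \<in> carrier A \<and> p k x = x"
  using p_gr p_id gr_sub by metis

lemma gr_zero: "\<zero> \<in> Agr k"
  by (simp add: gr_iff abelian_group_hom.hom_zero[OF p_hom])

lemma gr_add: "x \<in> Agr k \<Longrightarrow> y \<in> Agr k \<Longrightarrow> x \<oplus> y \<in> Agr k"
  by (simp add: gr_iff abelian_group_hom.hom_add[OF p_hom])

lemma gr_uminus: "x \<in> Agr k \<Longrightarrow> \<ominus> x \<in> Agr k"
  by (simp add: gr_iff abelian_group_hom.hom_a_inv[OF p_hom])

lemma gr_finsum: "(\<And>i. i \<in> I \<Longrightarrow> f i \<in> Agr k) \<Longrightarrow> finsum A f I \<in> Agr k"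
proof (induction I rule: infinite_finite_induct)
  case (insert x F)
  then have "finsum A f (insert x F) = f x \<oplus> finsum A f F"
    by (intro finsum_insert) (auto intro: gr_sub)
  then show ?case using insert by (simp add: gr_add)
qed (auto simp: gr_zero)

lemma gr_subgroup: "additive_subgroup (Agr k) A"
proof -
  have "\<And>x. x \<in> Agr k \<Longrightarrow> \<ominus> x \<in> Agr k" by (rule gr_uminus)
  then show ?thesis
    by (intro additive_subgroup.intro subgroup.intro)
      (auto simp: gr_zero gr_add gr_sub a_inv_def)
qed

lemma p_sum_superset:
  assumes "x \<in> carrier A" "finite F" "{k. p k x \<noteq> \<zero>} \<subseteq> F"
  shows "x = (\<Oplus>k\<in>F. p k x)"
proof -
  have "(\<Oplus>k\<in>{k. p k x \<noteq> \<zero>}. p k x) = (\<Oplus>k\<in>F. p k x)"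
    by (rule add.finprod_mono_neutral_cong_left) (use assms in \<open>auto simp: p_closed\<close>)
  then show ?thesis using p_sum[OF assms(1)] by simp
qed

lemma p_of_sum:
  assumes "finite F" "\<And>k. k \<in> F \<Longrightarrow> c k \<in> Agr k"
  shows "p l (\<Oplus>k\<in>F. c k) = (if l \<in> F then c l else \<zero>)"
proof -
  have c: "c \<in> F \<rightarrow> carrier A" using assms gr_sub by auto
  have "p l (\<Oplus>k\<in>F. c k) = (\<Oplus>k\<in>F. p l (c k))"
    by (rule abelian_group_hom.hom_finsum[OF p_hom]) (use c in auto)
  also have "\<dots> = (\<Oplus>k\<in>F. if l = k then c k else \<zero>)"
    using c assms by (intro finsum_cong') (auto simp: p_id p_other[OF assms(2)])
  also have "\<dots> = (if l \<in> F then c l else \<zero>)"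
  proof (cases "l \<in> F")
    case True
    then show ?thesis using finsum_singleton[of l F c] c assms by auto
  next
    case False
    then have "(\<Oplus>k\<in>F. if l = k then c k else \<zero>) = (\<Oplus>k\<in>F. \<zero>)"
      by (intro finsum_cong') auto
    then show ?thesis using False by simp
  qed
  finally show ?thesis .
qed

lemma gr_ex1:
  assumes "x \<in> carrier A"
  shows "\<exists>!c. (\<forall>k. c k \<in> Agr k) \<and> finite {k. c k \<noteq> \<zero>} \<and> x = (\<Oplus>k\<in>{k. c k \<noteq> \<zero>}. c k)"
proof (rule ex1I[of _ "\<lambda>k. p k x"])
  fix c assume c: "(\<forall>k. c k \<in> Agr k) \<and> finite {k. c k \<noteq> \<zero>} \<and> x = (\<Oplus>k\<in>{k. c k \<noteq> \<zero>}. c k)"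
  show "c = (\<lambda>k. p k x)"
  proof
    fix l
    have "p l x = p l (\<Oplus>k\<in>{k. c k \<noteq> \<zero>}. c k)" using c by simp
    also have "\<dots> = (if l \<in> {k. c k \<noteq> \<zero>} then c l else \<zero>)" using c by (intro p_of_sum) auto
    finally show "c l = p l x" by auto
  qed
qed (use assms p_sum p_gr p_fin in auto)

end

text \<open>Applying \<open>h\<close> to the decomposition of \<open>x\<close> gives a decomposition
  of \<open>h x\<close>, whose components can be read off by \<open>p_of_sum\<close>.\<close>

lemma graded_hom_p:
  assumes "graded_group A Agr p" "graded_group B Bgr q" "abelian_group_hom A B h"
    and deg: "\<And>k x. x \<in> Agr k \<Longrightarrow> h x \<in> Bgr k" and x: "x \<in> carrier A"
  shows "h (p k x) = q k (h x)"
proof -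
  interpret A: graded_group A Agr p by fact
  interpret B: graded_group B Bgr q by fact
  interpret h: abelian_group_hom A B h by fact
  let ?F = "{k. p k x \<noteq> \<zero>\<^bsub>A\<^esub>}"
  have "h x = h (\<Oplus>\<^bsub>A\<^esub>k\<in>?F. p k x)" using A.p_sum[OF x] by simp
  also have "\<dots> = (\<Oplus>\<^bsub>B\<^esub>k\<in>?F. h (p k x))" using x by (intro h.hom_finsum) (auto simp: A.p_closed)
  finally have "q k (h x) = (if k \<in> ?F then h (p k x) else \<zero>\<^bsub>B\<^esub>)"
    using B.p_of_sum[of ?F "\<lambda>k. h (p k x)" k] A.p_fin[OF x] deg A.p_gr[OF x] by simp
  then show ?thesis by auto
qed

text \<open>The working form of \<open>graded_module\<close>: given \<open>Sgr k\<close> inside the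
  ring, the two agree (\<open>gmod_graded_module\<close>, \<open>graded_module_gmod\<close>), but
  here the projections are at hand.\<close>

definition gmod :: "('s, 'x) ring_scheme \<Rightarrow> (int \<Rightarrow> 's set) \<Rightarrow> ('s, 'a, 'y) module_scheme \<Rightarrow> (int \<Rightarrow> 'a set) \<Rightarrow> bool"
  where "gmod S Sgr A Agr \<longleftrightarrow> left_module S A \<and> (\<forall>k. Sgr k \<subseteq> carrier S) \<and> (\<exists>p. graded_group A Agr p) \<and>
    (\<forall>k l. \<forall>s\<in>Sgr k. \<forall>x\<in>Agr l. s \<odot>\<^bsub>A\<^esub> x \<in> Agr (k + l))"

lemma gmod_left_module: "gmod S Sgr A Agr \<Longrightarrow> left_module S A"
  by (simp add: gmod_def)

lemma gmod_graded_module: "gmod S Sgr A Agr \<Longrightarrow> graded_module S Sgr A Agr"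
  unfolding gmod_def graded_module_def
  by (elim conjE exE) (intro conjI allI ballI graded_group.gr_subgroup graded_group.gr_ex1, auto)

text \<open>The projections are the components of the unique decomposition; all their properties
  come from uniqueness, by exhibiting a decomposition with the desired components.\<close>

lemma graded_module_gmod:
  assumes A: "graded_module S Sgr A Agr" and Sgr: "\<And>k. Sgr k \<subseteq> carrier S"
  shows "gmod S Sgr A Agr"
proof -
  have lm: "left_module S A" and sg: "\<And>k. additive_subgroup (Agr k) A"
    using A by (auto simp: graded_module_def)
  interpret left_module S A by fact
  define P where "P x c \<longleftrightarrow> (\<forall>k. c k \<in> Agr k) \<and> finite {k. c k \<noteq> \<zero>\<^bsub>A\<^esub>} \<and>
    x = (\<Oplus>\<^bsub>A\<^esub>k\<in>{k. c k \<noteq> \<zero>\<^bsub>A\<^esub>}. c k)" for x c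
  have ex1: "\<exists>!c. P x c" if "x \<in> carrier A" for x
    using A that unfolding graded_module_def P_def by blast
  define p where "p k x = (THE c. P x c) k" for k x
  have P: "P x (\<lambda>k. p k x)" if "x \<in> carrier A" for x
    using theI'[OF ex1[OF that]] by (simp add: p_def)
  have uniq: "c = (\<lambda>k. p k x)" if "x \<in> carrier A" "P x c" for x c
    using ex1[OF that(1)] P[OF that(1)] that(2) by blast
  have sub: "x \<in> carrier A" if "x \<in> Agr k" for x k
    using additive_subgroup.a_Hcarr[OF sg that] .
  have sup: "x = (\<Oplus>\<^bsub>A\<^esub>k\<in>F. c k)" if "P x c" "finite F" "{k. c k \<noteq> \<zero>\<^bsub>A\<^esub>} \<subseteq> F" for x c F
  proof -
    have "(\<Oplus>\<^bsub>A\<^esub>k\<in>{k. c k \<noteq> \<zero>\<^bsub>A\<^esub>}. c k) = (\<Oplus>\<^bsub>A\<^esub>k\<in>F. c k)"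
      by (rule add.finprod_mono_neutral_cong_left) (use that sub in \<open>auto simp: P_def Pi_iff\<close>)
    then show ?thesis using that by (simp add: P_def)
  qed
  have supI: "P x c" if "\<And>k. c k \<in> Agr k" "finite F" "{k. c k \<noteq> \<zero>\<^bsub>A\<^esub>} \<subseteq> F" "x = (\<Oplus>\<^bsub>A\<^esub>k\<in>F. c k)" for x c F
  proof -
    have "(\<Oplus>\<^bsub>A\<^esub>k\<in>{k. c k \<noteq> \<zero>\<^bsub>A\<^esub>}. c k) = (\<Oplus>\<^bsub>A\<^esub>k\<in>F. c k)"
      by (rule add.finprod_mono_neutral_cong_left) (use that sub in \<open>auto simp: P_def Pi_iff\<close>)
    then show ?thesis using that by (auto simp: P_def intro: finite_subset)
  qed
  have pgr: "p k x \<in> Agr k" if "x \<in> carrier A" for k x using P[OF that] by (simp add: P_def)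
  have pc: "p k x \<in> carrier A" if "x \<in> carrier A" for k x using sub[OF pgr[OF that]] .
  \<comment> \<open>The componentwise sum decomposes the sum, so by uniqueness the projections are
    additive.\<close>
  have "P (x \<oplus>\<^bsub>A\<^esub> y) (\<lambda>k. p k x \<oplus>\<^bsub>A\<^esub> p k y)" if xy: "x \<in> carrier A" "y \<in> carrier A" for x y
  proof (rule supI[where F = "{k. p k x \<noteq> \<zero>\<^bsub>A\<^esub>} \<union> {k. p k y \<noteq> \<zero>\<^bsub>A\<^esub>}"])
    let ?F = "{k. p k x \<noteq> \<zero>\<^bsub>A\<^esub>} \<union> {k. p k y \<noteq> \<zero>\<^bsub>A\<^esub>}"
    show fin: "finite ?F" using P[OF xy(1)] P[OF xy(2)] by (simp add: P_def)
    show "{k. p k x \<oplus>\<^bsub>A\<^esub> p k y \<noteq> \<zero>\<^bsub>A\<^esub>} \<subseteq> ?F" by auto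
    have "x = (\<Oplus>\<^bsub>A\<^esub>k\<in>?F. p k x)" "y = (\<Oplus>\<^bsub>A\<^esub>k\<in>?F. p k y)"
      using sup[OF P[OF xy(1)] fin] sup[OF P[OF xy(2)] fin] by auto
    moreover have "(\<Oplus>\<^bsub>A\<^esub>k\<in>?F. p k x \<oplus>\<^bsub>A\<^esub> p k y) = (\<Oplus>\<^bsub>A\<^esub>k\<in>?F. p k x) \<oplus>\<^bsub>A\<^esub> (\<Oplus>\<^bsub>A\<^esub>k\<in>?F. p k y)"
      using xy by (intro finsum_addf) (auto simp: pc)
    ultimately show "x \<oplus>\<^bsub>A\<^esub> y = (\<Oplus>\<^bsub>A\<^esub>k\<in>?F. p k x \<oplus>\<^bsub>A\<^esub> p k y)" by simp
    show "p k x \<oplus>\<^bsub>A\<^esub> p k y \<in> Agr k" for k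
      using pgr xy additive_subgroup.a_closed[OF sg] by blast
  qed
  then have padd: "p k (x \<oplus>\<^bsub>A\<^esub> y) = p k x \<oplus>\<^bsub>A\<^esub> p k y" if "x \<in> carrier A" "y \<in> carrier A" for x y k
    using uniq[of "x \<oplus>\<^bsub>A\<^esub> y"] that by (metis (no_types, lifting) M.a_closed)
  have "P x (\<lambda>l. if l = k then x else \<zero>\<^bsub>A\<^esub>)" if "x \<in> Agr k" for x k
  proof (rule supI[where F="{k}"])
    show "(if l = k then x else \<zero>\<^bsub>A\<^esub>) \<in> Agr l" for l
      using that additive_subgroup.zero_closed[OF sg] by auto
  qed (use that sub in auto)
  then have pk: "p l x = (if l = k then x else \<zero>\<^bsub>A\<^esub>)" if "x \<in> Agr k" for x k l
    using uniq[OF sub] that by (metis (mono_tags, lifting))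
  have "graded_group A Agr p"
  proof (intro graded_group.intro graded_group_axioms.intro)
    show "abelian_group_hom A A (p k)" for k
      by (rule abelian_group_homI') (auto simp: pc padd M.abelian_group_axioms)
    show "finite {k. p k x \<noteq> \<zero>\<^bsub>A\<^esub>}" "x = (\<Oplus>\<^bsub>A\<^esub>k\<in>{k. p k x \<noteq> \<zero>\<^bsub>A\<^esub>}. p k x)" if "x \<in> carrier A" for x
      using P[OF that] by (auto simp: P_def)
  qed (auto simp: sub pgr pk M.abelian_group_axioms)
  then show ?thesis using A Sgr by (auto simp: gmod_def graded_module_def)
qed

lemma gmod_hom_eq:
  assumes A: "gmod S Sgr A Agr" and B: "gmod S Sgr B Bgr" and h: "mhom S A B h"
    and deg: "\<And>k x. x \<in> Agr k \<Longrightarrow> h x \<in> Bgr k"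
  obtains p q where "graded_group A Agr p" "graded_group B Bgr q"
    "\<And>k x. x \<in> carrier A \<Longrightarrow> h (p k x) = q k (h x)"
proof -
  obtain p q where pq: "graded_group A Agr p" "graded_group B Bgr q" using A B by (auto simp: gmod_def)
  show ?thesis using graded_hom_p[OF pq mhom_hom[OF h] deg] by (rule that[OF pq])
qed

text \<open>Projecting an arbitrary preimage to degree \<open>k\<close> leaves a preimage, since
  \<open>h\<close> commutes with the projections.\<close>

lemma gmod_surj:
  assumes A: "gmod S Sgr A Agr" and B: "gmod S Sgr B Bgr" and h: "mhom S A B h"
    and deg: "\<And>k x. x \<in> Agr k \<Longrightarrow> h x \<in> Bgr k" and surj: "h ` carrier A = carrier B" and y: "y \<in> Bgr k"
  shows "\<exists>x\<in>Agr k. h x = y"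
proof -
  obtain p q where A: "graded_group A Agr p" and B: "graded_group B Bgr q"
    and eq: "\<And>k x. x \<in> carrier A \<Longrightarrow> h (p k x) = q k (h x)" using gmod_hom_eq[OF A B h deg] by metis
  obtain x where x: "x \<in> carrier A" "h x = y"
    using surj graded_group.gr_sub[OF B y] by (metis imageE)
  have "h (p k x) = y" using eq[OF x(1)] x(2) graded_group.p_id[OF B y] by simp
  then show ?thesis using graded_group.p_gr[OF A x(1)] by blast
qed

text \<open>\<open>x\<close> and its projection to degree \<open>k\<close> have the same image,
  hence are equal. This is used for inverses of isomorphisms.\<close>

lemma gmod_reflect:
  assumes A: "gmod S Sgr A Agr" and B: "gmod S Sgr B Bgr" and h: "mhom S A B h"
    and deg: "\<And>k x. x \<in> Agr k \<Longrightarrow> h x \<in> Bgr k" and inj: "inj_on h (carrier A)"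
    and x: "x \<in> carrier A" "h x \<in> Bgr k"
  shows "x \<in> Agr k"
proof -
  obtain p q where A: "graded_group A Agr p" and B: "graded_group B Bgr q"
    and eq: "\<And>k x. x \<in> carrier A \<Longrightarrow> h (p k x) = q k (h x)" using gmod_hom_eq[OF A B h deg] by metis
  have "h (p k x) = h x" using eq[OF x(1)] graded_group.p_id[OF B x(2)] by simp
  then show ?thesis using inj x(1) graded_group.p_closed[OF A x(1)] graded_group.gr_iff[OF A] by (metis inj_onD)
qed

text \<open>The projections commute with \<open>h\<close>, so they map the kernel to itself and
  grade it.\<close>

lemma gmod_kernel:
  assumes A: "gmod S Sgr A Agr" and B: "gmod S Sgr B Bgr" and h: "mhom S A B h"
    and deg: "\<And>k x. x \<in> Agr k \<Longrightarrow> h x \<in> Bgr k"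
  shows "gmod S Sgr (A\<lparr>carrier := a_kernel A B h\<rparr>) (\<lambda>k. Agr k \<inter> a_kernel A B h)"
proof -
  obtain p q where Ag: "graded_group A Agr p" and Bg: "graded_group B Bgr q"
    and eq: "\<And>k x. x \<in> carrier A \<Longrightarrow> h (p k x) = q k (h x)" using gmod_hom_eq[OF A B h deg] by metis
  interpret A: graded_group A Agr p by fact
  interpret B: graded_group B Bgr q by fact
  let ?K = "A\<lparr>carrier := a_kernel A B h\<rparr>"
  have pK: "p k x \<in> a_kernel A B h" if "x \<in> a_kernel A B h" for k x
    using that eq by (simp add: a_kernel_iff A.p_closed abelian_group_hom.hom_zero[OF B.p_hom])
  have incl: "mhom S ?K A (\<lambda>x. x)" by (rule mhom_kernel_incl[OF h h])
  interpret K: left_module S ?K by (rule left_module_kernel[OF h h])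
  have "graded_group ?K (\<lambda>k. Agr k \<inter> a_kernel A B h) p"
  proof (intro graded_group.intro graded_group_axioms.intro)
    show "abelian_group_hom ?K ?K (p k)" for k
      by (rule abelian_group_homI')
        (simp_all add: pK K.abelian_group_axioms, simp add: a_kernel_iff abelian_group_hom.hom_add[OF A.p_hom])
    fix x assume x: "x \<in> carrier ?K"
    then have xA: "x \<in> carrier A" by (simp add: a_kernel_iff)
    show "finite {k. p k x \<noteq> \<zero>\<^bsub>?K\<^esub>}" using A.p_fin[OF xA] by simp
    have "(\<Oplus>\<^bsub>?K\<^esub>k\<in>{k. p k x \<noteq> \<zero>\<^bsub>A\<^esub>}. p k x) = (\<Oplus>\<^bsub>A\<^esub>k\<in>{k. p k x \<noteq> \<zero>\<^bsub>A\<^esub>}. p k x)"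
      by (rule mhom_finsum[OF incl]) (use x pK in auto)
    then show "x = (\<Oplus>\<^bsub>?K\<^esub>k\<in>{k. p k x \<noteq> \<zero>\<^bsub>?K\<^esub>}. p k x)" using A.p_sum[OF xA] by simp
    show "p k x \<in> Agr k \<inter> a_kernel A B h" for k using x pK A.p_gr[OF xA] by simp
  qed (auto simp: K.abelian_group_axioms A.p_id A.p_other)
  moreover have "s \<odot>\<^bsub>A\<^esub> x \<in> a_kernel A B h" if "s \<in> carrier S" "x \<in> a_kernel A B h" for s x
    using submod_kernel[OF h] that by (simp add: submod_def)
  moreover have Sgr: "\<And>k. Sgr k \<subseteq> carrier S" using A by (simp add: gmod_def)
  moreover have "s \<odot>\<^bsub>A\<^esub> x \<in> Agr (k + l)" if "s \<in> Sgr k" "x \<in> Agr l" for k l s x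
    using A that by (simp add: gmod_def)
  ultimately show ?thesis using K.left_module unfolding gmod_def
    by (auto simp: subset_iff)
qed

section \<open>Free graded modules on an index set\<close>

definition Fr :: "'s ring \<Rightarrow> 'j set \<Rightarrow> ('s, 'j \<Rightarrow> 's) module" where
  "Fr S J = dirsum J (\<lambda>_. S) (\<lambda>s f j. s \<otimes>\<^bsub>S\<^esub> f j)"

text \<open>The basis element at \<open>j\<close> is placed in degree \<open>deg j\<close>, hence
  the shift in the degree of its coefficient.\<close>

definition Frgr :: "'s ring \<Rightarrow> (int \<Rightarrow> 's set) \<Rightarrow> 'j set \<Rightarrow> ('j \<Rightarrow> int) \<Rightarrow> int \<Rightarrow> ('j \<Rightarrow> 's) set" where
  "Frgr S Sgr J deg k = {f \<in> carrier (Fr S J). \<forall>j. f j \<in> Sgr (k - deg j)}"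

lemma Fr_simps:
  "carrier (Fr S J) = {f. (\<forall>x. f x \<in> carrier S) \<and> dsupp (\<lambda>_. S) f \<subseteq> J \<and> finite (dsupp (\<lambda>_. S) f)}"
  "\<zero>\<^bsub>Fr S J\<^esub> = (\<lambda>x. \<zero>\<^bsub>S\<^esub>)"
  "f \<oplus>\<^bsub>Fr S J\<^esub> g = (\<lambda>x. f x \<oplus>\<^bsub>S\<^esub> g x)"
  "s \<odot>\<^bsub>Fr S J\<^esub> f = (\<lambda>j. s \<otimes>\<^bsub>S\<^esub> f j)"
  by (simp_all add: Fr_def dirsum_simps)

lemma (in ring) dirsum_family_Fr: "dirsum_family (\<lambda>_. R)"
  by (simp add: dirsum_family_def abelian_group_axioms)

lemma left_module_Fr:
  assumes "ring S" shows "left_module S (Fr S J)"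
proof -
  interpret S: ring S by fact
  interpret D: dirsum_family J "\<lambda>_. S" "\<lambda>s f j. s \<otimes>\<^bsub>S\<^esub> f j" by (rule S.dirsum_family_Fr)
  show ?thesis
  proof (rule left_moduleI)
    fix a f assume a: "a \<in> carrier S" and f: "f \<in> carrier (Fr S J)"
    have "dsupp (\<lambda>_. S) (\<lambda>j. a \<otimes>\<^bsub>S\<^esub> f j) \<subseteq> dsupp (\<lambda>_. S) f" using a by (auto simp: dsupp_def)
    then show "a \<odot>\<^bsub>Fr S J\<^esub> f \<in> carrier (Fr S J)"
      using a f by (auto simp: Fr_simps intro: finite_subset)
  next
    show "abelian_group (Fr S J)" unfolding Fr_def by (rule D.dirsum_group)
  qed (simp_all add: assms Fr_simps S.l_distr S.r_distr S.m_assoc)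
qed

definition fext :: "'s ring \<Rightarrow> ('s, 'a) module \<Rightarrow> ('j \<Rightarrow> 'a) \<Rightarrow> ('j \<Rightarrow> 's) \<Rightarrow> 'a" where
  "fext S M g = dext (\<lambda>_. S) M (\<lambda>j s. s \<odot>\<^bsub>M\<^esub> g j)"

lemma mhom_fext:
  assumes "left_module S M" "\<And>j. j \<in> J \<Longrightarrow> g j \<in> carrier M"
  shows "mhom S (Fr S J) M (fext S M g)"
proof -
  interpret M: left_module S M by fact
  interpret F: left_module S "Fr S J" by (rule left_module_Fr) (rule M.R.ring_axioms)
  interpret D: dirsum_ext J "\<lambda>_. S" "\<lambda>s f j. s \<otimes>\<^bsub>S\<^esub> f j" M "\<lambda>j s. s \<odot>\<^bsub>M\<^esub> g j"
    by (intro dirsum_ext.intro dirsum_ext_axioms.intro M.R.dirsum_family_Fr M.smult_left_hom assms M.M.abelian_group_axioms)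
  have "dext (\<lambda>_. S) M (\<lambda>j s. s \<odot>\<^bsub>M\<^esub> g j) (a \<odot>\<^bsub>Fr S J\<^esub> f) = a \<odot>\<^bsub>M\<^esub> dext (\<lambda>_. S) M (\<lambda>j s. s \<odot>\<^bsub>M\<^esub> g j) f"
    if f: "f \<in> carrier (Fr S J)" and a: "a \<in> carrier S" for a f
    using f unfolding Fr_def
  proof (induction rule: D.dirsum_induct)
    case zero
    then show ?case using a F.smult_r_null[OF a]
      by (simp add: abelian_group_hom.hom_zero[OF D.dext_hom] M.smult_r_null Fr_def)
  next
    case (sing x s)
    have "a \<odot>\<^bsub>Fr S J\<^esub> sing (\<lambda>_. S) x s = sing (\<lambda>_. S) x (a \<otimes>\<^bsub>S\<^esub> s)"
      using a by (auto simp: Fr_simps sing_def)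
    then show ?case using a sing by (simp add: Fr_def D.dext_sing M.smult_assoc1 assms)
  next
    case (add f h)
    then show ?case using a F.smult_r_distr[OF a, of f h] F.smult_closed[OF a]
      by (simp add: Fr_def abelian_group_hom.hom_add[OF D.dext_hom] M.smult_r_distr D.dext_closed)
  qed
  then show ?thesis unfolding fext_def
    by (intro mhomI) (auto simp: F.left_module assms(1) D.dext_closed[folded Fr_def]
       abelian_group_hom.hom_add[OF D.dext_hom, folded Fr_def])
qed

lemma Fr_gen_closed: "ring S \<Longrightarrow> j \<in> J \<Longrightarrow> s \<in> carrier S \<Longrightarrow> sing (\<lambda>_. S) j s \<in> carrier (Fr S J)"
  unfolding Fr_def by (intro dirsum_family.sing_closed ring.dirsum_family_Fr)

lemma fext_sing:
  assumes "left_module S M" "\<And>j. j \<in> J \<Longrightarrow> g j \<in> carrier M" "j \<in> J" "s \<in> carrier S"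
  shows "fext S M g (sing (\<lambda>_. S) j s) = s \<odot>\<^bsub>M\<^esub> g j"
proof -
  interpret M: left_module S M by fact
  interpret D: dirsum_ext J "\<lambda>_. S" "\<lambda>s f j. s \<otimes>\<^bsub>S\<^esub> f j" M "\<lambda>j s. s \<odot>\<^bsub>M\<^esub> g j"
    by (intro dirsum_ext.intro dirsum_ext_axioms.intro M.R.dirsum_family_Fr M.smult_left_hom assms M.M.abelian_group_axioms)
  show ?thesis unfolding fext_def by (rule D.dext_sing) (use assms in auto)
qed

lemma mhom_Fr_unique:
  assumes g: "mhom S (Fr S J) M g" and h: "mhom S (Fr S J) M h"
    and eq: "\<And>j. j \<in> J \<Longrightarrow> g (sing (\<lambda>_. S) j \<one>\<^bsub>S\<^esub>) = h (sing (\<lambda>_. S) j \<one>\<^bsub>S\<^esub>)"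
    and f: "f \<in> carrier (Fr S J)"
  shows "g f = h f"
proof -
  interpret F: left_module S "Fr S J" by (rule mhom_dom[OF g])
  interpret D: dirsum_family J "\<lambda>_. S" "\<lambda>s f j. s \<otimes>\<^bsub>S\<^esub> f j" by (rule F.R.dirsum_family_Fr)
  show ?thesis using f unfolding Fr_def
  proof (induction rule: D.dirsum_induct)
    case zero
    then show ?case by (simp add: mhom_zero[OF g, unfolded Fr_def] mhom_zero[OF h, unfolded Fr_def])
  next
    case (sing x s)
    have *: "sing (\<lambda>_. S) x s = s \<odot>\<^bsub>Fr S J\<^esub> sing (\<lambda>_. S) x \<one>\<^bsub>S\<^esub>" using sing by (auto simp: Fr_simps sing_def)
    show ?case unfolding *
      using sing eq[OF sing(1)] by (simp add: mhom_smult[OF g] mhom_smult[OF h] Fr_gen_closed F.R.ring_axioms)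
  next
    case (add a b)
    then show ?case by (simp add: mhom_add[OF g, unfolded Fr_def] mhom_add[OF h, unfolded Fr_def])
  qed
qed

locale graded_ring = ring S + graded_group S Sgr pS
  for S :: "'s ring" (structure) and Sgr pS +
  assumes gr_mult: "s \<in> Sgr k \<Longrightarrow> t \<in> Sgr l \<Longrightarrow> s \<otimes> t \<in> Sgr (k + l)"
    and gr_one: "\<one> \<in> Sgr 0"
begin

lemma Frgr_sing: "j \<in> J \<Longrightarrow> s \<in> Sgr k \<Longrightarrow> sing (\<lambda>_. S) j s \<in> Frgr S Sgr J deg (deg j + k)"
  by (auto simp: Frgr_def Fr_gen_closed ring_axioms gr_sub) (auto simp: sing_def gr_zero)

lemma gmod_Fr: "gmod S Sgr (Fr S J) (Frgr S Sgr J deg)"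
proof -
  interpret F: left_module S "Fr S J" by (rule left_module_Fr) (rule ring_axioms)
  interpret D: dirsum_family J "\<lambda>_. S" "\<lambda>s f j. s \<otimes> f j" by (rule dirsum_family_Fr)
  define q where "q k f = (\<lambda>j. pS (k - deg j) (f j))" for k f
  have dz: "pS k \<zero> = \<zero>" for k by (rule abelian_group_hom.hom_zero[OF p_hom])
  have qs: "dsupp (\<lambda>_. S) (q k f) \<subseteq> dsupp (\<lambda>_. S) f" for k f
    by (auto simp: dsupp_def q_def dz)
  have qc: "q k f \<in> Frgr S Sgr J deg k" if "f \<in> carrier (Fr S J)" for k f
    using that qs[of k f] by (auto simp: Fr_simps Frgr_def q_def p_gr p_closed intro: finite_subset)
  have "graded_group (Fr S J) (Frgr S Sgr J deg) q"
  proof (intro graded_group.intro graded_group_axioms.intro)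
    fix f assume f: "f \<in> carrier (Fr S J)"
    \<comment> \<open>A finite set of degrees outside which all components vanish: those of the
      nonzero entries, shifted by the degrees of their basis elements.\<close>
    let ?F = "\<Union>j\<in>dsupp (\<lambda>_. S) f. (\<lambda>k. k + deg j) ` {k. pS k (f j) \<noteq> \<zero>}"
    have fS: "\<And>j. f j \<in> carrier S" using f by (simp add: Fr_simps)
    have fin: "finite ?F" using f by (auto simp: Fr_simps p_fin)
    have sub: "{k. q k f \<noteq> \<zero>\<^bsub>Fr S J\<^esub>} \<subseteq> ?F"
    proof
      fix k assume "k \<in> {k. q k f \<noteq> \<zero>\<^bsub>Fr S J\<^esub>}"
      then obtain j where j: "pS (k - deg j) (f j) \<noteq> \<zero>" by (auto simp: Fr_simps q_def)
      then have "f j \<noteq> \<zero>" using dz by metis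
      then show "k \<in> ?F" using j by (auto simp: dsupp_def intro!: bexI[of _ j] image_eqI[of _ _ "k - deg j"])
    qed
    show fin': "finite {k. q k f \<noteq> \<zero>\<^bsub>Fr S J\<^esub>}" using fin sub by (rule finite_subset[rotated])
    show "f = (\<Oplus>\<^bsub>Fr S J\<^esub>k\<in>{k. q k f \<noteq> \<zero>\<^bsub>Fr S J\<^esub>}. q k f)"
    proof
      fix j
      let ?Q = "{k. q k f \<noteq> \<zero>\<^bsub>Fr S J\<^esub>}"
      have "(\<Oplus>\<^bsub>Fr S J\<^esub>k\<in>?Q. q k f) j = (\<Oplus>k\<in>?Q. q k f j)"
        unfolding Fr_def by (rule D.eval_finsum) (use qc[OF f] in \<open>auto simp: Frgr_def Fr_def\<close>)
      also have "\<dots> = (\<Oplus>k\<in>?Q. pS (k - deg j) (f j))" by (simp add: q_def)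
      \<comment> \<open>Shifting the index by \<open>deg j\<close> turns the j-th entries of the
        components into the decomposition of the single ring element \<open>f j\<close>.\<close>
      also have "\<dots> = (\<Oplus>l\<in>(\<lambda>k. k - deg j) ` ?Q. pS l (f j))"
        using fS by (intro finsum_reindex[symmetric]) (auto simp: p_closed inj_on_def)
      also have "\<dots> = f j"
      proof (rule p_sum_superset[symmetric])
        show "{k. pS k (f j) \<noteq> \<zero>} \<subseteq> (\<lambda>k. k - deg j) ` ?Q"
        proof
          fix l assume l: "l \<in> {k. pS k (f j) \<noteq> \<zero>}"
          then have "q (l + deg j) f j \<noteq> \<zero>" by (simp add: q_def)
          then have "l + deg j \<in> ?Q" by (auto simp: Fr_simps)
          then show "l \<in> (\<lambda>k. k - deg j) ` ?Q" by (rule rev_image_eqI) simp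
        qed
      qed (use fin' fS in auto)
      finally show "f j = (\<Oplus>\<^bsub>Fr S J\<^esub>k\<in>?Q. q k f) j" ..
    qed
  next
    fix k show "abelian_group_hom (Fr S J) (Fr S J) (q k)"
      by (rule abelian_group_homI')
        (use qc in \<open>auto simp: F.abelian_group_axioms Frgr_def\<close>,
         auto simp: Fr_simps q_def abelian_group_hom.hom_add[OF p_hom])
  next
    fix f k l assume "f \<in> Frgr S Sgr J deg l" and "k \<noteq> l"
    then show "q k f = \<zero>\<^bsub>Fr S J\<^esub>"
      using p_other[of "f j" "l - deg j" "k - deg j" for j] by (auto simp: Frgr_def Fr_simps q_def)
  next
    show "x \<in> Frgr S Sgr J deg k \<Longrightarrow> x \<in> carrier (Fr S J)" for x k by (simp add: Frgr_def)
    show "x \<in> Frgr S Sgr J deg k \<Longrightarrow> q k x = x" for x k by (rule ext) (simp add: Frgr_def q_def p_id)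
  qed (auto simp: F.abelian_group_axioms qc)
  moreover have "s \<odot>\<^bsub>Fr S J\<^esub> f \<in> Frgr S Sgr J deg (k + l)" if s: "s \<in> Sgr k" and f: "f \<in> Frgr S Sgr J deg l" for k l s f
  proof -
    have "s \<otimes> f j \<in> Sgr (k + l - deg j)" for j
      using gr_mult[OF s, of "f j" "l - deg j"] f by (simp add: Frgr_def add_diff_eq)
    then show ?thesis using F.smult_closed[of s f] s f gr_sub by (auto simp: Frgr_def Fr_simps(4))
  qed
  ultimately show ?thesis using F.left_module gr_sub by (auto simp: gmod_def)
qed

lemma fext_degree:
  assumes A: "gmod S Sgr A Agr" and g: "\<And>j. j \<in> J \<Longrightarrow> g j \<in> Agr (deg j)" and f: "f \<in> Frgr S Sgr J deg k"
  shows "fext S A g f \<in> Agr k"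
proof -
  obtain p where "graded_group A Agr p" using A by (auto simp: gmod_def)
  then interpret A: graded_group A Agr p .
  have "f j \<odot>\<^bsub>A\<^esub> g j \<in> Agr k" if "j \<in> J" for j
  proof -
    have "f j \<in> Sgr (k - deg j)" using f by (simp add: Frgr_def)
    then have "f j \<odot>\<^bsub>A\<^esub> g j \<in> Agr ((k - deg j) + deg j)" using A g[OF that] unfolding gmod_def by blast
    then show ?thesis by simp
  qed
  moreover have "dsupp (\<lambda>_. S) f \<subseteq> J" using f by (simp add: Frgr_def Fr_simps)
  ultimately show ?thesis unfolding fext_def dext_def by (intro A.gr_finsum) auto
qed

end

section \<open>Graded free resolutions\<close>

definition fker :: "'s ring \<Rightarrow> 'j set \<Rightarrow> ('s, 'a) module \<Rightarrow> (('j \<Rightarrow> 's) \<Rightarrow> 'a) \<Rightarrow> ('s, 'j \<Rightarrow> 's) module" where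
  "fker S J A e = Fr S J\<lparr>carrier := a_kernel (Fr S J) A e\<rparr>"

definition fkergr :: "'s ring \<Rightarrow> (int \<Rightarrow> 's set) \<Rightarrow> 'j set \<Rightarrow> ('j \<Rightarrow> int) \<Rightarrow> ('s, 'a) module \<Rightarrow>
    (('j \<Rightarrow> 's) \<Rightarrow> 'a) \<Rightarrow> int \<Rightarrow> ('j \<Rightarrow> 's) set" where
  "fkergr S Sgr J deg A e k = Frgr S Sgr J deg k \<inter> a_kernel (Fr S J) A e"

text \<open>One stage of a graded free resolution. The ambient set \<open>J0\<close> keeps all index
  sets in reach of one embedding into the universe. The lower bound on \<open>deg\<close> makes
  \<open>Fr S J\<close> bounded below once \<open>Sgr\<close> vanishes in negative degrees.\<close>

definition covers :: "'s ring \<Rightarrow> (int \<Rightarrow> 's set) \<Rightarrow> 'j set \<Rightarrow> 'j set \<Rightarrow> ('j \<Rightarrow> int) \<Rightarrow> (('j \<Rightarrow> 's) \<Rightarrow> 'a) \<Rightarrow>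
    ('s, 'a) module \<Rightarrow> (int \<Rightarrow> 'a set) \<Rightarrow> bool" where
  "covers S Sgr J0 J deg e A Agr \<longleftrightarrow> J \<subseteq> J0 \<and> (\<exists>k0. \<forall>j\<in>J. k0 \<le> deg j) \<and> mhom S (Fr S J) A e \<and>
    e ` carrier (Fr S J) = carrier A \<and> (\<forall>k. \<forall>f\<in>Frgr S Sgr J deg k. e f \<in> Agr k)"

primrec resT :: "'s ring \<Rightarrow> (int \<Rightarrow> 's set) \<Rightarrow> 'j set \<Rightarrow> nat \<Rightarrow>
    ('s, 'j \<Rightarrow> 's) module \<Rightarrow> (int \<Rightarrow> ('j \<Rightarrow> 's) set) \<Rightarrow> bool" where
  "resT S Sgr J0 0 A Agr \<longleftrightarrow> carrier A = {\<zero>\<^bsub>A\<^esub>}"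
| "resT S Sgr J0 (Suc k) A Agr \<longleftrightarrow> (\<exists>J deg e. covers S Sgr J0 J deg e A Agr \<and>
    resT S Sgr J0 k (fker S J A e) (fkergr S Sgr J deg A e))"

text \<open>The number \<open>k\<close> counts the free modules in the resolution. The recursion in \<^const>\<open>resT\<close>
  runs through kernels, which all have the same type; this allows \<open>A\<close> to have any type here.\<close>

definition resP :: "'s ring \<Rightarrow> (int \<Rightarrow> 's set) \<Rightarrow> 'j set \<Rightarrow> nat \<Rightarrow>
    ('s, 'a) module \<Rightarrow> (int \<Rightarrow> 'a set) \<Rightarrow> bool" where
  "resP S Sgr J0 k A Agr \<longleftrightarrow> (case k of 0 \<Rightarrow> carrier A = {\<zero>\<^bsub>A\<^esub>}
   | Suc k \<Rightarrow> (\<exists>J deg e. covers S Sgr J0 J deg e A Agr \<and>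
       resT S Sgr J0 k (fker S J A e) (fkergr S Sgr J deg A e)))"

lemma resP_0: "resP S Sgr J0 0 A Agr \<longleftrightarrow> carrier A = {\<zero>\<^bsub>A\<^esub>}"
  by (simp add: resP_def)

lemma resP_T: "resP S Sgr J0 k A Agr = resT S Sgr J0 k A Agr"
  by (cases k) (simp_all add: resP_def)

lemma resP_Suc: "resP S Sgr J0 (Suc k) A Agr \<longleftrightarrow> (\<exists>J deg e. covers S Sgr J0 J deg e A Agr \<and>
    resP S Sgr J0 k (fker S J A e) (fkergr S Sgr J deg A e))"
  by (simp add: resP_def[of _ _ _ "Suc _"] resP_T)

definition graded_ses :: "'s ring \<Rightarrow> (int \<Rightarrow> 's set) \<Rightarrow> ('s, 'a) module \<Rightarrow> (int \<Rightarrow> 'a set) \<Rightarrow> ('a \<Rightarrow> 'b) \<Rightarrow>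
    ('s, 'b) module \<Rightarrow> (int \<Rightarrow> 'b set) \<Rightarrow> ('b \<Rightarrow> 'c) \<Rightarrow> ('s, 'c) module \<Rightarrow> (int \<Rightarrow> 'c set) \<Rightarrow> bool" where
  "graded_ses S Sgr K Kgr i Z Zgr p X Xgr \<longleftrightarrow>
    gmod S Sgr K Kgr \<and> gmod S Sgr Z Zgr \<and> gmod S Sgr X Xgr \<and> mhom S K Z i \<and> mhom S Z X p \<and>
    inj_on i (carrier K) \<and> p ` carrier Z = carrier X \<and> i ` carrier K = a_kernel Z X p \<and>
    (\<forall>k. \<forall>x\<in>Kgr k. i x \<in> Zgr k) \<and> (\<forall>k. \<forall>x\<in>Zgr k. p x \<in> Xgr k)"

lemma mhom_zero_zero:
  assumes "carrier A = {\<zero>\<^bsub>A\<^esub>}" "mhom S A B h" "h ` carrier A = carrier B"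
  shows "carrier B = {\<zero>\<^bsub>B\<^esub>}"
  using assms mhom_zero[OF assms(2)] by auto

section \<open>Kernels of covers, transport along isomorphisms, padding by zero modules\<close>

context graded_ring
begin

lemma gmod_fker:
  assumes c: "covers S Sgr J0 J deg e A Agr" and A: "gmod S Sgr A Agr"
  shows "gmod S Sgr (fker S J A e) (fkergr S Sgr J deg A e)"
proof -
  have e: "mhom S (Fr S J) A e" "\<And>k f. f \<in> Frgr S Sgr J deg k \<Longrightarrow> e f \<in> Agr k"
    using c by (auto simp: covers_def)
  show ?thesis using gmod_kernel[OF gmod_Fr A e] by (simp add: fker_def fkergr_def[abs_def])
qed

lemma covers_comp:
  assumes c: "covers S Sgr J0 J deg e A Agr" and q: "mhom S A B q" "q ` carrier A = carrier B"
    "\<And>k x. x \<in> Agr k \<Longrightarrow> q x \<in> Bgr k"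
  shows "covers S Sgr J0 J deg (\<lambda>f. q (e f)) B Bgr"
proof -
  have "e ` carrier (Fr S J) = carrier A" using c by (simp add: covers_def)
  then have "(\<lambda>f. q (e f)) ` carrier (Fr S J) = carrier B"
    using q(2) by (metis image_image)
  moreover have "mhom S (Fr S J) B (\<lambda>f. q (e f))" using c q by (auto simp: covers_def intro: mhom_comp)
  ultimately show ?thesis using c q(3) by (simp add: covers_def)
qed

text \<open>Only the first cover changes: composed with an isomorphism it has literally the same
  kernel, so the rest of the resolution is reused.\<close>

lemma resP_iso:
  assumes r: "resP S Sgr J0 k A Agr" and q: "mhom S A B q" "bij_betw q (carrier A) (carrier B)"
    and deg: "\<And>k x. x \<in> Agr k \<Longrightarrow> q x \<in> Bgr k"
  shows "resP S Sgr J0 k B Bgr"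
proof -
  have qs: "q ` carrier A = carrier B" and qi: "inj_on q (carrier A)" using q(2) by (auto simp: bij_betw_def)
  show ?thesis
  proof (cases k)
    case 0
    then show ?thesis using r mhom_zero_zero[OF _ q(1) qs] by (simp add: resP_0)
  next
    case (Suc l)
    then obtain J dg e where c: "covers S Sgr J0 J dg e A Agr"
      and r: "resP S Sgr J0 l (fker S J A e) (fkergr S Sgr J dg A e)" using r by (auto simp: resP_Suc)
    have e: "mhom S (Fr S J) A e" using c by (simp add: covers_def)
    have "q x = \<zero>\<^bsub>B\<^esub> \<longleftrightarrow> x = \<zero>\<^bsub>A\<^esub>" if "x \<in> carrier A" for x
      using qi that mhom_inj_iff[OF q(1)] mhom_zero[OF q(1)] by auto
    then have ker: "a_kernel (Fr S J) B (\<lambda>f. q (e f)) = a_kernel (Fr S J) A e"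
      using mhom_closed[OF e] by (auto simp: a_kernel_def')
    have "covers S Sgr J0 J dg (\<lambda>f. q (e f)) B Bgr"
      by (rule covers_comp[OF c q(1) qs deg])
    then show ?thesis using r unfolding Suc resP_Suc
      by (intro exI[of _ J] exI[of _ dg] exI[of _ "\<lambda>f. q (e f)"]) (simp add: fker_def fkergr_def[abs_def] ker)
  qed
qed

lemma Fr_empty: "carrier (Fr S {}) = {\<zero>\<^bsub>Fr S {}\<^esub>}"
  by (auto simp: Fr_simps dsupp_def)

lemma covers_zero:
  assumes A: "gmod S Sgr A Agr" and z: "carrier A = {\<zero>\<^bsub>A\<^esub>}"
  shows "covers S Sgr J0 {} (\<lambda>_. 0) (\<lambda>_. \<zero>\<^bsub>A\<^esub>) A Agr"
proof -
  obtain p where p: "graded_group A Agr p" using A by (auto simp: gmod_def)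
  show ?thesis unfolding covers_def
  proof (intro conjI allI ballI)
    show "mhom S (Fr S {}) A (\<lambda>_. \<zero>\<^bsub>A\<^esub>)"
      by (intro mhom_zero_map left_module_Fr ring_axioms gmod_left_module[OF A])
    show "(\<lambda>_. \<zero>\<^bsub>A\<^esub>) ` carrier (Fr S {}) = carrier A" by (simp add: Fr_empty z)
    show "\<zero>\<^bsub>A\<^esub> \<in> Agr k" for k by (rule graded_group.gr_zero[OF p])
  qed simp_all
qed

lemma fker_zero: "carrier (fker S {} A (\<lambda>_. \<zero>\<^bsub>A\<^esub>)) = {\<zero>\<^bsub>fker S {} A (\<lambda>_. \<zero>\<^bsub>A\<^esub>)\<^esub>}"
proof -
  have "a_kernel (Fr S {}) A (\<lambda>_. \<zero>\<^bsub>A\<^esub>) = carrier (Fr S {})" by (auto simp: a_kernel_def')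
  then show ?thesis unfolding fker_def by (simp add: Fr_empty)
qed

lemma resT_zero:
  assumes "gmod S Sgr K Kgr" "carrier K = {\<zero>\<^bsub>K\<^esub>}" shows "resT S Sgr J0 k K Kgr"
  using assms
proof (induction k arbitrary: K Kgr)
  case (Suc k)
  note c = covers_zero[OF Suc.prems, of J0]
  show ?case unfolding resT.simps
    by (rule exI[of _ "{}"], rule exI, rule exI, rule conjI[OF c Suc.IH[OF gmod_fker[OF c Suc.prems(1)] fker_zero]])
qed simp

lemma resP_zero:
  assumes "gmod S Sgr A Agr" "carrier A = {\<zero>\<^bsub>A\<^esub>}" shows "resP S Sgr J0 k A Agr"
proof (cases k)
  case (Suc l)
  note c = covers_zero[OF assms, of J0]
  show ?thesis unfolding Suc resP_Suc resP_T
    by (rule exI[of _ "{}"], rule exI, rule exI, rule conjI[OF c resT_zero[OF gmod_fker[OF c assms(1)] fker_zero]])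
qed (simp add: resP_0 assms)

text \<open>A resolution is padded at its far end, where the last kernel is zero and is covered by
  the free module on the empty set.\<close>

lemma resT_Suc_mono:
  assumes "gmod S Sgr K Kgr" "resT S Sgr J0 k K Kgr" shows "resT S Sgr J0 (Suc k) K Kgr"
  using assms
proof (induction k arbitrary: K Kgr)
  case 0
  then show ?case by (intro resT_zero) auto
next
  case (Suc k)
  then obtain J deg e where c: "covers S Sgr J0 J deg e K Kgr"
    and r: "resT S Sgr J0 k (fker S J K e) (fkergr S Sgr J deg K e)" by auto
  from Suc.IH[OF gmod_fker[OF c Suc.prems(1)] r] c
  show ?case by (subst resT.simps) blast
qed

lemma resP_Suc_mono:
  assumes A: "gmod S Sgr A Agr" and r: "resP S Sgr J0 k A Agr" shows "resP S Sgr J0 (Suc k) A Agr"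
proof (cases k)
  case 0
  then show ?thesis using r by (intro resP_zero A) (simp add: resP_0)
next
  case (Suc l)
  then obtain J deg e where c: "covers S Sgr J0 J deg e A Agr"
    and r: "resT S Sgr J0 l (fker S J A e) (fkergr S Sgr J deg A e)" using r by (auto simp: resP_def)
  from resT_Suc_mono[OF gmod_fker[OF c A] r] c
  show ?thesis unfolding Suc resP_Suc resP_T by blast
qed

lemma resP_mono:
  assumes "gmod S Sgr A Agr" "resP S Sgr J0 k A Agr" "k \<le> l" shows "resP S Sgr J0 l A Agr"
  using assms(3,2) by (induction rule: dec_induct) (auto intro: resP_Suc_mono[OF assms(1)])

end

section \<open>The horseshoe lemma and mapping cones\<close>

locale horseshoe = graded_ring S Sgr pS
  for S :: "'s ring" (structure) and Sgr pS +
  fixes J0 :: "'j set" and \<kappa> \<kappa>' :: "'j \<Rightarrow> 'j"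
  assumes inj: "inj \<kappa>" "inj \<kappa>'" and disj: "\<And>x y. \<kappa> x \<noteq> \<kappa>' y"
    and J0: "\<And>j. j \<in> J0 \<Longrightarrow> \<kappa> j \<in> J0" "\<And>j. j \<in> J0 \<Longrightarrow> \<kappa>' j \<in> J0"
begin

text \<open>It merges degree functions as well as elements of free modules; \<open>z\<close> is the
  value at indices outside both images.\<close>

definition mrg :: "'b \<Rightarrow> ('j \<Rightarrow> 'b) \<Rightarrow> ('j \<Rightarrow> 'b) \<Rightarrow> 'j \<Rightarrow> 'b" where
  "mrg z f g y = (if y \<in> range \<kappa> then f (inv_into UNIV \<kappa> y) else if y \<in> range \<kappa>' then g (inv_into UNIV \<kappa>' y) else z)"

lemma \<kappa>'_notin: "\<kappa>' j \<notin> \<kappa> ` J" "\<kappa> j \<notin> \<kappa>' ` J"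
  using disj disj[symmetric] by (auto simp: image_iff)

lemma mrg_simps: "mrg z f g (\<kappa> j) = f j" "mrg z f g (\<kappa>' j) = g j"
  "y \<notin> range \<kappa> \<Longrightarrow> y \<notin> range \<kappa>' \<Longrightarrow> mrg z f g y = z"
  using inj \<kappa>'_notin by (simp_all add: mrg_def)

lemma index_cases: obtains j where "y = \<kappa> j" | j where "y = \<kappa>' j" | "y \<notin> range \<kappa>" "y \<notin> range \<kappa>'"
  by auto

text \<open>The disjoint union of two index sets within one type: the injections \<kappa> and
  \<kappa>' have disjoint images and map \<open>J0\<close> into itself, so
  \<open>Fr S (JJ J J')\<close> is the direct sum of \<open>Fr S J\<close> and
  \<open>Fr S J'\<close> and again has its indices in \<open>J0\<close>.\<close>

definition "JJ J J' = \<kappa> ` J \<union> \<kappa>' ` J'"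

lemma mem_JJ: "\<kappa> j \<in> JJ J J' \<longleftrightarrow> j \<in> J" "\<kappa>' j \<in> JJ J J' \<longleftrightarrow> j \<in> J'"
proof -
  show "\<kappa> j \<in> JJ J J' \<longleftrightarrow> j \<in> J" "\<kappa>' j \<in> JJ J J' \<longleftrightarrow> j \<in> J'"
    by (simp_all add: JJ_def \<kappa>'_notin inj_image_mem_iff[OF inj(1)] inj_image_mem_iff[OF inj(2)])
qed

lemma restr_closed:
  assumes f: "f \<in> carrier (Fr S (JJ J J'))"
  shows "(\<lambda>j. f (\<kappa> j)) \<in> carrier (Fr S J)" "(\<lambda>j. f (\<kappa>' j)) \<in> carrier (Fr S J')"
proof -
  have "finite (\<kappa> -` dsupp (\<lambda>_. S) f)" "finite (\<kappa>' -` dsupp (\<lambda>_. S) f)"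
    using f inj by (auto intro!: finite_vimageI simp: Fr_simps)
  moreover have "\<kappa> -` dsupp (\<lambda>_. S) f \<subseteq> J" "\<kappa>' -` dsupp (\<lambda>_. S) f \<subseteq> J'"
    using f mem_JJ[of _ J J'] by (auto simp: Fr_simps subset_iff)
  ultimately show "(\<lambda>j. f (\<kappa> j)) \<in> carrier (Fr S J)" "(\<lambda>j. f (\<kappa>' j)) \<in> carrier (Fr S J')"
    using f by (auto simp: Fr_simps dsupp_def vimage_def)
qed

lemma mhom_restr: "mhom S (Fr S (JJ J J')) (Fr S J) (\<lambda>f j. f (\<kappa> j))"
  "mhom S (Fr S (JJ J J')) (Fr S J') (\<lambda>f j. f (\<kappa>' j))"
  by (rule mhomI; (intro left_module_Fr ring_axioms restr_closed(1)[where J' = J'])?; simp add: Fr_simps)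
    (rule mhomI; (intro left_module_Fr ring_axioms restr_closed(2)[where J = J])?; simp add: Fr_simps)

lemma mrg_closed:
  assumes f: "f \<in> carrier (Fr S J)" and g: "g \<in> carrier (Fr S J')"
  shows "mrg \<zero> f g \<in> carrier (Fr S (JJ J J'))"
proof -
  have sub: "dsupp (\<lambda>_. S) (mrg \<zero> f g) \<subseteq> \<kappa> ` dsupp (\<lambda>_. S) f \<union> \<kappa>' ` dsupp (\<lambda>_. S) g"
  proof
    fix y assume "y \<in> dsupp (\<lambda>_. S) (mrg \<zero> f g)"
    then show "y \<in> \<kappa> ` dsupp (\<lambda>_. S) f \<union> \<kappa>' ` dsupp (\<lambda>_. S) g"
      by (cases y rule: index_cases) (simp_all add: dsupp_def mrg_simps)
  qed
  moreover have "mrg \<zero> f g y \<in> carrier S" for y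
    using f g by (cases y rule: index_cases) (simp_all add: Fr_simps mrg_simps)
  moreover have "\<kappa> ` dsupp (\<lambda>_. S) f \<subseteq> \<kappa> ` J" "\<kappa>' ` dsupp (\<lambda>_. S) g \<subseteq> \<kappa>' ` J'"
    using f g by (auto simp: Fr_simps)
  ultimately have "dsupp (\<lambda>_. S) (mrg \<zero> f g) \<subseteq> JJ J J'" unfolding JJ_def by blast
  then show ?thesis using f g finite_subset[OF sub] \<open>\<And>y. mrg \<zero> f g y \<in> carrier S\<close>
    by (simp add: Fr_simps)
qed

lemma out_JJ:
  assumes "f \<in> carrier (Fr S (JJ J J'))" "y \<notin> range \<kappa>" "y \<notin> range \<kappa>'"
  shows "f y = \<zero>"
proof -
  have "y \<notin> JJ J J'" using assms by (auto simp: JJ_def)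
  then show ?thesis using assms by (auto simp: Fr_simps dsupp_def)
qed

lemma mrg_restr:
  assumes f: "f \<in> carrier (Fr S (JJ J J'))"
  shows "mrg \<zero> (\<lambda>j. f (\<kappa> j)) (\<lambda>j. f (\<kappa>' j)) = f"
proof
  fix y
  show "mrg \<zero> (\<lambda>j. f (\<kappa> j)) (\<lambda>j. f (\<kappa>' j)) y = f y"
    using out_JJ[OF f] by (cases y rule: index_cases) (simp_all add: mrg_simps)
qed

lemma zero_Fr: "(\<lambda>_. \<zero>) \<in> carrier (Fr S J)"
  by (simp add: Fr_simps dsupp_def)

lemma mhom_inj1: "mhom S (Fr S J) (Fr S (JJ J J')) (\<lambda>f. mrg \<zero> f (\<lambda>_. \<zero>))"
proof -
  have 1: "mrg \<zero> (\<lambda>x. f x \<oplus> g x) (\<lambda>_. \<zero>) y = mrg \<zero> f (\<lambda>_. \<zero>) y \<oplus> mrg \<zero> g (\<lambda>_. \<zero>) y"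
    if "\<And>x. f x \<in> carrier S" "\<And>x. g x \<in> carrier S" for f g y
    by (cases y rule: index_cases) (simp_all add: mrg_simps that)
  have 2: "mrg \<zero> (\<lambda>x. s \<otimes> f x) (\<lambda>_. \<zero>) y = s \<otimes> mrg \<zero> f (\<lambda>_. \<zero>) y"
    if "\<And>x. f x \<in> carrier S" "s \<in> carrier S" for f s y
    by (cases y rule: index_cases) (simp_all add: mrg_simps that)
  show ?thesis
    by (rule mhomI; (intro left_module_Fr ring_axioms mrg_closed zero_Fr)?; simp add: Fr_simps fun_eq_iff 1 2)
qed

lemma Frgr_JJ:
  assumes f: "f \<in> carrier (Fr S (JJ J J'))"
  shows "f \<in> Frgr S Sgr (JJ J J') (mrg 0 dg dg') k \<longleftrightarrow>
   (\<lambda>j. f (\<kappa> j)) \<in> Frgr S Sgr J dg k \<and> (\<lambda>j. f (\<kappa>' j)) \<in> Frgr S Sgr J' dg' k"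
proof
  assume "f \<in> Frgr S Sgr (JJ J J') (mrg 0 dg dg') k"
  then have *: "f y \<in> Sgr (k - mrg 0 dg dg' y)" for y by (simp add: Frgr_def)
  show "(\<lambda>j. f (\<kappa> j)) \<in> Frgr S Sgr J dg k \<and> (\<lambda>j. f (\<kappa>' j)) \<in> Frgr S Sgr J' dg' k"
    using *[of "\<kappa> j" for j] *[of "\<kappa>' j" for j] restr_closed[OF f] by (simp add: Frgr_def mrg_simps)
next
  assume *: "(\<lambda>j. f (\<kappa> j)) \<in> Frgr S Sgr J dg k \<and> (\<lambda>j. f (\<kappa>' j)) \<in> Frgr S Sgr J' dg' k"
  have "f y \<in> Sgr (k - mrg 0 dg dg' y)" for y
    using * out_JJ[OF f] by (cases y rule: index_cases) (simp_all add: mrg_simps gr_zero Frgr_def)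
  then show "f \<in> Frgr S Sgr (JJ J J') (mrg 0 dg dg') k" using f by (simp add: Frgr_def)
qed

text \<open>Lift \<open>e2\<close> through the surjection \<open>p\<close> to a map from
  \<open>Fr S J2\<close> to Z. Together with \<open>i\<close> after \<open>e1\<close> it covers Z on
  the direct sum, compatibly with inclusion and projection; by the snake lemma the kernels of the
  three covers again form a short exact sequence.\<close>

lemma horseshoe_step:
  fixes K :: "('s, 'a) module" and Z :: "('s, 'b) module" and X :: "('s, 'c) module"
  assumes ses: "graded_ses S Sgr K Kgr i Z Zgr p X Xgr"
    and c1: "covers S Sgr J0 J1 dg1 e1 K Kgr" and c2: "covers S Sgr J0 J2 dg2 e2 X Xgr"
  shows "\<exists>J dg e a b. covers S Sgr J0 J dg e Z Zgr \<and>
    graded_ses S Sgr (fker S J1 K e1) (fkergr S Sgr J1 dg1 K e1) a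
       (fker S J Z e) (fkergr S Sgr J dg Z e) b (fker S J2 X e2) (fkergr S Sgr J2 dg2 X e2)"
proof -
  have gK: "gmod S Sgr K Kgr" and gZ: "gmod S Sgr Z Zgr" and gX: "gmod S Sgr X Xgr"
    and i: "mhom S K Z i" and p: "mhom S Z X p"
    and inj: "inj_on i (carrier K)" and surj: "p ` carrier Z = carrier X" and ex: "i ` carrier K = a_kernel Z X p"
    and idg: "\<And>k x. x \<in> Kgr k \<Longrightarrow> i x \<in> Zgr k" and pdg: "\<And>k x. x \<in> Zgr k \<Longrightarrow> p x \<in> Xgr k"
    using ses by (auto simp: graded_ses_def)
  have e1: "mhom S (Fr S J1) K e1" and e2: "mhom S (Fr S J2) X e2"
    and e1s: "e1 ` carrier (Fr S J1) = carrier K" and e2s: "e2 ` carrier (Fr S J2) = carrier X"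
    and e1d: "\<And>k f. f \<in> Frgr S Sgr J1 dg1 k \<Longrightarrow> e1 f \<in> Kgr k"
    and e2d: "\<And>k f. f \<in> Frgr S Sgr J2 dg2 k \<Longrightarrow> e2 f \<in> Xgr k"
    using c1 c2 by (auto simp: covers_def)
  interpret K: left_module S K by (rule mhom_dom[OF i])
  interpret Z: left_module S Z by (rule mhom_dom[OF p])
  interpret X: left_module S X by (rule mhom_cod[OF p])
  obtain pz where "graded_group Z Zgr pz" using gZ by (auto simp: gmod_def)
  then interpret Zg: graded_group Z Zgr pz .
  \<comment> \<open>Basis elements are lifted to elements of the same degree, so that the extension
    by \<open>fext\<close> has degree zero.\<close>
  have "\<exists>z\<in>Zgr (dg2 j). p z = e2 (sing (\<lambda>_. S) j \<one>)" if "j \<in> J2" for j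
    using gmod_surj[OF gZ gX p pdg surj e2d[OF Frgr_sing[OF that gr_one, of dg2]]] by simp
  then obtain g where g: "\<And>j. j \<in> J2 \<Longrightarrow> g j \<in> Zgr (dg2 j)" "\<And>j. j \<in> J2 \<Longrightarrow> p (g j) = e2 (sing (\<lambda>_. S) j \<one>)"
    by metis
  have gc: "g j \<in> carrier Z" if "j \<in> J2" for j using g(1)[OF that] Zg.gr_sub by blast
  let ?z = "fext S Z g"
  have z: "mhom S (Fr S J2) Z ?z" by (rule mhom_fext) (auto simp: Z.left_module gc)
  have pz: "p (?z f) = e2 f" if "f \<in> carrier (Fr S J2)" for f
    using mhom_comp[OF z p] e2 _ that
    by (rule mhom_Fr_unique)
       (simp add: fext_sing[OF Z.left_module gc] gc Z.smult_one g)
  let ?J = "JJ J1 J2" and ?dg = "mrg 0 dg1 dg2"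
  define e where "e f = i (e1 (\<lambda>j. f (\<kappa> j))) \<oplus>\<^bsub>Z\<^esub> ?z (\<lambda>j. f (\<kappa>' j))" for f
  have e: "mhom S (Fr S ?J) Z e"
    unfolding e_def
    by (rule mhom_plus[OF mhom_comp[OF mhom_comp[OF mhom_restr(1) e1] i] mhom_comp[OF mhom_restr(2) z]])
  have e_mrg: "e (mrg \<zero> f1 f2) = i (e1 f1) \<oplus>\<^bsub>Z\<^esub> ?z f2" for f1 f2
    by (simp add: e_def mrg_simps)
  have pi: "p (i x) = \<zero>\<^bsub>X\<^esub>" if "x \<in> carrier K" for x
  proof -
    have "i x \<in> a_kernel Z X p" using that ex by blast
    then show ?thesis by (simp add: a_kernel_iff)
  qed
  have pe: "p (e f) = e2 (\<lambda>j. f (\<kappa>' j))" if f: "f \<in> carrier (Fr S ?J)" for f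
  proof -
    note r = restr_closed[OF f]
    have "p (e f) = p (i (e1 (\<lambda>j. f (\<kappa> j)))) \<oplus>\<^bsub>X\<^esub> p (?z (\<lambda>j. f (\<kappa>' j)))"
      unfolding e_def
      by (intro mhom_add[OF p] mhom_closed[OF i] mhom_closed[OF e1] mhom_closed[OF z] r)
    then show ?thesis using pi[OF mhom_closed[OF e1 r(1)]] pz[OF r(2)] mhom_closed[OF e2 r(2)] by simp
  qed
  have lift: "\<exists>f1\<in>carrier (Fr S J1). i (e1 f1) = y" if "y \<in> carrier Z" "p y = \<zero>\<^bsub>X\<^esub>" for y
  proof -
    have "y \<in> a_kernel Z X p" using that by (simp add: a_kernel_iff)
    then have "y \<in> i ` e1 ` carrier (Fr S J1)" by (simp add: ex e1s)
    then show ?thesis by blast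
  qed
  have cov: "covers S Sgr J0 ?J ?dg e Z Zgr"
    unfolding covers_def
  proof (intro conjI allI ballI)
    show "?J \<subseteq> J0" using c1 c2 J0 by (auto simp: JJ_def covers_def)
    obtain k1 k2 where "\<forall>j\<in>J1. k1 \<le> dg1 j" "\<forall>j\<in>J2. k2 \<le> dg2 j" using c1 c2 by (auto simp: covers_def)
    then show "\<exists>k0. \<forall>j\<in>?J. k0 \<le> ?dg j"
      by (intro exI[of _ "min k1 k2"]) (auto simp: JJ_def mrg_simps min_le_iff_disj)
    have "y \<in> e ` carrier (Fr S ?J)" if y: "y \<in> carrier Z" for y
    proof -
      have "p y \<in> e2 ` carrier (Fr S J2)" using mhom_closed[OF p y] e2s by simp
      then obtain f2 where f2: "f2 \<in> carrier (Fr S J2)" "e2 f2 = p y" by force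
      have zc: "?z f2 \<in> carrier Z" by (rule mhom_closed[OF z f2(1)])
      \<comment> \<open>The lift of \<open>p y\<close> misses \<open>y\<close> only by an element of
        the kernel of \<open>p\<close>, which is reached from \<open>Fr S J1\<close>.\<close>
      have "p (y \<ominus>\<^bsub>Z\<^esub> ?z f2) = \<zero>\<^bsub>X\<^esub>"
        using mhom_minus[OF p y zc] pz[OF f2(1)] f2(2) mhom_closed[OF p y] X.M.minus_eq_zero_iff by simp
      then obtain f1 where f1: "f1 \<in> carrier (Fr S J1)" "i (e1 f1) = y \<ominus>\<^bsub>Z\<^esub> ?z f2"
        using lift y zc by blast
      then have "y = e (mrg \<zero> f1 f2)" using y zc by (simp add: e_mrg Z.M.minus_add_cancel)
      then show ?thesis using mrg_closed[OF f1(1) f2(1)] by blast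
    qed
    then show "e ` carrier (Fr S ?J) = carrier Z" using mhom_closed[OF e] by auto
    fix k f assume f: "f \<in> Frgr S Sgr ?J ?dg k"
    then have fc: "f \<in> carrier (Fr S ?J)" by (simp add: Frgr_def)
    then have "(\<lambda>j. f (\<kappa> j)) \<in> Frgr S Sgr J1 dg1 k" "(\<lambda>j. f (\<kappa>' j)) \<in> Frgr S Sgr J2 dg2 k" using f Frgr_JJ[OF fc] by auto
    then show "e f \<in> Zgr k" unfolding e_def
      by (intro Zg.gr_add idg e1d fext_degree[OF gZ]) (auto simp: g)
  qed (rule e)
  let ?a = "\<lambda>f. mrg \<zero> f (\<lambda>_. \<zero>)" and ?b = "\<lambda>f j. f (\<kappa>' j)"
  have z0': "?z (\<lambda>_. \<zero>) = \<zero>\<^bsub>Z\<^esub>" using mhom_zero[OF z] by (simp add: Fr_simps)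
  have ea: "e (?a f) = i (e1 f)" if "f \<in> carrier (Fr S J1)" for f
    using mhom_closed[OF i mhom_closed[OF e1 that]] by (simp add: e_mrg z0')
  have i0: "i \<zero>\<^bsub>K\<^esub> = \<zero>\<^bsub>Z\<^esub>" by (rule mhom_zero[OF i])
  have ac: "?a f \<in> a_kernel (Fr S ?J) Z e" if "f \<in> a_kernel (Fr S J1) K e1" for f
    using that mhom_closed[OF mhom_inj1[of J1 J2]] by (simp add: a_kernel_iff ea i0)
  have bc: "?b f \<in> a_kernel (Fr S J2) X e2" if "f \<in> a_kernel (Fr S ?J) Z e" for f
    using that restr_closed(2)[of f J1 J2] pe[of f] by (simp add: a_kernel_iff mhom_zero[OF p])
  have ses': "graded_ses S Sgr (fker S J1 K e1) (fkergr S Sgr J1 dg1 K e1) ?a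
       (fker S ?J Z e) (fkergr S Sgr ?J ?dg Z e) ?b (fker S J2 X e2) (fkergr S Sgr J2 dg2 X e2)"
    unfolding graded_ses_def
  proof (intro conjI allI ballI)
    show "mhom S (fker S J1 K e1) (fker S ?J Z e) ?a" unfolding fker_def
      by (intro mhom_into_sub mhom_from_sub mhom_inj1 submod_kernel e e1) (simp add: ac)
    show "mhom S (fker S ?J Z e) (fker S J2 X e2) ?b" unfolding fker_def
      by (intro mhom_into_sub mhom_from_sub mhom_restr submod_kernel e e2) (simp add: bc)
    show "inj_on ?a (carrier (fker S J1 K e1))"
    proof (rule inj_onI, rule ext)
      fix f g j assume "?a f = ?a g"
      then have "?a f (\<kappa> j) = ?a g (\<kappa> j)" by simp
      then show "f j = g j" by (simp add: mrg_simps)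
    qed
    have surjb: "y \<in> ?b ` a_kernel (Fr S ?J) Z e" if y: "y \<in> a_kernel (Fr S J2) X e2" for y
    proof -
      have yc: "y \<in> carrier (Fr S J2)" "e2 y = \<zero>\<^bsub>X\<^esub>" using y by (auto simp: a_kernel_iff)
      have zc: "?z y \<in> carrier Z" by (rule mhom_closed[OF z yc(1)])
      then have "p (\<ominus>\<^bsub>Z\<^esub> ?z y) = \<zero>\<^bsub>X\<^esub>" using mhom_uminus[OF p zc] pz yc by simp
      \<comment> \<open>The correction in \<open>Fr S J1\<close> exists because \<open>e1\<close> is
        onto; it moves the pair into the kernel of \<open>e\<close> without changing its image
        \<open>y\<close>.\<close>
      then obtain f1 where f1: "f1 \<in> carrier (Fr S J1)" "i (e1 f1) = \<ominus>\<^bsub>Z\<^esub> ?z y" using lift zc by blast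
      have "mrg \<zero> f1 y \<in> a_kernel (Fr S ?J) Z e"
        using f1 zc mrg_closed[OF f1(1) yc(1)] by (simp add: a_kernel_iff e_mrg Z.M.l_neg)
      then show ?thesis by (rule rev_image_eqI) (simp add: mrg_simps)
    qed
    show "?b ` carrier (fker S ?J Z e) = carrier (fker S J2 X e2)"
    proof
      show "?b ` carrier (fker S ?J Z e) \<subseteq> carrier (fker S J2 X e2)" using bc by (auto simp: fker_def)
      show "carrier (fker S J2 X e2) \<subseteq> ?b ` carrier (fker S ?J Z e)" using surjb by (auto simp: fker_def)
    qed
    have kerb: "f \<in> ?a ` a_kernel (Fr S J1) K e1" if f: "f \<in> a_kernel (Fr S ?J) Z e" "?b f = (\<lambda>_. \<zero>)" for f
    proof -
      have fc: "f \<in> carrier (Fr S ?J)" "e f = \<zero>\<^bsub>Z\<^esub>" using f by (auto simp: a_kernel_iff)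
      let ?f1 = "\<lambda>j. f (\<kappa> j)"
      have fa: "f = ?a ?f1" using mrg_restr[OF fc(1)] f(2) by simp
      have f1: "?f1 \<in> carrier (Fr S J1)" by (rule restr_closed[OF fc(1)])
      have "i (e1 ?f1) = \<zero>\<^bsub>Z\<^esub>" using ea[OF f1] fa fc by simp
      then have "e1 ?f1 = \<zero>\<^bsub>K\<^esub>" using inj mhom_inj_iff[OF i] mhom_closed[OF e1 f1] by blast
      then have "?f1 \<in> a_kernel (Fr S J1) K e1" using f1 by (simp add: a_kernel_iff)
      then show ?thesis by (rule rev_image_eqI) (rule fa)
    qed
    have ba: "?b (?a f) = (\<lambda>_. \<zero>)" for f by (simp add: mrg_simps)
    show "?a ` carrier (fker S J1 K e1) = a_kernel (fker S ?J Z e) (fker S J2 X e2) ?b"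
    proof
      show "?a ` carrier (fker S J1 K e1) \<subseteq> a_kernel (fker S ?J Z e) (fker S J2 X e2) ?b"
      proof (rule image_subsetI, rule a_kernelI)
        fix f assume "f \<in> carrier (fker S J1 K e1)"
        then show "?a f \<in> carrier (fker S ?J Z e)" using ac by (simp add: fker_def)
        show "?b (?a f) = \<zero>\<^bsub>fker S J2 X e2\<^esub>" unfolding ba by (simp add: fker_def Fr_simps(2))
      qed
      show "a_kernel (fker S ?J Z e) (fker S J2 X e2) ?b \<subseteq> ?a ` carrier (fker S J1 K e1)"
      proof
        fix f assume "f \<in> a_kernel (fker S ?J Z e) (fker S J2 X e2) ?b"
        then have "f \<in> a_kernel (Fr S ?J) Z e" "?b f = (\<lambda>_. \<zero>)"
          unfolding a_kernel_iff[of _ "fker S ?J Z e"] by (simp_all add: fker_def Fr_simps(2))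
        then show "f \<in> ?a ` carrier (fker S J1 K e1)" using kerb by (simp add: fker_def)
      qed
    qed
    show "?a f \<in> fkergr S Sgr ?J ?dg Z e k" if "f \<in> fkergr S Sgr J1 dg1 K e1 k" for k f
    proof -
      have f: "f \<in> a_kernel (Fr S J1) K e1" "f \<in> Frgr S Sgr J1 dg1 k" using that by (auto simp: fkergr_def)
      have a: "?a f \<in> a_kernel (Fr S ?J) Z e" using f(1) by (rule ac)
      have "(\<lambda>_. \<zero>) \<in> Frgr S Sgr J2 dg2 k" by (simp add: Frgr_def zero_Fr gr_zero)
      then have "?a f \<in> Frgr S Sgr ?J ?dg k"
        using f a by (subst Frgr_JJ) (simp_all add: a_kernel_iff mrg_simps)
      then show ?thesis using a by (simp add: fkergr_def)
    qed
    show "?b f \<in> fkergr S Sgr J2 dg2 X e2 k" if "f \<in> fkergr S Sgr ?J ?dg Z e k" for k f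
    proof -
      have f: "f \<in> a_kernel (Fr S ?J) Z e" "f \<in> Frgr S Sgr ?J ?dg k" using that by (auto simp: fkergr_def)
      have "f \<in> carrier (Fr S ?J)" using f by (simp add: a_kernel_iff)
      then show ?thesis using bc[OF f(1)] Frgr_JJ[of f J1 J2 dg1 dg2 k] f(2) by (simp add: fkergr_def)
    qed
  qed (use gmod_fker[OF cov gZ] gmod_fker[OF c1 gK] gmod_fker[OF c2 gX] in simp_all)
  show ?thesis
    by (rule exI[of _ ?J], rule exI[of _ ?dg], rule exI[of _ e], rule exI[of _ ?a], rule exI[of _ ?b],
        rule conjI[OF cov ses'])
qed

lemma ses_zero:
  assumes "graded_ses S Sgr K Kgr i Z Zgr p X Xgr" "carrier K = {\<zero>\<^bsub>K\<^esub>}" "carrier X = {\<zero>\<^bsub>X\<^esub>}"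
  shows "carrier Z = {\<zero>\<^bsub>Z\<^esub>}"
proof -
  have i: "mhom S K Z i" "mhom S Z X p" and "i ` {\<zero>\<^bsub>K\<^esub>} = a_kernel Z X p" "p ` carrier Z = {\<zero>\<^bsub>X\<^esub>}"
    using assms by (auto simp: graded_ses_def)
  then have "a_kernel Z X p = carrier Z" "a_kernel Z X p = {\<zero>\<^bsub>Z\<^esub>}"
    using mhom_zero[OF i(1)] by (auto simp: a_kernel_def')
  then show ?thesis by simp
qed

lemma resT_horseshoe:
  assumes "graded_ses S Sgr K Kgr i Z Zgr p X Xgr" "resT S Sgr J0 k K Kgr" "resT S Sgr J0 k X Xgr"
  shows "resT S Sgr J0 k Z Zgr"
  using assms
proof (induction k arbitrary: K Kgr i Z Zgr p X Xgr)
  case 0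
  then show ?case using ses_zero by simp
next
  case (Suc k)
  obtain J1 dg1 e1 where c1: "covers S Sgr J0 J1 dg1 e1 K Kgr" and r1: "resT S Sgr J0 k (fker S J1 K e1) (fkergr S Sgr J1 dg1 K e1)"
    using Suc.prems(2) by auto
  obtain J2 dg2 e2 where c2: "covers S Sgr J0 J2 dg2 e2 X Xgr" and r2: "resT S Sgr J0 k (fker S J2 X e2) (fkergr S Sgr J2 dg2 X e2)"
    using Suc.prems(3) by auto
  obtain J dg e a b where c: "covers S Sgr J0 J dg e Z Zgr"
    and s: "graded_ses S Sgr (fker S J1 K e1) (fkergr S Sgr J1 dg1 K e1) a
       (fker S J Z e) (fkergr S Sgr J dg Z e) b (fker S J2 X e2) (fkergr S Sgr J2 dg2 X e2)"
    using horseshoe_step[OF Suc.prems(1) c1 c2] by blast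
  show ?case using Suc.IH[OF s r1 r2] c by auto
qed

text \<open>The first step is taken separately because K, Z and X may have other types; from the
  kernels on, all three have the type for which \<open>resT_horseshoe\<close> is an
  induction.\<close>

lemma resP_horseshoe:
  assumes ses: "graded_ses S Sgr K Kgr i Z Zgr p X Xgr" and "resP S Sgr J0 k K Kgr" "resP S Sgr J0 k X Xgr"
  shows "resP S Sgr J0 k Z Zgr"
proof (cases k)
  case 0
  then show ?thesis using assms ses_zero by (simp add: resP_0)
next
  case (Suc l)
  obtain J1 dg1 e1 where c1: "covers S Sgr J0 J1 dg1 e1 K Kgr" and r1: "resT S Sgr J0 l (fker S J1 K e1) (fkergr S Sgr J1 dg1 K e1)"
    using assms(2) unfolding Suc resP_Suc resP_T by auto
  obtain J2 dg2 e2 where c2: "covers S Sgr J0 J2 dg2 e2 X Xgr" and r2: "resT S Sgr J0 l (fker S J2 X e2) (fkergr S Sgr J2 dg2 X e2)"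
    using assms(3) unfolding Suc resP_Suc resP_T by auto
  obtain J dg e a b where c: "covers S Sgr J0 J dg e Z Zgr"
    and s: "graded_ses S Sgr (fker S J1 K e1) (fkergr S Sgr J1 dg1 K e1) a
       (fker S J Z e) (fkergr S Sgr J dg Z e) b (fker S J2 X e2) (fkergr S Sgr J2 dg2 X e2)"
    using horseshoe_step[OF ses c1 c2] by blast
  show ?thesis using resT_horseshoe[OF s r1 r2] c unfolding Suc resP_Suc resP_T by blast
qed

text \<open>The cover \<open>e\<close> of Y followed by \<open>q\<close> covers A. Its kernel is an
  extension of the kernel of \<open>q\<close> by the kernel of \<open>e\<close>, and both of these
  are resolved by \<open>k\<close> free modules, so the horseshoe lemma applies. This replaces an
  explicit mapping cone.\<close>

lemma resP_cone:
  fixes Y :: "('s, 'b) module" and A :: "('s, 'c) module"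
  assumes Y: "gmod S Sgr Y Ygr" and A: "gmod S Sgr A Agr" and q: "mhom S Y A q" "q ` carrier Y = carrier A"
    and qd: "\<And>k x. x \<in> Ygr k \<Longrightarrow> q x \<in> Agr k"
    and rY: "resP S Sgr J0 (Suc k) Y Ygr"
    and rX: "resP S Sgr J0 k (Y\<lparr>carrier := a_kernel Y A q\<rparr>) (\<lambda>i. Ygr i \<inter> a_kernel Y A q)"
  shows "resP S Sgr J0 (Suc k) A Agr"
proof -
  let ?X = "Y\<lparr>carrier := a_kernel Y A q\<rparr>" and ?Xgr = "\<lambda>i. Ygr i \<inter> a_kernel Y A q"
  obtain J dg e where c: "covers S Sgr J0 J dg e Y Ygr" and r: "resT S Sgr J0 k (fker S J Y e) (fkergr S Sgr J dg Y e)"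
    using rY unfolding resP_Suc resP_T by auto
  have e: "mhom S (Fr S J) Y e" and es: "e ` carrier (Fr S J) = carrier Y"
    and ed: "\<And>k f. f \<in> Frgr S Sgr J dg k \<Longrightarrow> e f \<in> Ygr k" using c by (auto simp: covers_def)
  let ?e = "\<lambda>f. q (e f)"
  have c': "covers S Sgr J0 J dg ?e A Agr" by (rule covers_comp[OF c q qd])
  have e': "mhom S (Fr S J) A ?e" using c' by (simp add: covers_def)
  have sub: "a_kernel (Fr S J) Y e \<subseteq> a_kernel (Fr S J) A ?e"
    using mhom_zero[OF q(1)] by (auto simp: a_kernel_def')
  have eX: "e f \<in> a_kernel Y A q" if "f \<in> a_kernel (Fr S J) A ?e" for f
    using that mhom_closed[OF e] by (simp add: a_kernel_iff)
  have "graded_ses S Sgr (fker S J Y e) (fkergr S Sgr J dg Y e) (\<lambda>x. x) (fker S J A ?e) (fkergr S Sgr J dg A ?e) e ?X ?Xgr"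
    unfolding graded_ses_def
  proof (intro conjI allI ballI)
    show "mhom S (fker S J Y e) (fker S J A ?e) (\<lambda>x. x)" unfolding fker_def
      using sub by (intro mhom_into_sub mhom_from_sub mhom_id submod_kernel e e' mhom_dom[OF e]) auto
    show "mhom S (fker S J A ?e) ?X e" unfolding fker_def
      using eX by (intro mhom_into_sub mhom_from_sub submod_kernel e e' q) simp_all
    show "e ` carrier (fker S J A ?e) = carrier ?X"
    proof
      show "carrier ?X \<subseteq> e ` carrier (fker S J A ?e)"
      proof
        fix y assume "y \<in> carrier ?X"
        then have y: "y \<in> carrier Y" "q y = \<zero>\<^bsub>A\<^esub>" by (auto simp: a_kernel_iff)
        then obtain f where "f \<in> carrier (Fr S J)" "e f = y" using es by (metis imageE)
        then show "y \<in> e ` carrier (fker S J A ?e)" using y by (auto simp: fker_def a_kernel_iff)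
      qed
      show "e ` carrier (fker S J A ?e) \<subseteq> carrier ?X" using eX by (auto simp: fker_def)
    qed
    show "(\<lambda>x. x) ` carrier (fker S J Y e) = a_kernel (fker S J A ?e) ?X e"
      using sub by (auto simp: fker_def a_kernel_def')
    show "x \<in> fkergr S Sgr J dg A ?e k" if "x \<in> fkergr S Sgr J dg Y e k" for k x
      using that sub by (auto simp: fkergr_def)
    show "e x \<in> ?Xgr k" if "x \<in> fkergr S Sgr J dg A ?e k" for k x
      using that eX ed by (auto simp: fkergr_def)
  qed (use gmod_fker[OF c Y] gmod_fker[OF c' A] gmod_kernel[OF Y A q(1) qd] in simp_all)
  then have "resP S Sgr J0 k (fker S J A ?e) (fkergr S Sgr J dg A ?e)"
    by (rule resP_horseshoe) (use r rX in \<open>auto simp: resP_T\<close>)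
  then show ?thesis using c' by (auto simp: resP_Suc)
qed

end

section \<open>Modules induced to a monoid ring\<close>

text \<open>Sums and gradings see only the additive fields of a record. This lets them pass between
  a direct sum and the ring or module built on it.\<close>

lemma finsum_group_cong:
  assumes "carrier G = carrier H" "add G = add H" "ring.zero G = ring.zero H"
  shows "finsum G f A = finsum H f A"
  using assms by (simp add: finsum_def finprod_def)

lemma abelian_group_cong:
  assumes G: "abelian_group G" and eq: "carrier G = carrier H" "add G = add H" "ring.zero G = ring.zero H"
  shows "abelian_group H"
  using abelian_groupE[OF G] unfolding eq by (intro abelian_groupI) auto

lemma graded_group_cong:
  assumes G: "graded_group G Agr p" and eq: "carrier G = carrier H" "add G = add H" "ring.zero G = ring.zero H"
  shows "graded_group H Agr p"
proof -
  interpret G: graded_group G Agr p by fact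
  have H: "abelian_group H" by (rule abelian_group_cong[OF G.abelian_group_axioms eq])
  have sum: "finsum H f A = finsum G f A" for f and A :: "'k set"
    using eq by (intro finsum_group_cong) auto
  show ?thesis
  proof (intro graded_group.intro graded_group_axioms.intro H)
    show "abelian_group_hom H H (p k)" for k
      using abelian_group_hom.hom_closed[OF G.p_hom] abelian_group_hom.hom_add[OF G.p_hom]
      by (intro abelian_group_homI' H) (auto simp: eq)
    fix x assume x: "x \<in> carrier H"
    then have x': "x \<in> carrier G" by (simp add: eq)
    show "finite {k. p k x \<noteq> \<zero>\<^bsub>H\<^esub>}" "p k x \<in> Agr k" for k
      using G.p_fin[OF x'] G.p_gr[OF x'] by (simp_all add: eq)
    show "x = (\<Oplus>\<^bsub>H\<^esub>k\<in>{k. p k x \<noteq> \<zero>\<^bsub>H\<^esub>}. p k x)"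
      using G.p_sum[OF x'] by (simp add: eq sum)
  next
    show "x \<in> carrier H" "p k x = x" if "x \<in> Agr k" for x k using G.gr_sub[OF that] G.p_id[OF that] by (simp_all add: eq)
    show "p k x = \<zero>\<^bsub>H\<^esub>" if "x \<in> Agr l" "k \<noteq> l" for x k l using G.p_other[OF that] by (simp add: eq)
  qed
qed

context dirsum_family
begin

definition dgr :: "('x \<Rightarrow> int) \<Rightarrow> int \<Rightarrow> ('x \<Rightarrow> 'u) set" where
  "dgr dg k = {f \<in> carrier (dirsum X N sm). \<forall>x\<in>dsupp N f. dg x = k}"

lemma sing_dgr: "x \<in> X \<Longrightarrow> a \<in> carrier (N x) \<Longrightarrow> dg x = k \<Longrightarrow> sing N x a \<in> dgr dg k"
  using sing_supp[of x a] by (auto simp: dgr_def sing_closed)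

lemma graded_dirsum: "graded_group (dirsum X N sm) (dgr dg) (\<lambda>k f x. if dg x = k then f x else \<zero>\<^bsub>N x\<^esub>)"
proof -
  let ?p = "\<lambda>k f x. if dg x = k then f x else \<zero>\<^bsub>N x\<^esub>"
  let ?D = "dirsum X N sm"
  have z: "\<zero>\<^bsub>N x\<^esub> \<in> carrier (N x)" "\<zero>\<^bsub>N x\<^esub> \<oplus>\<^bsub>N x\<^esub> \<zero>\<^bsub>N x\<^esub> = \<zero>\<^bsub>N x\<^esub>" for x
    using abelian_groupE(2,5)[OF N] by auto
  have ps: "dsupp N (?p k f) \<subseteq> dsupp N f" for k f by (auto simp: dsupp_def)
  have pc: "?p k f \<in> carrier ?D" if "f \<in> carrier ?D" for k f
    using dirsumD[OF that] ps[of k f] by (auto simp: dirsum_simps(1) z intro: finite_subset[OF ps])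
  show ?thesis
  proof (intro graded_group.intro graded_group_axioms.intro D.abelian_group_axioms)
    show "abelian_group_hom ?D ?D (?p k)" for k
      by (rule abelian_group_homI') (use pc in \<open>simp_all add: D.abelian_group_axioms dirsum_simps(3) z fun_eq_iff\<close>)
    show "?p k f \<in> dgr dg k" if "f \<in> carrier ?D" for k f
      using pc[OF that] by (auto simp: dgr_def dsupp_def)
    show "f \<in> carrier ?D" if "f \<in> dgr dg k" for f k using that by (simp add: dgr_def)
    show "?p k f = f" if "f \<in> dgr dg k" for k f
    proof (rule ext)
      fix x show "?p k f x = f x" using that by (cases "f x = \<zero>\<^bsub>N x\<^esub>") (auto simp: dgr_def dsupp_def)
    qed
    show "?p k f = \<zero>\<^bsub>?D\<^esub>" if "f \<in> dgr dg l" "k \<noteq> l" for k l f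
      using that by (auto simp: dgr_def dsupp_def fun_eq_iff dirsum_simps(2))
    fix f assume f: "f \<in> carrier ?D"
    have fin: "finite (dg ` dsupp N f)" using dirsumD[OF f] by simp
    have sub: "{k. ?p k f \<noteq> \<zero>\<^bsub>?D\<^esub>} \<subseteq> dg ` dsupp N f"
      by (auto simp: dirsum_simps(2) fun_eq_iff dsupp_def)
    show fin': "finite {k. ?p k f \<noteq> \<zero>\<^bsub>?D\<^esub>}" by (rule finite_subset[OF sub fin])
    show "f = (\<Oplus>\<^bsub>?D\<^esub>k\<in>{k. ?p k f \<noteq> \<zero>\<^bsub>?D\<^esub>}. ?p k f)"
    proof
      fix x
      interpret Nx: abelian_group "N x" by (rule N)
      have "(\<Oplus>\<^bsub>?D\<^esub>k\<in>{k. ?p k f \<noteq> \<zero>\<^bsub>?D\<^esub>}. ?p k f) x = (\<Oplus>\<^bsub>N x\<^esub>k\<in>{k. ?p k f \<noteq> \<zero>\<^bsub>?D\<^esub>}. ?p k f x)"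
        using pc[OF f] by (intro eval_finsum) simp
      also have "\<dots> = f x"
      proof (cases "f x = \<zero>\<^bsub>N x\<^esub>")
        case True
        then have "(\<lambda>k. ?p k f x) = (\<lambda>k. \<zero>\<^bsub>N x\<^esub>)" by auto
        then show ?thesis using True by simp
      next
        case False
        then have "dg x \<in> {k. ?p k f \<noteq> \<zero>\<^bsub>?D\<^esub>}" by (auto simp: dirsum_simps(2) fun_eq_iff)
        then show ?thesis using Nx.finsum_singleton[of "dg x" "{k. ?p k f \<noteq> \<zero>\<^bsub>?D\<^esub>}" "\<lambda>_. f x"] fin' dirsumD(1)[OF f] by simp
      qed
      finally show "f x = (\<Oplus>\<^bsub>?D\<^esub>k\<in>{k. ?p k f \<noteq> \<zero>\<^bsub>?D\<^esub>}. ?p k f) x" ..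
    qed
  qed
qed

end

text \<open>A placeholder for the scalar multiplication where only the additive group matters.\<close>

definition nosm :: "'r \<Rightarrow> 'f \<Rightarrow> 'f" where "nosm _ f = f"

text \<open>The action of the single term r \<alpha> of the monoid ring: \<beta> \<otimes> a goes to
  \<alpha> \<beta> \<otimes> r a.\<close>

definition ind_act :: "'r ring \<Rightarrow> 'm monoid \<Rightarrow> 'j set \<Rightarrow> ('j \<Rightarrow> ('r, 'u) module) \<Rightarrow> 'm \<Rightarrow> 'r \<Rightarrow>
    ('m \<times> 'j \<Rightarrow> 'u) \<Rightarrow> 'm \<times> 'j \<Rightarrow> 'u" where
  "ind_act R Mo J N \<alpha> r = dext (\<lambda>x. N (snd x)) (dirsum (carrier Mo \<times> J) (\<lambda>x. N (snd x)) (nosm :: 'r \<Rightarrow> _))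
    (\<lambda>x a. sing (\<lambda>x. N (snd x)) (\<alpha> \<otimes>\<^bsub>Mo\<^esub> fst x, snd x) (r \<odot>\<^bsub>N (snd x)\<^esub> a))"

text \<open>\<open>R[M] \<otimes>\<^sub>R (\<Oplus>j\<in>J. N j)\<close>, where \<open>\<mu> \<otimes> a\<close> with \<open>a \<in> N j\<close> is the family with the value \<open>a\<close> at \<open>(\<mu>, j)\<close>.\<close>

definition Ind :: "'r ring \<Rightarrow> 'm monoid \<Rightarrow> 'j set \<Rightarrow> ('j \<Rightarrow> ('r, 'u) module) \<Rightarrow> ('m \<Rightarrow> 'r, 'm \<times> 'j \<Rightarrow> 'u) module" where
  "Ind R Mo J N = dirsum (carrier Mo \<times> J) (\<lambda>x. N (snd x))
    (\<lambda>s f. dext (\<lambda>_. R) (dirsum (carrier Mo \<times> J) (\<lambda>x. N (snd x)) (nosm :: 'r \<Rightarrow> _)) (\<lambda>\<alpha> r. ind_act R Mo J N \<alpha> r f) s)"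

text \<open>That the monoid ring is a ring is assumed here because it is contained in the hypothesis that \<open>A\<close>
  is a left module over it.\<close>

locale mring =
  fixes R :: "'r ring" and Mo :: "'m monoid" and len :: "'m \<Rightarrow> nat"
  assumes R: "ring R" and Mo: "monoid Mo" and S: "ring (monoid_ring R Mo)"
    and len_mult: "\<And>\<alpha> \<beta>. \<alpha> \<in> carrier Mo \<Longrightarrow> \<beta> \<in> carrier Mo \<Longrightarrow> len (\<alpha> \<otimes>\<^bsub>Mo\<^esub> \<beta>) = len \<alpha> + len \<beta>"
    and len_one: "len \<one>\<^bsub>Mo\<^esub> = 0"
begin

sublocale R: ring R by (rule R)
sublocale Mo: monoid Mo by (rule Mo)
sublocale S: ring "monoid_ring R Mo" by (rule S)

abbreviation "S \<equiv> monoid_ring R Mo"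

sublocale DS: dirsum_family "carrier Mo" "\<lambda>_. R" "nosm :: 'r \<Rightarrow> ('m \<Rightarrow> 'r) \<Rightarrow> 'm \<Rightarrow> 'r"
  by (rule R.dirsum_family_Fr)

abbreviation "DS \<equiv> dirsum (carrier Mo) (\<lambda>_. R) (nosm :: 'r \<Rightarrow> ('m \<Rightarrow> 'r) \<Rightarrow> 'm \<Rightarrow> 'r)"

definition sgl :: "'m \<Rightarrow> 'r \<Rightarrow> 'm \<Rightarrow> 'r" where "sgl = sing (\<lambda>_. R)"

lemma supp_dsupp: "dsupp (\<lambda>_. R) s = supp R s"
  by (simp add: dsupp_def supp_def)

text \<open>The additive group of the monoid ring is a direct sum of copies of \<open>R\<close>; the
  induction rule, the extension of maps and the grading are borrowed from there.\<close>

lemma DS_S: "carrier DS = carrier S" "add DS = add S" "ring.zero DS = ring.zero S"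
  by (auto simp: dirsum_def monoid_ring_def supp_dsupp image_subset_iff)

lemma sgl_closed: "\<alpha> \<in> carrier Mo \<Longrightarrow> r \<in> carrier R \<Longrightarrow> sgl \<alpha> r \<in> carrier S"
  using DS.sing_closed by (simp add: DS_S sgl_def)

lemma S_induct [consumes 1, case_names zero sgl add]:
  assumes "s \<in> carrier S" and "P \<zero>\<^bsub>S\<^esub>"
    and "\<And>\<alpha> r. \<alpha> \<in> carrier Mo \<Longrightarrow> r \<in> carrier R \<Longrightarrow> P (sgl \<alpha> r)"
    and "\<And>s t. s \<in> carrier S \<Longrightarrow> t \<in> carrier S \<Longrightarrow> P s \<Longrightarrow> P t \<Longrightarrow> P (s \<oplus>\<^bsub>S\<^esub> t)"
  shows "P s"
  using assms(1) DS.dirsum_induct[of s P] assms(2-) by (simp add: DS_S sgl_def)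

lemma sgl_mult:
  assumes "\<alpha> \<in> carrier Mo" "\<beta> \<in> carrier Mo" "r \<in> carrier R" "t \<in> carrier R"
  shows "sgl \<alpha> r \<otimes>\<^bsub>S\<^esub> sgl \<beta> t = sgl (\<alpha> \<otimes>\<^bsub>Mo\<^esub> \<beta>) (r \<otimes>\<^bsub>R\<^esub> t)"
proof
  fix \<mu>
  let ?P = "{p \<in> supp R (sgl \<alpha> r) \<times> supp R (sgl \<beta> t). fst p \<otimes>\<^bsub>Mo\<^esub> snd p = \<mu>}"
  have "(sgl \<alpha> r \<otimes>\<^bsub>S\<^esub> sgl \<beta> t) \<mu> = (\<Oplus>\<^bsub>R\<^esub>p\<in>?P. sgl \<alpha> r (fst p) \<otimes>\<^bsub>R\<^esub> sgl \<beta> t (snd p))"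
    by (simp add: monoid_ring_def)
  also have "\<dots> = sgl (\<alpha> \<otimes>\<^bsub>Mo\<^esub> \<beta>) (r \<otimes>\<^bsub>R\<^esub> t) \<mu>"
  proof (cases "r = \<zero>\<^bsub>R\<^esub> \<or> t = \<zero>\<^bsub>R\<^esub> \<or> \<mu> \<noteq> \<alpha> \<otimes>\<^bsub>Mo\<^esub> \<beta>")
    case True
    then have P: "?P = {}" by (auto simp: supp_def sgl_def sing_def split: if_splits)
    show ?thesis unfolding P using True assms by (auto simp: sgl_def sing_def)
  next
    case False
    then have P: "?P = {(\<alpha>, \<beta>)}" by (auto simp: supp_def sgl_def sing_def split: if_splits)
    show ?thesis unfolding P using False assms by (simp add: sgl_def sing_def)
  qed
  finally show "(sgl \<alpha> r \<otimes>\<^bsub>S\<^esub> sgl \<beta> t) \<mu> = sgl (\<alpha> \<otimes>\<^bsub>Mo\<^esub> \<beta>) (r \<otimes>\<^bsub>R\<^esub> t) \<mu>" .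
qed

lemma sgl_one: "sgl \<one>\<^bsub>Mo\<^esub> \<one>\<^bsub>R\<^esub> = \<one>\<^bsub>S\<^esub>"
  by (auto simp: sgl_def sing_def monoid_ring_def)

lemma sgl_add: "\<alpha> \<in> carrier Mo \<Longrightarrow> r \<in> carrier R \<Longrightarrow> t \<in> carrier R \<Longrightarrow> sgl \<alpha> (r \<oplus>\<^bsub>R\<^esub> t) = sgl \<alpha> r \<oplus>\<^bsub>S\<^esub> sgl \<alpha> t"
  using DS.sing_add[of \<alpha> r t] by (simp add: DS_S sgl_def)

definition Sgr :: "int \<Rightarrow> ('m \<Rightarrow> 'r) set" where
  "Sgr k = {f \<in> carrier S. \<forall>\<mu>\<in>supp R f. int (len \<mu>) = k}"

lemma Sgr_dgr: "Sgr k = DS.dgr (\<lambda>\<mu>. int (len \<mu>)) k"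
  by (simp add: Sgr_def DS.dgr_def DS_S supp_dsupp)

lemma sgl_gr: "\<alpha> \<in> carrier Mo \<Longrightarrow> r \<in> carrier R \<Longrightarrow> sgl \<alpha> r \<in> Sgr (int (len \<alpha>))"
  unfolding Sgr_dgr sgl_def by (rule DS.sing_dgr) auto

lemma graded_S: "graded_ring S Sgr (\<lambda>k f \<mu>. if int (len \<mu>) = k then f \<mu> else \<zero>\<^bsub>R\<^esub>)"
proof (intro graded_ring.intro graded_ring_axioms.intro S)
  show "graded_group S Sgr (\<lambda>k f \<mu>. if int (len \<mu>) = k then f \<mu> else \<zero>\<^bsub>R\<^esub>)"
    using graded_group_cong[OF DS.graded_dirsum DS_S] by (simp add: Sgr_dgr[abs_def])
  show "s \<otimes>\<^bsub>S\<^esub> t \<in> Sgr (k + l)" if st: "s \<in> Sgr k" "t \<in> Sgr l" for s t k l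
  proof -
    have "int (len \<mu>) = k + l" if \<mu>: "\<mu> \<in> supp R (s \<otimes>\<^bsub>S\<^esub> t)" for \<mu>
    proof -
      let ?P = "{p \<in> supp R s \<times> supp R t. fst p \<otimes>\<^bsub>Mo\<^esub> snd p = \<mu>}"
      \<comment> \<open>An empty sum would be zero, so some pair of support elements has the product
        \<mu>.\<close>
      have "?P \<noteq> {}"
      proof
        assume P: "?P = {}"
        have "(s \<otimes>\<^bsub>S\<^esub> t) \<mu> = (\<Oplus>\<^bsub>R\<^esub>p\<in>?P. s (fst p) \<otimes>\<^bsub>R\<^esub> t (snd p))"
          by (simp add: monoid_ring_def)
        then show False using \<mu> unfolding P by (simp add: supp_def)
      qed
      then obtain \<alpha> \<beta> where ab: "\<alpha> \<in> supp R s" "\<beta> \<in> supp R t" "\<alpha> \<otimes>\<^bsub>Mo\<^esub> \<beta> = \<mu>" by auto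
      moreover have "\<alpha> \<in> carrier Mo" "\<beta> \<in> carrier Mo"
        using ab st by (auto simp: Sgr_def monoid_ring_def)
      ultimately show ?thesis using len_mult[of \<alpha> \<beta>] st by (auto simp: Sgr_def)
    qed
    then show ?thesis using st by (simp add: Sgr_def)
  qed
  show "\<one>\<^bsub>S\<^esub> \<in> Sgr 0" using sgl_gr[of "\<one>\<^bsub>Mo\<^esub>" "\<one>\<^bsub>R\<^esub>"] by (simp add: sgl_one len_one)
qed

end

locale ind_module = mring R Mo len
  for R :: "'r ring" and Mo :: "'m monoid" and len +
  fixes J :: "'j set" and N :: "'j \<Rightarrow> ('r, 'u) module" and dg :: "'j \<Rightarrow> int"
  assumes N: "\<And>j. left_module R (N j)"
begin

abbreviation "N' \<equiv> (\<lambda>x :: 'm \<times> 'j. N (snd x))"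
abbreviation "X \<equiv> carrier Mo \<times> J"
abbreviation "G \<equiv> dirsum X N' (nosm :: 'r \<Rightarrow> ('m \<times> 'j \<Rightarrow> 'u) \<Rightarrow> 'm \<times> 'j \<Rightarrow> 'u)"
abbreviation "I \<equiv> Ind R Mo J N"

sublocale G: dirsum_family X N' "nosm :: 'r \<Rightarrow> ('m \<times> 'j \<Rightarrow> 'u) \<Rightarrow> 'm \<times> 'j \<Rightarrow> 'u"
  by (rule dirsum_family.intro) (rule left_module_abelian_group[OF N])

lemma I_G: "carrier I = carrier G" "add I = add G" "ring.zero I = ring.zero G"
  by (simp_all add: Ind_def dirsum_def)

lemma I_group: "abelian_group I"
  by (rule abelian_group_cong[OF G.dirsum_group]) (simp_all add: I_G)

sublocale I: abelian_group I by (rule I_group)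

definition Igr :: "int \<Rightarrow> ('m \<times> 'j \<Rightarrow> 'u) set" where
  "Igr k = G.dgr (\<lambda>x. int (len (fst x)) + dg (snd x)) k"

lemma Igr_iff: "f \<in> Igr k \<longleftrightarrow> f \<in> carrier I \<and> (\<forall>\<mu> j. f (\<mu>, j) \<noteq> \<zero>\<^bsub>N j\<^esub> \<longrightarrow> int (len \<mu>) + dg j = k)"
  by (auto simp: Igr_def G.dgr_def I_G dsupp_def)

lemma graded_I: "graded_group I Igr (\<lambda>k f x. if int (len (fst x)) + dg (snd x) = k then f x else \<zero>\<^bsub>N' x\<^esub>)"
  using graded_group_cong[OF G.graded_dirsum[of "\<lambda>x. int (len (fst x)) + dg (snd x)"], of I]
  by (simp add: Igr_def[abs_def] I_G)

abbreviation "act \<equiv> ind_act R Mo J N"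

context
  fixes \<alpha> r assumes \<alpha>: "\<alpha> \<in> carrier Mo" and r: "r \<in> carrier R"
begin

interpretation A: dirsum_ext X N' "nosm :: 'r \<Rightarrow> ('m \<times> 'j \<Rightarrow> 'u) \<Rightarrow> 'm \<times> 'j \<Rightarrow> 'u" G
  "\<lambda>x a. sing N' (\<alpha> \<otimes>\<^bsub>Mo\<^esub> fst x, snd x) (r \<odot>\<^bsub>N (snd x)\<^esub> a)"
proof (intro dirsum_ext.intro dirsum_ext_axioms.intro G.dirsum_group G.dirsum_family_axioms)
  fix x assume x: "x \<in> X"
  then have y: "(\<alpha> \<otimes>\<^bsub>Mo\<^esub> fst x, snd x) \<in> X" using \<alpha> by auto
  have "abelian_group_hom (N' x) G (sing N' (\<alpha> \<otimes>\<^bsub>Mo\<^esub> fst x, snd x))"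
    using G.sing_hom[OF y] by simp
  then show "abelian_group_hom (N' x) G (\<lambda>a. sing N' (\<alpha> \<otimes>\<^bsub>Mo\<^esub> fst x, snd x) (r \<odot>\<^bsub>N (snd x)\<^esub> a))"
    by (rule abelian_group_hom_compose[OF left_module.smult_hom[OF N r]])
qed

lemma act_hom: "abelian_group_hom G G (act \<alpha> r)"
  unfolding ind_act_def by (rule A.dext_hom)

lemma act_sing: "\<beta> \<in> carrier Mo \<Longrightarrow> j \<in> J \<Longrightarrow> a \<in> carrier (N j) \<Longrightarrow>
    act \<alpha> r (sing N' (\<beta>, j) a) = sing N' (\<alpha> \<otimes>\<^bsub>Mo\<^esub> \<beta>, j) (r \<odot>\<^bsub>N j\<^esub> a)"
  unfolding ind_act_def by (subst A.dext_sing) auto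

end

lemma act_closed: "\<alpha> \<in> carrier Mo \<Longrightarrow> r \<in> carrier R \<Longrightarrow> f \<in> carrier G \<Longrightarrow> act \<alpha> r f \<in> carrier G"
  using abelian_group_hom.hom_closed[OF act_hom] .

lemma act_add_left:
  assumes "f \<in> carrier G" "\<alpha> \<in> carrier Mo" "r \<in> carrier R" "t \<in> carrier R"
  shows "act \<alpha> (r \<oplus>\<^bsub>R\<^esub> t) f = act \<alpha> r f \<oplus>\<^bsub>G\<^esub> act \<alpha> t f"
  using assms(1)
proof (induction rule: G.dirsum_induct)
  case zero
  show ?case using assms by (simp add: abelian_group_hom.hom_zero[OF act_hom])
next
  case (sing x a)
  obtain \<beta> j where x: "x = (\<beta>, j)" by (cases x)
  interpret Nj: left_module R "N j" by (rule N)
  have "sing N' (\<alpha> \<otimes>\<^bsub>Mo\<^esub> \<beta>, j) (r \<odot>\<^bsub>N j\<^esub> a \<oplus>\<^bsub>N j\<^esub> t \<odot>\<^bsub>N j\<^esub> a) =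
     sing N' (\<alpha> \<otimes>\<^bsub>Mo\<^esub> \<beta>, j) (r \<odot>\<^bsub>N j\<^esub> a) \<oplus>\<^bsub>G\<^esub> sing N' (\<alpha> \<otimes>\<^bsub>Mo\<^esub> \<beta>, j) (t \<odot>\<^bsub>N j\<^esub> a)"
    using sing assms G.sing_add[of "(\<alpha> \<otimes>\<^bsub>Mo\<^esub> \<beta>, j)"] by (simp add: x Nj.smult_closed)
  then show ?case using sing assms by (simp add: x act_sing Nj.smult_l_distr)
next
  case (add f g)
  then show ?case using assms
    by (simp add: abelian_group_hom.hom_add[OF act_hom] act_closed G.D.a_ac)
qed

lemma act_left_hom: "f \<in> carrier G \<Longrightarrow> \<alpha> \<in> carrier Mo \<Longrightarrow> abelian_group_hom R G (\<lambda>r. act \<alpha> r f)"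
  by (rule abelian_group_homI') (auto simp: act_closed act_add_left R.abelian_group_axioms G.dirsum_group)

lemma smult_I: "s \<odot>\<^bsub>I\<^esub> f = dext (\<lambda>_. R) G (\<lambda>\<alpha> r. act \<alpha> r f) s"
  by (simp add: Ind_def dirsum_simps)

lemma ext_f: "f \<in> carrier I \<Longrightarrow> dirsum_ext (carrier Mo) (\<lambda>_. R) G (\<lambda>\<alpha> r. act \<alpha> r f)"
  by (intro dirsum_ext.intro dirsum_ext_axioms.intro G.dirsum_group DS.dirsum_family_axioms act_left_hom) (auto simp: I_G)

lemma smult_left_hom:
  assumes "f \<in> carrier I" shows "abelian_group_hom S I (\<lambda>s. s \<odot>\<^bsub>I\<^esub> f)"
proof -
  have "abelian_group_hom DS G (dext (\<lambda>_. R) G (\<lambda>\<alpha> r. act \<alpha> r f))"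
    by (rule dirsum_ext.dext_hom[OF ext_f[OF assms]])
  then interpret h: abelian_group_hom DS G "dext (\<lambda>_. R) G (\<lambda>\<alpha> r. act \<alpha> r f)" .
  show ?thesis
    using h.hom_closed h.hom_add
    by (intro abelian_group_homI' I_group S.is_abelian_group) (simp_all add: smult_I I_G DS_S)
qed

lemma sgl_smult:
  assumes "\<alpha> \<in> carrier Mo" "r \<in> carrier R" "f \<in> carrier I"
  shows "sgl \<alpha> r \<odot>\<^bsub>I\<^esub> f = act \<alpha> r f"
  unfolding sgl_def smult_I using dirsum_ext.dext_sing[OF ext_f] assms by blast

lemma sgl_smult_sing:
  assumes "\<alpha> \<in> carrier Mo" "r \<in> carrier R" "\<beta> \<in> carrier Mo" "j \<in> J" "a \<in> carrier (N j)"
  shows "sgl \<alpha> r \<odot>\<^bsub>I\<^esub> sing N' (\<beta>, j) a = sing N' (\<alpha> \<otimes>\<^bsub>Mo\<^esub> \<beta>, j) (r \<odot>\<^bsub>N j\<^esub> a)"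
  using assms by (simp add: sgl_smult act_sing I_G G.sing_closed)

lemma I_induct [consumes 1, case_names zero sing add]:
  assumes "f \<in> carrier I" and "P \<zero>\<^bsub>I\<^esub>"
    and "\<And>\<beta> j a. \<beta> \<in> carrier Mo \<Longrightarrow> j \<in> J \<Longrightarrow> a \<in> carrier (N j) \<Longrightarrow> P (sing N' (\<beta>, j) a)"
    and "\<And>f g. f \<in> carrier I \<Longrightarrow> g \<in> carrier I \<Longrightarrow> P f \<Longrightarrow> P g \<Longrightarrow> P (f \<oplus>\<^bsub>I\<^esub> g)"
  shows "P f"
  using assms(1) G.dirsum_induct[of f P] assms(2-) by (auto simp: I_G)

lemma smult_I_closed: "s \<in> carrier S \<Longrightarrow> f \<in> carrier I \<Longrightarrow> s \<odot>\<^bsub>I\<^esub> f \<in> carrier I"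
  using abelian_group_hom.hom_closed[OF smult_left_hom] .

lemmas smult_I_add_left = abelian_group_hom.hom_add[OF smult_left_hom]

lemma smult_I_add:
  assumes "s \<in> carrier S" "f \<in> carrier I" "g \<in> carrier I"
  shows "s \<odot>\<^bsub>I\<^esub> (f \<oplus>\<^bsub>I\<^esub> g) = s \<odot>\<^bsub>I\<^esub> f \<oplus>\<^bsub>I\<^esub> s \<odot>\<^bsub>I\<^esub> g"
  using assms(1)
proof (induction rule: S_induct)
  case zero
  then show ?case using assms abelian_group_hom.hom_zero[OF smult_left_hom] by simp
next
  case (sgl \<alpha> r)
  then show ?case using assms by (simp add: sgl_smult) (simp add: I_G abelian_group_hom.hom_add[OF act_hom])
next
  case (add s t)
  then show ?case using assms by (simp add: smult_I_add_left smult_I_closed I.a_ac)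
qed

lemma smult_I_hom: "s \<in> carrier S \<Longrightarrow> abelian_group_hom I I (\<lambda>f. s \<odot>\<^bsub>I\<^esub> f)"
  by (rule abelian_group_homI') (auto simp: smult_I_closed smult_I_add I_group)

text \<open>Both sides are additive in \<open>s\<close>, \<open>t\<close> and \<open>f\<close>, so
  three nested inductions leave only single terms, where the claim is associativity in the monoid
  and in the summand \<open>N j\<close>.\<close>

lemma smult_I_assoc:
  assumes "s \<in> carrier S" "t \<in> carrier S" "f \<in> carrier I"
  shows "(s \<otimes>\<^bsub>S\<^esub> t) \<odot>\<^bsub>I\<^esub> f = s \<odot>\<^bsub>I\<^esub> (t \<odot>\<^bsub>I\<^esub> f)"
  using assms(1)
proof (induction rule: S_induct)
  case zero
  then show ?case using assms by (simp add: abelian_group_hom.hom_zero[OF smult_left_hom] smult_I_closed)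
next
  case (add s s')
  then show ?case using assms by (simp add: S.l_distr smult_I_add_left smult_I_closed)
next
  case a: (sgl \<alpha> r)
  show ?case using assms(2)
  proof (induction rule: S_induct)
    case zero
    then show ?case using assms a by (simp add: abelian_group_hom.hom_zero[OF smult_left_hom] abelian_group_hom.hom_zero[OF smult_I_hom] sgl_closed)
  next
    case (add s s')
    then show ?case using assms a by (simp add: S.r_distr smult_I_add_left smult_I_add smult_I_closed sgl_closed)
  next
    case b: (sgl \<beta> t)
    show ?case using assms(3)
    proof (induction rule: I_induct)
      case zero
      then show ?case using a b by (simp add: abelian_group_hom.hom_zero[OF smult_I_hom] sgl_closed)
    next
      case (add f g)
      then show ?case using a b by (simp add: smult_I_add smult_I_closed sgl_closed)
    next
      case (sing \<gamma> j x)
      interpret Nj: left_module R "N j" by (rule N)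
      show ?case using a b sing by (simp add: sgl_mult sgl_smult_sing Nj.smult_assoc1 Nj.smult_closed Mo.m_assoc)
    qed
  qed
qed

lemma smult_I_one:
  assumes "f \<in> carrier I" shows "\<one>\<^bsub>S\<^esub> \<odot>\<^bsub>I\<^esub> f = f"
  using assms
proof (induction rule: I_induct)
  case (sing \<gamma> j x)
  interpret Nj: left_module R "N j" by (rule N)
  show ?case using sing sgl_smult_sing[of "\<one>\<^bsub>Mo\<^esub>" "\<one>\<^bsub>R\<^esub>"] by (simp add: sgl_one Nj.smult_one)
qed (simp_all add: abelian_group_hom.hom_zero[OF smult_I_hom] smult_I_add)

lemma left_module_I: "left_module S I"
  by (rule left_moduleI) (auto simp: S I_group smult_I_closed smult_I_add_left smult_I_add smult_I_assoc smult_I_one)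

lemma sing_Igr:
  "\<beta> \<in> carrier Mo \<Longrightarrow> j \<in> J \<Longrightarrow> a \<in> carrier (N j) \<Longrightarrow> int (len \<beta>) + dg j = k \<Longrightarrow> sing N' (\<beta>, j) a \<in> Igr k"
  unfolding Igr_def by (rule G.sing_dgr) auto

lemma gmod_I: "gmod S Sgr I Igr"
proof -
  interpret Ig: graded_group I Igr "\<lambda>k f x. if int (len (fst x)) + dg (snd x) = k then f x else \<zero>\<^bsub>N' x\<^esub>"
    by (rule graded_I)
  have fs: "finsum G f A \<in> Igr k" if "\<And>i. i \<in> A \<Longrightarrow> f i \<in> Igr k" for f k and A :: "'z set"
  proof -
    have "finsum G f A = finsum I f A" by (rule finsum_group_cong) (simp_all add: I_G)
    then show ?thesis using Ig.gr_finsum[of A f k] that by simp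
  qed
  have "s \<odot>\<^bsub>I\<^esub> f \<in> Igr (k + l)" if s: "s \<in> Sgr k" and f: "f \<in> Igr l" for k l s f
  proof -
    have "f \<in> carrier G" using f by (simp add: Igr_iff I_G)
    note fd = G.dirsumD[OF this]
    have "s \<in> carrier DS" using s by (simp add: Sgr_def DS_S)
    note sd = DS.dirsumD[OF this]
    show ?thesis unfolding smult_I dext_def ind_act_def
    proof (intro fs)
      fix \<alpha> x assume a: "\<alpha> \<in> dsupp (\<lambda>_. R) s" and x: "x \<in> dsupp N' f"
      obtain \<beta> j where [simp]: "x = (\<beta>, j)" by (cases x)
      have ab: "\<alpha> \<in> carrier Mo" "\<beta> \<in> carrier Mo" "j \<in> J" using sd(2)[OF a] fd(2)[OF x] by auto
      have "int (len \<alpha>) = k" using a s by (simp add: Sgr_def supp_dsupp)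
      moreover have "int (len \<beta>) + dg j = l" using x f by (simp add: Igr_iff dsupp_def)
      ultimately have "int (len (\<alpha> \<otimes>\<^bsub>Mo\<^esub> \<beta>)) + dg j = k + l" using ab by (simp add: len_mult)
      moreover have "s \<alpha> \<odot>\<^bsub>N j\<^esub> f (\<beta>, j) \<in> carrier (N j)"
        using left_module.smult_closed[OF N sd(1), of "f (\<beta>, j)" j] fd(1)[of "(\<beta>, j)"] by simp
      ultimately show "sing N' (\<alpha> \<otimes>\<^bsub>Mo\<^esub> fst x, snd x) (s \<alpha> \<odot>\<^bsub>N (snd x)\<^esub> f x) \<in> Igr (k + l)"
        using ab by (simp add: sing_Igr)
    qed
  qed
  then show ?thesis using left_module_I graded_I unfolding gmod_def by (auto simp: Sgr_def)
qed

text \<open>Additivity in the scalar and in the element reduces linearity to a single term r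
  \<alpha> acting on a single \<beta> \<otimes> a.\<close>

lemma mhom_IndI:
  fixes Z :: "('m \<Rightarrow> 'r, 'b) module"
  assumes h: "abelian_group_hom I Z h" and Z: "left_module S Z"
    and eq: "\<And>\<alpha> r \<beta> j a. \<alpha> \<in> carrier Mo \<Longrightarrow> r \<in> carrier R \<Longrightarrow> \<beta> \<in> carrier Mo \<Longrightarrow> j \<in> J \<Longrightarrow> a \<in> carrier (N j) \<Longrightarrow>
      h (sing N' (\<alpha> \<otimes>\<^bsub>Mo\<^esub> \<beta>, j) (r \<odot>\<^bsub>N j\<^esub> a)) = sgl \<alpha> r \<odot>\<^bsub>Z\<^esub> h (sing N' (\<beta>, j) a)"
  shows "mhom S I Z h"
proof -
  interpret Z: left_module S Z by fact
  interpret h: abelian_group_hom I Z h by fact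
  have "h (s \<odot>\<^bsub>I\<^esub> f) = s \<odot>\<^bsub>Z\<^esub> h f" if s: "s \<in> carrier S" and f: "f \<in> carrier I" for s f
    using s
  proof (induction rule: S_induct)
    case zero
    then show ?case using f by (simp add: abelian_group_hom.hom_zero[OF smult_left_hom] Z.smult_l_null)
  next
    case (add s t)
    then show ?case using f by (simp add: smult_I_add_left smult_I_closed Z.smult_l_distr)
  next
    case a: (sgl \<alpha> r)
    show ?case using f
    proof (induction rule: I_induct)
      case zero
      then show ?case using a by (simp add: abelian_group_hom.hom_zero[OF smult_I_hom] sgl_closed Z.smult_r_null)
    next
      case (add f g)
      then show ?case using a by (simp add: smult_I_add smult_I_closed sgl_closed Z.smult_r_distr)
    next
      case (sing \<beta> j x)
      then show ?case using a eq by (simp add: sgl_smult_sing)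
    qed
  qed
  then show ?thesis using h Z left_module_I by (simp add: mhom_def)
qed

end

section \<open>Bases, and inducing free resolutions from \<open>R\<close>\<close>

lemma is_basis_bij:
  assumes M: "left_module R M"
  shows "is_basis R M B \<longleftrightarrow> B \<subseteq> carrier M \<and> bij_betw (fext R M (\<lambda>b. b)) (carrier (Fr R B)) (carrier M)"
proof (cases "B \<subseteq> carrier M")
  case True
  let ?e = "fext R M (\<lambda>b. b)"
  have e: "mhom R (Fr R B) M ?e" using True M by (intro mhom_fext) auto
  have c: "(range c \<subseteq> carrier R \<and> supp R c \<subseteq> B \<and> finite (supp R c) \<and> x = (\<Oplus>\<^bsub>M\<^esub>b\<in>supp R c. c b \<odot>\<^bsub>M\<^esub> b)) \<longleftrightarrow>
     c \<in> carrier (Fr R B) \<and> x = ?e c" for c x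
    by (auto simp: Fr_simps fext_def dext_def dsupp_def supp_def image_subset_iff)
  have "(\<forall>x\<in>carrier M. \<exists>!c. c \<in> carrier (Fr R B) \<and> x = ?e c) \<longleftrightarrow> bij_betw ?e (carrier (Fr R B)) (carrier M)"
  proof
    assume *: "\<forall>x\<in>carrier M. \<exists>!c. c \<in> carrier (Fr R B) \<and> x = ?e c"
    show "bij_betw ?e (carrier (Fr R B)) (carrier M)" unfolding bij_betw_def
    proof
      show "inj_on ?e (carrier (Fr R B))"
        by (rule inj_onI) (use * mhom_closed[OF e] in blast)
      show "?e ` carrier (Fr R B) = carrier M" using * mhom_closed[OF e] by blast
    qed
  next
    assume *: "bij_betw ?e (carrier (Fr R B)) (carrier M)"
    show "\<forall>x\<in>carrier M. \<exists>!c. c \<in> carrier (Fr R B) \<and> x = ?e c"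
    proof
      fix x assume "x \<in> carrier M"
      then have "x \<in> ?e ` carrier (Fr R B)" using * by (simp add: bij_betw_def)
      then obtain c where c: "c \<in> carrier (Fr R B)" "x = ?e c" by blast
      show "\<exists>!c. c \<in> carrier (Fr R B) \<and> x = ?e c"
        using c * by (intro ex1I[of _ c]) (auto simp: bij_betw_def inj_on_def)
    qed
  qed
  then show ?thesis using True unfolding is_basis_def c by simp
qed (simp add: is_basis_def)

lemma is_basis_coord:
  assumes M: "left_module R M" and B: "is_basis R M B"
  obtains c where "mhom R M (Fr R B) c" "bij_betw c (carrier M) (carrier (Fr R B))"
proof -
  let ?e = "fext R M (\<lambda>b. b)"
  have B: "B \<subseteq> carrier M" "bij_betw ?e (carrier (Fr R B)) (carrier M)" using B by (auto simp: is_basis_bij[OF M])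
  have e: "mhom R (Fr R B) M ?e" using B M by (intro mhom_fext) auto
  show ?thesis using mhom_inv_into[OF e B(2)] bij_betw_inv_into[OF B(2)] by (rule that)
qed

context ind_module
begin

text \<open>Inducing commutes with direct sums and takes \<open>R\<close> to the monoid ring, so the
  result is free on the pairs of a summand and one of its basis elements. A basis element of
  \<open>N j\<close> contributes a generator of degree \<open>dg j\<close>.\<close>

lemma free_iso:
  assumes B: "\<And>j. is_basis R (N j) (B j)"
  shows "\<exists>h. mhom S I (Fr S (Sigma J B)) h \<and> bij_betw h (carrier I) (carrier (Fr S (Sigma J B))) \<and>
    (\<forall>k. \<forall>f\<in>Igr k. h f \<in> Frgr S Sgr (Sigma J B) (\<lambda>x. dg (fst x)) k)"
proof -
  have "\<exists>c. mhom R (N j) (Fr R (B j)) c \<and> bij_betw c (carrier (N j)) (carrier (Fr R (B j)))" for j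
    using is_basis_coord[OF N B] by blast
  then obtain c where c: "\<And>j. mhom R (N j) (Fr R (B j)) (c j)" "\<And>j. bij_betw (c j) (carrier (N j)) (carrier (Fr R (B j)))"
    by metis
  let ?J = "Sigma J B"
  let ?F = "Fr S ?J"
  have cc: "c j a \<in> carrier (Fr R (B j))" if "a \<in> carrier (N j)" for j a by (rule mhom_closed[OF c(1) that])
  have cR: "c j a b \<in> carrier R" if "a \<in> carrier (N j)" for j a b using cc[OF that] by (simp add: Fr_simps)
  have c0: "c j \<zero>\<^bsub>N j\<^esub> = (\<lambda>_. \<zero>\<^bsub>R\<^esub>)" for j using mhom_zero[OF c(1)] by (simp add: Fr_simps)
  \<comment> \<open>Only the arguments are rearranged: the coefficient of \<mu> in the entry at (j,
    b) is the b-coordinate of the value at (\<mu>, j).\<close>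
  define h where "h f = (\<lambda>(j, b) \<mu>. c j (f (\<mu>, j)) b)" for f :: "'m \<times> 'j \<Rightarrow> 'u"
  have fN: "f (\<mu>, j) \<in> carrier (N j)" and fM: "f (\<mu>, j) \<noteq> \<zero>\<^bsub>N j\<^esub> \<Longrightarrow> \<mu> \<in> carrier Mo \<and> j \<in> J"
    and ff: "finite (dsupp N' f)" if "f \<in> carrier I" for f \<mu> j
    using that G.dirsumD[of f] by (auto simp: I_G dsupp_def dest: spec[of _ "(\<mu>, j)"])
  have hS: "h f (j, b) \<in> carrier S" if f: "f \<in> carrier I" for f j b
  proof -
    have sub: "supp R (h f (j, b)) \<subseteq> fst ` dsupp N' f \<inter> carrier Mo"
    proof
      fix \<mu> assume "\<mu> \<in> supp R (h f (j, b))"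
      then have "f (\<mu>, j) \<noteq> \<zero>\<^bsub>N j\<^esub>" by (auto simp: supp_def h_def c0)
      then show "\<mu> \<in> fst ` dsupp N' f \<inter> carrier Mo"
        using fM[OF f] by (auto simp: dsupp_def intro!: image_eqI[of _ _ "(\<mu>, j)"])
    qed
    then have "finite (supp R (h f (j, b)))" using ff[OF f] by (auto intro: finite_subset)
    then show ?thesis using sub cR[OF fN[OF f]] by (auto simp: monoid_ring_def h_def)
  qed
  have zS: "\<zero>\<^bsub>S\<^esub> = (\<lambda>_. \<zero>\<^bsub>R\<^esub>)" by (simp add: monoid_ring_def)
  have aS: "s \<oplus>\<^bsub>S\<^esub> t = (\<lambda>\<mu>. s \<mu> \<oplus>\<^bsub>R\<^esub> t \<mu>)" for s t by (simp add: monoid_ring_def)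
  have hF: "h f \<in> carrier ?F" if f: "f \<in> carrier I" for f
  proof -
    \<comment> \<open>Finiteness: each of the finitely many values of \<open>f\<close> has finitely
      many nonzero coordinates.\<close>
    let ?U = "\<Union>x\<in>dsupp N' f. Pair (snd x) ` dsupp (\<lambda>_. R) (c (snd x) (f x))"
    have "finite (dsupp (\<lambda>_. R) (c (snd x) (f x)))" for x
      using cc[OF fN[OF f, of "fst x" "snd x"]] by (simp add: Fr_simps)
    then have fin: "finite ?U" using ff[OF f] by auto
    have sub: "dsupp (\<lambda>_. S) (h f) \<subseteq> ?U \<inter> ?J"
    proof
      fix y assume y: "y \<in> dsupp (\<lambda>_. S) (h f)"
      obtain j b where jb: "y = (j, b)" by (cases y)
      obtain \<mu> where \<mu>: "c j (f (\<mu>, j)) b \<noteq> \<zero>\<^bsub>R\<^esub>" using y by (auto simp: dsupp_def jb h_def zS)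
      then have nz: "f (\<mu>, j) \<noteq> \<zero>\<^bsub>N j\<^esub>" using c0 by metis
      have "b \<in> B j" using cc[OF fN[OF f, of \<mu> j]] \<mu> by (auto simp: Fr_simps dsupp_def)
      then show "y \<in> ?U \<inter> ?J" using nz \<mu> fM[OF f nz]
        by (auto simp: jb dsupp_def intro!: bexI[of _ "(\<mu>, j)"])
    qed
    then show ?thesis using fin hS[OF f] finite_subset[OF sub] by (auto simp: Fr_simps)
  qed
  have hadd: "h (f \<oplus>\<^bsub>I\<^esub> g) = h f \<oplus>\<^bsub>?F\<^esub> h g" if "f \<in> carrier I" "g \<in> carrier I" for f g
    using mhom_add[OF c(1) fN[OF that(1)] fN[OF that(2)]]
    by (auto simp: Fr_simps h_def aS I_G(2) dirsum_simps fun_eq_iff)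
  have hsing: "h (sing N' (\<beta>, j) a) (j', b) = (if j' = j then sgl \<beta> (c j a b) else \<zero>\<^bsub>S\<^esub>)" for \<beta> j a j' b
    by (auto simp: h_def sing_def sgl_def c0 zS)
  have F: "left_module S ?F" by (rule left_module_Fr[OF S])
  have h: "mhom S I ?F h"
  proof (rule mhom_IndI[OF _ F])
    show "abelian_group_hom I ?F h"
      by (rule abelian_group_homI') (auto simp: I_group left_module_abelian_group[OF F] hF hadd)
    fix \<alpha> r \<beta> j a assume a: "\<alpha> \<in> carrier Mo" "r \<in> carrier R" "\<beta> \<in> carrier Mo" "j \<in> J" "a \<in> carrier (N j)"
    show "h (sing N' (\<alpha> \<otimes>\<^bsub>Mo\<^esub> \<beta>, j) (r \<odot>\<^bsub>N j\<^esub> a)) = sgl \<alpha> r \<odot>\<^bsub>?F\<^esub> h (sing N' (\<beta>, j) a)"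
    proof (rule ext)
      fix y :: "'j \<times> 'u" obtain j' b where y: "y = (j', b)" by (cases y)
      have "c j (r \<odot>\<^bsub>N j\<^esub> a) b = r \<otimes>\<^bsub>R\<^esub> c j a b" using mhom_smult[OF c(1) a(2,5)] by (simp add: Fr_simps)
      then show "h (sing N' (\<alpha> \<otimes>\<^bsub>Mo\<^esub> \<beta>, j) (r \<odot>\<^bsub>N j\<^esub> a)) y = (sgl \<alpha> r \<odot>\<^bsub>?F\<^esub> h (sing N' (\<beta>, j) a)) y"
        using a by (simp add: y hsing Fr_simps(4) sgl_mult cR sgl_closed)
    qed
  qed
  have inj: "inj_on h (carrier I)"
    unfolding mhom_inj_iff[OF h]
  proof (intro ballI impI)
    fix f assume f: "f \<in> carrier I" and z: "h f = \<zero>\<^bsub>?F\<^esub>"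
    show "f = \<zero>\<^bsub>I\<^esub>"
    proof (rule ext)
      fix x :: "'m \<times> 'j" obtain \<mu> j where x: "x = (\<mu>, j)" by (cases x)
      have "c j (f (\<mu>, j)) b = \<zero>\<^bsub>R\<^esub>" for b
        using fun_cong[OF fun_cong[OF z, of "(j, b)"], of \<mu>] by (simp add: h_def Fr_simps zS)
      then have "c j (f (\<mu>, j)) = \<zero>\<^bsub>Fr R (B j)\<^esub>" by (auto simp: Fr_simps)
      then have "f (\<mu>, j) = \<zero>\<^bsub>N j\<^esub>"
        using c(2)[of j] mhom_inj_iff[OF c(1)] fN[OF f] by (auto simp: bij_betw_def)
      then show "f x = \<zero>\<^bsub>I\<^esub> x" by (simp add: x I_G dirsum_simps)
    qed
  qed
  have surj: "g \<in> h ` carrier I" if g: "g \<in> carrier ?F" for g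
  proof -
    have gS: "g y \<in> carrier S" for y using g by (cases y) (simp add: Fr_simps)
    have gJ: "g y \<noteq> \<zero>\<^bsub>S\<^esub> \<Longrightarrow> y \<in> ?J" for y using g by (auto simp: Fr_simps dsupp_def)
    have fin: "finite (dsupp (\<lambda>_. S) g)" using g by (simp add: Fr_simps)
    define g' where "g' \<mu> j = (\<lambda>b. g (j, b) \<mu>)" for \<mu> j
    have g': "g' \<mu> j \<in> carrier (Fr R (B j))" for \<mu> j
    proof -
      have sub: "dsupp (\<lambda>_. R) (g' \<mu> j) \<subseteq> snd ` dsupp (\<lambda>_. S) g \<inter> B j"
      proof
        fix b assume "b \<in> dsupp (\<lambda>_. R) (g' \<mu> j)"
        then have "g (j, b) \<noteq> \<zero>\<^bsub>S\<^esub>" by (auto simp: dsupp_def g'_def zS fun_eq_iff)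
        then show "b \<in> snd ` dsupp (\<lambda>_. S) g \<inter> B j" using gJ[of "(j, b)"]
          by (auto simp: dsupp_def intro!: image_eqI[of _ _ "(j, b)"])
      qed
      have "g' \<mu> j b \<in> carrier R" for b using gS[of "(j, b)"] by (auto simp: g'_def monoid_ring_def)
      moreover have "finite (dsupp (\<lambda>_. R) (g' \<mu> j))" using fin by (auto intro: finite_subset[OF sub])
      ultimately show ?thesis using sub by (auto simp: Fr_simps)
    qed
    have ex: "\<exists>a\<in>carrier (N j). c j a = g' \<mu> j" for \<mu> j
    proof -
      have "g' \<mu> j \<in> c j ` carrier (N j)" using g' c(2)[of j] by (simp add: bij_betw_def)
      then show ?thesis by force
    qed
    \<comment> \<open>Entrywise preimages. By injectivity of the coordinate maps the chosen preimage
      of zero is zero, so the support stays finite.\<close>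
    define f where "f = (\<lambda>(\<mu>, j). SOME a. a \<in> carrier (N j) \<and> c j a = g' \<mu> j)"
    have f: "f (\<mu>, j) \<in> carrier (N j)" "c j (f (\<mu>, j)) = g' \<mu> j" for \<mu> j
      using someI_ex[of "\<lambda>a. a \<in> carrier (N j) \<and> c j a = g' \<mu> j"] ex[where j = j and \<mu> = \<mu>] by (auto simp: f_def)
    have f0: "f (\<mu>, j) = \<zero>\<^bsub>N j\<^esub>" if "g' \<mu> j = (\<lambda>_. \<zero>\<^bsub>R\<^esub>)" for \<mu> j
      using c(2)[of j] mhom_inj_iff[OF c(1)] f[where \<mu> = \<mu> and j = j] that by (auto simp: bij_betw_def Fr_simps)
    let ?U = "\<Union>y\<in>dsupp (\<lambda>_. S) g. (\<lambda>\<mu>. (\<mu>, fst y)) ` supp R (g y)"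
    have finU: "finite ?U" using fin gS by (auto simp: monoid_ring_def)
    have sub: "dsupp N' f \<subseteq> ?U \<inter> X"
    proof
      fix x assume "x \<in> dsupp N' f"
      moreover obtain \<mu> j where x: "x = (\<mu>, j)" by (cases x)
      ultimately have "g' \<mu> j \<noteq> (\<lambda>_. \<zero>\<^bsub>R\<^esub>)" using f0 by (auto simp: dsupp_def)
      then obtain b where b: "g (j, b) \<mu> \<noteq> \<zero>\<^bsub>R\<^esub>" by (auto simp: g'_def)
      then have nz: "g (j, b) \<noteq> \<zero>\<^bsub>S\<^esub>" by (auto simp: zS)
      have "\<mu> \<in> carrier Mo" using gS[of "(j, b)"] b by (auto simp: monoid_ring_def supp_def)
      then show "x \<in> ?U \<inter> X" using nz b gJ[OF nz]
        by (auto simp: x dsupp_def supp_def intro!: bexI[of _ "(j, b)"])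
    qed
    have "f x \<in> carrier (N' x)" for x using f(1)[of "fst x" "snd x"] by simp
    then have "f \<in> carrier I" using sub finite_subset[OF sub] finU by (auto simp: I_G dirsum_simps)
    moreover have "h f = g" by (auto simp: h_def f g'_def)
    ultimately show ?thesis by blast
  qed
  have deg: "h f \<in> Frgr S Sgr ?J (\<lambda>x. dg (fst x)) k" if f: "f \<in> Igr k" for f k
  proof -
    have fI: "f \<in> carrier I" using f by (simp add: Igr_iff)
    have "h f (j, b) \<in> Sgr (k - dg j)" for j b
    proof -
      have "int (len \<mu>) = k - dg j" if "\<mu> \<in> supp R (h f (j, b))" for \<mu>
      proof -
        have "f (\<mu>, j) \<noteq> \<zero>\<^bsub>N j\<^esub>" using that by (auto simp: supp_def h_def c0)
        then show ?thesis using f by (force simp: Igr_iff)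
      qed
      then show ?thesis using hS[OF fI] by (simp add: Sgr_def)
    qed
    then show ?thesis using hF[OF fI] by (auto simp: Frgr_def)
  qed
  have "bij_betw h (carrier I) (carrier ?F)" unfolding bij_betw_def using inj hF surj by auto
  then show ?thesis using h deg by blast
qed

end

lemma Ind_map:
  assumes "ind_module R Mo len N" "ind_module R Mo len N'" and \<phi>: "\<And>j. mhom R (N j) (N' j) (\<phi> j)"
  shows "mhom (monoid_ring R Mo) (Ind R Mo J N) (Ind R Mo J N') (\<lambda>f x. \<phi> (snd x) (f x))"
    and "f \<in> ind_module.Igr Mo len J N dg k \<Longrightarrow> (\<lambda>x. \<phi> (snd x) (f x)) \<in> ind_module.Igr Mo len J N' dg k"
proof -
  interpret A: ind_module R Mo len J N dg by fact
  interpret B: ind_module R Mo len J N' dg by fact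
  let ?h = "\<lambda>f x. \<phi> (snd x) (f x)"
  have z: "\<phi> j \<zero>\<^bsub>N j\<^esub> = \<zero>\<^bsub>N' j\<^esub>" for j by (rule mhom_zero[OF \<phi>])
  have cl: "?h f \<in> carrier B.I" if "f \<in> carrier A.I" for f
  proof -
    have f: "f \<in> carrier A.G" using that by (simp add: A.I_G)
    have sub: "dsupp B.N' (?h f) \<subseteq> dsupp A.N' f" by (auto simp: dsupp_def z)
    show ?thesis using A.G.dirsumD[OF f] sub finite_subset[OF sub]
      by (auto simp: B.I_G dirsum_simps(1) intro!: mhom_closed[OF \<phi>])
  qed
  show mh: "mhom (monoid_ring R Mo) A.I B.I ?h"
  proof (rule A.mhom_IndI[OF _ B.left_module_I])
    show "abelian_group_hom A.I B.I ?h"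
    proof (rule abelian_group_homI')
      fix f g assume fg: "f \<in> carrier A.I" "g \<in> carrier A.I"
      then have "f x \<in> carrier (N (snd x))" "g x \<in> carrier (N (snd x))" for x
        using A.G.dirsumD(1)[of f x] A.G.dirsumD(1)[of g x] by (simp_all add: A.I_G)
      then show "?h (f \<oplus>\<^bsub>A.I\<^esub> g) = ?h f \<oplus>\<^bsub>B.I\<^esub> ?h g"
        by (simp add: A.I_G B.I_G dirsum_simps mhom_add[OF \<phi>])
    qed (auto simp: cl A.I_group B.I_group)
    have s: "?h (sing A.N' (\<beta>, j) a) = sing B.N' (\<beta>, j) (\<phi> j a)" for \<beta> j a
      by (auto simp: sing_def z)
    show "?h (sing A.N' (\<alpha> \<otimes>\<^bsub>Mo\<^esub> \<beta>, j) (r \<odot>\<^bsub>N j\<^esub> a)) = A.sgl \<alpha> r \<odot>\<^bsub>B.I\<^esub> ?h (sing A.N' (\<beta>, j) a)"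
      if "\<alpha> \<in> carrier Mo" "r \<in> carrier R" "\<beta> \<in> carrier Mo" "j \<in> J" "a \<in> carrier (N j)" for \<alpha> r \<beta> j a
      unfolding s using that by (simp add: B.sgl_smult_sing mhom_closed[OF \<phi>] mhom_smult[OF \<phi>])
  qed
  show "?h f \<in> B.Igr k" if f: "f \<in> A.Igr k"
    unfolding B.Igr_iff
  proof (intro conjI allI impI)
    show "?h f \<in> carrier B.I" using f by (intro cl) (simp add: A.Igr_iff)
    fix \<mu> j assume "\<phi> (snd (\<mu>, j)) (f (\<mu>, j)) \<noteq> \<zero>\<^bsub>N' j\<^esub>"
    then have "f (\<mu>, j) \<noteq> \<zero>\<^bsub>N j\<^esub>" using z[of j] by auto
    then show "int (len \<mu>) + dg j = k" using f by (simp add: A.Igr_iff)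
  qed
qed

text \<open>As in \<open>resT\<close>, the number counts the free modules, so a resolution of length
  n is the case \<open>Suc n\<close>.\<close>

primrec resR :: "'r ring \<Rightarrow> nat \<Rightarrow> ('r, 'u) module \<Rightarrow> bool" where
  "resR R 0 N \<longleftrightarrow> carrier N = {\<zero>\<^bsub>N\<^esub>}"
| "resR R (Suc k) N \<longleftrightarrow> (\<exists>F e. free_module R F \<and> mhom R F N e \<and> e ` carrier F = carrier N \<and>
    resR R k (F\<lparr>carrier := a_kernel F N e\<rparr>))"

text \<open>Inducing is computed entrywise and is therefore exact: the kernel of the induced cover
  is the module induced from the kernels. Each step pairs \<open>J\<close> with basis elements from
  the same type \<open>'u\<close>, which is why one \<open>J0\<close> suffices throughout.\<close>

lemma (in mring) resP_Ind:
  fixes N :: "'j \<Rightarrow> ('r, 'u) module" and J0 :: "('j \<times> 'u) set"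
  assumes N: "\<And>j. left_module R (N j)" and res: "\<And>j. resR R k (N j)"
    and bd: "\<And>j. j \<in> J \<Longrightarrow> k0 \<le> dg j" and J0: "J \<times> UNIV \<subseteq> J0"
  shows "resP S Sgr J0 k (Ind R Mo J N) (ind_module.Igr Mo len J N dg)"
  using N res
proof (induction k arbitrary: N)
  case 0
  interpret N: ind_module R Mo len J N dg by (intro ind_module.intro ind_module_axioms.intro mring_axioms 0)
  have "f = \<zero>\<^bsub>N.I\<^esub>" if "f \<in> carrier N.I" for f
    using that 0(2) N.G.dirsumD(1)[of f] by (auto simp: N.I_G dirsum_simps fun_eq_iff)
  then show ?case using N.I.zero_closed by (auto simp: resP_0)
next
  case (Suc k)
  interpret gS: graded_ring S Sgr "\<lambda>k f \<mu>. if int (len \<mu>) = k then f \<mu> else \<zero>\<^bsub>R\<^esub>" by (rule graded_S)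
  have "\<exists>(F :: ('r, 'u) module) e. free_module R F \<and> mhom R F (N j) e \<and> e ` carrier F = carrier (N j) \<and>
    resR R k (F\<lparr>carrier := a_kernel F (N j) e\<rparr>)" for j using Suc.prems(2)[of j] by simp
  then obtain F :: "'j \<Rightarrow> ('r, 'u) module" and e where Fe: "\<And>j. free_module R (F j) \<and> mhom R (F j) (N j) (e j) \<and> e j ` carrier (F j) = carrier (N j) \<and>
    resR R k (F j\<lparr>carrier := a_kernel (F j) (N j) (e j)\<rparr>)" by metis
  have F: "\<And>j. free_module R (F j)" and e: "\<And>j. mhom R (F j) (N j) (e j)"
    and es: "\<And>j. e j ` carrier (F j) = carrier (N j)" and r: "\<And>j. resR R k (F j\<lparr>carrier := a_kernel (F j) (N j) (e j)\<rparr>)"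
    using Fe by simp_all
  define K where "K j = F j\<lparr>carrier := a_kernel (F j) (N j) (e j)\<rparr>" for j
  have Fm: "left_module R (F j)" for j using F by (simp add: free_module_def)
  obtain B where B: "\<And>j. is_basis R (F j) (B j)" using F unfolding free_module_def by metis
  have Km: "left_module R (K j)" for j unfolding K_def by (rule left_module_kernel[OF e e])
  have Ki: "mhom R (K j) (F j) (\<lambda>x. x)" for j unfolding K_def by (rule mhom_kernel_incl[OF e e])
  have iN: "ind_module R Mo len N" and iF: "ind_module R Mo len F" and iK: "ind_module R Mo len K"
    by (intro ind_module.intro ind_module_axioms.intro mring_axioms Suc.prems Fm Km)+
  interpret N: ind_module R Mo len J N dg by (rule iN)
  interpret F: ind_module R Mo len J F dg by (rule iF)
  interpret K: ind_module R Mo len J K dg by (rule iK)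
  let ?J = "Sigma J B" and ?dg = "\<lambda>x. dg (fst x)"
  obtain h where h: "mhom S F.I (Fr S ?J) h" "bij_betw h (carrier F.I) (carrier (Fr S ?J))"
    "\<And>k f. f \<in> F.Igr k \<Longrightarrow> h f \<in> Frgr S Sgr ?J ?dg k"
    using F.free_iso[OF B] by blast
  let ?h' = "inv_into (carrier F.I) h"
  have h': "mhom S (Fr S ?J) F.I ?h'" by (rule mhom_inv_into[OF h(1,2)])
  have h'b: "bij_betw ?h' (carrier (Fr S ?J)) (carrier F.I)" by (rule bij_betw_inv_into[OF h(2)])
  have hh': "h (?h' y) = y" if "y \<in> carrier (Fr S ?J)" for y
    using that h(2) by (simp add: bij_betw_def f_inv_into_f)
  have h'h: "?h' (h x) = x" if "x \<in> carrier F.I" for x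
    using that h(2) by (simp add: bij_betw_def)
  have h'd: "?h' y \<in> F.Igr k" if "y \<in> Frgr S Sgr ?J ?dg k" for y k
  proof -
    have y: "y \<in> carrier (Fr S ?J)" using that by (simp add: Frgr_def)
    show ?thesis
      by (rule gmod_reflect[OF F.gmod_I gS.gmod_Fr h(1) h(3)])
        (use h(2) y that mhom_closed[OF h' y] in \<open>simp_all add: bij_betw_def hh'\<close>)
  qed
  define q where "q f = (\<lambda>x. e (snd x) (f x))" for f :: "'m \<times> 'j \<Rightarrow> 'u"
  have q: "mhom S F.I N.I q" and qd: "\<And>k f. f \<in> F.Igr k \<Longrightarrow> q f \<in> N.Igr k"
    unfolding q_def by (rule Ind_map[OF iF iN e])+
  have fF: "f x \<in> carrier (F (snd x))" "dsupp F.N' f \<subseteq> F.X" "finite (dsupp F.N' f)" if "f \<in> carrier F.I" for f x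
    using F.G.dirsumD[of f] that by (simp_all add: F.I_G)
  have fN: "f x \<in> carrier (N (snd x))" "dsupp N.N' f \<subseteq> N.X" "finite (dsupp N.N' f)" if "f \<in> carrier N.I" for f x
    using N.G.dirsumD[of f] that by (simp_all add: N.I_G)
  have qs: "q ` carrier F.I = carrier N.I"
  proof
    show "carrier N.I \<subseteq> q ` carrier F.I"
    proof
      fix f assume f: "f \<in> carrier N.I"
      \<comment> \<open>Over a zero entry the preimage is taken to be zero, so that the family of
        preimages has finite support.\<close>
      have ex: "\<exists>a. a \<in> carrier (F (snd x)) \<and> e (snd x) a = f x \<and> (f x = \<zero>\<^bsub>N (snd x)\<^esub> \<longrightarrow> a = \<zero>\<^bsub>F (snd x)\<^esub>)" for x
      proof (cases "f x = \<zero>\<^bsub>N (snd x)\<^esub>")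
        case True
        interpret Fx: left_module R "F (snd x)" by (rule Fm)
        show ?thesis using True mhom_zero[OF e] by (intro exI[of _ "\<zero>\<^bsub>F (snd x)\<^esub>"]) simp
      next
        case False
        have "f x \<in> e (snd x) ` carrier (F (snd x))" using fN(1)[OF f] es by simp
        then show ?thesis using False by force
      qed
      obtain g where g: "\<And>x. g x \<in> carrier (F (snd x))" "\<And>x. e (snd x) (g x) = f x"
        "\<And>x. f x = \<zero>\<^bsub>N (snd x)\<^esub> \<Longrightarrow> g x = \<zero>\<^bsub>F (snd x)\<^esub>" using ex by metis
      have "dsupp F.N' g \<subseteq> dsupp N.N' f" using g(3) by (auto simp: dsupp_def)
      then have "g \<in> carrier F.I" using g(1) fN[OF f] by (auto simp: F.I_G dirsum_simps(1) intro: finite_subset)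
      moreover have "q g = f" by (simp add: q_def g)
      ultimately show "f \<in> q ` carrier F.I" by blast
    qed
  qed (use mhom_closed[OF q] in auto)
  have c: "covers S Sgr J0 ?J ?dg (\<lambda>y. q (?h' y)) N.I N.Igr"
    unfolding covers_def
  proof (intro conjI allI ballI)
    show "?J \<subseteq> J0" using J0 by auto
    show "\<exists>k0. \<forall>j\<in>?J. k0 \<le> ?dg j" using bd by auto
    show "mhom S (Fr S ?J) N.I (\<lambda>y. q (?h' y))" by (rule mhom_comp[OF h' q])
    have "(\<lambda>y. q (?h' y)) ` carrier (Fr S ?J) = q ` ?h' ` carrier (Fr S ?J)" by (simp add: image_image)
    then show "(\<lambda>y. q (?h' y)) ` carrier (Fr S ?J) = carrier N.I" using h'b qs by (simp add: bij_betw_def)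
    show "q (?h' y) \<in> N.Igr k" if "y \<in> Frgr S Sgr ?J ?dg k" for k y using that by (intro qd h'd)
  qed
  let ?e = "\<lambda>y. q (?h' y)"
  have i: "mhom S K.I F.I (\<lambda>f. f)" and id: "\<And>k f. f \<in> K.Igr k \<Longrightarrow> f \<in> F.Igr k"
    using Ind_map[OF iK iF Ki] by auto
  \<comment> \<open>Exactness of inducing: the kernel of \<open>q\<close> consists of the families
    whose entries lie in the kernels \<open>K j\<close>.\<close>
  have KI: "carrier K.I = a_kernel F.I N.I q"
  proof (rule equalityI; rule subsetI)
    fix f assume f: "f \<in> carrier K.I"
    then have "f x \<in> carrier (K (snd x))" for x using K.G.dirsumD(1)[of f x] by (simp add: K.I_G)
    then have "q f = \<zero>\<^bsub>N.I\<^esub>" by (simp add: q_def K_def a_kernel_iff N.I_G dirsum_simps)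
    then show "f \<in> a_kernel F.I N.I q" using mhom_closed[OF i f] by (simp add: a_kernel_iff)
  next
    fix f assume "f \<in> a_kernel F.I N.I q"
    then have f: "f \<in> carrier F.I" "q f = \<zero>\<^bsub>N.I\<^esub>" by (auto simp: a_kernel_iff)
    have "e (snd x) (f x) = \<zero>\<^bsub>N (snd x)\<^esub>" for x
      using fun_cong[OF f(2), of x] by (simp add: q_def N.I_G dirsum_simps)
    then have "f x \<in> carrier (K (snd x))" for x using fF(1)[OF f(1)] by (simp add: K_def a_kernel_iff)
    moreover have "dsupp K.N' f = dsupp F.N' f" by (simp add: dsupp_def K_def)
    ultimately show "f \<in> carrier K.I" unfolding K.I_G dirsum_simps(1)
      using fF(2,3)[OF f(1)] by (intro CollectI conjI allI) simp_all
  qed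
  have he: "?e (h f) = q f" if "f \<in> carrier F.I" for f using that by (simp add: h'h)
  have hk: "h f \<in> a_kernel (Fr S ?J) N.I ?e" if "f \<in> carrier K.I" for f
    using that mhom_closed[OF h(1)] by (simp add: KI a_kernel_iff he)
  have e': "mhom S (Fr S ?J) N.I ?e" by (rule mhom_comp[OF h' q])
  have "resP S Sgr J0 k (fker S ?J N.I ?e) (fkergr S Sgr ?J ?dg N.I ?e)"
  \<comment> \<open>The induction hypothesis resolves the module induced from \<open>K\<close>;
    \<open>h\<close> identifies it with the kernel inside \<open>Fr S ?J\<close>.\<close>
  proof (rule gS.resP_iso[OF Suc.IH])
    show "left_module R (K j)" "resR R k (K j)" for j using Km r by (simp_all add: K_def)
    show "mhom S K.I (fker S ?J N.I ?e) h" unfolding fker_def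
      by (intro mhom_into_sub submod_kernel e' mhom_comp[OF i h(1)] hk)
    show "bij_betw h (carrier K.I) (carrier (fker S ?J N.I ?e))"
      unfolding bij_betw_def
    proof
      show "inj_on h (carrier K.I)" using h(2) mhom_closed[OF i] by (auto simp: bij_betw_def intro: inj_on_subset)
      have "y \<in> h ` carrier K.I" if "y \<in> a_kernel (Fr S ?J) N.I ?e" for y
      proof -
        have "y \<in> carrier (Fr S ?J)" "?e y = \<zero>\<^bsub>N.I\<^esub>" using that by (auto simp: a_kernel_iff)
        then have "?h' y \<in> carrier K.I" "h (?h' y) = y" using mhom_closed[OF h'] by (auto simp: KI a_kernel_iff hh')
        then show ?thesis by force
      qed
      then show "h ` carrier K.I = carrier (fker S ?J N.I ?e)" using hk by (auto simp: fker_def)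
    qed
    show "h x \<in> fkergr S Sgr ?J ?dg N.I ?e i" if "x \<in> K.Igr i" for i x
    proof -
      have "x \<in> carrier K.I" using that by (simp add: K.Igr_iff)
      then show ?thesis using hk h(3)[OF id[OF that]] by (simp add: fkergr_def)
    qed
  qed
  then show ?case using c unfolding resP_Suc by blast
qed

section \<open>Right division by generators\<close>

locale fpc =
  fixes E :: "'e set" and I :: "('e \<times> 'e) set"
  assumes I: "I \<subseteq> E \<times> E" and sym: "sym I"
begin

abbreviation "Mo \<equiv> fpc_monoid E I"

definition cls :: "'e list \<Rightarrow> 'e list set" where "cls w = fpc_cong E I `` {w}"

sublocale Mo: monoid Mo by (rule monoid_fpc_monoid)

lemma cls_closed: "set w \<subseteq> E \<Longrightarrow> cls w \<in> carrier Mo"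
  by (simp add: cls_def fpc_monoid_def quotientI lists_eq_set)

lemma cls_cases: assumes "\<mu> \<in> carrier Mo" obtains w where "set w \<subseteq> E" "\<mu> = cls w"
proof -
  have "\<mu> \<in> lists E // fpc_cong E I" using assms by (simp add: fpc_monoid_def)
  then obtain w where "w \<in> lists E" "\<mu> = fpc_cong E I `` {w}" by (rule quotientE)
  then show ?thesis using that by (simp add: cls_def lists_eq_set)
qed

lemma cls_eq_iff: "set v \<subseteq> E \<Longrightarrow> set w \<subseteq> E \<Longrightarrow> cls v = cls w \<longleftrightarrow> (v, w) \<in> fpc_cong E I"
  unfolding cls_def by (rule eq_equiv_class_iff[OF equiv_fpc_cong]) (simp_all add: lists_eq_set)

lemma cls_append: "set v \<subseteq> E \<Longrightarrow> set w \<subseteq> E \<Longrightarrow> cls (v @ w) = cls v \<otimes>\<^bsub>Mo\<^esub> cls w"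
  unfolding cls_def by (rule fpc_mult_class[symmetric]) (simp_all add: lists_eq_set)

lemma cls_Nil: "cls [] = \<one>\<^bsub>Mo\<^esub>"
  by (simp add: cls_def fpc_monoid_def)

lemma fpc_length_cls: "set w \<subseteq> E \<Longrightarrow> fpc_length (cls w) = length w"
  unfolding cls_def by (rule fpc_length_class) (simp add: lists_eq_set)

lemma cls_comm: "(a, b) \<in> I \<Longrightarrow> cls [a] \<otimes>\<^bsub>Mo\<^esub> cls [b] = cls [b] \<otimes>\<^bsub>Mo\<^esub> cls [a]"
  using I fpc_comm[of a b I E] cls_append[of "[a]" "[b]"] cls_append[of "[b]" "[a]"] cls_eq_iff[of "[a, b]" "[b, a]"] by auto

text \<open>\<open>quo e (rev w)\<close> is the class of \<open>w\<close> with its last \<open>e\<close> removed, provided that this \<open>e\<close> commutes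
  with all later letters.\<close>

fun quo :: "'e \<Rightarrow> 'e list \<Rightarrow> 'e list set option" where
  "quo e [] = None"
| "quo e (x # r) = (if x = e then Some (cls (rev r)) else if (x, e) \<in> I
     then map_option (\<lambda>\<kappa>. \<kappa> \<otimes>\<^bsub>Mo\<^esub> cls [x]) (quo e r) else None)"

text \<open>The letters passed on the way to \<open>e\<close> all commute with it, so
  \<open>e\<close> can be moved to the right end.\<close>

lemma quo_Some:
  assumes "quo e r = Some \<kappa>" "set r \<subseteq> E" shows "\<kappa> \<in> carrier Mo \<and> e \<in> E \<and> cls (rev r) = \<kappa> \<otimes>\<^bsub>Mo\<^esub> cls [e]"
  using assms
proof (induction r arbitrary: \<kappa>)
  case (Cons x r)
  then have xr: "x \<in> E" "set r \<subseteq> E" by auto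
  show ?case
  proof (cases "x = e")
    case True
    then show ?thesis using Cons xr by (auto simp: cls_closed cls_append)
  next
    case False
    then obtain \<kappa>' where \<kappa>': "quo e r = Some \<kappa>'" "\<kappa> = \<kappa>' \<otimes>\<^bsub>Mo\<^esub> cls [x]" and xe: "(x, e) \<in> I"
      using Cons.prems by (auto split: if_splits)
    note IH = Cons.IH[OF \<kappa>'(1) xr(2)]
    have "cls (rev (x # r)) = (\<kappa>' \<otimes>\<^bsub>Mo\<^esub> cls [e]) \<otimes>\<^bsub>Mo\<^esub> cls [x]" using xr IH by (simp add: cls_append)
    also have "\<dots> = \<kappa>' \<otimes>\<^bsub>Mo\<^esub> (cls [x] \<otimes>\<^bsub>Mo\<^esub> cls [e])"
      using IH xr cls_comm[OF xe] by (simp add: Mo.m_assoc cls_closed)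
    also have "\<dots> = \<kappa> \<otimes>\<^bsub>Mo\<^esub> cls [e]" using IH xr by (simp add: \<kappa>' Mo.m_assoc cls_closed)
    finally show ?thesis using IH xr by (simp add: \<kappa>' cls_closed)
  qed
qed simp

text \<open>The prefixes \<open>w\<close> and \<open>w'\<close> make the induction work for
  concatenation: what stands to the left of \<open>v\<close> matters only through its class and its
  \<open>quo\<close>.\<close>

lemma quo_cong:
  assumes "(v, v') \<in> fpc_cong E I" "(w, w') \<in> fpc_cong E I" "quo e (rev w) = quo e (rev w')"
  shows "quo e (rev (w @ v)) = quo e (rev (w' @ v'))"
  using assms
proof (induction arbitrary: w w' rule: fpc_cong.induct)
  case (fpc_comm a b)
  have w: "set w \<subseteq> E" "set w' \<subseteq> E" using fpc_cong_lists[OF fpc_comm.prems(1)] by (auto simp: lists_eq_set)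
  have ww: "cls w = cls w'" using fpc_comm.prems(1) w cls_eq_iff by blast
  have ba: "(b, a) \<in> I" using sym fpc_comm.hyps(1) by (rule symD)
  have c: "cls (u @ [x]) = cls u \<otimes>\<^bsub>Mo\<^esub> cls [x]" if "set u \<subseteq> E" "x \<in> E" for u x using that by (simp add: cls_append)
  show ?case
  \<comment> \<open>If one of the two letters is \<open>e\<close>, it is removed either at once or
    after passing the other letter, and the other letter remains in both cases.\<close>
  proof (cases "a = e \<or> b = e")
    case True
    then show ?thesis using fpc_comm ba w ww by (auto simp: c)
  next
    case False
    have "\<kappa> \<otimes>\<^bsub>Mo\<^esub> cls [a] \<otimes>\<^bsub>Mo\<^esub> cls [b] = \<kappa> \<otimes>\<^bsub>Mo\<^esub> cls [b] \<otimes>\<^bsub>Mo\<^esub> cls [a]" if "quo e (rev w') = Some \<kappa>" for \<kappa>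
      using quo_Some[OF that] w fpc_comm.hyps cls_comm[OF fpc_comm.hyps(1)] by (auto simp: Mo.m_assoc cls_closed)
    then show ?thesis using False fpc_comm.prems(2)
      by (cases "quo e (rev w')") auto
  qed
next
  case (fpc_refl u)
  have su: "set u \<subseteq> E" using fpc_refl.hyps by (simp add: lists_eq_set)
  have w: "set w \<subseteq> E" "set w' \<subseteq> E" using fpc_cong_lists[OF fpc_refl.prems(1)] by (auto simp: lists_eq_set)
  show ?case using su
  proof (induction u rule: rev_induct)
    case (snoc x u)
    then have u: "set u \<subseteq> E" "x \<in> E" by auto
    have "(w @ u, w' @ u) \<in> fpc_cong E I"
      by (intro fpc_append fpc_cong.fpc_refl fpc_refl.prems) (use u in \<open>simp add: lists_eq_set\<close>)
    then have "cls (w @ u) = cls (w' @ u)" using w u by (subst cls_eq_iff) auto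
    then show ?case using snoc.IH[OF u(1)] by (simp flip: append_assoc)
  qed (use fpc_refl.prems in simp)
next
  case (fpc_sym u v)
  then show ?case using fpc_cong.fpc_sym[OF fpc_sym.prems(1)] by metis
next
  case (fpc_trans u v x)
  \<comment> \<open>The change of prefix is spent on the first half; the second half is applied with
    equal prefixes.\<close>
  have "(w', w') \<in> fpc_cong E I" using fpc_cong_lists[OF fpc_trans.prems(1)] by (auto intro: fpc_cong.fpc_refl)
  then show ?case using fpc_trans.IH(1)[OF fpc_trans.prems] fpc_trans.IH(2)[of w' w'] by simp
next
  case (fpc_append u u' v v')
  have "(w @ u, w' @ u') \<in> fpc_cong E I" using fpc_append by (auto intro: fpc_cong.fpc_append)
  then show ?case using fpc_append.IH(2)[of "w @ u" "w' @ u'"] fpc_append.IH(1)[OF fpc_append.prems] by simp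
qed

lemma quo_cls_eq:
  assumes "set u \<subseteq> E" "set v \<subseteq> E" "cls u = cls v" shows "quo e (rev u) = quo e (rev v)"
  using quo_cong[of u v "[]" "[]"] assms by (simp add: cls_eq_iff fpc_refl lists_eq_set)

text \<open>Since \<open>quo\<close> is well defined on classes, removing a final \<open>e\<close>
  is too.\<close>

lemma right_cancel:
  assumes "e \<in> E" "\<mu> \<in> carrier Mo" "\<mu>' \<in> carrier Mo" "\<mu> \<otimes>\<^bsub>Mo\<^esub> cls [e] = \<mu>' \<otimes>\<^bsub>Mo\<^esub> cls [e]"
  shows "\<mu> = \<mu>'"
proof -
  obtain u v where uv: "set u \<subseteq> E" "\<mu> = cls u" "set v \<subseteq> E" "\<mu>' = cls v" using assms by (metis cls_cases)
  then have "cls (u @ [e]) = cls (v @ [e])" using assms by (simp add: cls_append)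
  then have "quo e (rev (u @ [e])) = quo e (rev (v @ [e]))" using uv assms by (intro quo_cls_eq) auto
  then show ?thesis using uv by simp
qed

text \<open>Apply \<open>quo f\<close> to both words. It succeeds at once on the one ending in
  \<open>f\<close>, hence also on the one ending in \<open>e\<close>, which forces \<open>e\<close>
  and \<open>f\<close> to commute and \<open>f\<close> to divide \<mu>.\<close>

lemma right_diamond:
  assumes "e \<in> E" "f \<in> E" "e \<noteq> f" "\<mu> \<in> carrier Mo" "\<mu>' \<in> carrier Mo" "\<mu> \<otimes>\<^bsub>Mo\<^esub> cls [e] = \<mu>' \<otimes>\<^bsub>Mo\<^esub> cls [f]"
  shows "(e, f) \<in> I \<and> (\<exists>\<kappa>\<in>carrier Mo. \<mu> = \<kappa> \<otimes>\<^bsub>Mo\<^esub> cls [f])"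
proof -
  obtain u v where uv: "set u \<subseteq> E" "\<mu> = cls u" "set v \<subseteq> E" "\<mu>' = cls v" using assms by (metis cls_cases)
  then have "cls (u @ [e]) = cls (v @ [f])" using assms by (simp add: cls_append)
  then have "quo f (rev (u @ [e])) = quo f (rev (v @ [f]))" using uv assms by (intro quo_cls_eq) auto
  then have "(e, f) \<in> I \<and> (\<exists>\<kappa>. quo f (rev u) = Some \<kappa>)" using assms by (auto split: if_splits)
  then show ?thesis using quo_Some[of f "rev u"] uv by force
qed

lemma generator_factor:
  assumes "\<mu> \<in> carrier Mo" "\<mu> \<noteq> \<one>\<^bsub>Mo\<^esub>"
  shows "\<exists>e\<in>E. \<exists>\<kappa>\<in>carrier Mo. \<mu> = \<kappa> \<otimes>\<^bsub>Mo\<^esub> cls [e]"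
proof -
  obtain w where w: "set w \<subseteq> E" "\<mu> = cls w" using assms by (metis cls_cases)
  show ?thesis
  proof (cases w rule: rev_cases)
    case Nil
    then show ?thesis using assms(2) w by (simp add: cls_Nil)
  next
    case (snoc ys y)
    then have "cls ys \<in> carrier Mo" "y \<in> E" "\<mu> = cls ys \<otimes>\<^bsub>Mo\<^esub> cls [y]" using w by (auto simp: cls_closed cls_append)
    then show ?thesis by blast
  qed
qed

lemma fpc_length_mult: "\<mu> \<in> carrier Mo \<Longrightarrow> \<nu> \<in> carrier Mo \<Longrightarrow>
    fpc_length (\<mu> \<otimes>\<^bsub>Mo\<^esub> \<nu>) = fpc_length \<mu> + fpc_length \<nu>"
  by (elim cls_cases) (simp add: fpc_length_cls flip: cls_append)

lemma fpc_length_one: "fpc_length \<one>\<^bsub>Mo\<^esub> = 0"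
  using fpc_length_cls[of "[]"] by (simp add: cls_Nil)

definition clique :: "'e set \<Rightarrow> bool" where
  "clique c \<longleftrightarrow> c \<subseteq> E \<and> finite c \<and> mutually_commuting I c"

lemma clique_subset: "clique c \<Longrightarrow> b \<subseteq> c \<Longrightarrow> clique b"
  by (auto simp: clique_def mutually_commuting_def intro: finite_subset)

lemma clique_comm:
  assumes "clique c" "e \<in> c" "f \<in> c" shows "cls [e] \<otimes>\<^bsub>Mo\<^esub> cls [f] = cls [f] \<otimes>\<^bsub>Mo\<^esub> cls [e]"
proof (cases "e = f")
  case False
  then have "(e, f) \<in> I" using assms by (auto simp: clique_def mutually_commuting_def)
  then show ?thesis by (rule cls_comm)
qed simp

text \<open>Made the identity outside the monoid, because folding over a set asks for commutation on
  the whole type.\<close>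

definition rmul :: "'e \<Rightarrow> 'e list set \<Rightarrow> 'e list set" where
  "rmul e \<mu> = (if \<mu> \<in> carrier Mo then \<mu> \<otimes>\<^bsub>Mo\<^esub> cls [e] else \<mu>)"

text \<open>The product \<mu> \<Prod>c. On a clique the order of the factors is immaterial, so a
  fold over the set is well behaved.\<close>

definition cprod :: "'e set \<Rightarrow> 'e list set \<Rightarrow> 'e list set" where
  "cprod c \<mu> = Finite_Set.fold rmul \<mu> c"

lemma gen_closed: "e \<in> E \<Longrightarrow> cls [e] \<in> carrier Mo"
  by (simp add: cls_closed)

lemma rmul_commute:
  assumes "clique c" shows "comp_fun_commute_on c rmul"
proof
  fix e f assume ef: "e \<in> c" "f \<in> c"
  then have E: "cls [e] \<in> carrier Mo" "cls [f] \<in> carrier Mo"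
    using assms by (auto simp: clique_def intro: gen_closed)
  show "rmul f \<circ> rmul e = rmul e \<circ> rmul f"
    using E clique_comm[OF assms ef] by (auto simp: rmul_def fun_eq_iff Mo.m_assoc)
qed

lemma cprod_empty: "cprod {} \<mu> = \<mu>"
  by (simp add: cprod_def)

lemma cprod_insert_aux:
  assumes "clique (insert e c)" "e \<notin> c"
  shows "cprod (insert e c) \<mu> = rmul e (cprod c \<mu>)" "cprod (insert e c) \<mu> = cprod c (rmul e \<mu>)"
proof -
  interpret comp_fun_commute_on "insert e c" rmul by (rule rmul_commute) fact
  have "finite c" using assms by (simp add: clique_def)
  then show "cprod (insert e c) \<mu> = rmul e (cprod c \<mu>)" "cprod (insert e c) \<mu> = cprod c (rmul e \<mu>)"
    using assms fold_insert[of e c \<mu>] fold_insert2[of e c \<mu>] by (auto simp: cprod_def)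
qed

lemma cprod_closed: "clique c \<Longrightarrow> \<mu> \<in> carrier Mo \<Longrightarrow> cprod c \<mu> \<in> carrier Mo \<and> fpc_length (cprod c \<mu>) = fpc_length \<mu> + card c"
proof -
  assume c: "clique c" and \<mu>: "\<mu> \<in> carrier Mo"
  then have "finite c" by (simp add: clique_def)
  then show ?thesis using c
  proof (induction c)
    case (insert e c)
    have e: "e \<in> E" "clique c" using insert.prems clique_subset[OF insert.prems, of c] by (auto simp: clique_def)
    then have "fpc_length (cls [e]) = 1" by (simp add: fpc_length_cls)
    then show ?case using insert e
      by (simp add: cprod_insert_aux rmul_def gen_closed fpc_length_mult)
  qed (simp add: cprod_empty \<mu>)
qed

lemma cprod_insert:
  assumes "clique (insert e c)" "e \<notin> c" "\<mu> \<in> carrier Mo"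
  shows "cprod (insert e c) \<mu> = cprod c \<mu> \<otimes>\<^bsub>Mo\<^esub> cls [e]" "cprod (insert e c) \<mu> = cprod c (\<mu> \<otimes>\<^bsub>Mo\<^esub> cls [e])"
proof -
  have "cprod c \<mu> \<in> carrier Mo" using cprod_closed[OF clique_subset[OF assms(1), of c] assms(3)] by auto
  then show "cprod (insert e c) \<mu> = cprod c \<mu> \<otimes>\<^bsub>Mo\<^esub> cls [e]"
    using cprod_insert_aux(1)[OF assms(1,2)] by (simp add: rmul_def)
  show "cprod (insert e c) \<mu> = cprod c (\<mu> \<otimes>\<^bsub>Mo\<^esub> cls [e])"
    using cprod_insert_aux(2)[OF assms(1,2)] assms(3) by (simp add: rmul_def)
qed

text \<open>Strip the elements of \<open>c\<close> off one by one: by \<open>right_diamond\<close>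
  each commutes with \<open>e\<close>, and \<open>e\<close> still divides what is left. At the end
  \<open>e\<close> divides \<mu>, which lets it move from \<mu> into the clique.\<close>

lemma cprod_dvd:
  assumes c: "clique c" and \<mu>: "\<mu> \<in> carrier Mo" and e: "e \<in> E" "e \<notin> c"
    and dvd: "\<exists>\<kappa>\<in>carrier Mo. cprod c \<mu> = \<kappa> \<otimes>\<^bsub>Mo\<^esub> cls [e]"
  shows "(\<exists>\<kappa>\<in>carrier Mo. \<mu> = \<kappa> \<otimes>\<^bsub>Mo\<^esub> cls [e]) \<and> (\<forall>f\<in>c. (f, e) \<in> I)"
proof -
  have "finite c" using c by (simp add: clique_def)
  then show ?thesis using c e dvd
  proof (induction c)
    case (insert f c)
    have f: "f \<in> E" "clique c" using insert.prems clique_subset[OF insert.prems(1), of c] by (auto simp: clique_def)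
    have cp: "cprod c \<mu> \<in> carrier Mo" using cprod_closed[OF f(2) \<mu>] by simp
    obtain \<kappa> where \<kappa>: "\<kappa> \<in> carrier Mo" "cprod c \<mu> \<otimes>\<^bsub>Mo\<^esub> cls [f] = \<kappa> \<otimes>\<^bsub>Mo\<^esub> cls [e]"
      using insert \<mu> by (auto simp: cprod_insert)
    have "f \<noteq> e" using insert by auto
    from right_diamond[OF f(1) insert.prems(2) this cp \<kappa>] insert.IH insert.prems f
    show ?case by auto
  qed (simp add: cprod_empty)
qed

definition rdiv :: "'e list set \<Rightarrow> 'e" where
  "rdiv \<nu> = (SOME e. e \<in> E \<and> (\<exists>\<kappa>\<in>carrier Mo. \<nu> = \<kappa> \<otimes>\<^bsub>Mo\<^esub> cls [e]))"

definition rquot :: "'e list set \<Rightarrow> 'e \<Rightarrow> 'e list set" where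
  "rquot \<mu> e = (THE \<kappa>. \<kappa> \<in> carrier Mo \<and> \<mu> = \<kappa> \<otimes>\<^bsub>Mo\<^esub> cls [e])"

lemma rdiv:
  assumes "\<nu> \<in> carrier Mo" "\<nu> \<noteq> \<one>\<^bsub>Mo\<^esub>"
  shows "rdiv \<nu> \<in> E" "\<exists>\<kappa>\<in>carrier Mo. \<nu> = \<kappa> \<otimes>\<^bsub>Mo\<^esub> cls [rdiv \<nu>]"
proof -
  have "\<exists>e. e \<in> E \<and> (\<exists>\<kappa>\<in>carrier Mo. \<nu> = \<kappa> \<otimes>\<^bsub>Mo\<^esub> cls [e])" using generator_factor[OF assms] by blast
  from someI_ex[OF this] show "rdiv \<nu> \<in> E" "\<exists>\<kappa>\<in>carrier Mo. \<nu> = \<kappa> \<otimes>\<^bsub>Mo\<^esub> cls [rdiv \<nu>]"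
    by (auto simp: rdiv_def)
qed

lemma rquot_mult: "\<kappa> \<in> carrier Mo \<Longrightarrow> e \<in> E \<Longrightarrow> rquot (\<kappa> \<otimes>\<^bsub>Mo\<^esub> cls [e]) e = \<kappa>"
  unfolding rquot_def by (rule the_equality) (auto dest: right_cancel)

end

section \<open>Signs\<close>

text \<open>The multiple by \<open>(-1)^n\<close> in an abelian group.\<close>

definition sgp :: "('a, 'x) ring_scheme \<Rightarrow> nat \<Rightarrow> 'a \<Rightarrow> 'a" where
  "sgp G n x = (if even n then x else \<ominus>\<^bsub>G\<^esub> x)"

lemma (in abelian_group_hom) hom_sgp: "x \<in> carrier G \<Longrightarrow> h (sgp G n x) = sgp H n (h x)"
  by (simp add: sgp_def)

context abelian_group
begin

lemma sgp_closed: "x \<in> carrier G \<Longrightarrow> sgp G n x \<in> carrier G"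
  by (simp add: sgp_def)

lemma sgp_sgp: "x \<in> carrier G \<Longrightarrow> sgp G n (sgp G k x) = sgp G (n + k) x"
  by (simp add: sgp_def)

lemma sgp_hom: "abelian_group_hom G G (sgp G n)"
  by (rule abelian_group_homI') (auto simp: sgp_def abelian_group_axioms minus_add)

lemma minus_minus_minus:
  assumes "a \<in> carrier G" "b \<in> carrier G" "c \<in> carrier G" "d \<in> carrier G"
  shows "(a \<ominus> b) \<ominus> (c \<ominus> d) = (a \<ominus> c) \<ominus> (b \<ominus> d)"
  using assms by (simp add: a_minus_def minus_add a_ac)

lemma add_minus_add:
  assumes "a \<in> carrier G" "b \<in> carrier G" "c \<in> carrier G" "d \<in> carrier G"
  shows "(a \<oplus> b) \<ominus> (c \<oplus> d) = (a \<ominus> c) \<oplus> (b \<ominus> d)"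
  using assms by (simp add: a_minus_def minus_add a_ac)

lemma minus_hom: "abelian_group_hom H G f \<Longrightarrow> abelian_group_hom H G g \<Longrightarrow> abelian_group_hom H G (\<lambda>x. f x \<ominus> g x)"
proof -
  assume "abelian_group_hom H G f" "abelian_group_hom H G g"
  then interpret f: abelian_group_hom H G f + g: abelian_group_hom H G g .
  show ?thesis
    by (rule abelian_group_homI') (auto simp: f.G.abelian_group_axioms abelian_group_axioms add_minus_add)
qed

lemma finsum_hom:
  assumes "abelian_group H" "\<And>i. i \<in> A \<Longrightarrow> abelian_group_hom H G (f i)"
  shows "abelian_group_hom H G (\<lambda>x. \<Oplus>i\<in>A. f i x)"
  using assms(2)
proof (intro abelian_group_homI' assms(1) abelian_group_axioms)
  fix x y assume xy: "x \<in> carrier H" "y \<in> carrier H"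
  note cl = abelian_group_hom.hom_closed[OF assms(2)]
  show "(\<Oplus>i\<in>A. f i x) \<in> carrier G" using cl xy by auto
  have "(\<Oplus>i\<in>A. f i (x \<oplus>\<^bsub>H\<^esub> y)) = (\<Oplus>i\<in>A. f i x \<oplus> f i y)"
    using xy cl by (intro finsum_cong') (auto simp: abelian_group_hom.hom_add[OF assms(2)])
  also have "\<dots> = (\<Oplus>i\<in>A. f i x) \<oplus> (\<Oplus>i\<in>A. f i y)" using xy cl by (intro finsum_addf) auto
  finally show "(\<Oplus>i\<in>A. f i (x \<oplus>\<^bsub>H\<^esub> y)) = (\<Oplus>i\<in>A. f i x) \<oplus> (\<Oplus>i\<in>A. f i y)" .
qed

text \<open>Antisymmetry of the double sum alone would only show that twice the sum vanishes, and
  the group may have 2-torsion. Hence an induction in which the row and the column of a new index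
  cancel.\<close>

lemma finsum_antisym:
  assumes "finite A" "\<And>x y. x \<in> A \<Longrightarrow> y \<in> A \<Longrightarrow> U x y \<in> carrier G"
    "\<And>x y. x \<in> A \<Longrightarrow> y \<in> A \<Longrightarrow> x \<noteq> y \<Longrightarrow> U x y = \<ominus> U y x"
  shows "(\<Oplus>x\<in>A. \<Oplus>y\<in>A - {x}. U x y) = \<zero>"
  using assms
proof (induction A)
  case (insert z A)
  have h: "finite A" "z \<notin> A" by fact+
  have cl: "U x y \<in> carrier G" if "x \<in> insert z A" "y \<in> insert z A" for x y using insert.prems(1) that .
  have zA: "insert z A - {z} = A" using h cl by auto
  have inner: "(\<Oplus>y\<in>insert z A - {x}. U x y) = U x z \<oplus> (\<Oplus>y\<in>A - {x}. U x y)" if "x \<in> A" for x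
  proof -
    have "insert z A - {x} = insert z (A - {x})" using that h cl by auto
    then show ?thesis using that h cl by (simp add: Pi_iff)
  qed
  have "(\<Oplus>x\<in>insert z A. \<Oplus>y\<in>insert z A - {x}. U x y) = (\<Oplus>y\<in>A. U z y) \<oplus> (\<Oplus>x\<in>A. \<Oplus>y\<in>insert z A - {x}. U x y)"
    using h cl by (subst finsum_insert) (auto simp: zA)
  also have "(\<Oplus>x\<in>A. \<Oplus>y\<in>insert z A - {x}. U x y) = (\<Oplus>x\<in>A. U x z \<oplus> (\<Oplus>y\<in>A - {x}. U x y))"
    using h cl inner by (intro finsum_cong') auto
  also have "\<dots> = (\<Oplus>x\<in>A. U x z) \<oplus> (\<Oplus>x\<in>A. \<Oplus>y\<in>A - {x}. U x y)"
    using h cl by (intro finsum_addf) auto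
  also have "(\<Oplus>x\<in>A. \<Oplus>y\<in>A - {x}. U x y) = \<zero>" by (rule insert.IH; rule insert.prems) auto
  also have "(\<Oplus>x\<in>A. U x z) \<oplus> \<zero> = (\<Oplus>x\<in>A. U x z)" using h cl by auto
  also have "(\<Oplus>y\<in>A. U z y) \<oplus> (\<Oplus>x\<in>A. U x z) = (\<Oplus>x\<in>A. U z x \<oplus> U x z)"
    using h cl by (intro finsum_addf[symmetric]) auto
  also have "\<dots> = (\<Oplus>x\<in>A. \<zero>)"
  proof (intro finsum_cong')
    fix x assume x: "x \<in> A"
    then have "U z x = \<ominus> U x z" using h(2) by (intro insert.prems(2)) auto
    then show "U z x \<oplus> U x z = \<zero>" using x cl by (simp add: l_neg)
  qed auto
  finally show ?case by simp
qed simp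

end

text \<open>The parity of the number of elements of \<open>c\<close> before \<open>e\<close> gives the sign of the face \<open>c - {e}\<close>.
  Only totality and antisymmetry of the relation \<open>lt\<close> matter.\<close>

definition pos :: "('e \<Rightarrow> 'e \<Rightarrow> bool) \<Rightarrow> 'e \<Rightarrow> 'e set \<Rightarrow> nat" where
  "pos lt e c = card {y \<in> c. y \<noteq> e \<and> lt y e}"

lemma pos_remove:
  assumes "finite c" "f \<in> c" "e \<noteq> f"
  shows "pos lt e c = pos lt e (c - {f}) + of_bool (lt f e)"
proof (cases "lt f e")
  case True
  then have "{y \<in> c. y \<noteq> e \<and> lt y e} = insert f {y \<in> c - {f}. y \<noteq> e \<and> lt y e}" using assms by auto
  then show ?thesis using True assms by (simp add: pos_def)
next
  case False
  then have "{y \<in> c. y \<noteq> e \<and> lt y e} = {y \<in> c - {f}. y \<noteq> e \<and> lt y e}" by auto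
  then show ?thesis using False by (simp add: pos_def)
qed

text \<open>Removing \<open>f\<close> lowers the position of \<open>e\<close> by one exactly if
  \<open>f\<close> comes before \<open>e\<close>, and conversely. Exactly one of the two happens, so
  the four positions add up to an even number plus one.\<close>

lemma pos_parity:
  assumes "finite c" "e \<in> c" "f \<in> c" "e \<noteq> f" "lt e f \<longleftrightarrow> \<not> lt f e"
  shows "odd (pos lt e c + pos lt f (c - {e}) + (pos lt f c + pos lt e (c - {f})))"
  using pos_remove[OF assms(1,2), of f lt] pos_remove[OF assms(1,3), of e lt] assms by auto

text \<open>The generators come without an order; a well-order of their type provides one for the
  signs.\<close>

lemma tournament_exists: "\<exists>lt :: 'e \<Rightarrow> 'e \<Rightarrow> bool. \<forall>e f. e \<noteq> f \<longrightarrow> (lt e f \<longleftrightarrow> \<not> lt f e)"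
proof -
  obtain r :: "('e \<times> 'e) set" where r: "well_order_on UNIV r" using well_order_on by blast
  then have "antisym r" "total r"
    by (auto simp: well_order_on_def linear_order_on_def partial_order_on_def)
  then show ?thesis by (intro exI[of _ "\<lambda>e f. (e, f) \<in> r"]) (auto simp: antisym_def total_on_def)
qed

section \<open>Elements of a direct sum with support in a given set\<close>

context dirsum_family
begin

text \<open>The filtration by weight (\<open>W\<close>), the degree in the complex
  (\<open>Y\<close>) and the grading (\<open>Igr_fs\<close>) are all described by sets of indices,
  so one collection of closure rules serves the three.\<close>

definition fs :: "'x set \<Rightarrow> ('x \<Rightarrow> 'u) set" where
  "fs Y = {f \<in> carrier (dirsum X N sm). dsupp N f \<subseteq> Y}"

lemma fs_carrier: "f \<in> fs Y \<Longrightarrow> f \<in> carrier (dirsum X N sm)"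
  by (simp add: fs_def)

lemma fs_zero: "\<zero>\<^bsub>dirsum X N sm\<^esub> \<in> fs Y"
  by (simp add: fs_def) (simp add: dirsum_simps(2) dsupp_def)

lemma fs_add: "f \<in> fs Y \<Longrightarrow> g \<in> fs Y \<Longrightarrow> f \<oplus>\<^bsub>dirsum X N sm\<^esub> g \<in> fs Y"
  using dsupp_add[of f g] D.a_closed[of f g] by (auto simp: fs_def dirsum_simps(3))

lemma fs_uminus: "f \<in> fs Y \<Longrightarrow> \<ominus>\<^bsub>dirsum X N sm\<^esub> f \<in> fs Y"
proof -
  assume f: "f \<in> fs Y"
  have "dsupp N (\<ominus>\<^bsub>dirsum X N sm\<^esub> f) \<subseteq> dsupp N f"
  proof
    fix x assume x: "x \<in> dsupp N (\<ominus>\<^bsub>dirsum X N sm\<^esub> f)"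
    interpret Nx: abelian_group "N x" by (rule N)
    show "x \<in> dsupp N f" using x eval_uminus[of f x] f by (auto simp: dsupp_def fs_def)
  qed
  then show ?thesis using f by (auto simp: fs_def)
qed

lemma fs_minus: "f \<in> fs Y \<Longrightarrow> g \<in> fs Y \<Longrightarrow> f \<ominus>\<^bsub>dirsum X N sm\<^esub> g \<in> fs Y"
  by (simp add: a_minus_def fs_add fs_uminus)

lemma fs_sgp: "f \<in> fs Y \<Longrightarrow> sgp (dirsum X N sm) n f \<in> fs Y"
  by (simp add: sgp_def fs_uminus)

lemma fs_finsum: "(\<And>i. i \<in> A \<Longrightarrow> f i \<in> fs Y) \<Longrightarrow> finsum (dirsum X N sm) f A \<in> fs Y"
proof (induction A rule: infinite_finite_induct)
  case (insert x F)
  then have "finsum (dirsum X N sm) f (insert x F) = f x \<oplus>\<^bsub>dirsum X N sm\<^esub> finsum (dirsum X N sm) f F"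
    by (intro D.finsum_insert) (auto intro: fs_carrier)
  then show ?case using insert by (simp add: fs_add)
qed (auto simp: fs_zero)

lemma fs_sing: "x \<in> X \<Longrightarrow> x \<in> Y \<Longrightarrow> a \<in> carrier (N x) \<Longrightarrow> sing N x a \<in> fs Y"
  using sing_supp[of x a] by (auto simp: fs_def sing_closed)

lemma fs_Int: "f \<in> fs Y \<Longrightarrow> f \<in> fs Z \<Longrightarrow> f \<in> fs (Y \<inter> Z)"
  by (auto simp: fs_def)

lemma fs_empty: "f \<in> fs {} \<Longrightarrow> f = \<zero>\<^bsub>dirsum X N sm\<^esub>"
  by (auto simp: fs_def dsupp_def dirsum_simps(2))

lemma fs_induct [consumes 1, case_names zero sing add]:
  assumes f: "f \<in> fs Y" and z: "P \<zero>\<^bsub>dirsum X N sm\<^esub>"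
    and s: "\<And>x a. x \<in> X \<Longrightarrow> x \<in> Y \<Longrightarrow> a \<in> carrier (N x) \<Longrightarrow> P (sing N x a)"
    and a: "\<And>f g. f \<in> fs Y \<Longrightarrow> g \<in> fs Y \<Longrightarrow> P f \<Longrightarrow> P g \<Longrightarrow> P (f \<oplus>\<^bsub>dirsum X N sm\<^esub> g)"
  shows "P f"
proof -
  interpret Y: dirsum_family "X \<inter> Y" N sm by (rule dirsum_family_axioms)
  have eq: "carrier (dirsum (X \<inter> Y) N sm) = fs Y" by (auto simp: fs_def dirsum_simps(1))
  show ?thesis
    using f unfolding eq[symmetric]
  proof (induction rule: Y.dirsum_induct)
    case zero show ?case using z by (simp add: dirsum_simps)
  next
    case (sing x b) then show ?case using s by simp
  next
    case (add f g) then show ?case using a[of f g] unfolding eq by (simp add: dirsum_simps(3))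
  qed
qed

end

lemma (in dirsum_ext) dext_into:
  assumes V: "\<zero>\<^bsub>H\<^esub> \<in> V" "\<And>a b. a \<in> V \<Longrightarrow> b \<in> V \<Longrightarrow> a \<oplus>\<^bsub>H\<^esub> b \<in> V"
    and g: "\<And>x a. x \<in> X \<Longrightarrow> x \<in> Y \<Longrightarrow> a \<in> carrier (N x) \<Longrightarrow> g x a \<in> V" and f: "f \<in> fs Y"
  shows "dext N H g f \<in> V"
  using f
proof (induction rule: fs_induct)
  case zero
  then show ?case using V by (simp add: abelian_group_hom.hom_zero[OF dext_hom])
next
  case (sing x a)
  then show ?case using assms by (simp add: dext_sing)
next
  case (add f g)
  then show ?case using V by (simp add: abelian_group_hom.hom_add[OF dext_hom] fs_carrier)
qed

section \<open>The Koszul complex of a module over the monoid ring\<close>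

context mring
begin

text \<open>Restriction of scalars to \<open>R\<close>, embedded as multiples of the unit of the
  monoid. The set \<open>C\<close> will be a homogeneous piece of A, which is stable under
  \<open>R\<close> but in general not under the monoid ring.\<close>

definition Rm :: "('m \<Rightarrow> 'r, 'a) module \<Rightarrow> 'a set \<Rightarrow> ('r, 'a) module" where
  "Rm Z C = \<lparr>carrier = C, monoid.mult = monoid.mult Z, monoid.one = monoid.one Z, ring.zero = \<zero>\<^bsub>Z\<^esub>,
     ring.add = add Z, smult = (\<lambda>r x. sgl \<one>\<^bsub>Mo\<^esub> r \<odot>\<^bsub>Z\<^esub> x)\<rparr>"

lemma Rm_simps: "carrier (Rm Z C) = C" "\<zero>\<^bsub>Rm Z C\<^esub> = \<zero>\<^bsub>Z\<^esub>" "x \<oplus>\<^bsub>Rm Z C\<^esub> y = x \<oplus>\<^bsub>Z\<^esub> y"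
  "r \<odot>\<^bsub>Rm Z C\<^esub> x = sgl \<one>\<^bsub>Mo\<^esub> r \<odot>\<^bsub>Z\<^esub> x"
  by (simp_all add: Rm_def)

lemma left_module_Rm:
  assumes Z: "left_module S Z" and C: "\<And>x. x \<in> C \<Longrightarrow> x \<in> carrier Z" "\<zero>\<^bsub>Z\<^esub> \<in> C"
    "\<And>x y. x \<in> C \<Longrightarrow> y \<in> C \<Longrightarrow> x \<oplus>\<^bsub>Z\<^esub> y \<in> C" "\<And>x. x \<in> C \<Longrightarrow> \<ominus>\<^bsub>Z\<^esub> x \<in> C"
    "\<And>r x. r \<in> carrier R \<Longrightarrow> x \<in> C \<Longrightarrow> sgl \<one>\<^bsub>Mo\<^esub> r \<odot>\<^bsub>Z\<^esub> x \<in> C"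
  shows "left_module R (Rm Z C)"
proof -
  interpret Z: left_module S Z by fact
  note c1 = sgl_closed[OF Mo.one_closed]
  show ?thesis
  proof (rule left_moduleI[OF R abelian_groupI])
    show "\<exists>y\<in>carrier (Rm Z C). y \<oplus>\<^bsub>Rm Z C\<^esub> x = \<zero>\<^bsub>Rm Z C\<^esub>" if "x \<in> carrier (Rm Z C)" for x
      using that C by (intro bexI[of _ "\<ominus>\<^bsub>Z\<^esub> x"]) (simp_all add: Rm_simps Z.M.l_neg)
    show "(a \<otimes>\<^bsub>R\<^esub> b) \<odot>\<^bsub>Rm Z C\<^esub> x = a \<odot>\<^bsub>Rm Z C\<^esub> (b \<odot>\<^bsub>Rm Z C\<^esub> x)"
      if "a \<in> carrier R" "b \<in> carrier R" "x \<in> carrier (Rm Z C)" for a b x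
      using that C(1) sgl_mult[of "\<one>\<^bsub>Mo\<^esub>" "\<one>\<^bsub>Mo\<^esub>" a b]
      by (simp add: Rm_simps Z.smult_assoc1[OF c1 c1, symmetric])
  qed (use C in \<open>simp_all add: Rm_simps Z.M.a_ac sgl_add c1 Z.smult_l_distr Z.smult_r_distr sgl_one Z.smult_one\<close>)
qed

end

lemma finsum_rel:
  assumes "abelian_group G" "P \<zero>\<^bsub>G\<^esub>" "\<And>x y. x \<in> carrier G \<Longrightarrow> y \<in> carrier G \<Longrightarrow> P x \<Longrightarrow> P y \<Longrightarrow> P (x \<oplus>\<^bsub>G\<^esub> y)"
    and "\<And>i. i \<in> A \<Longrightarrow> f i \<in> carrier G \<and> P (f i)"
  shows "P (finsum G f A)"
proof -
  interpret abelian_group G by fact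
  show ?thesis using assms(4)
  proof (induction A rule: infinite_finite_induct)
    case (insert x F)
    then have "finsum G f (insert x F) = f x \<oplus>\<^bsub>G\<^esub> finsum G f F" "finsum G f F \<in> carrier G"
      by (auto intro!: finsum_insert finsum_closed)
    then show ?case using insert assms(3) by simp
  qed (simp_all add: assms(2))
qed

locale koszul = fpc E I + mring R "fpc_monoid E I" fpc_length
  for E :: "'e set" and I :: "('e \<times> 'e) set" and R :: "'r ring" +
  fixes A :: "('e list set \<Rightarrow> 'r, 'a) module" and Agr :: "int \<Rightarrow> 'a set" and pA :: "int \<Rightarrow> 'a \<Rightarrow> 'a"
    and k0 :: int and lt :: "'e \<Rightarrow> 'e \<Rightarrow> bool"
  assumes A: "left_module S A" and gA: "graded_group A Agr pA"
    and A_smult: "\<And>k l s x. s \<in> Sgr k \<Longrightarrow> x \<in> Agr l \<Longrightarrow> s \<odot>\<^bsub>A\<^esub> x \<in> Agr (k + l)"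
    and below: "\<And>k. k < k0 \<Longrightarrow> Agr k = {\<zero>\<^bsub>A\<^esub>}"
    and lt: "\<And>e f. e \<noteq> f \<Longrightarrow> lt e f \<longleftrightarrow> \<not> lt f e"
begin

sublocale A: left_module S A by (rule A)
sublocale gA: graded_group A Agr pA by (rule gA)

text \<open>In degrees below \<open>k0\<close> A has only zero, so nothing is lost, and the degrees
  \<open>dg\<close> of the summands are bounded below by \<open>k0\<close>.\<close>

definition J :: "('e set \<times> int) set" where "J = {(c, i). clique c \<and> k0 \<le> i}"

definition N :: "'e set \<times> int \<Rightarrow> ('r, 'a) module" where "N x = Rm A (Agr (snd x))"

text \<open>The shift by the size of the clique makes the differential preserve degrees: each face
  gives up one letter of c, which either lengthens \<mu> or raises the degree of a.\<close>

definition dg :: "'e set \<times> int \<Rightarrow> int" where "dg x = int (card (fst x)) + snd x"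

lemma smult_gr: "\<alpha> \<in> carrier Mo \<Longrightarrow> r \<in> carrier R \<Longrightarrow> x \<in> Agr k \<Longrightarrow> l = int (fpc_length \<alpha>) + k \<Longrightarrow> sgl \<alpha> r \<odot>\<^bsub>A\<^esub> x \<in> Agr l"
  using A_smult[OF sgl_gr] by simp

lemma left_module_N: "left_module R (N x)"
  unfolding N_def
proof (rule left_module_Rm[OF A])
  show "sgl \<one>\<^bsub>Mo\<^esub> r \<odot>\<^bsub>A\<^esub> y \<in> Agr (snd x)" if "r \<in> carrier R" "y \<in> Agr (snd x)" for r y
    by (rule smult_gr[OF Mo.one_closed that]) (simp add: len_one)
qed (rule gA.gr_sub gA.gr_zero gA.gr_add gA.gr_uminus; assumption)+

sublocale K: ind_module R Mo fpc_length J N dg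
  by (intro ind_module.intro ind_module_axioms.intro mring_axioms left_module_N)

lemma N_simps: "carrier (N (c, i)) = Agr i" "\<zero>\<^bsub>N x\<^esub> = \<zero>\<^bsub>A\<^esub>" "y \<oplus>\<^bsub>N x\<^esub> z = y \<oplus>\<^bsub>A\<^esub> z"
  "r \<odot>\<^bsub>N x\<^esub> y = sgl \<one>\<^bsub>Mo\<^esub> r \<odot>\<^bsub>A\<^esub> y"
  by (simp_all add: N_def Rm_simps)

definition s :: "'e list set \<Rightarrow> 'e set \<Rightarrow> int \<Rightarrow> 'a \<Rightarrow> 'e list set \<times> 'e set \<times> int \<Rightarrow> 'a" where
  "s \<mu> c i = sing K.N' (\<mu>, c, i)"

abbreviation "G \<equiv> K.G"

lemma s_hom: "\<mu> \<in> carrier Mo \<Longrightarrow> clique c \<Longrightarrow> k0 \<le> i \<Longrightarrow> abelian_group_hom (N (c, i)) G (s \<mu> c i)"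
  unfolding s_def using K.G.sing_hom[of "(\<mu>, c, i)"] by (simp add: J_def)

lemma s_closed: "\<mu> \<in> carrier Mo \<Longrightarrow> clique c \<Longrightarrow> k0 \<le> i \<Longrightarrow> a \<in> Agr i \<Longrightarrow> s \<mu> c i a \<in> carrier G"
  using abelian_group_hom.hom_closed[OF s_hom] by (simp add: N_simps)

definition ev :: "'e \<Rightarrow> 'a \<Rightarrow> 'a" where "ev e a = sgl (cls [e]) \<one>\<^bsub>R\<^esub> \<odot>\<^bsub>A\<^esub> a"

lemma fpc_length_gen: "e \<in> E \<Longrightarrow> fpc_length (cls [e]) = 1"
  by (simp add: fpc_length_cls)

lemma ev_gr: "e \<in> E \<Longrightarrow> a \<in> Agr i \<Longrightarrow> ev e a \<in> Agr (i + 1)"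
  unfolding ev_def by (rule smult_gr) (simp_all add: gen_closed fpc_length_gen)

lemma ev_hom: "e \<in> E \<Longrightarrow> abelian_group_hom (N (c, i)) (N (b, i + 1)) (ev e)"
  by (rule abelian_group_homI')
   (auto simp: N_simps ev_gr left_module_abelian_group[OF left_module_N],
    simp add: ev_def A.smult_r_distr sgl_closed gen_closed gA.gr_sub)

lemma ev_comm:
  assumes "(e, f) \<in> I" "a \<in> Agr i" shows "ev e (ev f a) = ev f (ev e a)"
proof -
  have ef: "cls [e] \<in> carrier Mo" "cls [f] \<in> carrier Mo" using assms I by (auto intro: gen_closed)
  then show ?thesis
    using gA.gr_sub[OF assms(2)] cls_comm[OF assms(1)]
    by (simp add: ev_def A.smult_assoc1[symmetric] sgl_closed sgl_mult)
qed

text \<open>The face of \<mu> \<otimes> c \<otimes> a at \<open>e\<close>, without sign. The first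
  term keeps the weight |\<mu>| + |c|, the second lowers it by one.\<close>

definition \<tau> :: "'e \<Rightarrow> 'e list set \<Rightarrow> 'e set \<Rightarrow> int \<Rightarrow> 'a \<Rightarrow> 'e list set \<times> 'e set \<times> int \<Rightarrow> 'a" where
  "\<tau> e \<mu> c i a = s (\<mu> \<otimes>\<^bsub>Mo\<^esub> cls [e]) (c - {e}) i a \<ominus>\<^bsub>G\<^esub> s \<mu> (c - {e}) (i + 1) (ev e a)"

definition bd :: "'e list set \<times> 'e set \<times> int \<Rightarrow> 'a \<Rightarrow> 'e list set \<times> 'e set \<times> int \<Rightarrow> 'a" where
  "bd = (\<lambda>(\<mu>, c, i) a. \<Oplus>\<^bsub>G\<^esub>e\<in>c. sgp G (pos lt e c) (\<tau> e \<mu> c i a))"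

definition d :: "('e list set \<times> 'e set \<times> int \<Rightarrow> 'a) \<Rightarrow> 'e list set \<times> 'e set \<times> int \<Rightarrow> 'a" where
  "d = dext K.N' G bd"

definition eps :: "('e list set \<times> 'e set \<times> int \<Rightarrow> 'a) \<Rightarrow> 'a" where
  "eps = dext K.N' A (\<lambda>(\<mu>, c, i) a. if c = {} then sgl \<mu> \<one>\<^bsub>R\<^esub> \<odot>\<^bsub>A\<^esub> a else \<zero>\<^bsub>A\<^esub>)"

text \<open>The leading terms \<open>\<mu> e \<otimes> (c - {e})\<close> of the boundary of \<open>\<mu> \<otimes> c\<close> have the same product \<open>\<nu>\<close> as \<open>\<mu> \<otimes> c\<close>,
  hence the same \<open>rdiv \<nu>\<close>. This makes the homotopy formula hold up to the remaining terms.\<close>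

definition hgen :: "'e list set \<times> 'e set \<times> int \<Rightarrow> 'a \<Rightarrow> 'e list set \<times> 'e set \<times> int \<Rightarrow> 'a" where
  "hgen = (\<lambda>(\<mu>, c, i) a. let \<nu> = cprod c \<mu>; e = rdiv \<nu> in
     if \<nu> = \<one>\<^bsub>Mo\<^esub> \<or> e \<in> c then \<zero>\<^bsub>G\<^esub> else sgp G (pos lt e (insert e c)) (s (rquot \<mu> e) (insert e c) i a))"

definition h :: "('e list set \<times> 'e set \<times> int \<Rightarrow> 'a) \<Rightarrow> 'e list set \<times> 'e set \<times> int \<Rightarrow> 'a" where
  "h = dext K.N' G hgen"

lemma clique_E: "clique c \<Longrightarrow> e \<in> c \<Longrightarrow> e \<in> E"
  by (auto simp: clique_def)

lemma clique_Diff: "clique c \<Longrightarrow> clique (c - b)"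
  by (rule clique_subset) auto

lemma clique_finite: "clique c \<Longrightarrow> finite c"
  by (simp add: clique_def)

lemma \<tau>_hom:
  assumes "\<mu> \<in> carrier Mo" "clique c" "k0 \<le> i" "e \<in> c"
  shows "abelian_group_hom (N (c, i)) G (\<tau> e \<mu> c i)"
proof -
  have e: "e \<in> E" using assms clique_E by blast
  have "abelian_group_hom (N (c, i)) (N (c - {e}, i)) (\<lambda>x. x)"
    by (rule abelian_group_homI') (auto simp: left_module_abelian_group[OF left_module_N] N_simps)
  from abelian_group_hom_compose[OF this s_hom]
  have 1: "abelian_group_hom (N (c, i)) G (s (\<mu> \<otimes>\<^bsub>Mo\<^esub> cls [e]) (c - {e}) i)"
    using assms e by (simp add: gen_closed clique_Diff)
  have 2: "abelian_group_hom (N (c, i)) G (\<lambda>a. s \<mu> (c - {e}) (i + 1) (ev e a))"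
    using assms e by (intro abelian_group_hom_compose[OF ev_hom s_hom] clique_Diff) simp_all
  show ?thesis using K.G.D.minus_hom[OF 1 2] by (simp add: \<tau>_def[abs_def])
qed

lemma \<tau>_closed: "\<mu> \<in> carrier Mo \<Longrightarrow> clique c \<Longrightarrow> k0 \<le> i \<Longrightarrow> e \<in> c \<Longrightarrow> a \<in> Agr i \<Longrightarrow> \<tau> e \<mu> c i a \<in> carrier G"
  using abelian_group_hom.hom_closed[OF \<tau>_hom] by (simp add: N_simps)

lemma bd_hom: "x \<in> K.X \<Longrightarrow> abelian_group_hom (K.N' x) G (bd x)"
proof -
  assume x: "x \<in> K.X"
  obtain \<mu> c i where [simp]: "x = (\<mu>, c, i)" by (cases x) auto
  have x': "\<mu> \<in> carrier Mo" "clique c" "k0 \<le> i" using x by (auto simp: J_def)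
  have "abelian_group_hom (N (c, i)) G (\<lambda>a. \<Oplus>\<^bsub>G\<^esub>e\<in>c. sgp G (pos lt e c) (\<tau> e \<mu> c i a))"
    by (intro K.G.D.finsum_hom abelian_group_hom_compose[OF \<tau>_hom K.G.D.sgp_hom]
        left_module_abelian_group[OF left_module_N] x')
  then show ?thesis by (simp add: bd_def)
qed

sublocale d: dirsum_ext K.X K.N' "nosm :: 'r \<Rightarrow> _" G bd
  by (intro dirsum_ext.intro dirsum_ext_axioms.intro K.G.dirsum_family_axioms K.G.dirsum_group bd_hom)

lemma eps_gen_hom: "x \<in> K.X \<Longrightarrow> abelian_group_hom (K.N' x) A
    ((\<lambda>(\<mu>, c, i) a. if c = {} then sgl \<mu> \<one>\<^bsub>R\<^esub> \<odot>\<^bsub>A\<^esub> a else \<zero>\<^bsub>A\<^esub>) x)"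
proof -
  assume x: "x \<in> K.X"
  obtain \<mu> c i where [simp]: "x = (\<mu>, c, i)" by (cases x) auto
  show ?thesis using x
    by (intro abelian_group_homI')
      (auto simp: left_module_abelian_group[OF left_module_N] A.M.abelian_group_axioms N_simps A.smult_closed sgl_closed gA.gr_sub A.smult_r_distr)
qed

sublocale e: dirsum_ext K.X K.N' "nosm :: 'r \<Rightarrow> _" A "\<lambda>(\<mu>, c, i) a. if c = {} then sgl \<mu> \<one>\<^bsub>R\<^esub> \<odot>\<^bsub>A\<^esub> a else \<zero>\<^bsub>A\<^esub>"
  by (intro dirsum_ext.intro dirsum_ext_axioms.intro K.G.dirsum_family_axioms A.M.abelian_group_axioms eps_gen_hom)

text \<open>What makes \<open>hgen\<close> meaningful: by \<open>cprod_dvd\<close> the chosen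
  divisor, if it is not in \<open>c\<close> already, extends the clique and can be split off
  \<mu>.\<close>

lemma rdiv_new:
  assumes \<mu>: "\<mu> \<in> carrier Mo" and c: "clique c" and nu: "cprod c \<mu> \<noteq> \<one>\<^bsub>Mo\<^esub>" and e: "rdiv (cprod c \<mu>) \<notin> c"
  shows "rdiv (cprod c \<mu>) \<in> E" "clique (insert (rdiv (cprod c \<mu>)) c)"
    "rquot \<mu> (rdiv (cprod c \<mu>)) \<in> carrier Mo" "\<mu> = rquot \<mu> (rdiv (cprod c \<mu>)) \<otimes>\<^bsub>Mo\<^esub> cls [rdiv (cprod c \<mu>)]"
proof -
  let ?e = "rdiv (cprod c \<mu>)"
  have cl: "cprod c \<mu> \<in> carrier Mo" using cprod_closed[OF c \<mu>] by simp
  show eE: "?e \<in> E" using rdiv(1)[OF cl nu] .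
  have *: "(\<exists>\<kappa>\<in>carrier Mo. \<mu> = \<kappa> \<otimes>\<^bsub>Mo\<^esub> cls [?e]) \<and> (\<forall>f\<in>c. (f, ?e) \<in> I)"
    by (rule cprod_dvd[OF c \<mu> eE e rdiv(2)[OF cl nu]])
  then show "clique (insert ?e c)" using c eE sym by (auto simp: clique_def mutually_commuting_def dest: symD)
  obtain \<kappa> where "\<kappa> \<in> carrier Mo" "\<mu> = \<kappa> \<otimes>\<^bsub>Mo\<^esub> cls [?e]" using * by blast
  then show "rquot \<mu> ?e \<in> carrier Mo" "\<mu> = rquot \<mu> ?e \<otimes>\<^bsub>Mo\<^esub> cls [?e]"
    using rquot_mult[OF _ eE, of \<kappa>] by auto
qed

lemma hgen_hom: "x \<in> K.X \<Longrightarrow> abelian_group_hom (K.N' x) G (hgen x)"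
proof -
  assume x: "x \<in> K.X"
  obtain \<mu> c i where [simp]: "x = (\<mu>, c, i)" by (cases x) auto
  have x': "\<mu> \<in> carrier Mo" "clique c" "k0 \<le> i" using x by (auto simp: J_def)
  show ?thesis
  proof (cases "cprod c \<mu> = \<one>\<^bsub>Mo\<^esub> \<or> rdiv (cprod c \<mu>) \<in> c")
    case True
    then have "hgen (\<mu>, c, i) = (\<lambda>a. \<zero>\<^bsub>G\<^esub>)" by (auto simp: hgen_def Let_def)
    then show ?thesis
      by (auto intro!: abelian_group_homI' left_module_abelian_group[OF left_module_N] K.G.dirsum_group)
  next
    case False
    let ?e = "rdiv (cprod c \<mu>)"
    have eq: "hgen (\<mu>, c, i) = (\<lambda>a. sgp G (pos lt ?e (insert ?e c)) (s (rquot \<mu> ?e) (insert ?e c) i a))"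
      using False by (auto simp: hgen_def Let_def)
    have "abelian_group_hom (N (c, i)) (N (insert ?e c, i)) (\<lambda>x. x)"
      by (rule abelian_group_homI') (auto simp: left_module_abelian_group[OF left_module_N] N_simps)
    from abelian_group_hom_compose[OF this s_hom]
    have "abelian_group_hom (N (c, i)) G (s (rquot \<mu> ?e) (insert ?e c) i)"
      using rdiv_new[OF x'(1,2)] False x' by auto
    from abelian_group_hom_compose[OF this K.G.D.sgp_hom] show ?thesis by (simp add: eq)
  qed
qed

sublocale h: dirsum_ext K.X K.N' "nosm :: 'r \<Rightarrow> _" G hgen
  by (intro dirsum_ext.intro dirsum_ext_axioms.intro K.G.dirsum_family_axioms K.G.dirsum_group hgen_hom)

lemma d_hom: "abelian_group_hom G G d" unfolding d_def by (rule d.dext_hom)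
lemma h_hom: "abelian_group_hom G G h" unfolding h_def by (rule h.dext_hom)
lemma eps_hom: "abelian_group_hom G A eps" unfolding eps_def by (rule e.dext_hom)

lemma d_s: "\<mu> \<in> carrier Mo \<Longrightarrow> clique c \<Longrightarrow> k0 \<le> i \<Longrightarrow> a \<in> Agr i \<Longrightarrow>
    d (s \<mu> c i a) = (\<Oplus>\<^bsub>G\<^esub>e\<in>c. sgp G (pos lt e c) (\<tau> e \<mu> c i a))"
  unfolding d_def s_def by (subst d.dext_sing) (auto simp: J_def N_simps bd_def)

lemma eps_s: "\<mu> \<in> carrier Mo \<Longrightarrow> clique c \<Longrightarrow> k0 \<le> i \<Longrightarrow> a \<in> Agr i \<Longrightarrow>
    eps (s \<mu> c i a) = (if c = {} then sgl \<mu> \<one>\<^bsub>R\<^esub> \<odot>\<^bsub>A\<^esub> a else \<zero>\<^bsub>A\<^esub>)"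
  unfolding eps_def s_def by (subst e.dext_sing) (auto simp: J_def N_simps)

lemma h_s: "\<mu> \<in> carrier Mo \<Longrightarrow> clique c \<Longrightarrow> k0 \<le> i \<Longrightarrow> a \<in> Agr i \<Longrightarrow>
    h (s \<mu> c i a) = hgen (\<mu>, c, i) a"
  unfolding h_def s_def by (subst h.dext_sing) (auto simp: J_def N_simps)

lemma G_induct [consumes 1, case_names zero s add]:
  assumes "f \<in> carrier G" "P \<zero>\<^bsub>G\<^esub>"
    and "\<And>\<mu> c i a. \<mu> \<in> carrier Mo \<Longrightarrow> clique c \<Longrightarrow> k0 \<le> i \<Longrightarrow> a \<in> Agr i \<Longrightarrow> P (s \<mu> c i a)"
    and "\<And>f g. f \<in> carrier G \<Longrightarrow> g \<in> carrier G \<Longrightarrow> P f \<Longrightarrow> P g \<Longrightarrow> P (f \<oplus>\<^bsub>G\<^esub> g)"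
  shows "P f"
  using assms(1)
proof (induction rule: K.G.dirsum_induct)
  case (sing x a)
  obtain \<mu> c i where [simp]: "x = (\<mu>, c, i)" by (cases x) auto
  show ?case using assms(3)[of \<mu> c i a] sing by (simp add: J_def N_simps s_def)
qed (use assms in auto)

lemma d_\<tau>:
  assumes \<mu>: "\<mu> \<in> carrier Mo" and c: "clique c" and i: "k0 \<le> i" and e: "e \<in> c" and a: "a \<in> Agr i"
  shows "d (\<tau> e \<mu> c i a) = (\<Oplus>\<^bsub>G\<^esub>f\<in>c - {e}. sgp G (pos lt f (c - {e}))
    (\<tau> f (\<mu> \<otimes>\<^bsub>Mo\<^esub> cls [e]) (c - {e}) i a \<ominus>\<^bsub>G\<^esub> \<tau> f \<mu> (c - {e}) (i + 1) (ev e a)))"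
proof -
  have eE: "e \<in> E" using c e clique_E by blast
  have me: "\<mu> \<otimes>\<^bsub>Mo\<^esub> cls [e] \<in> carrier Mo" using \<mu> eE by (simp add: gen_closed)
  have c': "clique (c - {e})" using c by (rule clique_Diff)
  have ea: "ev e a \<in> Agr (i + 1)" using eE a by (rule ev_gr)
  let ?T1 = "\<lambda>f. \<tau> f (\<mu> \<otimes>\<^bsub>Mo\<^esub> cls [e]) (c - {e}) i a" and ?T2 = "\<lambda>f. \<tau> f \<mu> (c - {e}) (i + 1) (ev e a)"
  have cl: "?T1 f \<in> carrier G" "?T2 f \<in> carrier G" if "f \<in> c - {e}" for f
    using that \<tau>_closed[OF me c' i _ a] \<tau>_closed[OF \<mu> c' _ _ ea] i by auto
  have "d (\<tau> e \<mu> c i a) = d (s (\<mu> \<otimes>\<^bsub>Mo\<^esub> cls [e]) (c - {e}) i a) \<ominus>\<^bsub>G\<^esub> d (s \<mu> (c - {e}) (i + 1) (ev e a))"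
    unfolding \<tau>_def by (rule abelian_group_hom.hom_minus[OF d_hom]) (use me c' i a ea \<mu> in \<open>auto intro!: s_closed\<close>)
  also have "\<dots> = (\<Oplus>\<^bsub>G\<^esub>f\<in>c - {e}. sgp G (pos lt f (c - {e})) (?T1 f)) \<ominus>\<^bsub>G\<^esub> (\<Oplus>\<^bsub>G\<^esub>f\<in>c - {e}. sgp G (pos lt f (c - {e})) (?T2 f))"
    using me c' i a ea \<mu> by (simp add: d_s)
  also have "\<dots> = (\<Oplus>\<^bsub>G\<^esub>f\<in>c - {e}. sgp G (pos lt f (c - {e})) (?T1 f) \<ominus>\<^bsub>G\<^esub> sgp G (pos lt f (c - {e})) (?T2 f))"
  proof -
    have c1: "(\<lambda>f. sgp G (pos lt f (c - {e})) (?T1 f)) \<in> c - {e} \<rightarrow> carrier G"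
      and c2: "(\<lambda>f. sgp G (pos lt f (c - {e})) (?T2 f)) \<in> c - {e} \<rightarrow> carrier G"
      using cl by (auto intro: K.G.D.sgp_closed)
    have inv: "abelian_group_hom G G (\<lambda>x. \<ominus>\<^bsub>G\<^esub> x)"
      using K.G.D.sgp_hom[of 1] by (simp add: sgp_def[abs_def])
    show ?thesis unfolding a_minus_def
      using abelian_group_hom.hom_finsum[OF inv c2] K.G.D.finsum_addf[OF c1, of "\<lambda>f. \<ominus>\<^bsub>G\<^esub> sgp G (pos lt f (c - {e})) (?T2 f)"] c2
      by (simp add: Pi_iff)
  qed
  also have "\<dots> = (\<Oplus>\<^bsub>G\<^esub>f\<in>c - {e}. sgp G (pos lt f (c - {e})) (?T1 f \<ominus>\<^bsub>G\<^esub> ?T2 f))"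
    using cl by (intro K.G.D.finsum_cong') (auto intro!: K.G.D.sgp_closed simp: abelian_group_hom.hom_minus[OF K.G.D.sgp_hom])
  finally show ?thesis .
qed

text \<open>The double face at \<open>e\<close> and \<open>f\<close> does not depend on the order,
  as the two generators commute, while its sign changes with the order by
  \<open>pos_parity\<close>.\<close>

lemma d_d:
  assumes "f \<in> carrier G" shows "d (d f) = \<zero>\<^bsub>G\<^esub>"
  using assms
proof (induction rule: G_induct)
  case zero
  then show ?case by (simp add: abelian_group_hom.hom_zero[OF d_hom])
next
  case (add f g)
  then show ?case by (simp add: abelian_group_hom.hom_add[OF d_hom] abelian_group_hom.hom_closed[OF d_hom])
next
  case (s \<mu> c i a)
  define V where "V e f = \<tau> f (\<mu> \<otimes>\<^bsub>Mo\<^esub> cls [e]) (c - {e}) i a \<ominus>\<^bsub>G\<^esub> \<tau> f \<mu> (c - {e}) (i + 1) (ev e a)" for e f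
  define U where "U e f = sgp G (pos lt e c + pos lt f (c - {e})) (V e f)" for e f
  have Vc: "V e f \<in> carrier G" if "e \<in> c" "f \<in> c" "e \<noteq> f" for e f
    unfolding V_def using s that by (intro K.G.D.minus_closed \<tau>_closed clique_Diff ev_gr) (auto intro: gen_closed clique_E)
  \<comment> \<open>\<open>U\<close> without its diagonal, whose terms do not occur in the sum but
    have to lie in the group for \<open>finsum_antisym\<close>.\<close>
  define W where "W e f = (if e = f then \<zero>\<^bsub>G\<^esub> else U e f)" for e f
  have Wc: "W e f \<in> carrier G" if "e \<in> c" "f \<in> c" for e f
    using that Vc[of e f] by (cases "e = f") (simp_all add: W_def U_def K.G.D.sgp_closed)
  have "d (d (s \<mu> c i a)) = d (\<Oplus>\<^bsub>G\<^esub>e\<in>c. sgp G (pos lt e c) (\<tau> e \<mu> c i a))" using s by (simp add: d_s)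
  also have "\<dots> = (\<Oplus>\<^bsub>G\<^esub>e\<in>c. d (sgp G (pos lt e c) (\<tau> e \<mu> c i a)))"
    using s by (intro abelian_group_hom.hom_finsum[OF d_hom]) (auto intro!: K.G.D.sgp_closed \<tau>_closed)
  also have "\<dots> = (\<Oplus>\<^bsub>G\<^esub>e\<in>c. \<Oplus>\<^bsub>G\<^esub>f\<in>c - {e}. U e f)"
  proof (intro K.G.D.finsum_cong')
    show "(\<lambda>e. \<Oplus>\<^bsub>G\<^esub>f\<in>c - {e}. U e f) \<in> c \<rightarrow> carrier G"
      by (auto simp: U_def intro!: K.G.D.finsum_closed K.G.D.sgp_closed Vc)
    fix e assume e: "e \<in> c"
    have "d (sgp G (pos lt e c) (\<tau> e \<mu> c i a)) = sgp G (pos lt e c) (\<Oplus>\<^bsub>G\<^esub>f\<in>c - {e}. sgp G (pos lt f (c - {e})) (V e f))"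
      using s e by (simp add: abelian_group_hom.hom_sgp[OF d_hom] \<tau>_closed d_\<tau> V_def)
    also have "\<dots> = (\<Oplus>\<^bsub>G\<^esub>f\<in>c - {e}. sgp G (pos lt e c) (sgp G (pos lt f (c - {e})) (V e f)))"
      using e by (intro abelian_group_hom.hom_finsum[OF K.G.D.sgp_hom]) (auto intro!: K.G.D.sgp_closed Vc)
    also have "\<dots> = (\<Oplus>\<^bsub>G\<^esub>f\<in>c - {e}. U e f)"
      using e by (intro K.G.D.finsum_cong') (auto simp: U_def K.G.D.sgp_sgp Vc intro!: K.G.D.sgp_closed Vc)
    finally show "d (sgp G (pos lt e c) (\<tau> e \<mu> c i a)) = (\<Oplus>\<^bsub>G\<^esub>f\<in>c - {e}. U e f)" .
  qed auto
  also have "\<dots> = (\<Oplus>\<^bsub>G\<^esub>e\<in>c. \<Oplus>\<^bsub>G\<^esub>f\<in>c - {e}. W e f)"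
  proof (intro K.G.D.finsum_cong' refl funcsetI K.G.D.finsum_closed Wc)
    show "U e f = W e f" if "f \<in> c - {e}" for e f using that by (auto simp: W_def)
  qed auto
  also have "\<dots> = \<zero>\<^bsub>G\<^esub>"
  proof (rule K.G.D.finsum_antisym)
    show "finite c" using s by (simp add: clique_finite)
    show "W e f \<in> carrier G" if "e \<in> c" "f \<in> c" for e f
      using that by (rule Wc)
    fix e f assume ef: "e \<in> c" "f \<in> c" "e \<noteq> f"
    have efE: "e \<in> E" "f \<in> E" using ef s clique_E by auto
    have efI: "(e, f) \<in> I" using ef s by (auto simp: clique_def mutually_commuting_def)
    have cc: "c - {e} - {f} = c - {f} - {e}" by auto
    have mc: "\<mu> \<otimes>\<^bsub>Mo\<^esub> cls [e] \<otimes>\<^bsub>Mo\<^esub> cls [f] = \<mu> \<otimes>\<^bsub>Mo\<^esub> cls [f] \<otimes>\<^bsub>Mo\<^esub> cls [e]"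
      using s efE cls_comm[OF efI] by (simp add: Mo.m_assoc gen_closed)
    have cl: "clique (c - {f} - {e})" using s by (intro clique_Diff)
    have k: "k0 \<le> i" "k0 \<le> i + 1" "k0 \<le> i + 1 + 1" using s(3) by auto
    \<comment> \<open>Four terms on each side, for \<open>e\<close> and \<open>f\<close> each going
      to \<mu> or to a; the two mixed ones trade places.\<close>
    have "V e f = V f e" unfolding V_def \<tau>_def cc mc ev_comm[OF efI s(4)]
      by (rule K.G.D.minus_minus_minus; intro s_closed Mo.m_closed gen_closed ev_gr efE cl s(1,4) k)
    moreover have "odd (pos lt e c + pos lt f (c - {e}) + (pos lt f c + pos lt e (c - {f})))"
      using pos_parity[OF clique_finite[OF s(2)] ef lt[OF ef(3)]] .
    ultimately show "W e f = \<ominus>\<^bsub>G\<^esub> W f e"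
      using ef Vc[of f e] by (auto simp: W_def U_def sgp_def)
  qed
  finally show ?case .
qed

text \<open>Already each face is mapped to zero: both of its terms carry the same set, and if that
  is empty the difference is (\<mu> e) a - \<mu> (e a).\<close>

lemma eps_d:
  assumes "f \<in> carrier G" shows "eps (d f) = \<zero>\<^bsub>A\<^esub>"
  using assms
proof (induction rule: G_induct)
  case zero
  then show ?case by (simp add: abelian_group_hom.hom_zero[OF d_hom] abelian_group_hom.hom_zero[OF eps_hom])
next
  case (add f g)
  then show ?case by (simp add: abelian_group_hom.hom_add[OF d_hom] abelian_group_hom.hom_add[OF eps_hom] abelian_group_hom.hom_closed[OF d_hom])
next
  case (s \<mu> c i a)
  have z: "eps (\<tau> e \<mu> c i a) = \<zero>\<^bsub>A\<^esub>" if e: "e \<in> c" for e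
  proof -
    have eE: "e \<in> E" using e s clique_E by auto
    have c': "clique (c - {e})" using s by (intro clique_Diff)
    have aA: "a \<in> carrier A" using s gA.gr_sub by auto
    have me: "\<mu> \<otimes>\<^bsub>Mo\<^esub> cls [e] \<in> carrier Mo" using s eE by (simp add: gen_closed)
    have ea: "ev e a \<in> Agr (i + 1)" using eE s by (intro ev_gr)
    have "eps (\<tau> e \<mu> c i a) = eps (s (\<mu> \<otimes>\<^bsub>Mo\<^esub> cls [e]) (c - {e}) i a) \<ominus>\<^bsub>A\<^esub> eps (s \<mu> (c - {e}) (i + 1) (ev e a))"
      unfolding \<tau>_def by (rule abelian_group_hom.hom_minus[OF eps_hom]) (use s me c' ea in \<open>auto intro!: s_closed\<close>)
    also have "\<dots> = \<zero>\<^bsub>A\<^esub>"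
    proof -
      have "sgl \<mu> \<one>\<^bsub>R\<^esub> \<odot>\<^bsub>A\<^esub> ev e a = sgl (\<mu> \<otimes>\<^bsub>Mo\<^esub> cls [e]) \<one>\<^bsub>R\<^esub> \<odot>\<^bsub>A\<^esub> a"
        using s eE aA by (simp add: ev_def A.smult_assoc1[symmetric] sgl_closed gen_closed sgl_mult)
      then show ?thesis using s me c' ea aA
        by (simp add: eps_s A.smult_closed sgl_closed A.M.minus_eq_zero_iff)
    qed
    finally show ?thesis .
  qed
  have z': "eps (sgp G (pos lt e c) (\<tau> e \<mu> c i a)) = \<zero>\<^bsub>A\<^esub>" if "e \<in> c" for e
    unfolding abelian_group_hom.hom_sgp[OF eps_hom \<tau>_closed[OF s(1-3) that s(4)]] z[OF that] by (simp add: sgp_def)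
  have "eps (d (s \<mu> c i a)) = eps (\<Oplus>\<^bsub>G\<^esub>e\<in>c. sgp G (pos lt e c) (\<tau> e \<mu> c i a))" using s by (simp add: d_s)
  also have "\<dots> = (\<Oplus>\<^bsub>A\<^esub>e\<in>c. eps (sgp G (pos lt e c) (\<tau> e \<mu> c i a)))"
    using s by (intro abelian_group_hom.hom_finsum[OF eps_hom]) (auto intro!: K.G.D.sgp_closed \<tau>_closed)
  also have "\<dots> = (\<Oplus>\<^bsub>A\<^esub>e\<in>c. \<zero>\<^bsub>A\<^esub>)"
    by (intro A.M.finsum_cong') (simp_all add: z')
  finally show ?case by simp
qed

end

lemma abelian_group_hom_cong:
  assumes h: "abelian_group_hom G H h" and G: "carrier G = carrier G'" "add G = add G'" "ring.zero G = ring.zero G'"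
    and H: "carrier H = carrier H'" "add H = add H'" "ring.zero H = ring.zero H'"
  shows "abelian_group_hom G' H' h"
proof -
  interpret h: abelian_group_hom G H h by fact
  show ?thesis
    using h.hom_closed h.hom_add
    by (intro abelian_group_homI' abelian_group_cong[OF h.G.abelian_group_axioms G] abelian_group_cong[OF h.H.abelian_group_axioms H])
      (simp_all add: G H)
qed

context abelian_group
begin

lemma minus_minus_cancel:
  assumes "x \<in> carrier G" "y \<in> carrier G" shows "(x \<ominus> y) \<ominus> x = \<ominus> y"
proof -
  have "(x \<ominus> y) \<ominus> x = (\<ominus> y \<oplus> x) \<ominus> x" using assms by (simp add: a_minus_def a_comm)
  also have "\<dots> = \<ominus> y \<oplus> (x \<oplus> \<ominus> x)" using assms by (simp add: a_minus_def a_assoc)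
  finally show ?thesis using assms by (simp add: r_neg)
qed

lemma minus_zero_right: "x \<in> carrier G \<Longrightarrow> x \<ominus> \<zero> = x"
  using minus_add_cancel[of x \<zero>] by simp

end

section \<open>Weight, degree in the complex, and exactness\<close>

context koszul
begin

text \<open>The bound is strict: \<open>W 0\<close> is zero, and \<open>W 1\<close> is the part of
  weight zero, supported where \<mu> is the unit and c is empty. The descent ends there.\<close>

definition W :: "nat \<Rightarrow> ('e list set \<times> 'e set \<times> int \<Rightarrow> 'a) set" where
  "W w = K.G.fs {x. fpc_length (fst x) + card (fst (snd x)) < w}"

definition Y :: "nat \<Rightarrow> ('e list set \<times> 'e set \<times> int \<Rightarrow> 'a) set" where
  "Y p = K.G.fs {x. card (fst (snd x)) = p}"

lemma s_fs: "\<mu> \<in> carrier Mo \<Longrightarrow> clique c \<Longrightarrow> k0 \<le> i \<Longrightarrow> a \<in> Agr i \<Longrightarrow> (\<mu>, c, i) \<in> Z \<Longrightarrow> s \<mu> c i a \<in> K.G.fs Z"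
  unfolding s_def by (rule K.G.fs_sing) (auto simp: J_def N_simps)

lemma fs_induct_s [consumes 1, case_names zero s add]:
  assumes "f \<in> K.G.fs Z" "P \<zero>\<^bsub>G\<^esub>"
    and "\<And>\<mu> c i a. \<mu> \<in> carrier Mo \<Longrightarrow> clique c \<Longrightarrow> k0 \<le> i \<Longrightarrow> a \<in> Agr i \<Longrightarrow> (\<mu>, c, i) \<in> Z \<Longrightarrow> P (s \<mu> c i a)"
    and "\<And>f g. f \<in> K.G.fs Z \<Longrightarrow> g \<in> K.G.fs Z \<Longrightarrow> P f \<Longrightarrow> P g \<Longrightarrow> P (f \<oplus>\<^bsub>G\<^esub> g)"
  shows "P f"
  using assms(1)
proof (induction rule: K.G.fs_induct)
  case (sing x a)
  obtain \<mu> c i where [simp]: "x = (\<mu>, c, i)" by (cases x) auto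
  show ?case using assms(3)[of \<mu> c i a] sing by (simp add: J_def N_simps s_def)
qed (use assms in auto)

lemma hom_into:
  assumes k: "abelian_group_hom G H k" and V: "\<zero>\<^bsub>H\<^esub> \<in> V" "\<And>a b. a \<in> V \<Longrightarrow> b \<in> V \<Longrightarrow> a \<oplus>\<^bsub>H\<^esub> b \<in> V"
    and g: "\<And>\<mu> c i a. \<mu> \<in> carrier Mo \<Longrightarrow> clique c \<Longrightarrow> k0 \<le> i \<Longrightarrow> a \<in> Agr i \<Longrightarrow> (\<mu>, c, i) \<in> Z \<Longrightarrow> k (s \<mu> c i a) \<in> V"
    and f: "f \<in> K.G.fs Z"
  shows "k f \<in> V"
  using f
proof (induction rule: fs_induct_s)
  case zero
  then show ?case using V by (simp add: abelian_group_hom.hom_zero[OF k])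
next
  case (s \<mu> c i a)
  then show ?case by (rule g)
next
  case (add f g)
  then show ?case using V by (simp add: abelian_group_hom.hom_add[OF k] K.G.fs_carrier)
qed

lemma d_into:
  assumes g: "\<And>\<mu> c i a e. \<mu> \<in> carrier Mo \<Longrightarrow> clique c \<Longrightarrow> k0 \<le> i \<Longrightarrow> a \<in> Agr i \<Longrightarrow> (\<mu>, c, i) \<in> Z \<Longrightarrow> e \<in> c \<Longrightarrow>
      (\<mu> \<otimes>\<^bsub>Mo\<^esub> cls [e], c - {e}, i) \<in> Z' \<and> (\<mu>, c - {e}, i + 1) \<in> Z'"
    and f: "f \<in> K.G.fs Z"
  shows "d f \<in> K.G.fs Z'"
proof (rule hom_into[OF d_hom K.G.fs_zero K.G.fs_add _ f])
  fix \<mu> c i a assume *: "\<mu> \<in> carrier Mo" "clique c" "k0 \<le> i" "a \<in> Agr i" "(\<mu>, c, i) \<in> Z"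
  show "d (s \<mu> c i a) \<in> K.G.fs Z'"
    unfolding d_s[OF *(1-4)]
  proof (intro K.G.fs_finsum K.G.fs_sgp)
    fix e assume e: "e \<in> c"
    then have eE: "e \<in> E" using *(2) clique_E by blast
    show "\<tau> e \<mu> c i a \<in> K.G.fs Z'" unfolding \<tau>_def
      using g[OF * e] * eE ev_gr[OF eE *(4)]
      by (intro K.G.fs_minus s_fs clique_Diff) (auto simp: gen_closed)
  qed
qed

lemma card_Diff_e: "clique c \<Longrightarrow> e \<in> c \<Longrightarrow> Suc (card (c - {e})) = card c"
  using card.remove[of c e] by (simp add: clique_finite)

lemma len_gen: "\<mu> \<in> carrier Mo \<Longrightarrow> e \<in> E \<Longrightarrow> fpc_length (\<mu> \<otimes>\<^bsub>Mo\<^esub> cls [e]) = Suc (fpc_length \<mu>)"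
  by (simp add: fpc_length_mult gen_closed fpc_length_gen)

lemma d_W: assumes "f \<in> W w" shows "d f \<in> W w"
  using assms unfolding W_def
proof (rule d_into[rotated], goal_cases)
  case (1 \<mu> c i a e)
  then show ?case using card_Diff_e[of c e] len_gen[of \<mu> e] clique_E[of c e] by simp
qed

lemma d_Y: assumes "f \<in> Y (Suc p)" shows "d f \<in> Y p"
  using assms unfolding Y_def
proof (rule d_into[rotated], goal_cases)
  case (1 \<mu> c i a e)
  then show ?case using card_Diff_e[of c e] by simp
qed

lemma d_Y0: assumes "f \<in> Y 0" shows "d f = \<zero>\<^bsub>G\<^esub>"
proof -
  have "d f \<in> {\<zero>\<^bsub>G\<^esub>}"
    using assms unfolding Y_def by (rule hom_into[OF d_hom, rotated 3]) (auto simp: d_s clique_finite)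
  then show ?thesis by simp
qed

lemma Igr_fs: "K.Igr k = K.G.fs {x. int (fpc_length (fst x)) + dg (snd x) = k}"
  by (auto simp: K.Igr_def K.G.dgr_def K.G.fs_def)

lemma d_gr: assumes "f \<in> K.Igr k" shows "d f \<in> K.Igr k"
  using assms unfolding Igr_fs
proof (rule d_into[rotated], goal_cases)
  case (1 \<mu> c i a e)
  then show ?case using card_Diff_e[of c e] len_gen[of \<mu> e] clique_E[of c e] by (simp add: dg_def)
qed

lemma eps_gr: assumes "f \<in> K.Igr k" shows "eps f \<in> Agr k"
  using assms unfolding Igr_fs
  by (rule hom_into[OF eps_hom, rotated 3]) (auto simp: eps_s gA.gr_zero gA.gr_add dg_def intro!: smult_gr)

lemma h_into:
  assumes g: "\<And>\<mu> c i e \<kappa>. clique (insert e c) \<Longrightarrow> \<kappa> \<in> carrier Mo \<Longrightarrow> e \<in> E \<Longrightarrow> e \<notin> c \<Longrightarrow> \<mu> = \<kappa> \<otimes>\<^bsub>Mo\<^esub> cls [e] \<Longrightarrow>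
      (\<mu>, c, i) \<in> Z \<Longrightarrow> (\<kappa>, insert e c, i) \<in> Z'"
    and f: "f \<in> K.G.fs Z"
  shows "h f \<in> K.G.fs Z'"
proof (rule hom_into[OF h_hom K.G.fs_zero K.G.fs_add _ f])
  fix \<mu> c i a assume *: "\<mu> \<in> carrier Mo" "clique c" "k0 \<le> i" "a \<in> Agr i" "(\<mu>, c, i) \<in> Z"
  let ?e = "rdiv (cprod c \<mu>)"
  show "h (s \<mu> c i a) \<in> K.G.fs Z'"
  proof (cases "cprod c \<mu> = \<one>\<^bsub>Mo\<^esub> \<or> ?e \<in> c")
    case True
    then have "h (s \<mu> c i a) = \<zero>\<^bsub>G\<^esub>" using * by (auto simp: h_s hgen_def Let_def)
    then show ?thesis by (simp add: K.G.fs_zero)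
  next
    case False
    then have nu: "cprod c \<mu> \<noteq> \<one>\<^bsub>Mo\<^esub>" "?e \<notin> c" by auto
    note r = rdiv_new[OF *(1,2) nu]
    have "h (s \<mu> c i a) = sgp G (pos lt ?e (insert ?e c)) (s (rquot \<mu> ?e) (insert ?e c) i a)"
      using * False by (simp add: h_s hgen_def Let_def)
    moreover have "s (rquot \<mu> ?e) (insert ?e c) i a \<in> K.G.fs Z'"
      by (rule s_fs[OF r(3,2) *(3,4) g[OF r(2,3,1) nu(2) r(4) *(5)]])
    ultimately show ?thesis by (simp add: K.G.fs_sgp)
  qed
qed

lemma h_W: assumes "f \<in> W w" shows "h f \<in> W w"
  using assms unfolding W_def
proof (rule h_into[rotated], goal_cases)
  case (1 \<mu> c i e \<kappa>)
  then show ?case using len_gen[of \<kappa> e] clique_finite[OF 1(1)] by simp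
qed

lemma h_Y: assumes "f \<in> Y p" shows "h f \<in> Y (Suc p)"
  using assms unfolding Y_def
proof (rule h_into[rotated], goal_cases)
  case (1 \<mu> c i e \<kappa>)
  then show ?case using clique_finite[OF 1(1)] by simp
qed

subsection \<open>The contracting homotopy modulo terms of lower weight\<close>

definition eqv :: "nat \<Rightarrow> ('e list set \<times> 'e set \<times> int \<Rightarrow> 'a) \<Rightarrow> ('e list set \<times> 'e set \<times> int \<Rightarrow> 'a) \<Rightarrow> bool" where
  "eqv w f g \<longleftrightarrow> f \<in> carrier G \<and> g \<in> carrier G \<and> f \<ominus>\<^bsub>G\<^esub> g \<in> W w"

lemma W_zero: "\<zero>\<^bsub>G\<^esub> \<in> W w" and W_add: "f \<in> W w \<Longrightarrow> g \<in> W w \<Longrightarrow> f \<oplus>\<^bsub>G\<^esub> g \<in> W w"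
  and W_minus: "f \<in> W w \<Longrightarrow> g \<in> W w \<Longrightarrow> f \<ominus>\<^bsub>G\<^esub> g \<in> W w" and W_sgp: "f \<in> W w \<Longrightarrow> sgp G n f \<in> W w"
  and W_carrier: "f \<in> W w \<Longrightarrow> f \<in> carrier G"
  unfolding W_def by (fact K.G.fs_zero K.G.fs_add K.G.fs_minus K.G.fs_sgp K.G.fs_carrier)+

lemma eqv_add: "eqv w f g \<Longrightarrow> eqv w f' g' \<Longrightarrow> eqv w (f \<oplus>\<^bsub>G\<^esub> f') (g \<oplus>\<^bsub>G\<^esub> g')"
  by (simp add: eqv_def K.G.D.add_minus_add W_add)

lemma eqv_sgp: "eqv w f g \<Longrightarrow> eqv w (sgp G n f) (sgp G n g)"
  by (simp add: eqv_def K.G.D.sgp_closed abelian_group_hom.hom_minus[OF K.G.D.sgp_hom, symmetric] W_sgp)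

lemma eqv_h: "eqv w f g \<Longrightarrow> eqv w (h f) (h g)"
  by (simp add: eqv_def abelian_group_hom.hom_closed[OF h_hom] abelian_group_hom.hom_minus[OF h_hom, symmetric] h_W)

lemma eqv_refl: "f \<in> carrier G \<Longrightarrow> eqv w f f"
  by (simp add: eqv_def a_minus_def K.G.D.r_neg W_zero)

lemma eqv_finsum:
  assumes "\<And>i. i \<in> B \<Longrightarrow> eqv w (f i) (g i)"
  shows "eqv w (finsum G f B) (finsum G g B)"
  using assms
proof (induction B rule: infinite_finite_induct)
  case (insert x F)
  then have "\<And>i. i \<in> insert x F \<Longrightarrow> f i \<in> carrier G" "\<And>i. i \<in> insert x F \<Longrightarrow> g i \<in> carrier G"
    by (auto simp: eqv_def)
  then have "finsum G f (insert x F) = f x \<oplus>\<^bsub>G\<^esub> finsum G f F" "finsum G g (insert x F) = g x \<oplus>\<^bsub>G\<^esub> finsum G g F"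
    using insert(1,2) by (auto intro!: K.G.D.finsum_insert)
  then show ?case using insert by (simp add: eqv_add)
qed (simp_all add: eqv_refl)

text \<open>Modulo lower weight the term with the action on A disappears, and the differential only
  multiplies letters of c into \<mu>.\<close>

lemma eqv_\<tau>:
  assumes *: "\<mu> \<in> carrier Mo" "clique c" "k0 \<le> i" "a \<in> Agr i" "e \<in> c" and w: "fpc_length \<mu> + card c \<le> w"
  shows "eqv w (\<tau> e \<mu> c i a) (s (\<mu> \<otimes>\<^bsub>Mo\<^esub> cls [e]) (c - {e}) i a)"
proof -
  have eE: "e \<in> E" using * clique_E by blast
  let ?u = "s (\<mu> \<otimes>\<^bsub>Mo\<^esub> cls [e]) (c - {e}) i a" and ?v = "s \<mu> (c - {e}) (i + 1) (ev e a)"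
  have u: "?u \<in> carrier G" using * eE by (intro s_closed clique_Diff) (auto simp: gen_closed)
  have v: "?v \<in> W w" unfolding W_def
    using * eE w card_Diff_e[OF *(2,5)] by (intro s_fs clique_Diff ev_gr) auto
  have vc: "?v \<in> carrier G" by (rule W_carrier[OF v])
  have "(?u \<ominus>\<^bsub>G\<^esub> ?v) \<ominus>\<^bsub>G\<^esub> ?u = \<zero>\<^bsub>G\<^esub> \<ominus>\<^bsub>G\<^esub> ?v"
    using K.G.D.minus_minus_cancel[OF u vc] vc by (simp add: a_minus_def)
  then show ?thesis unfolding eqv_def \<tau>_def using u v vc W_minus[OF W_zero v] by simp
qed

lemma eqv_d_s:
  assumes *: "\<mu> \<in> carrier Mo" "clique c" "k0 \<le> i" "a \<in> Agr i" and w: "fpc_length \<mu> + card c \<le> w"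
  shows "eqv w (d (s \<mu> c i a)) (\<Oplus>\<^bsub>G\<^esub>e\<in>c. sgp G (pos lt e c) (s (\<mu> \<otimes>\<^bsub>Mo\<^esub> cls [e]) (c - {e}) i a))"
  unfolding d_s[OF *] by (intro eqv_finsum eqv_sgp eqv_\<tau> * w)

text \<open>Let e be the divisor chosen for the product of \<mu> and c. If e lies in c, then h kills
  the element, and h d returns it through the face at e. Otherwise d h returns it through that face
  of the enlarged clique, and the remaining faces cancel those of h d.\<close>

lemma hd_dh_s:
  assumes *: "\<mu> \<in> carrier Mo" "clique c" "k0 \<le> i" "a \<in> Agr i" and w: "fpc_length \<mu> + card c = w" "w \<noteq> 0"
  shows "eqv w (d (h (s \<mu> c i a)) \<oplus>\<^bsub>G\<^esub> h (d (s \<mu> c i a))) (s \<mu> c i a)"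
proof -
  let ?\<nu> = "cprod c \<mu>" and ?e = "rdiv (cprod c \<mu>)"
  have sc: "s \<mu> c i a \<in> carrier G" by (rule s_closed[OF *])
  have \<nu>: "?\<nu> \<in> carrier Mo" "fpc_length ?\<nu> = w" using cprod_closed[OF *(2,1)] w by auto
  \<comment> \<open>In weight zero the product is the unit, which has no divisor to move; hence the
    assumption on \<open>w\<close>.\<close>
  then have \<nu>1: "?\<nu> \<noteq> \<one>\<^bsub>Mo\<^esub>" using w by (auto simp: fpc_length_one)
  have cE: "e \<in> E" if "e \<in> c" for e using * clique_E that by blast
  have me: "\<mu> \<otimes>\<^bsub>Mo\<^esub> cls [e] \<in> carrier Mo" if "e \<in> c" for e using * cE[OF that] by (simp add: gen_closed)
  have sec: "s (\<mu> \<otimes>\<^bsub>Mo\<^esub> cls [e]) (c - {e}) i a \<in> carrier G" if "e \<in> c" for e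
    by (rule s_closed[OF me[OF that] clique_Diff[OF *(2)] *(3,4)])
  \<comment> \<open>All leading faces have the product of the original element, so \<open>h\<close>
    uses the same divisor \<open>?e\<close> on each of them.\<close>
  have cp: "cprod (c - {e}) (\<mu> \<otimes>\<^bsub>Mo\<^esub> cls [e]) = ?\<nu>" if "e \<in> c" for e
    using cprod_insert(2)[of e "c - {e}" \<mu>] * that by (simp add: insert_absorb)
  have hs: "h (s (\<mu> \<otimes>\<^bsub>Mo\<^esub> cls [e]) (c - {e}) i a) = (if ?e \<in> c - {e} then \<zero>\<^bsub>G\<^esub> else
     sgp G (pos lt ?e (insert ?e (c - {e}))) (s (rquot (\<mu> \<otimes>\<^bsub>Mo\<^esub> cls [e]) ?e) (insert ?e (c - {e})) i a))" if "e \<in> c" for e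
    using h_s[OF me[OF that] clique_Diff[OF *(2)] *(3,4)] \<nu>1 by (simp add: hgen_def Let_def cp[OF that])
  have hc: "h (s (\<mu> \<otimes>\<^bsub>Mo\<^esub> cls [e]) (c - {e}) i a) \<in> carrier G" if "e \<in> c" for e
    by (rule abelian_group_hom.hom_closed[OF h_hom sec[OF that]])
  have hd: "eqv w (h (d (s \<mu> c i a))) (\<Oplus>\<^bsub>G\<^esub>e\<in>c. sgp G (pos lt e c) (h (s (\<mu> \<otimes>\<^bsub>Mo\<^esub> cls [e]) (c - {e}) i a)))"
  proof -
    have "h (\<Oplus>\<^bsub>G\<^esub>e\<in>c. sgp G (pos lt e c) (s (\<mu> \<otimes>\<^bsub>Mo\<^esub> cls [e]) (c - {e}) i a)) =
       (\<Oplus>\<^bsub>G\<^esub>e\<in>c. h (sgp G (pos lt e c) (s (\<mu> \<otimes>\<^bsub>Mo\<^esub> cls [e]) (c - {e}) i a)))"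
      by (rule abelian_group_hom.hom_finsum[OF h_hom]) (auto intro!: K.G.D.sgp_closed sec)
    also have "\<dots> = (\<Oplus>\<^bsub>G\<^esub>e\<in>c. sgp G (pos lt e c) (h (s (\<mu> \<otimes>\<^bsub>Mo\<^esub> cls [e]) (c - {e}) i a)))"
      by (intro K.G.D.finsum_cong') (auto intro!: K.G.D.sgp_closed hc simp: abelian_group_hom.hom_sgp[OF h_hom sec])
    finally show ?thesis using eqv_h[OF eqv_d_s[OF *, of w]] w by simp
  qed
  show ?thesis
  proof (cases "?e \<in> c")
    \<comment> \<open>A face at another letter still contains \<open>?e\<close> and is killed by
      \<open>h\<close>. The face at \<open>?e\<close> is sent back, and its sign occurs
      twice.\<close>
    case True
    have "h (s \<mu> c i a) = \<zero>\<^bsub>G\<^esub>" using True * by (simp add: h_s hgen_def Let_def)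
    then have dh: "d (h (s \<mu> c i a)) = \<zero>\<^bsub>G\<^esub>" by (simp add: abelian_group_hom.hom_zero[OF d_hom])
    have "(\<Oplus>\<^bsub>G\<^esub>e\<in>c. sgp G (pos lt e c) (h (s (\<mu> \<otimes>\<^bsub>Mo\<^esub> cls [e]) (c - {e}) i a))) =
       (\<Oplus>\<^bsub>G\<^esub>e\<in>c. if ?e = e then s \<mu> c i a else \<zero>\<^bsub>G\<^esub>)"
    proof (intro K.G.D.finsum_cong')
      fix e assume e: "e \<in> c"
      show "sgp G (pos lt e c) (h (s (\<mu> \<otimes>\<^bsub>Mo\<^esub> cls [e]) (c - {e}) i a)) = (if ?e = e then s \<mu> c i a else \<zero>\<^bsub>G\<^esub>)"
      proof (cases "e = ?e")
        case eq: True
        have "rquot (\<mu> \<otimes>\<^bsub>Mo\<^esub> cls [e]) e = \<mu>" by (rule rquot_mult[OF *(1) cE[OF e]])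
        then have "h (s (\<mu> \<otimes>\<^bsub>Mo\<^esub> cls [e]) (c - {e}) i a) = sgp G (pos lt e c) (s \<mu> c i a)"
          using hs[OF e] eq[symmetric] e by (simp add: insert_absorb)
        then show ?thesis using eq sc by (simp add: K.G.D.sgp_sgp) (simp add: sgp_def)
      next
        case False
        then have "h (s (\<mu> \<otimes>\<^bsub>Mo\<^esub> cls [e]) (c - {e}) i a) = \<zero>\<^bsub>G\<^esub>" using hs[OF e] True by simp
        then show ?thesis using False by (simp add: sgp_def)
      qed
    qed (use sc in auto)
    also have "\<dots> = s \<mu> c i a" using True sc clique_finite[OF *(2)] by (intro K.G.D.finsum_singleton) auto
    finally show ?thesis using hd dh by (simp add: eqv_def)
  next
    case False
    note r = rdiv_new[OF *(1,2) \<nu>1 False]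
    define \<kappa> where "\<kappa> = rquot \<mu> ?e"
    define c' where "c' = insert ?e c"
    note r = r[folded \<kappa>_def c'_def]
    have ec': "?e \<in> c'" by (simp add: c'_def)
    have cc': "c' - {?e} = c" using False by (simp add: c'_def)
    have finc: "finite c" by (rule clique_finite[OF *(2)])
    have \<kappa>w: "fpc_length \<kappa> + card c' \<le> w" using r(1,3,4) w False finc len_gen[OF r(3,1)] by (simp add: c'_def)
    have hs0: "h (s \<mu> c i a) = sgp G (pos lt ?e c') (s \<kappa> c' i a)"
      using False \<nu>1 * by (simp add: h_s hgen_def Let_def \<kappa>_def c'_def)
    have ins: "finsum G F c' = F ?e \<oplus>\<^bsub>G\<^esub> finsum G F c" if "F \<in> c' \<rightarrow> carrier G" for F
      unfolding c'_def by (rule K.G.D.finsum_insert) (use that False finc in \<open>auto simp: c'_def\<close>)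
    let ?t = "\<lambda>e. s (\<kappa> \<otimes>\<^bsub>Mo\<^esub> cls [e]) (c' - {e}) i a"
    have tc: "?t e \<in> carrier G" if "e \<in> c'" for e
      using that r(2,3) * clique_E[OF r(2) that] by (intro s_closed clique_Diff) (auto simp: gen_closed)
    have ke: "\<kappa> \<otimes>\<^bsub>Mo\<^esub> cls [?e] = \<mu>" using r(4) by simp
    have 1: "eqv w (d (h (s \<mu> c i a))) (sgp G (pos lt ?e c') (\<Oplus>\<^bsub>G\<^esub>e\<in>c'. sgp G (pos lt e c') (?t e)))"
      unfolding hs0 abelian_group_hom.hom_sgp[OF d_hom s_closed[OF r(3,2) *(3,4)]]
      by (rule eqv_sgp[OF eqv_d_s[OF r(3,2) *(3,4) \<kappa>w]])
    \<comment> \<open>The face of \<open>c'\<close> at \<open>?e\<close> is the given element, its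
      sign being squared; the rest is the sum that has to cancel.\<close>
    have 2: "sgp G (pos lt ?e c') (\<Oplus>\<^bsub>G\<^esub>e\<in>c'. sgp G (pos lt e c') (?t e)) = s \<mu> c i a \<oplus>\<^bsub>G\<^esub> (\<Oplus>\<^bsub>G\<^esub>e\<in>c. sgp G (pos lt ?e c' + pos lt e c') (?t e))"
    proof -
      have "(\<Oplus>\<^bsub>G\<^esub>e\<in>c'. sgp G (pos lt e c') (?t e)) = sgp G (pos lt ?e c') (?t ?e) \<oplus>\<^bsub>G\<^esub> (\<Oplus>\<^bsub>G\<^esub>e\<in>c. sgp G (pos lt e c') (?t e))"
        using ins[of "\<lambda>e. sgp G (pos lt e c') (?t e)"] tc by (simp add: K.G.D.sgp_closed)
      moreover have "(\<Oplus>\<^bsub>G\<^esub>e\<in>c. sgp G (pos lt e c') (?t e)) \<in> carrier G"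
        using tc by (intro K.G.D.finsum_closed) (auto simp: c'_def intro!: K.G.D.sgp_closed)
      ultimately have "sgp G (pos lt ?e c') (\<Oplus>\<^bsub>G\<^esub>e\<in>c'. sgp G (pos lt e c') (?t e)) =
        sgp G (pos lt ?e c') (sgp G (pos lt ?e c') (?t ?e)) \<oplus>\<^bsub>G\<^esub> sgp G (pos lt ?e c') (\<Oplus>\<^bsub>G\<^esub>e\<in>c. sgp G (pos lt e c') (?t e))"
        using tc[OF ec'] by (simp add: abelian_group_hom.hom_add[OF K.G.D.sgp_hom] K.G.D.sgp_closed)
      moreover have "sgp G (pos lt ?e c') (sgp G (pos lt ?e c') (?t ?e)) = s \<mu> c i a"
        using tc[OF ec'] by (simp add: K.G.D.sgp_sgp ke cc') (simp add: sgp_def)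
      moreover have "sgp G (pos lt ?e c') (\<Oplus>\<^bsub>G\<^esub>e\<in>c. sgp G (pos lt e c') (?t e)) = (\<Oplus>\<^bsub>G\<^esub>e\<in>c. sgp G (pos lt ?e c' + pos lt e c') (?t e))"
      proof -
        have "sgp G (pos lt ?e c') (\<Oplus>\<^bsub>G\<^esub>e\<in>c. sgp G (pos lt e c') (?t e)) = (\<Oplus>\<^bsub>G\<^esub>e\<in>c. sgp G (pos lt ?e c') (sgp G (pos lt e c') (?t e)))"
          using tc by (intro abelian_group_hom.hom_finsum[OF K.G.D.sgp_hom]) (auto simp: c'_def intro!: K.G.D.sgp_closed)
        also have "\<dots> = (\<Oplus>\<^bsub>G\<^esub>e\<in>c. sgp G (pos lt ?e c' + pos lt e c') (?t e))"
          using tc by (intro K.G.D.finsum_cong') (auto simp: c'_def K.G.D.sgp_sgp intro!: K.G.D.sgp_closed)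
        finally show ?thesis .
      qed
      ultimately show ?thesis by simp
    qed
    have 3: "(\<Oplus>\<^bsub>G\<^esub>e\<in>c. sgp G (pos lt e c) (h (s (\<mu> \<otimes>\<^bsub>Mo\<^esub> cls [e]) (c - {e}) i a))) =
      (\<Oplus>\<^bsub>G\<^esub>e\<in>c. \<ominus>\<^bsub>G\<^esub> sgp G (pos lt ?e c' + pos lt e c') (?t e))"
    proof (intro K.G.D.finsum_cong')
      fix e assume e: "e \<in> c"
      have ee: "e \<noteq> ?e" "e \<in> c'" using e False by (auto simp: c'_def)
      have ins: "insert ?e (c - {e}) = c' - {e}" using ee by (auto simp: c'_def)
      note gc = gen_closed[OF r(1)] gen_closed[OF cE[OF e]]
      \<comment> \<open>With \<kappa> the quotient of \<mu> by \<open>?e\<close>, the product of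
        \<mu> and \<open>e\<close> is \<kappa> times \<open>e\<close> times \<open>?e\<close>;
        dividing by \<open>?e\<close> therefore gives the same monomial as the face of
        \<open>c'\<close> at \<open>e\<close>.\<close>
      have "\<mu> \<otimes>\<^bsub>Mo\<^esub> cls [e] = (\<kappa> \<otimes>\<^bsub>Mo\<^esub> cls [?e]) \<otimes>\<^bsub>Mo\<^esub> cls [e]" by (simp only: ke)
      also have "\<dots> = \<kappa> \<otimes>\<^bsub>Mo\<^esub> (cls [?e] \<otimes>\<^bsub>Mo\<^esub> cls [e])"
        by (rule Mo.m_assoc[OF r(3) gc])
      also have "\<dots> = \<kappa> \<otimes>\<^bsub>Mo\<^esub> cls [e] \<otimes>\<^bsub>Mo\<^esub> cls [?e]"
        using r(3) gc clique_comm[OF r(2) ec' ee(2)] by (simp add: Mo.m_assoc)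
      finally have "rquot (\<mu> \<otimes>\<^bsub>Mo\<^esub> cls [e]) ?e = \<kappa> \<otimes>\<^bsub>Mo\<^esub> cls [e]"
        using rquot_mult[OF _ r(1), of "\<kappa> \<otimes>\<^bsub>Mo\<^esub> cls [e]"] r(3) cE[OF e] by (simp add: gen_closed)
      then have hse: "h (s (\<mu> \<otimes>\<^bsub>Mo\<^esub> cls [e]) (c - {e}) i a) = sgp G (pos lt ?e (c' - {e})) (?t e)"
        using hs[OF e] False ins by simp
      \<comment> \<open>Removing \<open>e\<close> and then inserting \<open>?e\<close> has the
        opposite sign of doing it in the other order, by the parity fact that also gives
        \<open>d_d\<close>.\<close>
      have "odd (pos lt ?e c' + pos lt e (c' - {?e}) + (pos lt e c' + pos lt ?e (c' - {e})))"
        by (rule pos_parity[OF clique_finite[OF r(2)] ec' ee(2) _ lt]) (use ee in auto)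
      then have "odd ((pos lt e c + pos lt ?e (c' - {e})) + (pos lt ?e c' + pos lt e c'))" by (simp add: cc') presburger
      then show "sgp G (pos lt e c) (h (s (\<mu> \<otimes>\<^bsub>Mo\<^esub> cls [e]) (c - {e}) i a)) = \<ominus>\<^bsub>G\<^esub> sgp G (pos lt ?e c' + pos lt e c') (?t e)"
        unfolding hse using tc[OF ee(2)] by (simp add: K.G.D.sgp_sgp) (auto simp: sgp_def)
    qed (use tc in \<open>auto simp: c'_def intro!: K.G.D.sgp_closed K.G.D.a_inv_closed\<close>)
    let ?D = "\<Oplus>\<^bsub>G\<^esub>e\<in>c. sgp G (pos lt ?e c' + pos lt e c') (?t e)"
    have Dc: "(\<lambda>e. sgp G (pos lt ?e c' + pos lt e c') (?t e)) \<in> c \<rightarrow> carrier G"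
      using tc by (auto simp: c'_def intro!: K.G.D.sgp_closed)
    have inv: "abelian_group_hom G G (\<lambda>x. \<ominus>\<^bsub>G\<^esub> x)"
      using K.G.D.sgp_hom[of 1] by (simp add: sgp_def[abs_def])
    have "(\<Oplus>\<^bsub>G\<^esub>e\<in>c. \<ominus>\<^bsub>G\<^esub> sgp G (pos lt ?e c' + pos lt e c') (?t e)) = \<ominus>\<^bsub>G\<^esub> ?D"
      by (rule abelian_group_hom.hom_finsum[OF inv Dc, symmetric])
    then have "eqv w (d (h (s \<mu> c i a)) \<oplus>\<^bsub>G\<^esub> h (d (s \<mu> c i a))) ((s \<mu> c i a \<oplus>\<^bsub>G\<^esub> ?D) \<oplus>\<^bsub>G\<^esub> \<ominus>\<^bsub>G\<^esub> ?D)"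
      using eqv_add[OF 1 hd] by (simp add: 2 3)
    moreover have "(s \<mu> c i a \<oplus>\<^bsub>G\<^esub> ?D) \<oplus>\<^bsub>G\<^esub> \<ominus>\<^bsub>G\<^esub> ?D = s \<mu> c i a"
      using sc K.G.D.finsum_closed[OF Dc] by (simp add: K.G.D.a_assoc K.G.D.r_neg)
    ultimately show ?thesis by simp
  qed
qed

text \<open>By additivity it is enough to treat generators. In weight exactly \<open>w\<close> this
  is \<open>hd_dh_s\<close>.\<close>

lemma hd_dh:
  assumes w: "w \<noteq> 0" and f: "f \<in> W (Suc w)"
  shows "eqv w (d (h f) \<oplus>\<^bsub>G\<^esub> h (d f)) f"
  using f unfolding W_def
proof (induction rule: fs_induct_s)
  case zero
  show ?case by (simp add: abelian_group_hom.hom_zero[OF h_hom] abelian_group_hom.hom_zero[OF d_hom] eqv_refl)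
next
  case (s \<mu> c i a)
  show ?case
  proof (cases "fpc_length \<mu> + card c = w")
    case True
    then show ?thesis using s w by (intro hd_dh_s) auto
  next
    case False
    \<comment> \<open>A generator of smaller weight stays below \<open>w\<close> under
      \<open>d\<close> and \<open>h\<close>, so both sides are congruent to zero.\<close>
    then have sW: "s \<mu> c i a \<in> W w" unfolding W_def using s by (intro s_fs) auto
    then have "d (h (s \<mu> c i a)) \<oplus>\<^bsub>G\<^esub> h (d (s \<mu> c i a)) \<in> W w" by (intro W_add d_W h_W)
    then show ?thesis using sW by (simp add: eqv_def W_minus W_carrier)
  qed
next
  case (add f g)
  note c = add.hyps[THEN K.G.fs_carrier]
  note hc = abelian_group_hom.hom_closed[OF h_hom] and dc = abelian_group_hom.hom_closed[OF d_hom]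
  have "d (h (f \<oplus>\<^bsub>G\<^esub> g)) \<oplus>\<^bsub>G\<^esub> h (d (f \<oplus>\<^bsub>G\<^esub> g)) = (d (h f) \<oplus>\<^bsub>G\<^esub> h (d f)) \<oplus>\<^bsub>G\<^esub> (d (h g) \<oplus>\<^bsub>G\<^esub> h (d g))"
    using c by (simp add: abelian_group_hom.hom_add[OF h_hom] abelian_group_hom.hom_add[OF d_hom] hc dc K.G.D.a_ac)
  then show ?case using eqv_add[OF add.IH] by simp
qed

lemma Y_zero: "\<zero>\<^bsub>G\<^esub> \<in> Y p" and Y_add: "f \<in> Y p \<Longrightarrow> g \<in> Y p \<Longrightarrow> f \<oplus>\<^bsub>G\<^esub> g \<in> Y p"
  and Y_minus: "f \<in> Y p \<Longrightarrow> g \<in> Y p \<Longrightarrow> f \<ominus>\<^bsub>G\<^esub> g \<in> Y p" and Y_carrier: "f \<in> Y p \<Longrightarrow> f \<in> carrier G"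
  unfolding Y_def by (fact K.G.fs_zero K.G.fs_add K.G.fs_minus K.G.fs_carrier)+

text \<open>Subtracting \<open>d (h f)\<close> from a cycle leaves a cycle of lower weight in the
  same degree. Repeating this reaches weight zero, and the terms subtracted add up to one
  boundary.\<close>

lemma cycle_descend:
  assumes "f \<in> W (Suc w)" "f \<in> Y p" "d f = \<zero>\<^bsub>G\<^esub>"
  shows "\<exists>y\<in>Y (Suc p). f \<ominus>\<^bsub>G\<^esub> d y \<in> W 1 \<and> f \<ominus>\<^bsub>G\<^esub> d y \<in> Y p"
  using assms
proof (induction w arbitrary: f)
  case 0
  then show ?case using Y_carrier[OF 0(2)]
    by (intro bexI[OF _ Y_zero]) (simp add: abelian_group_hom.hom_zero[OF d_hom] K.G.D.minus_zero_right)
next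
  case (Suc w)
  have fc: "f \<in> carrier G" by (rule Y_carrier[OF Suc.prems(2)])
  have hc: "h f \<in> carrier G" by (rule abelian_group_hom.hom_closed[OF h_hom fc])
  have dhc: "d (h f) \<in> carrier G" by (rule abelian_group_hom.hom_closed[OF d_hom hc])
  let ?f = "f \<ominus>\<^bsub>G\<^esub> d (h f)"
  \<comment> \<open>On a cycle the summand \<open>h (d f)\<close> of the homotopy formula
    vanishes.\<close>
  have "eqv (Suc w) (d (h f)) f"
    using hd_dh[OF _ Suc.prems(1)] Suc.prems(3) dhc by (simp add: abelian_group_hom.hom_zero[OF h_hom])
  then have "sgp G 1 (d (h f) \<ominus>\<^bsub>G\<^esub> f) \<in> W (Suc w)" unfolding eqv_def by (intro W_sgp) simp
  moreover have "sgp G 1 (d (h f) \<ominus>\<^bsub>G\<^esub> f) = ?f"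
    using fc dhc by (simp add: sgp_def a_minus_def K.G.D.minus_add K.G.D.a_ac)
  ultimately have 1: "?f \<in> W (Suc w)" by simp
  have 2: "?f \<in> Y p" by (intro Y_minus Suc.prems(2) d_Y h_Y)
  have 3: "d ?f = \<zero>\<^bsub>G\<^esub>" using abelian_group_hom.hom_minus[OF d_hom fc dhc] Suc.prems(3) d_d[OF hc] by (simp add: K.G.D.minus_zero_right)
  obtain y where y: "y \<in> Y (Suc p)" "?f \<ominus>\<^bsub>G\<^esub> d y \<in> W 1" "?f \<ominus>\<^bsub>G\<^esub> d y \<in> Y p" using Suc.IH[OF 1 2 3] by auto
  have yc: "y \<in> carrier G" by (rule Y_carrier[OF y(1)])
  have dyc: "d y \<in> carrier G" by (rule abelian_group_hom.hom_closed[OF d_hom yc])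
  have "f \<ominus>\<^bsub>G\<^esub> d (h f \<oplus>\<^bsub>G\<^esub> y) = ?f \<ominus>\<^bsub>G\<^esub> d y"
    using fc dhc dyc hc yc by (simp add: abelian_group_hom.hom_add[OF d_hom] a_minus_def K.G.D.minus_add K.G.D.a_ac)
  then show ?case using y Y_add[OF h_Y[OF Suc.prems(2)] y(1)] by (intro bexI[of _ "h f \<oplus>\<^bsub>G\<^esub> y"]) auto
qed

lemma W_exists: assumes "f \<in> carrier G" shows "\<exists>w. f \<in> W (Suc w)"
proof -
  have "finite ((\<lambda>x. fpc_length (fst x) + card (fst (snd x))) ` dsupp K.N' f)"
    using K.G.dirsumD(4)[OF assms] by simp
  then obtain n where "\<forall>k\<in>(\<lambda>x. fpc_length (fst x) + card (fst (snd x))) ` dsupp K.N' f. k < n"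
    unfolding finite_nat_set_iff_bounded by blast
  then have "f \<in> W (Suc n)" using assms by (auto simp: W_def K.G.fs_def intro: less_SucI)
  then show ?thesis by blast
qed

text \<open>The remainder of the descent has weight zero, whereas its cliques have
  \<open>Suc p\<close> elements; so it is zero.\<close>

lemma exact_pos:
  assumes f: "f \<in> Y (Suc p)" and z: "d f = \<zero>\<^bsub>G\<^esub>" shows "\<exists>y\<in>Y (Suc (Suc p)). f = d y"
proof -
  obtain w where "f \<in> W (Suc w)" using W_exists[OF Y_carrier[OF f]] by blast
  then obtain y where y: "y \<in> Y (Suc (Suc p))" "f \<ominus>\<^bsub>G\<^esub> d y \<in> W 1" "f \<ominus>\<^bsub>G\<^esub> d y \<in> Y (Suc p)"
    using cycle_descend[OF _ f z] by blast
  have "f \<ominus>\<^bsub>G\<^esub> d y \<in> K.G.fs {}"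
  proof -
    have "{x :: 'e list set \<times> 'e set \<times> int. fpc_length (fst x) + card (fst (snd x)) < 1} \<inter> {x. card (fst (snd x)) = Suc p} = {}"
      by auto
    then show ?thesis using K.G.fs_Int[OF y(2)[unfolded W_def] y(3)[unfolded Y_def]] by (simp only:)
  qed
  then have "f \<ominus>\<^bsub>G\<^esub> d y = \<zero>\<^bsub>G\<^esub>" by (rule K.G.fs_empty)
  then show ?thesis using y(1) Y_carrier[OF f] abelian_group_hom.hom_closed[OF d_hom Y_carrier[OF y(1)]]
    by (auto simp: K.G.D.minus_eq_zero_iff)
qed

text \<open>The remainder of the descent is supported at unit monomials with empty cliques, where
  \<open>eps\<close> just adds up values of different degrees and is injective.\<close>

lemma exact_0:
  assumes f: "f \<in> Y 0" and z: "eps f = \<zero>\<^bsub>A\<^esub>" shows "\<exists>y\<in>Y (Suc 0). f = d y"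
proof -
  obtain w where "f \<in> W (Suc w)" using W_exists[OF Y_carrier[OF f]] by blast
  then obtain y where y: "y \<in> Y (Suc 0)" "f \<ominus>\<^bsub>G\<^esub> d y \<in> W 1" "f \<ominus>\<^bsub>G\<^esub> d y \<in> Y 0"
    using cycle_descend[OF _ f d_Y0[OF f]] by blast
  let ?g = "f \<ominus>\<^bsub>G\<^esub> d y"
  have yc: "d y \<in> carrier G" by (rule abelian_group_hom.hom_closed[OF d_hom Y_carrier[OF y(1)]])
  have gc: "?g \<in> carrier G" by (rule Y_carrier[OF y(3)])
  let ?Z = "{x. fpc_length (fst x) + card (fst (snd x)) < 1} \<inter> {x. card (fst (snd x)) = 0}"
  have gZ: "?g \<in> K.G.fs ?Z"
    using K.G.fs_Int[OF y(2)[unfolded W_def] y(3)[unfolded Y_def]] .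
  have len0: "\<mu> = \<one>\<^bsub>Mo\<^esub>" if "\<mu> \<in> carrier Mo" "fpc_length \<mu> = 0" for \<mu>
  proof (rule ccontr)
    assume n1: "\<mu> \<noteq> \<one>\<^bsub>Mo\<^esub>"
    have "\<exists>e\<in>E. \<exists>\<kappa>\<in>carrier Mo. \<mu> = \<kappa> \<otimes>\<^bsub>Mo\<^esub> cls [e]" by (rule generator_factor[OF that(1) n1])
    then show False using len_gen that(2) by auto
  qed
  \<comment> \<open>The homogeneous components of \<open>eps g\<close> are the values of
    \<open>g\<close>, so \<open>eps g\<close> determines \<open>g\<close>.\<close>
  have val: "pA i (eps g) = g (\<one>\<^bsub>Mo\<^esub>, {}, i)" if "g \<in> K.G.fs ?Z" for g i
    using that
  proof (induction rule: fs_induct_s)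
    case zero
    show ?case by (simp add: abelian_group_hom.hom_zero[OF eps_hom] abelian_group_hom.hom_zero[OF gA.p_hom])
      (simp add: dirsum_simps N_simps)
  next
    case (s \<mu> c j a)
    then have "c = {}" "fpc_length \<mu> = 0" using clique_finite by auto
    then have [simp]: "c = {}" "\<mu> = \<one>\<^bsub>Mo\<^esub>" using len0 s by auto
    have "eps (s \<mu> c j a) = a" using s gA.gr_sub[OF s(4)] by (simp add: eps_s sgl_one A.smult_one)
    then show ?case using gA.p_id[OF s(4)] gA.p_other[OF s(4), of i]
      by (auto simp: s_def sing_def N_simps)
  next
    case (add f g)
    note c = add.hyps[THEN K.G.fs_carrier]
    show ?case using add.IH c
      by (simp add: abelian_group_hom.hom_add[OF eps_hom] abelian_group_hom.hom_add[OF gA.p_hom] abelian_group_hom.hom_closed[OF eps_hom])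
        (simp add: dirsum_simps N_simps)
  qed
  have "eps ?g = \<zero>\<^bsub>A\<^esub>"
    using abelian_group_hom.hom_minus[OF eps_hom Y_carrier[OF f] yc] z eps_d[OF Y_carrier[OF y(1)]] by (simp add: a_minus_def)
  then have g0: "?g (\<one>\<^bsub>Mo\<^esub>, {}, i) = \<zero>\<^bsub>A\<^esub>" for i
    using val[OF gZ, of i] by (simp add: abelian_group_hom.hom_zero[OF gA.p_hom])
  have "dsupp K.N' ?g \<subseteq> {}"
  proof
    fix x assume x: "x \<in> dsupp K.N' ?g"
    obtain \<mu> c i where [simp]: "x = (\<mu>, c, i)" by (cases x) auto
    have "(\<mu>, c, i) \<in> K.X" "(\<mu>, c, i) \<in> ?Z" using x gZ K.G.dirsumD(2)[OF gc x] by (auto simp: K.G.fs_def)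
    then have "c = {}" "\<mu> = \<one>\<^bsub>Mo\<^esub>" using clique_finite len0 by (auto simp: J_def)
    then show "x \<in> {}" using x g0[of i] by (simp add: dsupp_def N_simps)
  qed
  then have "?g \<in> K.G.fs {}" using gc by (auto simp: K.G.fs_def)
  then have "?g = \<zero>\<^bsub>G\<^esub>" by (rule K.G.fs_empty)
  then show ?thesis using y(1) Y_carrier[OF f] yc by (auto simp: K.G.D.minus_eq_zero_iff)
qed

end

section \<open>The complex as graded modules, its cycles, and splicing their resolutions\<close>

context koszul
begin

abbreviation "KI \<equiv> K.I"

lemma I_ops: "carrier KI = carrier G" "\<zero>\<^bsub>KI\<^esub> = \<zero>\<^bsub>G\<^esub>" "x \<oplus>\<^bsub>KI\<^esub> y = x \<oplus>\<^bsub>G\<^esub> y"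
  by (simp_all add: K.I_G)

lemma hom_from_I: "abelian_group_hom G H f \<Longrightarrow> abelian_group_hom KI H f"
  by (erule abelian_group_hom_cong) (simp_all add: K.I_G)

lemma hom_I_I: "abelian_group_hom G G f \<Longrightarrow> abelian_group_hom KI KI f"
  by (erule abelian_group_hom_cong) (simp_all add: K.I_G)

lemma smult_G_hom: "t \<in> carrier S \<Longrightarrow> abelian_group_hom G G (\<lambda>f. t \<odot>\<^bsub>KI\<^esub> f)"
  by (rule abelian_group_hom_cong[OF K.smult_I_hom]) (simp_all add: K.I_G)

lemma smult_s:
  assumes "\<alpha> \<in> carrier Mo" "r \<in> carrier R" "\<mu> \<in> carrier Mo" "clique c" "k0 \<le> i" "a \<in> Agr i"
  shows "sgl \<alpha> r \<odot>\<^bsub>KI\<^esub> s \<mu> c i a = s (\<alpha> \<otimes>\<^bsub>Mo\<^esub> \<mu>) c i (sgl \<one>\<^bsub>Mo\<^esub> r \<odot>\<^bsub>A\<^esub> a)"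
  using K.sgl_smult_sing[of \<alpha> r \<mu> "(c, i)" a] assms by (simp add: s_def J_def N_simps)

lemma R_gr: "r \<in> carrier R \<Longrightarrow> a \<in> Agr i \<Longrightarrow> sgl \<one>\<^bsub>Mo\<^esub> r \<odot>\<^bsub>A\<^esub> a \<in> Agr i"
  by (rule smult_gr[OF Mo.one_closed]) (simp_all add: len_one)

lemma ev_R:
  assumes "r \<in> carrier R" "a \<in> Agr i" "e \<in> E"
  shows "ev e (sgl \<one>\<^bsub>Mo\<^esub> r \<odot>\<^bsub>A\<^esub> a) = sgl \<one>\<^bsub>Mo\<^esub> r \<odot>\<^bsub>A\<^esub> ev e a"
  using assms gA.gr_sub[OF assms(2)] by (simp add: ev_def A.smult_assoc1[symmetric] sgl_closed gen_closed sgl_mult)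

lemma smult_\<tau>:
  assumes *: "\<alpha> \<in> carrier Mo" "r \<in> carrier R" "\<mu> \<in> carrier Mo" "clique c" "k0 \<le> i" "a \<in> Agr i" and e: "e \<in> c"
  shows "sgl \<alpha> r \<odot>\<^bsub>KI\<^esub> \<tau> e \<mu> c i a = \<tau> e (\<alpha> \<otimes>\<^bsub>Mo\<^esub> \<mu>) c i (sgl \<one>\<^bsub>Mo\<^esub> r \<odot>\<^bsub>A\<^esub> a)"
proof -
  have eE: "e \<in> E" using * e clique_E by blast
  have me: "\<mu> \<otimes>\<^bsub>Mo\<^esub> cls [e] \<in> carrier Mo" using * eE by (simp add: gen_closed)
  have k: "k0 \<le> i + 1" using * by simp
  note c' = clique_Diff[OF *(4), of "{e}"] and ea = ev_gr[OF eE *(6)]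
  show ?thesis unfolding \<tau>_def
    using abelian_group_hom.hom_minus[OF smult_G_hom[OF sgl_closed[OF *(1,2)]] s_closed[OF me c' *(5,6)] s_closed[OF *(3) c' k ea]]
      smult_s[OF *(1,2) me c' *(5,6)] smult_s[OF *(1,2,3) c' k ea] * eE
    by (simp add: ev_R Mo.m_assoc gen_closed)
qed

lemma mhom_d: "mhom S KI KI d"
proof (rule K.mhom_IndI[OF hom_I_I[OF d_hom] K.left_module_I])
  fix \<alpha> r \<mu> x a assume *: "\<alpha> \<in> carrier Mo" "r \<in> carrier R" "\<mu> \<in> carrier Mo" "x \<in> J" "a \<in> carrier (N x)"
  obtain c i where x: "x = (c, i)" by (cases x)
  have c: "clique c" "k0 \<le> i" "a \<in> Agr i" using * by (auto simp: x J_def N_simps)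
  have am: "\<alpha> \<otimes>\<^bsub>Mo\<^esub> \<mu> \<in> carrier Mo" using * by simp
  have "sgl \<alpha> r \<odot>\<^bsub>KI\<^esub> d (s \<mu> c i a) = (\<Oplus>\<^bsub>G\<^esub>e\<in>c. sgl \<alpha> r \<odot>\<^bsub>KI\<^esub> sgp G (pos lt e c) (\<tau> e \<mu> c i a))"
    unfolding d_s[OF *(3) c] using *(3) c
    by (intro abelian_group_hom.hom_finsum[OF smult_G_hom[OF sgl_closed[OF *(1,2)]]]) (auto intro!: K.G.D.sgp_closed \<tau>_closed)
  also have "\<dots> = (\<Oplus>\<^bsub>G\<^esub>e\<in>c. sgp G (pos lt e c) (\<tau> e (\<alpha> \<otimes>\<^bsub>Mo\<^esub> \<mu>) c i (sgl \<one>\<^bsub>Mo\<^esub> r \<odot>\<^bsub>A\<^esub> a)))"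
  proof (intro K.G.D.finsum_cong')
    fix e assume e: "e \<in> c"
    show "sgl \<alpha> r \<odot>\<^bsub>KI\<^esub> sgp G (pos lt e c) (\<tau> e \<mu> c i a) = sgp G (pos lt e c) (\<tau> e (\<alpha> \<otimes>\<^bsub>Mo\<^esub> \<mu>) c i (sgl \<one>\<^bsub>Mo\<^esub> r \<odot>\<^bsub>A\<^esub> a))"
      unfolding abelian_group_hom.hom_sgp[OF smult_G_hom[OF sgl_closed[OF *(1,2)]] \<tau>_closed[OF *(3) c(1,2) e c(3)]]
        smult_\<tau>[OF *(1-3) c e] ..
  qed (auto intro!: K.G.D.sgp_closed \<tau>_closed am c R_gr *)
  also have "\<dots> = d (s (\<alpha> \<otimes>\<^bsub>Mo\<^esub> \<mu>) c i (sgl \<one>\<^bsub>Mo\<^esub> r \<odot>\<^bsub>A\<^esub> a))"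
    by (rule d_s[OF am c(1,2) R_gr[OF *(2) c(3)], symmetric])
  finally show "d (sing K.N' (\<alpha> \<otimes>\<^bsub>Mo\<^esub> \<mu>, x) (r \<odot>\<^bsub>N x\<^esub> a)) = sgl \<alpha> r \<odot>\<^bsub>KI\<^esub> d (sing K.N' (\<mu>, x) a)"
    by (simp add: x s_def N_simps)
qed

lemma mhom_eps: "mhom S KI A eps"
proof (rule K.mhom_IndI[OF hom_from_I[OF eps_hom] A])
  fix \<alpha> r \<mu> x a assume *: "\<alpha> \<in> carrier Mo" "r \<in> carrier R" "\<mu> \<in> carrier Mo" "x \<in> J" "a \<in> carrier (N x)"
  obtain c i where x: "x = (c, i)" by (cases x)
  have c: "clique c" "k0 \<le> i" "a \<in> Agr i" using * by (auto simp: x J_def N_simps)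
  have am: "\<alpha> \<otimes>\<^bsub>Mo\<^esub> \<mu> \<in> carrier Mo" using * by simp
  have "eps (s (\<alpha> \<otimes>\<^bsub>Mo\<^esub> \<mu>) c i (sgl \<one>\<^bsub>Mo\<^esub> r \<odot>\<^bsub>A\<^esub> a)) = sgl \<alpha> r \<odot>\<^bsub>A\<^esub> eps (s \<mu> c i a)"
    unfolding eps_s[OF *(3) c] eps_s[OF am c(1,2) R_gr[OF *(2) c(3)]]
    using * gA.gr_sub[OF c(3)] by (simp add: A.smult_assoc1[symmetric] sgl_closed sgl_mult A.smult_r_null)
  then show "eps (sing K.N' (\<alpha> \<otimes>\<^bsub>Mo\<^esub> \<mu>, x) (r \<odot>\<^bsub>N x\<^esub> a)) = sgl \<alpha> r \<odot>\<^bsub>A\<^esub> eps (sing K.N' (\<mu>, x) a)"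
    by (simp add: x s_def N_simps)
qed

definition Jp :: "nat \<Rightarrow> ('e set \<times> int) set" where "Jp p = {x \<in> J. card (fst x) = p}"

lemma indp: "ind_module R Mo fpc_length N"
  by (rule K.ind_module_axioms)

lemma Ind_Y: "carrier (Ind R Mo (Jp p) N) = Y p" "\<zero>\<^bsub>Ind R Mo (Jp p) N\<^esub> = \<zero>\<^bsub>KI\<^esub>"
  "f \<oplus>\<^bsub>Ind R Mo (Jp p) N\<^esub> g = f \<oplus>\<^bsub>KI\<^esub> g"
  by (auto simp: Ind_def dirsum_simps Y_def K.G.fs_def Jp_def)

lemma incl_Y: "mhom S (Ind R Mo (Jp p) N) KI (\<lambda>f. f)"
proof -
  interpret Kp: ind_module R Mo fpc_length "Jp p" N dg by (rule indp)
  show ?thesis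
  proof (rule Kp.mhom_IndI[OF _ K.left_module_I])
    show "abelian_group_hom Kp.I KI (\<lambda>f. f)"
      by (rule abelian_group_homI') (auto simp: Kp.I_group K.I_group Ind_Y Y_carrier I_ops)
    show "sing K.N' (\<alpha> \<otimes>\<^bsub>Mo\<^esub> \<beta>, j) (r \<odot>\<^bsub>N j\<^esub> a) = sgl \<alpha> r \<odot>\<^bsub>KI\<^esub> sing K.N' (\<beta>, j) a"
      if "\<alpha> \<in> carrier Mo" "r \<in> carrier R" "\<beta> \<in> carrier Mo" "j \<in> Jp p" "a \<in> carrier (N j)" for \<alpha> r \<beta> j a
      using K.sgl_smult_sing[OF that(1-3) _ that(5)] that(4) by (simp add: Jp_def)
  qed
qed

lemma submod_Y: "submod S KI (Y p)"
proof -
  interpret Kp: left_module S "Ind R Mo (Jp p) N" by (rule mhom_dom[OF incl_Y])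
  show ?thesis unfolding submod_def
    using Y_carrier Y_zero Y_add mhom_smult[OF incl_Y] Kp.smult_closed
    by (auto simp: I_ops Ind_Y)
qed

text \<open>The degree \<open>p\<close> part occurs in two guises: as a submodule of
  \<open>KI\<close>, where \<open>d\<close> and \<open>eps\<close> live, and as a module induced
  over \<open>Jp p\<close>, for which resolutions are available. \<open>Y_iso\<close> is the
  identity map between the two records.\<close>

definition YM :: "nat \<Rightarrow> ('e list set \<Rightarrow> 'r, 'e list set \<times> 'e set \<times> int \<Rightarrow> 'a) module" where
  "YM p = KI\<lparr>carrier := Y p\<rparr>"

definition Ygr :: "nat \<Rightarrow> int \<Rightarrow> ('e list set \<times> 'e set \<times> int \<Rightarrow> 'a) set" where
  "Ygr p k = K.Igr k \<inter> Y p"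

lemma YM_simps: "carrier (YM p) = Y p" "\<zero>\<^bsub>YM p\<^esub> = \<zero>\<^bsub>G\<^esub>"
  by (simp_all add: YM_def K.I_G)

lemma Y_iso: "mhom S (Ind R Mo (Jp p) N) (YM p) (\<lambda>f. f)"
  unfolding YM_def by (rule mhom_into_sub[OF incl_Y submod_Y]) (simp add: Ind_Y)

lemma Ygr_Igr: "ind_module.Igr Mo fpc_length (Jp p) N dg k = Ygr p k"
proof -
  interpret Kp: ind_module R Mo fpc_length "Jp p" N dg by (rule indp)
  show ?thesis using Y_carrier by (auto simp: Kp.Igr_iff K.Igr_iff Ygr_def Ind_Y I_ops)
qed

lemma gmod_Y: "gmod S Sgr (YM p) (Ygr p)"
proof -
  interpret Kp: ind_module R Mo fpc_length "Jp p" N dg by (rule indp)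
  have g: "gmod S Sgr Kp.I (Ygr p)" using Kp.gmod_I by (simp add: Ygr_Igr[abs_def])
  then obtain q where q: "graded_group Kp.I (Ygr p) q" by (auto simp: gmod_def)
  have "graded_group (YM p) (Ygr p) q"
    by (rule graded_group_cong[OF q]) (auto simp: YM_simps Ind_Y YM_def fun_eq_iff K.I_G Kp.I_G dirsum_def)
  moreover have "t \<odot>\<^bsub>YM p\<^esub> x \<in> Ygr p (k + l)" if "t \<in> Sgr k" "x \<in> Ygr p l" for t x k l
  proof -
    have "t \<in> carrier S" "x \<in> carrier Kp.I" using that by (auto simp: Sgr_def Ygr_def Ind_Y)
    then have "t \<odot>\<^bsub>YM p\<^esub> x = t \<odot>\<^bsub>Kp.I\<^esub> x" using mhom_smult[OF Y_iso, of t x p] by simp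
    then show ?thesis using g that by (simp add: gmod_def)
  qed
  ultimately show ?thesis using mhom_cod[OF Y_iso] by (auto simp: gmod_def Sgr_def)
qed

text \<open>The cycles in degree \<open>p\<close>, with \<open>eps\<close> as the differential of degree \<open>0\<close>.\<close>

definition Zc :: "nat \<Rightarrow> ('e list set \<times> 'e set \<times> int \<Rightarrow> 'a) set" where
  "Zc p = (case p of 0 \<Rightarrow> {f \<in> Y 0. eps f = \<zero>\<^bsub>A\<^esub>} | Suc q \<Rightarrow> {f \<in> Y p. d f = \<zero>\<^bsub>G\<^esub>})"

definition ZM :: "nat \<Rightarrow> ('e list set \<Rightarrow> 'r, 'e list set \<times> 'e set \<times> int \<Rightarrow> 'a) module" where
  "ZM p = KI\<lparr>carrier := Zc p\<rparr>"

definition Zgr :: "nat \<Rightarrow> int \<Rightarrow> ('e list set \<times> 'e set \<times> int \<Rightarrow> 'a) set" where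
  "Zgr p k = Ygr p k \<inter> Zc p"

lemma Zgr_eq: "(\<lambda>k. Ygr p k \<inter> Zc p) = Zgr p"
  by (simp add: Zgr_def[abs_def])

lemma Y_eps: "mhom S (YM p) A eps" and Y_d: "mhom S (YM p) KI d"
  unfolding YM_def by (rule mhom_from_sub[OF mhom_eps submod_Y] mhom_from_sub[OF mhom_d submod_Y])+

lemma Zc_0: "Zc 0 = a_kernel (YM 0) A eps" and Zc_Suc: "Zc (Suc p) = a_kernel (YM (Suc p)) KI d"
  by (auto simp: Zc_def a_kernel_def' YM_simps K.I_G)

lemma ZM_kernel_0: "YM 0\<lparr>carrier := a_kernel (YM 0) A eps\<rparr> = ZM 0"
  and ZM_kernel: "YM (Suc p)\<lparr>carrier := Zc (Suc p)\<rparr> = ZM (Suc p)"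
  unfolding ZM_def Zc_0 YM_def by simp_all

lemma gmod_Z: "gmod S Sgr (ZM p) (Zgr p)"
proof (cases p)
  case 0
  have "gmod S Sgr A Agr" using A gA A_smult by (auto simp: gmod_def Sgr_def)
  from gmod_kernel[OF gmod_Y this Y_eps, of 0] show ?thesis
    unfolding 0 Zgr_def[abs_def] ZM_kernel_0[symmetric] Zc_0 by (auto simp: Ygr_def eps_gr)
next
  case (Suc q)
  from gmod_kernel[OF gmod_Y K.gmod_I Y_d, of "Suc q"] show ?thesis
    unfolding Suc Zgr_def[abs_def] ZM_kernel[symmetric] Zc_Suc by (auto simp: Ygr_def d_gr)
qed

lemma Zc_sub: "Zc p \<subseteq> Y p"
  by (auto simp: Zc_def split: nat.splits)

lemma submod_Z: "submod S KI (Zc p)"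
proof -
  have "left_module S (ZM p)" by (rule gmod_left_module[OF gmod_Z])
  then interpret Z: left_module S "ZM p" .
  show ?thesis unfolding submod_def
    using Zc_sub[of p] Y_carrier Z.M.zero_closed Z.M.a_closed Z.smult_closed
    by (auto simp: ZM_def I_ops)
qed

text \<open>Exactness in the form needed for cones: \<open>YM (Suc p)\<close> maps onto the cycles
  of degree \<open>p\<close>, and the kernel is the next module of cycles.\<close>

lemma d_onto_Z:
  shows "mhom S (YM (Suc p)) (ZM p) d" "d ` carrier (YM (Suc p)) = carrier (ZM p)"
    "f \<in> Ygr (Suc p) k \<Longrightarrow> d f \<in> Zgr p k"
proof -
  have dZ: "d f \<in> Zc p" if f: "f \<in> Y (Suc p)" for f
    using d_Y[OF f] d_d[OF Y_carrier[OF f]] eps_d[OF Y_carrier[OF f]] by (auto simp: Zc_def split: nat.splits)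
  show "mhom S (YM (Suc p)) (ZM p) d" unfolding ZM_def
    by (rule mhom_into_sub[OF Y_d submod_Z]) (simp add: YM_simps dZ)
  have "f \<in> d ` Y (Suc p)" if f: "f \<in> Zc p" for f
  proof (cases p)
    case 0
    then show ?thesis using f exact_0[of f] by (auto simp: Zc_def)
  next
    case (Suc q)
    then show ?thesis using f exact_pos[of f q] by (auto simp: Zc_def)
  qed
  then show "d ` carrier (YM (Suc p)) = carrier (ZM p)" using dZ by (auto simp: YM_simps ZM_def)
  show "d f \<in> Zgr p k" if "f \<in> Ygr (Suc p) k"
    using that dZ[of f] d_gr[of f k] Zc_sub[of p] by (auto simp: Zgr_def Ygr_def)
qed

lemma eps_onto: "eps ` carrier (YM 0) = carrier A"
proof
  have e: "mhom S (YM 0) A eps" by (rule Y_eps)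
  show "eps ` carrier (YM 0) \<subseteq> carrier A" using mhom_closed[OF e] by auto
  \<comment> \<open>A homogeneous a is the image of 1 \<otimes> {} \<otimes> a. Below
    \<open>k0\<close> there is no such summand, but there a is zero.\<close>
  have gr: "a \<in> eps ` Y 0" if a: "a \<in> Agr k" for a k
  proof (cases "k < k0")
    case True
    then have "a = eps \<zero>\<^bsub>G\<^esub>" using a below by (simp add: abelian_group_hom.hom_zero[OF eps_hom])
    then show ?thesis using Y_zero by blast
  next
    case False
    have cl: "clique {}" by (simp add: clique_def mutually_commuting_def)
    have "eps (s \<one>\<^bsub>Mo\<^esub> {} k a) = a" using a False cl gA.gr_sub[OF a] by (simp add: eps_s sgl_one A.smult_one)
    moreover have "s \<one>\<^bsub>Mo\<^esub> {} k a \<in> Y 0" unfolding Y_def using a False cl by (intro s_fs) auto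
    ultimately show ?thesis by force
  qed
  have sum: "x \<oplus>\<^bsub>A\<^esub> y \<in> eps ` Y 0" if xy: "x \<in> eps ` Y 0" "y \<in> eps ` Y 0" for x y
  proof -
    obtain f g where "f \<in> Y 0" "x = eps f" "g \<in> Y 0" "y = eps g" using xy by blast
    then have "x \<oplus>\<^bsub>A\<^esub> y = eps (f \<oplus>\<^bsub>G\<^esub> g)" "f \<oplus>\<^bsub>G\<^esub> g \<in> Y 0"
      by (simp_all add: abelian_group_hom.hom_add[OF eps_hom] Y_carrier Y_add)
    then show ?thesis by blast
  qed
  show "carrier A \<subseteq> eps ` carrier (YM 0)"
  proof
    fix a assume a: "a \<in> carrier A"
    have "(\<Oplus>\<^bsub>A\<^esub>k\<in>{k. pA k a \<noteq> \<zero>\<^bsub>A\<^esub>}. pA k a) \<in> eps ` Y 0"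
    proof (rule finsum_rel[where P = "\<lambda>x. x \<in> eps ` Y 0", OF A.M.abelian_group_axioms])
      show "\<zero>\<^bsub>A\<^esub> \<in> eps ` Y 0" using gr[OF gA.gr_zero] .
      show "pA i a \<in> carrier A \<and> pA i a \<in> eps ` Y 0" for i using gr[OF gA.p_gr[OF a]] gA.p_closed[OF a] by blast
    qed (rule sum)
    then show "a \<in> eps ` carrier (YM 0)" using gA.p_sum[OF a] by (simp add: YM_simps)
  qed
qed

text \<open>Descent from \<open>ZM m\<close> to \<open>ZM 0\<close> and finally A, one cone at a
  time: the source of each map is a Koszul term and its kernel is the module of cycles resolved
  before.\<close>

lemma resP_koszul:
  fixes J0 :: "'j set" and \<kappa> \<kappa>' :: "'j \<Rightarrow> 'j"
  assumes hs: "horseshoe S Sgr pS J0 \<kappa> \<kappa>'"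
    and max: "\<And>c. clique c \<Longrightarrow> card c \<le> m"
    and res: "\<And>p. resP S Sgr J0 (Suc n) (Ind R Mo (Jp p) N) (ind_module.Igr Mo fpc_length (Jp p) N dg)"
  shows "resP S Sgr J0 (Suc (n + m)) A Agr"
proof -
  interpret hs: horseshoe S Sgr pS J0 \<kappa> \<kappa>' by (rule hs)
  have gA: "gmod S Sgr A Agr" using A gA A_smult by (auto simp: gmod_def Sgr_def)
  have resY: "resP S Sgr J0 (Suc n) (YM p) (Ygr p)" for p
    by (rule hs.resP_iso[OF res Y_iso[of p]]) (auto simp: bij_betw_def YM_simps Ind_Y Ygr_Igr)
  \<comment> \<open>The allowance at p = m is n, although the module is zero there: a cone needs one
    more free module for the Koszul term than for the kernel, and the Koszul term takes n +
    1.\<close>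
  have resZ: "resP S Sgr J0 (n + (m - p)) (ZM p) (Zgr p)" if "p \<le> m" for p
    using that
  proof (induction "m - p" arbitrary: p)
    case 0
    \<comment> \<open>Here p = m. There is no clique of m + 1 elements, so the complex vanishes in
      degree m + 1, and with it the cycles of degree m, which it maps onto.\<close>
    have "Y (Suc p) = {\<zero>\<^bsub>G\<^esub>}"
    proof -
      have "dsupp K.N' f \<subseteq> {}" if f: "f \<in> Y (Suc p)" for f
      proof
        fix x assume x: "x \<in> dsupp K.N' f"
        obtain \<mu> c i where [simp]: "x = (\<mu>, c, i)" by (cases x) auto
        have "card c = Suc p" using x f by (auto simp: Y_def K.G.fs_def)
        moreover have "clique c" using K.G.dirsumD(2)[OF Y_carrier[OF f] x] by (simp add: J_def)
        ultimately have "clique c" "card c = Suc p" by auto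
        then show "x \<in> {}" using max[of c] 0 by simp
      qed
      then have "f \<in> K.G.fs {}" if "f \<in> Y (Suc p)" for f using that Y_carrier by (auto simp: K.G.fs_def)
      then show ?thesis using K.G.fs_empty Y_zero by blast
    qed
    then have "carrier (ZM p) = {\<zero>\<^bsub>G\<^esub>}"
      using d_onto_Z(2)[of p] by (simp add: YM_simps abelian_group_hom.hom_zero[OF d_hom])
    then show ?case by (intro hs.resP_zero gmod_Z) (simp add: ZM_def I_ops)
  next
    case (Suc t)
    have t: "m - Suc p = t" "Suc p \<le> m" "n + (m - p) = Suc (n + t)" using Suc.hyps(2) Suc.prems by auto
    have ker: "a_kernel (YM (Suc p)) (ZM p) d = Zc (Suc p)" by (simp add: Zc_Suc a_kernel_def' ZM_def)
    have "resP S Sgr J0 (n + t) (YM (Suc p)\<lparr>carrier := Zc (Suc p)\<rparr>) (\<lambda>k. Ygr (Suc p) k \<inter> Zc (Suc p))"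
      using Suc.hyps(1)[of "Suc p"] t unfolding ZM_kernel Zgr_eq by simp
    moreover have "resP S Sgr J0 (Suc (n + t)) (YM (Suc p)) (Ygr (Suc p))"
      by (rule hs.resP_mono[OF gmod_Y resY]) simp
    ultimately show ?case unfolding t(3)
      using hs.resP_cone[OF gmod_Y gmod_Z d_onto_Z, of p "n + t"] by (simp add: ker)
  qed
  have "resP S Sgr J0 (Suc (n + m)) (YM 0) (Ygr 0)"
    by (rule hs.resP_mono[OF gmod_Y resY]) simp
  moreover have "resP S Sgr J0 (n + m) (YM 0\<lparr>carrier := a_kernel (YM 0) A eps\<rparr>) (\<lambda>k. Ygr 0 k \<inter> a_kernel (YM 0) A eps)"
    using resZ[of 0] unfolding ZM_kernel_0 unfolding Zc_0[symmetric] Zgr_eq by simp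
  ultimately show ?thesis
    using hs.resP_cone[OF gmod_Y gA Y_eps eps_onto] by (auto simp: Ygr_def eps_gr)
qed

end

section \<open>Transport of structure and free modules\<close>

definition tr :: "('a \<Rightarrow> 'b) \<Rightarrow> ('r, 'a) module \<Rightarrow> ('r, 'b) module" where
  "tr f M = \<lparr>carrier = f ` carrier M, monoid.mult = undefined, monoid.one = undefined, ring.zero = f \<zero>\<^bsub>M\<^esub>,
     ring.add = (\<lambda>x y. f (inv_into (carrier M) f x \<oplus>\<^bsub>M\<^esub> inv_into (carrier M) f y)),
     smult = (\<lambda>r x. f (r \<odot>\<^bsub>M\<^esub> inv_into (carrier M) f x))\<rparr>"

lemma tr_simps: "carrier (tr f M) = f ` carrier M" "\<zero>\<^bsub>tr f M\<^esub> = f \<zero>\<^bsub>M\<^esub>"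
  "x \<oplus>\<^bsub>tr f M\<^esub> y = f (inv_into (carrier M) f x \<oplus>\<^bsub>M\<^esub> inv_into (carrier M) f y)"
  "r \<odot>\<^bsub>tr f M\<^esub> x = f (r \<odot>\<^bsub>M\<^esub> inv_into (carrier M) f x)"
  by (simp_all add: tr_def)

lemma left_module_tr:
  assumes M: "left_module R M" and inj: "inj_on f (carrier M)"
  shows "left_module R (tr f M)"
proof -
  interpret M: left_module R M by fact
  have neg: "\<exists>y\<in>carrier M. f (x \<oplus>\<^bsub>M\<^esub> y) = f \<zero>\<^bsub>M\<^esub>" if "x \<in> carrier M" for x
    using that by (intro bexI[of _ "\<ominus>\<^bsub>M\<^esub> x"]) (simp_all add: M.M.r_neg)
  show ?thesis
    by (rule left_moduleI[OF M.R.ring_axioms abelian_groupI])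
     (auto simp: tr_simps inv_into_f_f[OF inj] M.smult_closed M.M.a_ac M.smult_l_distr M.smult_r_distr M.smult_assoc1 M.smult_one neg)
qed

lemma mhom_tr:
  assumes M: "left_module R M" and inj: "inj_on f (carrier M)"
  shows "mhom R M (tr f M) f" "bij_betw f (carrier M) (carrier (tr f M))"
proof -
  show "mhom R M (tr f M) f"
    by (rule mhomI[OF M left_module_tr[OF M inj]]) (auto simp: tr_simps inv_into_f_f[OF inj])
  show "bij_betw f (carrier M) (carrier (tr f M))" using inj by (simp add: bij_betw_def tr_simps)
qed

text \<open>The images of the standard generators form a basis. Only an inclusion is claimed because
  over the zero ring the empty set is taken; it still guarantees that the basis is homogeneous if
  the images are.\<close>

lemma basis_of_iso:
  fixes M :: "('r, 'a) module"
  assumes \<Phi>: "mhom R (Fr R J) M \<Phi>" and bij: "bij_betw \<Phi> (carrier (Fr R J)) (carrier M)"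
  shows "\<exists>B \<subseteq> (\<lambda>j. \<Phi> (sing (\<lambda>_. R) j \<one>\<^bsub>R\<^esub>)) ` J. is_basis R M B"
proof -
  interpret M: left_module R M using \<Phi> by (rule mhom_cod)
  show ?thesis
  proof (cases "\<one>\<^bsub>R\<^esub> = \<zero>\<^bsub>R\<^esub>")
    \<comment> \<open>In the zero ring all standard generators coincide, and the indexing by
      \<open>b\<close> in the other case would fail to be injective.\<close>
    case True
    have F0: "carrier (Fr R {}) = {\<zero>\<^bsub>Fr R {}\<^esub>}" by (auto simp: Fr_simps dsupp_def)
    have "x = \<zero>\<^bsub>M\<^esub>" if "x \<in> carrier M" for x
      using M.smult_one[OF that] M.smult_l_null[OF that] True by simp
    then have M0: "carrier M = {\<zero>\<^bsub>M\<^esub>}" by auto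
    have e: "mhom R (Fr R {}) M (fext R M (\<lambda>b. b))" by (rule mhom_fext[OF M.left_module]) simp
    have "is_basis R M {}" unfolding is_basis_bij[OF M.left_module]
      using mhom_zero[OF e] by (simp add: bij_betw_def F0 M0)
    then show ?thesis by blast
  next
    case False
    define b where "b j = \<Phi> (sing (\<lambda>_. R) j \<one>\<^bsub>R\<^esub>)" for j
    have sc: "sing (\<lambda>_. R) j \<one>\<^bsub>R\<^esub> \<in> carrier (Fr R J)" if "j \<in> J" for j
      using that by (intro Fr_gen_closed M.R.ring_axioms) auto
    have binj: "inj_on b J"
    proof (rule inj_onI)
      fix i j assume ij: "i \<in> J" "j \<in> J" "b i = b j"
      then have "sing (\<lambda>_. R) i \<one>\<^bsub>R\<^esub> = sing (\<lambda>_. R) j \<one>\<^bsub>R\<^esub>"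
        using bij sc by (auto simp: b_def bij_betw_def dest: inj_onD)
      from fun_cong[OF this, of i] show "i = j" using False by (auto simp: sing_def split: if_splits)
    qed
    let ?B = "b ` J"
    have bM: "b j \<in> carrier M" if "j \<in> J" for j unfolding b_def by (rule mhom_closed[OF \<Phi> sc[OF that]])
    \<comment> \<open>Renaming of coordinates from the set of images back to \<open>J\<close>; it
      turns the evaluation map of the claimed basis into \<Phi>.\<close>
    define \<rho> where "\<rho> c = (\<lambda>j. if j \<in> J then c (b j) else \<zero>\<^bsub>R\<^esub>)" for c :: "'a \<Rightarrow> 'r"
    have \<rho>c: "\<rho> c \<in> carrier (Fr R J)" if c: "c \<in> carrier (Fr R ?B)" for c
    proof -
      have "b ` dsupp (\<lambda>_. R) (\<rho> c) \<subseteq> dsupp (\<lambda>_. R) c" by (auto simp: dsupp_def \<rho>_def)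
      then have "finite (b ` dsupp (\<lambda>_. R) (\<rho> c))" using c by (auto simp: Fr_simps intro: finite_subset)
      moreover have sub: "dsupp (\<lambda>_. R) (\<rho> c) \<subseteq> J" by (auto simp: dsupp_def \<rho>_def)
      ultimately have "finite (dsupp (\<lambda>_. R) (\<rho> c))"
        using finite_imageD[OF _ inj_on_subset[OF binj sub]] by blast
      then show ?thesis using sub c by (auto simp: Fr_simps \<rho>_def)
    qed
    have Bs: "c y = \<zero>\<^bsub>R\<^esub>" if "c \<in> carrier (Fr R ?B)" "y \<notin> ?B" for c y
      using that by (auto simp: Fr_simps dsupp_def)
    have \<rho>: "mhom R (Fr R ?B) (Fr R J) \<rho>"
    proof (rule mhomI)
      show "\<rho> (x \<oplus>\<^bsub>Fr R ?B\<^esub> y) = \<rho> x \<oplus>\<^bsub>Fr R J\<^esub> \<rho> y" for x y by (auto simp: Fr_simps \<rho>_def)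
      show "\<rho> (r \<odot>\<^bsub>Fr R ?B\<^esub> x) = r \<odot>\<^bsub>Fr R J\<^esub> \<rho> x" if "r \<in> carrier R" for r x using that by (auto simp: Fr_simps \<rho>_def)
    qed (intro left_module_Fr M.R.ring_axioms \<rho>c; assumption?)+
    have \<rho>bij: "bij_betw \<rho> (carrier (Fr R ?B)) (carrier (Fr R J))"
      unfolding bij_betw_def
    proof
      show "inj_on \<rho> (carrier (Fr R ?B))"
      proof (rule inj_onI, rule ext)
        fix c c' y assume c: "c \<in> carrier (Fr R ?B)" "c' \<in> carrier (Fr R ?B)" "\<rho> c = \<rho> c'"
        show "c y = c' y"
        proof (cases "y \<in> ?B")
          case True
          then obtain j where "j \<in> J" "y = b j" by blast
          then show ?thesis using fun_cong[OF c(3), of j] by (simp add: \<rho>_def)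
        next
          case False
          then show ?thesis using Bs[OF c(1) False] Bs[OF c(2) False] by simp
        qed
      qed
      have "f \<in> \<rho> ` carrier (Fr R ?B)" if f: "f \<in> carrier (Fr R J)" for f
      proof -
        have f0: "f j = \<zero>\<^bsub>R\<^esub>" if "j \<notin> J" for j using f that by (auto simp: Fr_simps dsupp_def)
        define c where "c y = (if y \<in> ?B then f (inv_into J b y) else \<zero>\<^bsub>R\<^esub>)" for y
        have "dsupp (\<lambda>_. R) c \<subseteq> b ` dsupp (\<lambda>_. R) f"
        proof
          fix y assume "y \<in> dsupp (\<lambda>_. R) c"
          then have "y \<in> ?B" "f (inv_into J b y) \<noteq> \<zero>\<^bsub>R\<^esub>" by (auto simp: dsupp_def c_def split: if_splits)
          then show "y \<in> b ` dsupp (\<lambda>_. R) f" by (intro image_eqI[of _ _ "inv_into J b y"]) (auto simp: dsupp_def f_inv_into_f)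
        qed
        moreover have "finite (b ` dsupp (\<lambda>_. R) f)" using f by (simp add: Fr_simps)
        moreover have "dsupp (\<lambda>_. R) c \<subseteq> ?B" by (auto simp: dsupp_def c_def)
        ultimately have "c \<in> carrier (Fr R ?B)" using f by (auto simp: Fr_simps c_def intro: finite_subset)
        moreover have "\<rho> c = f"
        proof (rule ext)
          fix j show "\<rho> c j = f j"
            using f0[of j] by (cases "j \<in> J") (simp_all add: \<rho>_def c_def inv_into_f_f[OF binj])
        qed
        ultimately show ?thesis by blast
      qed
      then show "\<rho> ` carrier (Fr R ?B) = carrier (Fr R J)" using \<rho>c by blast
    qed
    have e: "mhom R (Fr R ?B) M (fext R M (\<lambda>b. b))" using bM by (intro mhom_fext M.left_module) auto
    have eq: "fext R M (\<lambda>b. b) c = \<Phi> (\<rho> c)" if c: "c \<in> carrier (Fr R ?B)" for c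
    proof (rule mhom_Fr_unique[OF e mhom_comp[OF \<rho> \<Phi>] _ c])
      fix y assume "y \<in> ?B"
      then obtain j where j: "j \<in> J" "y = b j" by blast
      have "\<rho> (sing (\<lambda>_. R) (b j) \<one>\<^bsub>R\<^esub>) = sing (\<lambda>_. R) j \<one>\<^bsub>R\<^esub>"
        using j binj by (auto simp: \<rho>_def sing_def fun_eq_iff dest: inj_onD)
      then show "fext R M (\<lambda>b. b) (sing (\<lambda>_. R) y \<one>\<^bsub>R\<^esub>) = \<Phi> (\<rho> (sing (\<lambda>_. R) y \<one>\<^bsub>R\<^esub>))"
        using j bM fext_sing[OF M.left_module, where g = "\<lambda>b. b" and J = ?B and j = y and s = "\<one>\<^bsub>R\<^esub>"] by (auto simp: M.smult_one b_def[symmetric])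
    qed
    have "bij_betw (\<lambda>c. \<Phi> (\<rho> c)) (carrier (Fr R ?B)) (carrier M)"
      using bij_betw_trans[OF \<rho>bij bij] by (simp add: comp_def)
    then have "bij_betw (fext R M (\<lambda>b. b)) (carrier (Fr R ?B)) (carrier M)"
      using eq by (simp cong: bij_betw_cong)
    then have "is_basis R M ?B" unfolding is_basis_bij[OF M.left_module] using bM by auto
    then show ?thesis by (auto simp: b_def)
  qed
qed

section \<open>Global dimension and free resolutions\<close>

lemma free_projective:
  fixes P :: "('r, 'u) module"
  assumes "free_module R P" shows "projective_module R P"
  unfolding projective_module_def
proof (intro conjI allI ballI impI)
  show P: "left_module R P" using assms by (simp add: free_module_def)
  obtain B where B: "is_basis R P B" using assms by (auto simp: free_module_def)
  fix L N :: "('r, 'u) module" and g f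
  assume g: "g \<in> module_homs R L N" and f: "f \<in> module_homs R P N"
    and LN: "left_module R L \<and> left_module R N \<and> g ` carrier L = carrier N"
  interpret P: left_module R P by (rule P)
  interpret L: left_module R L using LN by simp
  have gm: "mhom R L N g" and fm: "mhom R P N f" using g f LN P by (auto simp: module_homs_mhom)
  let ?e = "fext R P (\<lambda>b. b)"
  have BP: "B \<subseteq> carrier P" and bij: "bij_betw ?e (carrier (Fr R B)) (carrier P)" using B by (auto simp: is_basis_bij[OF P])
  have e: "mhom R (Fr R B) P ?e" using BP by (intro mhom_fext P) auto
  have "\<exists>y\<in>carrier L. g y = f b" if "b \<in> B" for b
  proof -
    have "f b \<in> g ` carrier L" using LN mhom_closed[OF fm] BP that by auto
    then show ?thesis by force
  qed
  then obtain y where y: "\<And>b. b \<in> B \<Longrightarrow> y b \<in> carrier L" "\<And>b. b \<in> B \<Longrightarrow> g (y b) = f b" by metis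
  let ?c = "inv_into (carrier (Fr R B)) ?e"
  have c: "mhom R P (Fr R B) ?c" by (rule mhom_inv_into[OF e bij])
  have l: "mhom R (Fr R B) L (fext R L y)" by (intro mhom_fext L.left_module y)
  have eq: "g (fext R L y x) = f (?e x)" if "x \<in> carrier (Fr R B)" for x
  proof (rule mhom_Fr_unique[OF mhom_comp[OF l gm] mhom_comp[OF e fm] _ that])
    fix b assume b: "b \<in> B"
    have "fext R L y (sing (\<lambda>_. R) b \<one>\<^bsub>R\<^esub>) = y b"
      using fext_sing[OF L.left_module y(1) b P.R.one_closed] y(1)[OF b] by (simp add: L.smult_one)
    moreover have "?e (sing (\<lambda>_. R) b \<one>\<^bsub>R\<^esub>) = b"
      using fext_sing[OF P, where g = "\<lambda>b. b" and J = B and j = b and s = "\<one>\<^bsub>R\<^esub>"] b BP by (auto simp: P.smult_one)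
    ultimately show "g (fext R L y (sing (\<lambda>_. R) b \<one>\<^bsub>R\<^esub>)) = f (?e (sing (\<lambda>_. R) b \<one>\<^bsub>R\<^esub>))"
      using y(2)[OF b] by simp
  qed
  have h: "mhom R P L (\<lambda>x. fext R L y (?c x))" by (rule mhom_comp[OF c l])
  have "g (fext R L y (?c x)) = f x" if x: "x \<in> carrier P" for x
    using eq[OF mhom_closed[OF c x]] bij x by (simp add: bij_betw_def f_inv_into_f)
  then show "\<exists>h\<in>module_homs R P L. \<forall>x\<in>carrier P. g (h x) = f x"
    by (intro bexI[OF _ restrict_module_homs[OF h]]) simp
qed

text \<open>The free module on all elements of the universe \<open>'u\<close> embeds into
  \<open>'u\<close>. So every module with elements there has a free cover, and hence a free
  resolution, with elements there.\<close>

locale small_ring = ring R for R :: "'r ring" +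
  fixes \<tau> :: "('u \<Rightarrow> 'r) \<Rightarrow> 'u"
  assumes inj: "inj_on \<tau> (carrier (Fr R UNIV))"
begin

lemma free_cover:
  fixes N :: "('r, 'u) module"
  assumes N: "left_module R N"
  shows "\<exists>(P :: ('r, 'u) module) e. free_module R P \<and> mhom R P N e \<and> e ` carrier P = carrier N"
proof -
  interpret N: left_module R N by fact
  let ?F = "Fr R (carrier N)"
  have F: "left_module R ?F" by (rule left_module_Fr[OF ring_axioms])
  have i: "inj_on \<tau> (carrier ?F)" by (rule inj_on_subset[OF inj]) (auto simp: Fr_simps)
  note t = mhom_tr[OF F i]
  have free: "free_module R (tr \<tau> ?F)"
    using basis_of_iso[OF t] left_module_tr[OF F i] by (auto simp: free_module_def)
  have e: "mhom R ?F N (fext R N (\<lambda>b. b))" by (rule mhom_fext[OF N])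
  have es: "fext R N (\<lambda>b. b) ` carrier ?F = carrier N"
  proof
    show "carrier N \<subseteq> fext R N (\<lambda>b. b) ` carrier ?F"
    proof
      fix x assume x: "x \<in> carrier N"
      have "fext R N (\<lambda>b. b) (sing (\<lambda>_. R) x \<one>\<^bsub>R\<^esub>) = x"
        using fext_sing[OF N, where g = "\<lambda>b. b" and J = "carrier N" and j = x and s = "\<one>\<^bsub>R\<^esub>"] x by (simp add: N.smult_one)
      then show "x \<in> fext R N (\<lambda>b. b) ` carrier ?F"
        using Fr_gen_closed[OF ring_axioms x one_closed] by (metis image_eqI)
    qed
  qed (use mhom_closed[OF e] in auto)
  let ?i = "inv_into (carrier ?F) \<tau>"
  have "mhom R (tr \<tau> ?F) N (\<lambda>x. fext R N (\<lambda>b. b) (?i x))"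
    by (rule mhom_comp[OF mhom_inv_into[OF t] e])
  moreover have "(\<lambda>x. fext R N (\<lambda>b. b) (?i x)) ` carrier (tr \<tau> ?F) = carrier N"
    using bij_betw_inv_into[OF t(2)] es by (simp add: bij_betw_def image_image[symmetric])
  ultimately show ?thesis using free by blast
qed

definition cov :: "('r, 'u) module \<Rightarrow> ('r, 'u) module \<times> ('u \<Rightarrow> 'u)" where
  "cov N = (SOME (P, e). free_module R P \<and> mhom R P N e \<and> e ` carrier P = carrier N)"

lemma cov:
  assumes "left_module R N"
  shows "free_module R (fst (cov N))" "mhom R (fst (cov N)) N (snd (cov N))" "snd (cov N) ` carrier (fst (cov N)) = carrier N"
proof -
  have "\<exists>x :: ('r, 'u) module \<times> ('u \<Rightarrow> 'u). case x of (P, e) \<Rightarrow> free_module R P \<and> mhom R P N e \<and> e ` carrier P = carrier N"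
  proof -
    obtain P :: "('r, 'u) module" and e where "free_module R P" "mhom R P N e" "e ` carrier P = carrier N"
      using free_cover[OF assms] by blast
    then show ?thesis by (intro exI[of _ "(P, e)"]) simp
  qed
  from someI_ex[OF this]
  show "free_module R (fst (cov N))" "mhom R (fst (cov N)) N (snd (cov N))" "snd (cov N) ` carrier (fst (cov N)) = carrier N"
    unfolding cov_def[symmetric] by (auto split: prod.splits)
qed

primrec syz :: "('r, 'u) module \<Rightarrow> nat \<Rightarrow> ('r, 'u) module" where
  "syz N 0 = N"
| "syz N (Suc i) = fst (cov (syz N i))\<lparr>carrier := a_kernel (fst (cov (syz N i))) (syz N i) (snd (cov (syz N i)))\<rparr>"

lemma syz_module: "left_module R N \<Longrightarrow> left_module R (syz N i)"
  by (induction i) (auto intro: left_module_kernel[OF cov(2) cov(2)])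

text \<open>\<open>Ext\<close> chooses a resolution by \<open>SOME\<close>, so facts about it can be
  used only once a resolution exists within the type \<open>'u\<close>. It is built by iterating
  \<open>cov\<close>.\<close>

lemma projective_resolution_exists:
  fixes N :: "('r, 'u) module"
  assumes N: "left_module R N"
  shows "\<exists>P d \<epsilon>. projective_resolution R P d \<epsilon> N"
proof -
  define P where "P i = fst (cov (syz N i))" for i
  define e where "e i = snd (cov (syz N i))" for i
  note c = cov[OF syz_module[OF N], folded P_def e_def]
  define d where "d i = restrict (e (Suc i)) (carrier (P (Suc i)))" for i
  have syz: "syz N (Suc i) = P i\<lparr>carrier := a_kernel (P i) (syz N i) (e i)\<rparr>" for i by (simp add: P_def e_def)
  have m: "mhom R (P (Suc i)) (P i) (e (Suc i))" for i
    using mhom_comp[OF c(2)[of "Suc i", unfolded syz] mhom_kernel_incl[OF c(2) c(2)]] by simp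
  have im: "e (Suc i) ` carrier (P (Suc i)) = a_kernel (P i) (syz N i) (e i)" for i
    using c(3)[of "Suc i"] unfolding syz by simp
  have ker: "a_kernel (P (Suc i)) (P i) (d i) = a_kernel (P (Suc i)) (syz N (Suc i)) (e (Suc i))" for i
    unfolding syz by (auto simp: a_kernel_def' d_def)
  have ker0: "a_kernel (P 0) N (restrict (e 0) (carrier (P 0))) = a_kernel (P 0) (syz N 0) (e 0)"
    by (auto simp: a_kernel_def')
  have im': "d i ` carrier (P (Suc i)) = e (Suc i) ` carrier (P (Suc i))" for i by (simp add: d_def)
  have "exact_resolution R P d (restrict (e 0) (carrier (P 0))) N"
    unfolding exact_resolution_def
  proof (intro conjI allI)
    show "restrict (e 0) (carrier (P 0)) \<in> module_homs R (P 0) N" using c(2)[of 0] by (intro restrict_module_homs) simp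
    show "d i \<in> module_homs R (P (Suc i)) (P i)" for i unfolding d_def by (rule restrict_module_homs[OF m])
    show "restrict (e 0) (carrier (P 0)) ` carrier (P 0) = carrier N" using c(3)[of 0] by simp
    show "a_kernel (P 0) N (restrict (e 0) (carrier (P 0))) = d 0 ` carrier (P 1)"
      unfolding ker0 im[symmetric] using im'[of 0] by simp
    show "a_kernel (P (Suc i)) (P i) (d i) = d (Suc i) ` carrier (P (Suc (Suc i)))" for i
      unfolding ker im[symmetric] im' ..
  qed
  then show ?thesis unfolding projective_resolution_def using free_projective c(1) by blast
qed

end

section \<open>From vanishing of Ext to free resolutions over the base ring\<close>

lemma gl_dim_Ext:
  fixes A B :: "('r, 'u) module"
  assumes "gl_dim TYPE('u) R = enat n" "n < k" "left_module R A" "left_module R B"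
  shows "carrier (Ext R k A B) = {\<one>\<^bsub>Ext R k A B\<^esub>}"
proof (rule ccontr)
  assume "carrier (Ext R k A B) \<noteq> {\<one>\<^bsub>Ext R k A B\<^esub>}"
  then have "enat k \<le> gl_dim TYPE('u) R" unfolding gl_dim_def using assms(3,4)
    by (intro complete_lattice_class.Sup_upper) blast
  then show False using assms(1,2) by simp
qed

text \<open>In a trivial quotient the coset of \<open>f\<close> is the set of coboundaries, and
  \<open>f\<close> lies in its own coset because the zero map is a coboundary.\<close>

lemma hom_cohomology_trivial:
  fixes P :: "nat \<Rightarrow> ('r, 'u) module"
  assumes triv: "carrier (hom_cohomology R P d B (Suc k)) = {\<one>\<^bsub>hom_cohomology R P d B (Suc k)\<^esub>}"
    and P: "\<And>i. left_module R (P i)" and B: "left_module R B" and d: "\<And>i. d i \<in> module_homs R (P (Suc i)) (P i)"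
    and f: "f \<in> cocycles R P d B (Suc k)"
  shows "f \<in> coboundaries R P d B (Suc k)"
proof -
  interpret B: left_module R B by fact
  have dm: "mhom R (P (Suc i)) (P i) (d i)" for i using d P by (simp add: module_homs_mhom)
  let ?H = "coboundaries R P d B (Suc k)"
  let ?G = "\<lparr>carrier = cocycles R P d B (Suc k),
     monoid.mult = (\<lambda>f g. \<lambda>x\<in>carrier (P (Suc k)). f x \<oplus>\<^bsub>B\<^esub> g x),
     monoid.one = (\<lambda>x\<in>carrier (P (Suc k)). \<zero>\<^bsub>B\<^esub>)\<rparr>"
  have "?H #>\<^bsub>?G\<^esub> f \<in> carrier (hom_cohomology R P d B (Suc k))"
    using f by (auto simp: hom_cohomology_def FactGroup_def RCOSETS_def)
  then have eq: "?H #>\<^bsub>?G\<^esub> f = ?H" unfolding triv by (simp add: hom_cohomology_def FactGroup_def)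
  let ?z = "\<lambda>x\<in>carrier (P (Suc k)). \<zero>\<^bsub>B\<^esub>"
  have "?z = compose (carrier (P (Suc k))) (restrict (\<lambda>x. \<zero>\<^bsub>B\<^esub>) (carrier (P k))) (d k)"
    using mhom_closed[OF dm] by (auto simp: compose_def)
  then have z: "?z \<in> ?H"
    using restrict_module_homs[OF mhom_zero_map[OF P[of k] B]] by (auto simp: coboundaries_def)
  have fe: "f \<in> module_homs R (P (Suc k)) B" using f by (simp add: cocycles_def)
  then have fx: "f x \<in> carrier B" if "x \<in> carrier (P (Suc k))" for x using that by (auto simp: module_homs_def)
  have "f \<in> extensional (carrier (P (Suc k)))" using fe by (simp add: module_homs_def PiE_def)
  then have "?z \<otimes>\<^bsub>?G\<^esub> f = f"
    by (intro ext) (auto simp: fx extensional_def)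
  then have "f \<in> ?H #>\<^bsub>?G\<^esub> f" unfolding r_coset_def by (intro UN_I[OF z]) (simp only: singleton_iff)
  then show ?thesis using eq by simp
qed

text \<open>Lift the composite of \<open>f\<close> with \<open>q\<close> from P and precompose with
  the section.\<close>

lemma projective_retract:
  fixes P M :: "('r, 'u) module"
  assumes P: "projective_module R P" and q: "mhom R P M q" and \<sigma>: "mhom R M P \<sigma>" and id: "\<And>x. x \<in> carrier M \<Longrightarrow> q (\<sigma> x) = x"
  shows "projective_module R M"
  unfolding projective_module_def
proof (intro conjI allI ballI impI)
  show M: "left_module R M" by (rule mhom_cod[OF q])
  fix L N :: "('r, 'u) module" and g f
  assume g: "g \<in> module_homs R L N" and f: "f \<in> module_homs R M N"
    and LN: "left_module R L \<and> left_module R N \<and> g ` carrier L = carrier N"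
  have Pm: "left_module R P" by (rule mhom_dom[OF q])
  have fm: "mhom R M N f" using f LN M by (simp add: module_homs_mhom)
  let ?f = "restrict (\<lambda>x. f (q x)) (carrier P)"
  have "?f \<in> module_homs R P N" by (rule restrict_module_homs[OF mhom_comp[OF q fm]])
  from P[unfolded projective_module_def, THEN conjunct2, rule_format, OF g this LN]
  have "\<exists>h\<in>module_homs R P L. \<forall>x\<in>carrier P. g (h x) = ?f x" .
  then obtain h where h: "h \<in> module_homs R P L" "\<And>x. x \<in> carrier P \<Longrightarrow> g (h x) = f (q x)" by auto
  have hm: "mhom R P L h" using h(1) LN Pm by (simp add: module_homs_mhom)
  show "\<exists>h\<in>module_homs R M L. \<forall>x\<in>carrier M. g (h x) = f x"
    using h(2) mhom_closed[OF \<sigma>] id by (intro bexI[OF _ restrict_module_homs[OF mhom_comp[OF \<sigma> hm]]]) simp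
qed

text \<open>Here \<open>g\<close> retracts P onto the kernel of \<open>q\<close>. It fixes the
  difference of two preimages, so x - g x depends on \<open>q x\<close> only and defines a section
  of \<open>q\<close>.\<close>

lemma split_quotient:
  assumes q: "mhom R P M q" and surj: "q ` carrier P = carrier M" and g: "mhom R P P g"
    and gB: "\<And>x. x \<in> carrier P \<Longrightarrow> q (g x) = \<zero>\<^bsub>M\<^esub>" and gid: "\<And>x. x \<in> carrier P \<Longrightarrow> q x = \<zero>\<^bsub>M\<^esub> \<Longrightarrow> g x = x"
  shows "\<exists>\<sigma>. mhom R M P \<sigma> \<and> (\<forall>y\<in>carrier M. q (\<sigma> y) = y)"
proof -
  interpret P: left_module R P by (rule mhom_dom[OF q])
  interpret M: left_module R M by (rule mhom_cod[OF q])
  define \<sigma> where "\<sigma> y = (let x = inv_into (carrier P) q y in x \<ominus>\<^bsub>P\<^esub> g x)" for y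
  have \<sigma>q: "\<sigma> (q x) = x \<ominus>\<^bsub>P\<^esub> g x" if x: "x \<in> carrier P" for x
  proof -
    let ?x = "inv_into (carrier P) q (q x)"
    have x': "?x \<in> carrier P" "q ?x = q x" using x by (auto simp: inv_into_into f_inv_into_f)
    have gx: "g x \<in> carrier P" "g ?x \<in> carrier P" using mhom_closed[OF g] x x' by auto
    have "q (?x \<ominus>\<^bsub>P\<^esub> x) = \<zero>\<^bsub>M\<^esub>" using x x' mhom_closed[OF q] by (simp add: mhom_minus[OF q] M.M.minus_eq_zero_iff)
    then have "g ?x \<ominus>\<^bsub>P\<^esub> g x = ?x \<ominus>\<^bsub>P\<^esub> x" using gid[of "?x \<ominus>\<^bsub>P\<^esub> x"] x x' by (simp add: mhom_minus[OF g])
    moreover have "(?x \<ominus>\<^bsub>P\<^esub> g ?x) \<ominus>\<^bsub>P\<^esub> (x \<ominus>\<^bsub>P\<^esub> g x) = (?x \<ominus>\<^bsub>P\<^esub> x) \<ominus>\<^bsub>P\<^esub> (g ?x \<ominus>\<^bsub>P\<^esub> g x)"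
      using x x' gx by (intro P.M.minus_minus_minus)
    ultimately have "(?x \<ominus>\<^bsub>P\<^esub> g ?x) \<ominus>\<^bsub>P\<^esub> (x \<ominus>\<^bsub>P\<^esub> g x) = \<zero>\<^bsub>P\<^esub>" using x x' P.M.minus_eq_zero_iff by simp
    then show ?thesis using x x' gx P.M.minus_eq_zero_iff by (simp add: \<sigma>_def Let_def)
  qed
  have sur: "\<exists>x\<in>carrier P. y = q x" if "y \<in> carrier M" for y using that surj by blast
  have "mhom R M P \<sigma>"
  proof (rule mhomI)
    fix y z assume "y \<in> carrier M" "z \<in> carrier M"
    then obtain a b where ab: "a \<in> carrier P" "y = q a" "b \<in> carrier P" "z = q b" using sur by metis
    have "\<sigma> (q (a \<oplus>\<^bsub>P\<^esub> b)) = \<sigma> (q a) \<oplus>\<^bsub>P\<^esub> \<sigma> (q b)"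
      using ab mhom_closed[OF g] by (simp add: \<sigma>q mhom_add[OF g] P.M.add_minus_add)
    then show "\<sigma> (y \<oplus>\<^bsub>M\<^esub> z) = \<sigma> y \<oplus>\<^bsub>P\<^esub> \<sigma> z" using ab by (simp add: mhom_add[OF q])
  next
    fix r y assume r: "r \<in> carrier R" and "y \<in> carrier M"
    then obtain a where a: "a \<in> carrier P" "y = q a" using sur by metis
    have "\<sigma> (q (r \<odot>\<^bsub>P\<^esub> a)) = r \<odot>\<^bsub>P\<^esub> \<sigma> (q a)"
      using r a mhom_closed[OF g]
      by (simp add: \<sigma>q P.smult_closed mhom_smult[OF g] abelian_group_hom.hom_minus[OF P.smult_hom])
    then show "\<sigma> (r \<odot>\<^bsub>M\<^esub> y) = r \<odot>\<^bsub>P\<^esub> \<sigma> y" using r a by (simp add: mhom_smult[OF q])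
  next
    fix y assume "y \<in> carrier M"
    then obtain a where "a \<in> carrier P" "y = q a" using sur by metis
    then show "\<sigma> y \<in> carrier P" using mhom_closed[OF g] by (simp add: \<sigma>q)
  qed (rule M.left_module P.left_module)+
  moreover have "q (\<sigma> y) = y" if "y \<in> carrier M" for y
  proof -
    obtain a where a: "a \<in> carrier P" "y = q a" using sur \<open>y \<in> carrier M\<close> by metis
    then show ?thesis
      using mhom_closed[OF g a(1)] mhom_closed[OF q a(1)] by (simp add: \<sigma>q mhom_minus[OF q] gB M.M.minus_zero_right)
  qed
  ultimately show ?thesis by blast
qed

lemma resR_1: "free_module R F \<Longrightarrow> resR R (Suc 0) F"
proof -
  assume F: "free_module R F"
  then have m: "left_module R F" by (simp add: free_module_def)
  then interpret left_module R F .
  have "a_kernel F F (\<lambda>x. x) = {\<zero>\<^bsub>F\<^esub>}" by (auto simp: a_kernel_def')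
  then show ?thesis unfolding resR.simps using F mhom_id[OF m] by (intro exI[of _ F] exI[of _ "\<lambda>x. x"]) simp
qed

text \<open>Vanishing of Ext in degree n + 1 with coefficients in the syzygy
  \<open>K (Suc n)\<close> makes that syzygy a direct summand of \<open>P n\<close>. So the quotient
  \<open>K n\<close> is projective, hence free, and ends the resolution; the earlier terms are free
  because they are projective.\<close>

lemma (in small_ring) gl_dim_resR:
  fixes N :: "('r, 'u) module"
  assumes pf: "projective_free TYPE('u) R" and gl: "gl_dim TYPE('u) R = enat n" and N: "left_module R N"
  shows "resR R (Suc n) N"
proof -
  let ?S = "SOME (P, d). \<exists>\<epsilon>. projective_resolution R P d \<epsilon> N"
  obtain P d where Pd: "?S = (P, d)" by (cases ?S) auto
  have "\<exists>x. case x of (P, d) \<Rightarrow> \<exists>\<epsilon>. projective_resolution R P d \<epsilon> N"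
    using projective_resolution_exists[OF N] by auto
  from someI_ex[OF this] obtain \<epsilon> where res: "projective_resolution R P d \<epsilon> N" unfolding Pd by auto
  \<comment> \<open>The chosen resolution of N depends neither on the degree nor on the
    coefficients, so the same \<open>P\<close> and \<open>d\<close> serve throughout.\<close>
  have Ext: "Ext R k N B = hom_cohomology R P d B k" for k B unfolding Ext_def Pd by simp
  have proj: "projective_module R (P i)" for i using res by (simp add: projective_resolution_def)
  have Pm: "left_module R (P i)" for i using proj by (simp add: projective_module_def)
  have ex: "exact_resolution R P d \<epsilon> N" using res by (simp add: projective_resolution_def)
  have d: "d i \<in> module_homs R (P (Suc i)) (P i)" for i using ex by (simp add: exact_resolution_def)
  have dm: "mhom R (P (Suc i)) (P i) (d i)" for i using d Pm by (simp add: module_homs_mhom)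
  have em: "mhom R (P 0) N \<epsilon>" using ex N Pm by (simp add: exact_resolution_def module_homs_mhom)
  define q where "q i = (case i of 0 \<Rightarrow> \<epsilon> | Suc j \<Rightarrow> d j)" for i
  define C where "C i = d i ` carrier (P (Suc i))" for i
  \<comment> \<open>The i-th syzygy, starting with \<open>K 0\<close> = N; \<open>q i\<close> maps
    \<open>P i\<close> onto it, and its kernel is \<open>K (Suc i)\<close>.\<close>
  define K where "K i = (case i of 0 \<Rightarrow> N | Suc j \<Rightarrow> P j\<lparr>carrier := C j\<rparr>)" for i
  have C0: "C 0 = a_kernel (P 0) N \<epsilon>" using ex by (simp add: exact_resolution_def C_def)
  have CS: "C (Suc i) = a_kernel (P (Suc i)) (P i) (d i)" for i using ex by (simp add: exact_resolution_def C_def)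
  have Csub: "submod R (P i) (C i)" for i using submod_kernel[OF em] submod_kernel[OF dm] by (cases i) (simp_all add: C0 CS)
  have Ck: "C i = a_kernel (P i) (K i) (q i)" for i
    by (cases i) (simp_all add: C0 CS K_def q_def a_kernel_def')
  have qm: "mhom R (P i) (K i) (q i)" for i
    using em mhom_into_sub[OF dm Csub] by (cases i) (auto simp: K_def q_def C_def)
  have qs: "q i ` carrier (P i) = carrier (K i)" for i
    using ex by (cases i) (auto simp: K_def q_def C_def exact_resolution_def)
  have KSuc: "K (Suc i) = P i\<lparr>carrier := a_kernel (P i) (K i) (q i)\<rparr>" for i unfolding Ck[symmetric] by (simp add: K_def)
  have "projective_module R (K n)"
  proof -
    \<comment> \<open>The test class is \<open>d n\<close> itself, as a cocycle with values in its
      own image. That it is a coboundary means that it factors as \<open>g\<close> after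
      \<open>d n\<close>, so \<open>g\<close> is the identity on this image.\<close>
    let ?B = "K (Suc n)"
    have B: "left_module R ?B" by (rule mhom_cod[OF qm])
    have dB: "d n \<in> module_homs R (P (Suc n)) ?B"
      using d[of n] qm[of "Suc n"] by (simp add: module_homs_mhom Pm B q_def)
    have "d n (d (Suc n) x) = \<zero>\<^bsub>?B\<^esub>" if "x \<in> carrier (P (Suc (Suc n)))" for x
    proof -
      have "d (Suc n) x \<in> C (Suc n)" using that by (simp add: C_def)
      then show ?thesis by (simp add: CS a_kernel_iff K_def)
    qed
    then have "d n \<in> cocycles R P d ?B (Suc n)" using dB by (simp add: cocycles_def)
    then have "d n \<in> coboundaries R P d ?B (Suc n)"
      using gl_dim_Ext[OF gl lessI N B] by (intro hom_cohomology_trivial Pm B d) (simp add: Ext)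
    then obtain g where g: "g \<in> module_homs R (P n) ?B" "d n = compose (carrier (P (Suc n))) g (d n)"
      by (auto simp: coboundaries_def)
    have gm: "mhom R (P n) ?B g" using g(1) Pm B by (simp add: module_homs_mhom)
    have gP: "mhom R (P n) (P n) g"
    proof -
      have "mhom R ?B (P n) (\<lambda>x. x)" using mhom_incl[OF Pm Csub, of n] by (simp add: K_def)
      from mhom_comp[OF gm this] show ?thesis by simp
    qed
    have gid: "g x = x" if "x \<in> C n" for x
    proof -
      have "x \<in> d n ` carrier (P (Suc n))" using that by (simp add: C_def)
      then obtain y where y: "y \<in> carrier (P (Suc n))" "x = d n y" by blast
      have "d n y = g (d n y)" using fun_cong[OF g(2), of y] y(1) by (simp add: compose_def)
      then show ?thesis using y by simp
    qed
    have gC: "g x \<in> C n" if "x \<in> carrier (P n)" for x using mhom_closed[OF gm that] by (simp add: K_def)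
    have "\<exists>\<sigma>. mhom R (K n) (P n) \<sigma> \<and> (\<forall>y\<in>carrier (K n). q n (\<sigma> y) = y)"
      by (rule split_quotient[OF qm qs gP]) (use gC gid in \<open>auto simp: Ck a_kernel_iff\<close>)
    then show ?thesis using projective_retract[OF proj qm] by blast
  qed
  then have "resR R (Suc 0) (K n)" using pf resR_1 unfolding projective_free_def by blast
  \<comment> \<open>The free module \<open>K n\<close> resolves itself with one term; going down to
    \<open>K 0\<close> each step prepends one \<open>P i\<close>.\<close>
  then have "resR R (Suc (n - i)) (K i)" if "i \<le> n" for i
    using that
  proof (induction "n - i" arbitrary: i)
    case 0
    then show ?case by simp
  next
    case (Suc t)
    then have t: "n - Suc i = t" "Suc i \<le> n" "n - i = Suc t" by auto
    have "resR R (Suc t) (K (Suc i))" using Suc(1)[of "Suc i"] Suc(3) t by simp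
    moreover have "free_module R (P i)" using pf proj by (simp add: projective_free_def)
    ultimately show ?case unfolding t(3) resR.simps(2)[of R "Suc t"] KSuc using qm qs by blast
  qed
  from this[of 0] show ?thesis by (simp add: K_def)
qed

section \<open>The universe\<close>

lemma Fpow_lepoll: "A \<lesssim> B \<Longrightarrow> Fpow A \<lesssim> Fpow B"
  unfolding lepoll_def by (metis image_Fpow_mono inj_on_image_Fpow)

lemma times_lepoll_infinite:
  assumes "infinite U" "A \<lesssim> U" "B \<lesssim> U" shows "A \<times> B \<lesssim> U"
proof -
  have "A \<times> B \<lesssim> U \<times> U" using assms(2,3) by (rule times_lepoll_mono)
  also have "U \<times> U \<approx> U" unfolding eqpoll_iff_card_of_ordIso by (rule card_of_Times_same_infinite[OF assms(1)])
  finally show ?thesis .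
qed

lemma lists_lepoll_infinite:
  assumes "infinite U" "A \<lesssim> U" shows "lists A \<lesssim> U"
proof -
  have "lists A \<lesssim> lists U" using assms(2) by (rule lists_lepoll_mono)
  also have "lists U \<approx> U" unfolding eqpoll_iff_card_of_ordIso by (rule card_of_lists_infinite[OF assms(1)])
  finally show ?thesis .
qed

lemma Fpow_lepoll_infinite:
  assumes "infinite U" "A \<lesssim> U" shows "Fpow A \<lesssim> U"
  using lepoll_trans2[OF Fpow_lepoll[OF assms(2)] eqpoll_Fpow[OF assms(1)]] .

text \<open>A finitely supported function is determined by the finite graph of its nonzero
  values.\<close>

lemma Fr_lepoll:
  assumes U: "infinite U" and J: "J \<lesssim> U" and S: "carrier S \<lesssim> U"
  shows "carrier (Fr S J) \<lesssim> U"
proof -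
  have "carrier (Fr S J) \<subseteq> {f. f ` J \<subseteq> carrier S \<and> {x. f x \<noteq> \<zero>\<^bsub>S\<^esub>} \<subseteq> J \<and> finite {x. f x \<noteq> \<zero>\<^bsub>S\<^esub>}}"
    by (auto simp: Fr_simps dsupp_def)
  then have "carrier (Fr S J) \<lesssim> {f. f ` J \<subseteq> carrier S \<and> {x. f x \<noteq> \<zero>\<^bsub>S\<^esub>} \<subseteq> J \<and> finite {x. f x \<noteq> \<zero>\<^bsub>S\<^esub>}}"
    by (rule subset_imp_lepoll)
  also have "\<dots> \<lesssim> Fpow (J \<times> carrier S)" by (rule lepoll_restricted_funspace)
  also have "\<dots> \<lesssim> U" by (intro Fpow_lepoll_infinite U times_lepoll_infinite J S)
  finally show ?thesis .
qed

lemma monoid_ring_lepoll: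
  assumes U: "infinite U" and M: "carrier M \<lesssim> U" and R: "carrier R \<lesssim> U"
  shows "carrier (monoid_ring R M) \<lesssim> U"
proof -
  have "carrier (monoid_ring R M) \<subseteq> {f. f ` carrier M \<subseteq> carrier R \<and> {x. f x \<noteq> \<zero>\<^bsub>R\<^esub>} \<subseteq> carrier M \<and> finite {x. f x \<noteq> \<zero>\<^bsub>R\<^esub>}}"
    by (auto simp: monoid_ring_def supp_def)
  then have "carrier (monoid_ring R M) \<lesssim> {f. f ` carrier M \<subseteq> carrier R \<and> {x. f x \<noteq> \<zero>\<^bsub>R\<^esub>} \<subseteq> carrier M \<and> finite {x. f x \<noteq> \<zero>\<^bsub>R\<^esub>}}"
    by (rule subset_imp_lepoll)
  also have "\<dots> \<lesssim> Fpow (carrier M \<times> carrier R)" by (rule lepoll_restricted_funspace)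
  also have "\<dots> \<lesssim> U" by (intro Fpow_lepoll_infinite U times_lepoll_infinite M R)
  finally show ?thesis .
qed

lemma fpc_monoid_lepoll:
  assumes "infinite U" "E \<lesssim> U" shows "carrier (fpc_monoid E I) \<lesssim> U"
proof -
  have "carrier (fpc_monoid E I) = (\<lambda>w. fpc_cong E I `` {w}) ` lists E"
    by (auto simp: fpc_monoid_def quotient_def)
  then have "carrier (fpc_monoid E I) \<lesssim> lists E" using image_lepoll by metis
  then show ?thesis using lists_lepoll_infinite[OF assms] lepoll_trans by blast
qed

text \<open>An infinite set contains a copy of its square; two different rows of it are disjoint
  copies of the set.\<close>

lemma disjoint_injections:
  assumes "infinite (UNIV :: 'u set)"
  obtains \<iota> \<iota>' :: "'u \<Rightarrow> 'u" where "inj \<iota>" "inj \<iota>'" "\<And>x y. \<iota> x \<noteq> \<iota>' y"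
proof -
  have "(UNIV :: 'u set) \<times> (UNIV :: 'u set) \<lesssim> (UNIV :: 'u set)" by (rule times_lepoll_infinite[OF assms lepoll_refl lepoll_refl])
  then obtain f :: "'u \<times> 'u \<Rightarrow> 'u" where f: "inj f" by (auto simp: lepoll_def)
  obtain a b :: 'u where ab: "a \<noteq> b"
  proof -
    obtain a where "a \<notin> {undefined :: 'u}" using ex_new_if_finite[OF assms, of "{undefined}"] by auto
    then show ?thesis using that by blast
  qed
  show ?thesis
    by (rule that[of "\<lambda>x. f (a, x)" "\<lambda>x. f (b, x)"]) (use ab in \<open>auto intro!: injI dest: injD[OF f]\<close>)
qed

section \<open>Assembling the resolution\<close>

lemma gmod_iso:
  assumes A: "gmod S Sgr A Agr" and h: "mhom S A B h" and bij: "bij_betw h (carrier A) (carrier B)"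
  shows "gmod S Sgr B (\<lambda>k. h ` Agr k)"
proof -
  obtain p where "graded_group A Agr p" using A by (auto simp: gmod_def)
  then interpret A: graded_group A Agr p .
  interpret B: left_module S B using h by (rule mhom_cod)
  let ?i = "inv_into (carrier A) h"
  have i: "mhom S B A ?i" by (rule mhom_inv_into[OF h bij])
  have hi: "h (?i y) = y" if "y \<in> carrier B" for y using that bij by (simp add: bij_betw_def f_inv_into_f)
  have ih: "?i (h x) = x" if "x \<in> carrier A" for x using that bij by (simp add: bij_betw_def)
  have hz: "h x = \<zero>\<^bsub>B\<^esub> \<longleftrightarrow> x = \<zero>\<^bsub>A\<^esub>" if "x \<in> carrier A" for x
    using that bij mhom_inj_iff[OF h] mhom_zero[OF h] by (auto simp: bij_betw_def)
  let ?q = "\<lambda>k y. h (p k (?i y))"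
  have "graded_group B (\<lambda>k. h ` Agr k) ?q"
  proof (intro graded_group.intro graded_group_axioms.intro B.M.abelian_group_axioms)
    show "abelian_group_hom B B (?q k)" for k
      by (rule abelian_group_hom_compose[OF abelian_group_hom_compose[OF mhom_hom[OF i] A.p_hom] mhom_hom[OF h]])
    show "y \<in> carrier B" "?q k y = y" if "y \<in> h ` Agr k" for y k
      using that mhom_closed[OF h] A.gr_sub ih A.p_id by auto
    show "?q k y = \<zero>\<^bsub>B\<^esub>" if "y \<in> h ` Agr l" "k \<noteq> l" for y k l
      using that A.gr_sub ih A.p_other mhom_zero[OF h] by fastforce
    fix y assume y: "y \<in> carrier B"
    have iy: "?i y \<in> carrier A" by (rule mhom_closed[OF i y])
    show "?q k y \<in> h ` Agr k" for k using A.p_gr[OF iy] by blast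
    have eq: "{k. ?q k y \<noteq> \<zero>\<^bsub>B\<^esub>} = {k. p k (?i y) \<noteq> \<zero>\<^bsub>A\<^esub>}" using hz[OF A.p_closed[OF iy]] by auto
    show "finite {k. ?q k y \<noteq> \<zero>\<^bsub>B\<^esub>}" unfolding eq by (rule A.p_fin[OF iy])
    have "h (?i y) = h (\<Oplus>\<^bsub>A\<^esub>k\<in>{k. p k (?i y) \<noteq> \<zero>\<^bsub>A\<^esub>}. p k (?i y))" using A.p_sum[OF iy] by simp
    also have "\<dots> = (\<Oplus>\<^bsub>B\<^esub>k\<in>{k. p k (?i y) \<noteq> \<zero>\<^bsub>A\<^esub>}. ?q k y)"
      by (rule mhom_finsum[OF h]) (use A.p_closed[OF iy] in auto)
    finally show "y = (\<Oplus>\<^bsub>B\<^esub>k\<in>{k. ?q k y \<noteq> \<zero>\<^bsub>B\<^esub>}. ?q k y)" unfolding eq hi[OF y] .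
  qed
  moreover have "t \<odot>\<^bsub>B\<^esub> y \<in> h ` Agr (k + l)" if t: "t \<in> Sgr k" and y: "y \<in> h ` Agr l" for t y k l
  proof -
    obtain x where x: "x \<in> Agr l" "y = h x" using y by blast
    have "t \<odot>\<^bsub>A\<^esub> x \<in> Agr (k + l)" "t \<in> carrier S" using A t x(1) by (auto simp: gmod_def)
    then show ?thesis using x A.gr_sub[OF x(1)] by (auto simp: mhom_smult[OF h, symmetric])
  qed
  ultimately show ?thesis using B.left_module A by (auto simp: gmod_def)
qed

text \<open>The conclusion of the theorem with \<open>k\<close> for n + m + 1, stated for a variable
  number of modules so that splicing becomes an induction on \<open>k\<close>.\<close>

definition graded_resolution where
  "graded_resolution S Sgr k A Agr F Fgr d \<epsilon> \<longleftrightarrow> exact_resolution S F d \<epsilon> A \<and>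
    (\<forall>i\<ge>k. carrier (F i) = {\<zero>\<^bsub>F i\<^esub>}) \<and>
    (\<forall>i. free_graded_module S Sgr (F i) (Fgr i) \<and> bounded_below (F i) (Fgr i)) \<and>
    degree_zero (Fgr 0) Agr \<epsilon> \<and> (\<forall>i. degree_zero (Fgr (Suc i)) (Fgr i) (d i))"

text \<open>All free modules of a resolution have their indices in \<open>J0\<close>, so the one
  injection \<sigma> moves them all into the type \<open>'v\<close> of the statement.\<close>

locale small_graded_ring = graded_ring S Sgr pS
  for S :: "'s ring" (structure) and Sgr pS +
  fixes J0 :: "'j set" and \<sigma> :: "('j \<Rightarrow> 's) \<Rightarrow> 'v"
  assumes \<sigma>: "inj_on \<sigma> (carrier (Fr S J0))" and nonneg: "\<And>k. k < 0 \<Longrightarrow> Sgr k = {\<zero>}"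
begin

lemma \<sigma>_sub: "J \<subseteq> J0 \<Longrightarrow> inj_on \<sigma> (carrier (Fr S J))"
  by (rule inj_on_subset[OF \<sigma>]) (auto simp: Fr_simps)

definition FM :: "'j set \<Rightarrow> ('s, 'v) module" where "FM J = tr \<sigma> (Fr S J)"

lemma FM:
  assumes "J \<subseteq> J0" shows "mhom S (Fr S J) (FM J) \<sigma>" "bij_betw \<sigma> (carrier (Fr S J)) (carrier (FM J))"
  unfolding FM_def using mhom_tr[OF left_module_Fr[OF ring_axioms] \<sigma>_sub[OF assms]] by auto

text \<open>The transported standard generators are homogeneous and contain a basis. In degrees
  below \<open>k0\<close> every coefficient would have negative degree and therefore
  vanishes.\<close>

lemma free_FM:
  assumes J: "J \<subseteq> J0" and bd: "\<And>j. j \<in> J \<Longrightarrow> k0 \<le> dg j"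
  shows "free_graded_module S Sgr (FM J) (\<lambda>k. \<sigma> ` Frgr S Sgr J dg k)" "bounded_below (FM J) (\<lambda>k. \<sigma> ` Frgr S Sgr J dg k)"
proof -
  obtain B where B: "B \<subseteq> (\<lambda>j. \<sigma> (sing (\<lambda>_. S) j \<one>)) ` J" "is_basis S (FM J) B"
    using basis_of_iso[OF FM[OF J]] by blast
  have "\<sigma> (sing (\<lambda>_. S) j \<one>) \<in> (\<Union>k. \<sigma> ` Frgr S Sgr J dg k)" if "j \<in> J" for j
    using Frgr_sing[OF that gr_one, of dg] by blast
  then have BU: "B \<subseteq> (\<Union>k. \<sigma> ` Frgr S Sgr J dg k)" by (intro subset_trans[OF B(1)] image_subsetI)
  then show "free_graded_module S Sgr (FM J) (\<lambda>k. \<sigma> ` Frgr S Sgr J dg k)"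
    unfolding free_graded_module_def
    by (intro conjI exI[of _ B] gmod_graded_module[OF gmod_iso[OF gmod_Fr FM[OF J]]] B(2) BU)
  have "Frgr S Sgr J dg k = {\<zero>\<^bsub>Fr S J\<^esub>}" if "k < k0" for k
  proof -
    have "f = \<zero>\<^bsub>Fr S J\<^esub>" if f: "f \<in> Frgr S Sgr J dg k" for f
    proof
      fix j
      show "f j = \<zero>\<^bsub>Fr S J\<^esub> j"
      proof (cases "j \<in> J")
        case True
        have "f j \<in> Sgr (k - dg j)" using f by (auto simp: Frgr_def)
        moreover have "Sgr (k - dg j) = {\<zero>}" using bd[OF True] \<open>k < k0\<close> by (intro nonneg) simp
        ultimately have "f j = \<zero>" by simp
        then show ?thesis by (simp add: Fr_simps)
      next
        case False
        then show ?thesis using f by (auto simp: Frgr_def Fr_simps dsupp_def)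
      qed
    qed
    moreover have "\<zero>\<^bsub>Fr S J\<^esub> \<in> Frgr S Sgr J dg k"
      by (simp add: Frgr_def Fr_simps dsupp_def gr_zero)
    ultimately show ?thesis by blast
  qed
  then show "bounded_below (FM J) (\<lambda>k. \<sigma> ` Frgr S Sgr J dg k)"
    unfolding bounded_below_def FM_def tr_simps by (intro exI[of _ k0]) simp
qed

lemma graded_resolution_zero:
  fixes A :: "('s, 'a) module"
  assumes A: "gmod S Sgr A Agr" and z: "carrier A = {\<zero>\<^bsub>A\<^esub>}"
  shows "\<exists>(F :: nat \<Rightarrow> ('s, 'v) module) Fgr d \<epsilon>. graded_resolution S Sgr 0 A Agr F Fgr d \<epsilon>"
proof -
  let ?F = "FM {}"
  have F0: "carrier ?F = {\<zero>\<^bsub>?F\<^esub>}" by (simp add: FM_def tr_simps Fr_empty)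
  note F = free_FM[of "{}" 0 "\<lambda>_. 0", simplified]
  let ?g = "\<lambda>k. \<sigma> ` Frgr S Sgr {} (\<lambda>_. 0) k"
  obtain p where p: "graded_group A Agr p" using A by (auto simp: gmod_def)
  have gF: "gmod S Sgr ?F ?g" using gmod_iso[OF gmod_Fr FM] by simp
  then obtain q where q: "graded_group ?F ?g q" by (auto simp: gmod_def)
  have lF: "left_module S ?F" by (rule gmod_left_module[OF gF])
  let ?d = "restrict (\<lambda>_. \<zero>\<^bsub>?F\<^esub>) (carrier ?F)" and ?e = "restrict (\<lambda>_. \<zero>\<^bsub>A\<^esub>) (carrier ?F)"
  have k: "a_kernel ?F ?F ?d = {\<zero>\<^bsub>?F\<^esub>}" "a_kernel ?F A ?e = {\<zero>\<^bsub>?F\<^esub>}"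
    using F0 by (auto simp: a_kernel_def')
  have "exact_resolution S (\<lambda>_. ?F) (\<lambda>_. ?d) ?e A"
    unfolding exact_resolution_def
    using restrict_module_homs[OF mhom_zero_map[OF lF lF]] restrict_module_homs[OF mhom_zero_map[OF lF gmod_left_module[OF A]]]
    by (simp add: k) (simp add: F0 z)
  moreover have "degree_zero ?g Agr ?e" "degree_zero ?g ?g ?d"
    using graded_group.gr_zero[OF p] graded_group.gr_zero[OF q] graded_group.gr_sub[OF q] unfolding degree_zero_def by fastforce+
  ultimately have "graded_resolution S Sgr 0 A Agr (\<lambda>_. ?F) (\<lambda>_. ?g) (\<lambda>_. ?d) ?e"
    using F F0 by (simp add: graded_resolution_def)
  then show ?thesis by blast
qed

text \<open>The resolution of the kernel is shifted by one place and the transported cover is put in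
  front; the augmentation of the old resolution, followed by \<sigma>, becomes the first
  differential.\<close>

lemma graded_resolution_step:
  fixes A :: "('s, 'a) module" and F :: "nat \<Rightarrow> ('s, 'v) module"
  assumes A: "gmod S Sgr A Agr" and c: "covers S Sgr J0 J dg e A Agr"
    and r: "graded_resolution S Sgr k (fker S J A e) (fkergr S Sgr J dg A e) F Fgr d \<epsilon>"
  shows "\<exists>(F :: nat \<Rightarrow> ('s, 'v) module) Fgr d \<epsilon>. graded_resolution S Sgr (Suc k) A Agr F Fgr d \<epsilon>"
proof -
  have J: "J \<subseteq> J0" and e: "mhom S (Fr S J) A e" and es: "e ` carrier (Fr S J) = carrier A"
    and ed: "\<And>k f. f \<in> Frgr S Sgr J dg k \<Longrightarrow> e f \<in> Agr k" using c by (auto simp: covers_def)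
  obtain k0 where bd: "\<And>j. j \<in> J \<Longrightarrow> k0 \<le> dg j" using c by (auto simp: covers_def)
  let ?K = "fker S J A e"
  let ?K' = "a_kernel (Fr S J) A e"
  have K: "carrier ?K = ?K'" "\<zero>\<^bsub>?K\<^esub> = \<zero>\<^bsub>Fr S J\<^esub>" by (simp_all add: fker_def)
  have ex: "exact_resolution S F d \<epsilon> ?K" and zero: "\<And>i. i \<ge> k \<Longrightarrow> carrier (F i) = {\<zero>\<^bsub>F i\<^esub>}"
    and free: "\<And>i. free_graded_module S Sgr (F i) (Fgr i)" "\<And>i. bounded_below (F i) (Fgr i)"
    and deg: "degree_zero (Fgr 0) (fkergr S Sgr J dg A e) \<epsilon>" "\<And>i. degree_zero (Fgr (Suc i)) (Fgr i) (d i)"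
    using r by (auto simp: graded_resolution_def)
  have gF: "gmod S Sgr (F i) (Fgr i)" for i
    using free(1)[of i] gmod_Fr by (intro graded_module_gmod) (auto simp: free_graded_module_def gmod_def gr_sub)
  have Fm: "left_module S (F i)" for i by (rule gmod_left_module[OF gF])
  have km: "left_module S ?K" unfolding fker_def by (rule left_module_kernel[OF e e])
  have \<epsilon>m: "mhom S (F 0) ?K \<epsilon>" and \<epsilon>s: "\<epsilon> ` carrier (F 0) = ?K'"
    using ex by (simp_all add: exact_resolution_def module_homs_mhom Fm km K)
  let ?P = "FM J" and ?i = "inv_into (carrier (Fr S J)) \<sigma>"
  note \<sigma>m = FM[OF J]
  have im: "mhom S ?P (Fr S J) ?i" by (rule mhom_inv_into[OF \<sigma>m])
  have i\<sigma>: "?i (\<sigma> f) = f" if "f \<in> carrier (Fr S J)" for f using that \<sigma>_sub[OF J] by simp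
  have \<sigma>i: "\<sigma> (?i y) = y" if "y \<in> carrier ?P" for y using that \<sigma>m(2) by (simp add: bij_betw_def f_inv_into_f)
  have Kin: "mhom S ?K (Fr S J) (\<lambda>x. x)" unfolding fker_def by (rule mhom_kernel_incl[OF e e])
  let ?F = "\<lambda>i. case i of 0 \<Rightarrow> ?P | Suc j \<Rightarrow> F j"
  let ?Fgr = "\<lambda>i. case i of 0 \<Rightarrow> (\<lambda>k. \<sigma> ` Frgr S Sgr J dg k) | Suc j \<Rightarrow> Fgr j"
  let ?e = "restrict (\<lambda>x. e (?i x)) (carrier ?P)"
  let ?dz = "restrict (\<lambda>x. \<sigma> (\<epsilon> x)) (carrier (F 0))"
  let ?d = "\<lambda>i. case i of 0 \<Rightarrow> ?dz | Suc j \<Rightarrow> d j"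
  have e': "mhom S ?P A (\<lambda>x. e (?i x))" by (rule mhom_comp[OF im e])
  have d0: "mhom S (F 0) ?P (\<lambda>x. \<sigma> (\<epsilon> x))" using mhom_comp[OF mhom_comp[OF \<epsilon>m Kin] \<sigma>m(1)] by simp
  have ker0: "a_kernel ?P A ?e = ?dz ` carrier (F 0)"
  proof -
    have "?dz ` carrier (F 0) = \<sigma> ` ?K'" by (simp add: \<epsilon>s[symmetric] image_image)
    moreover have "a_kernel ?P A ?e = \<sigma> ` ?K'"
    proof (rule equalityI; rule subsetI)
      fix y assume "y \<in> a_kernel ?P A ?e"
      then have "y \<in> carrier ?P" "e (?i y) = \<zero>\<^bsub>A\<^esub>" by (auto simp: a_kernel_iff)
      then have "?i y \<in> ?K'" "y = \<sigma> (?i y)" using mhom_closed[OF im] by (simp_all add: a_kernel_iff \<sigma>i)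
      then show "y \<in> \<sigma> ` ?K'" by blast
    next
      fix y assume "y \<in> \<sigma> ` ?K'"
      then obtain f where "f \<in> carrier (Fr S J)" "e f = \<zero>\<^bsub>A\<^esub>" "y = \<sigma> f" by (auto simp: a_kernel_iff)
      then show "y \<in> a_kernel ?P A ?e" using mhom_closed[OF \<sigma>m(1)] by (simp add: a_kernel_iff i\<sigma>)
    qed
    ultimately show ?thesis by simp
  qed
  have ker1: "a_kernel (F 0) ?P ?dz = d 0 ` carrier (F 1)"
  proof -
    have "\<sigma> (\<epsilon> x) = \<zero>\<^bsub>?P\<^esub> \<longleftrightarrow> \<epsilon> x = \<zero>\<^bsub>?K\<^esub>" if "x \<in> carrier (F 0)" for x
    proof -
      have "\<epsilon> x \<in> carrier (Fr S J)" using mhom_closed[OF \<epsilon>m that] by (simp add: K a_kernel_iff)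
      then show ?thesis using mhom_inj_iff[OF \<sigma>m(1)] \<sigma>_sub[OF J] mhom_zero[OF \<sigma>m(1)] by (auto simp: K)
    qed
    then have "a_kernel (F 0) ?P ?dz = a_kernel (F 0) ?K \<epsilon>" by (auto simp: a_kernel_def')
    then show ?thesis using ex by (simp add: exact_resolution_def)
  qed
  have ei: "?e ` carrier ?P = carrier A"
  proof -
    have "?e ` carrier ?P = e ` ?i ` carrier ?P" by (simp add: image_image)
    then show ?thesis using bij_betw_inv_into[OF \<sigma>m(2)] es by (simp add: bij_betw_def)
  qed
  have "exact_resolution S ?F ?d ?e A"
    unfolding exact_resolution_def
  proof (intro conjI allI)
    show "?e \<in> module_homs S (?F 0) A" using restrict_module_homs[OF e'] by simp
    show "?d i \<in> module_homs S (?F (Suc i)) (?F i)" for i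
      using restrict_module_homs[OF d0] ex by (cases i) (simp_all add: exact_resolution_def)
    show "a_kernel (?F (Suc i)) (?F i) (?d i) = ?d (Suc i) ` carrier (?F (Suc (Suc i)))" for i
      using ker1 ex by (cases i) (simp_all add: exact_resolution_def)
  qed (use ker0 ei in simp_all)
  moreover have "degree_zero (?Fgr 0) Agr ?e"
    unfolding degree_zero_def
  proof (intro allI, unfold nat.case(1), intro subsetI, elim imageE, hypsubst)
    fix k f assume f: "f \<in> Frgr S Sgr J dg k"
    then have "f \<in> carrier (Fr S J)" by (simp add: Frgr_def)
    then show "?e (\<sigma> f) \<in> Agr k" using ed[OF f] mhom_closed[OF \<sigma>m(1)] by (simp add: i\<sigma>)
  qed
  moreover have "degree_zero (?Fgr (Suc i)) (?Fgr i) (?d i)" for i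
  proof (cases i)
    case 0
    have "\<epsilon> x \<in> Frgr S Sgr J dg k" "x \<in> carrier (F 0)" if "x \<in> Fgr 0 k" for x k
    proof -
      obtain q where q: "graded_group (F 0) (Fgr 0) q" using gF[of 0] by (auto simp: gmod_def)
      show "x \<in> carrier (F 0)" by (rule graded_group.gr_sub[OF q that])
      have "\<epsilon> x \<in> fkergr S Sgr J dg A e k" using deg(1) that by (auto simp: degree_zero_def)
      then show "\<epsilon> x \<in> Frgr S Sgr J dg k" by (simp add: fkergr_def)
    qed
    then show ?thesis unfolding 0 degree_zero_def by auto
  next
    case (Suc j)
    then show ?thesis using deg(2)[of j] by simp
  qed
  moreover have "free_graded_module S Sgr (?F i) (?Fgr i) \<and> bounded_below (?F i) (?Fgr i)" for i
    using free_FM[OF J bd] free by (cases i) simp_all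
  moreover have "carrier (?F i) = {\<zero>\<^bsub>?F i\<^esub>}" if "i \<ge> Suc k" for i
    using zero that by (cases i) simp_all
  ultimately have "graded_resolution S Sgr (Suc k) A Agr ?F ?Fgr ?d ?e"
    by (simp add: graded_resolution_def)
  then show ?thesis by blast
qed

lemma resT_resolution:
  assumes "gmod S Sgr A Agr" "resT S Sgr J0 k A Agr"
  shows "\<exists>(F :: nat \<Rightarrow> ('s, 'v) module) Fgr d \<epsilon>. graded_resolution S Sgr k A Agr F Fgr d \<epsilon>"
  using assms
proof (induction k arbitrary: A Agr)
  case 0
  then show ?case using graded_resolution_zero by simp
next
  case (Suc k)
  then obtain J dg e where c: "covers S Sgr J0 J dg e A Agr" and r: "resT S Sgr J0 k (fker S J A e) (fkergr S Sgr J dg A e)"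
    by auto
  obtain F :: "nat \<Rightarrow> ('s, 'v) module" and Fgr d \<epsilon> where
    "graded_resolution S Sgr k (fker S J A e) (fkergr S Sgr J dg A e) F Fgr d \<epsilon>"
    using Suc.IH[OF gmod_fker[OF c Suc.prems(1)] r] by blast
  then show ?case by (rule graded_resolution_step[OF Suc.prems(1) c])
qed

lemma resP_resolution:
  fixes A :: "('s, 'a) module"
  assumes A: "gmod S Sgr A Agr" and r: "resP S Sgr J0 k A Agr"
  shows "\<exists>(F :: nat \<Rightarrow> ('s, 'v) module) Fgr d \<epsilon>. graded_resolution S Sgr k A Agr F Fgr d \<epsilon>"
proof (cases k)
  case 0
  then show ?thesis using graded_resolution_zero[OF A] r by (simp add: resP_0)
next
  case (Suc l)
  then obtain J dg e where c: "covers S Sgr J0 J dg e A Agr" and r: "resT S Sgr J0 l (fker S J A e) (fkergr S Sgr J dg A e)"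
    using r by (auto simp: resP_Suc resP_T)
  obtain F :: "nat \<Rightarrow> ('s, 'v) module" and Fgr d \<epsilon> where
    "graded_resolution S Sgr l (fker S J A e) (fkergr S Sgr J dg A e) F Fgr d \<epsilon>"
    using resT_resolution[OF gmod_fker[OF c A] r] by blast
  then show ?thesis unfolding Suc by (rule graded_resolution_step[OF A c])
qed

end

lemma mhom_tr_inv:
  assumes M: "left_module R M" and inj: "inj_on f (carrier M)"
  shows "mhom R (tr f M) M (inv_into (carrier M) f)"
  by (rule mhom_inv_into[OF mhom_tr[OF M inj]])

lemma Ind_map_bij:
  assumes N: "ind_module R Mo len N" and N': "ind_module R Mo len N'"
    and \<phi>: "\<And>j. mhom R (N j) (N' j) (\<phi> j)" and \<psi>: "\<And>j. mhom R (N' j) (N j) (\<psi> j)"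
    and inv: "\<And>j x. x \<in> carrier (N j) \<Longrightarrow> \<psi> j (\<phi> j x) = x" "\<And>j x. x \<in> carrier (N' j) \<Longrightarrow> \<phi> j (\<psi> j x) = x"
  shows "bij_betw (\<lambda>f x. \<phi> (snd x) (f x)) (carrier (Ind R Mo J N)) (carrier (Ind R Mo J N'))"
proof -
  interpret A: ind_module R Mo len J N undefined by (rule N)
  interpret B: ind_module R Mo len J N' undefined by (rule N')
  have fN: "f x \<in> carrier (N (snd x))" if "f \<in> carrier A.I" for f x using that A.G.dirsumD(1)[of f x] by (simp add: A.I_G)
  have fN': "f x \<in> carrier (N' (snd x))" if "f \<in> carrier B.I" for f x using that B.G.dirsumD(1)[of f x] by (simp add: B.I_G)
  show ?thesis
    by (rule bij_betw_byWitness[where f' = "\<lambda>f x. \<psi> (snd x) (f x)"])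
      (use mhom_closed[OF Ind_map(1)[OF N N' \<phi>, where J = J]] mhom_closed[OF Ind_map(1)[OF N' N \<psi>, where J = J]] in \<open>auto simp: inv fN fN'\<close>)
qed

theorem corollary2p5:
  fixes E :: "'e set" and I :: "('e \<times> 'e) set" and R :: "'r ring" and n m :: nat
    and A :: "('e list set \<Rightarrow> 'r, 'a) module" and Agr :: "int \<Rightarrow> 'a set"
  assumes "I \<subseteq> E \<times> E" and "irrefl I" and "sym I"
    and "ring R"
    and "projective_free TYPE(('r, 'e, 'a) universe) R"
    and "gl_dim TYPE(('r, 'e, 'a) universe) R = enat n"
    and "max_commuting E I m"
    and "graded_module (fpc_ring R E I) (fpc_ring_grading R E I) A Agr" and "bounded_below A Agr"
  shows "\<exists>(F :: nat \<Rightarrow> ('e list set \<Rightarrow> 'r, ('r, 'e, 'a) universe) module) Fgr d \<epsilon>.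
    exact_resolution (fpc_ring R E I) F d \<epsilon> A \<and>
    (\<forall>i>n + m. carrier (F i) = {\<zero>\<^bsub>F i\<^esub>}) \<and>
    (\<forall>i. free_graded_module (fpc_ring R E I) (fpc_ring_grading R E I) (F i) (Fgr i) \<and>
      bounded_below (F i) (Fgr i)) \<and>
    degree_zero (Fgr 0) Agr \<epsilon> \<and> (\<forall>i. degree_zero (Fgr (Suc i)) (Fgr i) (d i))"
proof -
  let ?U = "UNIV :: ('r, 'e, 'a) universe set"
  have nat: "(UNIV :: nat set) \<lesssim> ?U" unfolding lepoll_def
    by (rule exI[of _ "\<lambda>x. Inr (Inr (Inr x))"]) (auto simp: inj_def)
  have inf: "infinite ?U" using nat infinite_le_lepoll by blast
  have rU: "carrier R \<lesssim> ?U" unfolding lepoll_def by (rule exI[of _ Inl]) (auto simp: inj_on_def)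
  have eU: "(UNIV :: 'e set) \<lesssim> ?U" unfolding lepoll_def
    by (rule exI[of _ "\<lambda>x. Inr (Inl x)"]) (auto simp: inj_def)
  have EU: "E \<lesssim> ?U" by (rule lepoll_trans[OF subset_imp_lepoll eU]) simp
  have intU: "(UNIV :: int set) \<lesssim> ?U"
    by (rule lepoll_trans[OF _ nat]) (auto simp: lepoll_def intro!: exI[of _ int_encode] inj_int_encode)

  interpret fpc E I by (rule fpc.intro) (use assms in auto)
  have Amod: "left_module (fpc_ring R E I) A" using assms(8) by (simp add: graded_module_def)
  have Sring: "ring (fpc_ring R E I)" by (rule left_module_ring[OF Amod])
  interpret mring R "fpc_monoid E I" fpc_length
    by (rule mring.intro) (use assms(4) Sring in \<open>auto simp: fpc_length_mult fpc_length_one monoid_fpc_monoid\<close>)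
  have Sgr: "fpc_ring_grading R E I = Sgr" by (simp add: fpc_ring_grading_def[abs_def] Sgr_def[abs_def])
  interpret gS: graded_ring S Sgr "\<lambda>k f \<mu>. if int (fpc_length \<mu>) = k then f \<mu> else \<zero>\<^bsub>R\<^esub>" by (rule graded_S)
  have gradA: "gmod S Sgr A Agr"
    by (rule graded_module_gmod) (use assms(8) in \<open>auto simp: Sgr gS.gr_sub\<close>)
  obtain pA where pA: "graded_group A Agr pA" using gradA by (auto simp: gmod_def)
  obtain k0 where k0: "\<And>k. k < k0 \<Longrightarrow> Agr k = {\<zero>\<^bsub>A\<^esub>}" using assms(9) by (auto simp: bounded_below_def)
  obtain lt :: "'e \<Rightarrow> 'e \<Rightarrow> bool" where lt: "\<And>e f. e \<noteq> f \<Longrightarrow> lt e f \<longleftrightarrow> \<not> lt f e" using tournament_exists by metis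
  interpret koszul E I R A Agr pA k0 lt
  proof (intro koszul.intro koszul_axioms.intro fpc_axioms mring_axioms Amod pA k0 lt)
    show "s \<odot>\<^bsub>A\<^esub> x \<in> Agr (k + l)" if "s \<in> Sgr k" "x \<in> Agr l" for k l s x using gradA that by (simp add: gmod_def)
  qed

  define J0 :: "(('e set \<times> int) \<times> ('r, 'e, 'a) universe) set" where "J0 = (Fpow UNIV \<times> UNIV) \<times> UNIV"
  have J0U: "J0 \<lesssim> ?U" unfolding J0_def
    by (intro times_lepoll_infinite inf Fpow_lepoll_infinite eU intU lepoll_refl)
  have SU: "carrier S \<lesssim> ?U" by (intro monoid_ring_lepoll fpc_monoid_lepoll inf EU rU)
  obtain \<sigma> :: "(('e set \<times> int) \<times> ('r, 'e, 'a) universe \<Rightarrow> 'e list set \<Rightarrow> 'r) \<Rightarrow> ('r, 'e, 'a) universe"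
    where \<sigma>: "inj_on \<sigma> (carrier (Fr S J0))"
    using Fr_lepoll[OF inf J0U SU] by (auto simp: lepoll_def)
  obtain \<tau> :: "(('r, 'e, 'a) universe \<Rightarrow> 'r) \<Rightarrow> ('r, 'e, 'a) universe" where \<tau>: "inj_on \<tau> (carrier (Fr R UNIV))"
    using Fr_lepoll[OF inf lepoll_refl rU] by (auto simp: lepoll_def)
  obtain \<iota> \<iota>' :: "('r, 'e, 'a) universe \<Rightarrow> ('r, 'e, 'a) universe" where
    \<iota>: "inj \<iota>" "inj \<iota>'" "\<And>x y. \<iota> x \<noteq> \<iota>' y" using disjoint_injections[OF inf] by blast
  \<comment> \<open>The two copies are told apart by the universe coordinate, which is unrestricted
    in \<open>J0\<close>.\<close>
  have hs: "horseshoe S Sgr (\<lambda>k f \<mu>. if int (fpc_length \<mu>) = k then f \<mu> else \<zero>\<^bsub>R\<^esub>) J0 (map_prod id \<iota>) (map_prod id \<iota>')"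
  proof (intro horseshoe.intro horseshoe_axioms.intro gS.graded_ring_axioms)
    show "map_prod id \<iota> j \<in> J0" "map_prod id \<iota>' j \<in> J0" if "j \<in> J0" for j using that by (auto simp: J0_def)
  qed (use \<iota>(3) in \<open>auto intro!: injI dest: injD[OF \<iota>(1)] injD[OF \<iota>(2)]\<close>)

  have "small_ring R \<tau>" by (intro small_ring.intro small_ring_axioms.intro assms(4) \<tau>)
  then interpret small: small_ring R \<tau> .
  \<comment> \<open>The hypotheses on \<open>R\<close> concern modules with elements in the
    universe, whereas the pieces of A have elements in \<open>'a\<close>. They are copied into the
    universe, resolved there, and the induced resolution is brought back by
    \<open>resP_iso\<close>.\<close>
  define \<rho> :: "'a \<Rightarrow> ('r, 'e, 'a) universe" where "\<rho> x = Inr (Inr (Inl x))" for x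
  have \<rho>: "inj_on \<rho> C" for C by (auto simp: inj_on_def \<rho>_def)
  define N' where "N' x = tr \<rho> (N x)" for x
  have N': "left_module R (N' x)" for x unfolding N'_def by (rule left_module_tr[OF left_module_N \<rho>])
  have iN': "ind_module R Mo fpc_length N'" by (intro ind_module.intro ind_module_axioms.intro mring_axioms N')
  have resR': "resR R (Suc n) (N' x)" for x by (rule small.gl_dim_resR[OF assms(5,6) N'])
  have res: "resP S Sgr J0 (Suc n) (Ind R Mo (Jp p) N) (ind_module.Igr Mo fpc_length (Jp p) N dg)" for p
  proof (rule gS.resP_iso)
    show "resP S Sgr J0 (Suc n) (Ind R Mo (Jp p) N') (ind_module.Igr Mo fpc_length (Jp p) N' dg)"
    proof (rule resP_Ind[OF N' resR'])
      show "k0 \<le> dg j" if "j \<in> Jp p" for j using that by (auto simp: Jp_def J_def dg_def)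
      show "Jp p \<times> UNIV \<subseteq> J0" by (auto simp: Jp_def J_def J0_def Fpow_def clique_finite)
    qed
    let ?\<phi> = "\<lambda>j. inv_into (carrier (N j)) \<rho>"
    have \<phi>: "mhom R (N' j) (N j) (?\<phi> j)" for j unfolding N'_def by (rule mhom_tr_inv[OF left_module_N \<rho>])
    have \<psi>: "mhom R (N j) (N' j) \<rho>" for j unfolding N'_def by (rule mhom_tr(1)[OF left_module_N \<rho>])
    show "mhom S (Ind R Mo (Jp p) N') (Ind R Mo (Jp p) N) (\<lambda>f x. ?\<phi> (snd x) (f x))"
      by (rule Ind_map(1)[OF iN' indp \<phi>])
    show "bij_betw (\<lambda>f x. ?\<phi> (snd x) (f x)) (carrier (Ind R Mo (Jp p) N')) (carrier (Ind R Mo (Jp p) N))"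
      by (rule Ind_map_bij[OF iN' indp \<phi> \<psi>]) (auto simp: N'_def tr_simps inv_into_f_f[OF \<rho>])
    show "(\<lambda>x. ?\<phi> (snd x) (f x)) \<in> ind_module.Igr Mo fpc_length (Jp p) N dg k"
      if "f \<in> ind_module.Igr Mo fpc_length (Jp p) N' dg k" for f k
      by (rule Ind_map(2)[OF iN' indp \<phi> that])
  qed
  have max: "card c \<le> m" if "clique c" for c
    using assms(7) that by (auto simp: max_commuting_def clique_def)
  have resA: "resP S Sgr J0 (Suc (n + m)) A Agr" by (rule resP_koszul[OF hs max res])

  have nonneg: "Sgr k = {\<zero>\<^bsub>S\<^esub>}" if "k < 0" for k
  proof -
    have "f = \<zero>\<^bsub>S\<^esub>" if f: "f \<in> Sgr k" for f
    proof -
      have "supp R f = {}" using f \<open>k < 0\<close> by (auto simp: Sgr_def)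
      then show ?thesis by (auto simp: supp_def monoid_ring_def)
    qed
    then show ?thesis using gS.gr_zero by blast
  qed
  interpret small_graded_ring S Sgr "\<lambda>k f \<mu>. if int (fpc_length \<mu>) = k then f \<mu> else \<zero>\<^bsub>R\<^esub>" J0 \<sigma>
    by (intro small_graded_ring.intro small_graded_ring_axioms.intro gS.graded_ring_axioms \<sigma> nonneg)
  show ?thesis
    \<comment> \<open>\<open>Suc (n + m)\<close> free modules, indexed from 0, so that those with
      index above n + m are zero.\<close>
    using resP_resolution[OF gradA resA] unfolding graded_resolution_def Sgr Suc_le_eq .
qed

end
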